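(* Let $n\geq 2$ and let $\mathbf{a},\mathbf{b}\in(\mathbb{N}_{\geq 2})^n$. Write $\mathbf{a}\sim\mathbf{b}$ if $\mathbf{a}$ and $\mathbf{b}$ are equal up to permutation of entries. \begin{enumerate} \item[(1)] Over a field $k$ of characteristic $0$, \[ B_{\mathbf{a},k}\cong_{k\text{-alg}} B_{\mathbf{b},k}\iff V_{\mathbf{a},k}\cong_k V_{\mathbf{b},k}\iff \mathbf{a}\sim\mathbf{b}. \] \item[(2)] If $k=\mathbb{C}$, then \[ \widehat{B}_{\mathbf{a}}\cong_{\mathbb{C}\text{-alg}}\widehat{B}_{\mathbf{b}}\iff \widehat{V}_{\mathbf{a}}\cong\widehat{V}_{\mathbf{b}}\iff V_{\mathbf{a}}^{\rm an}\cong V_{\mathbf{b}}^{\rm an}\iff \mathbf{a}\sim\mathbf{b}, \] where $\widehat{V}_{\mathbf{a}}\cong\widehat{V}_{\mathbf{b}}$ denotes isomorphism of algebroid spaces and $V_{\mathbf{a}}^{\rm an}\cong V_{\mathbf{b}}^{\rm an}$ denotes isomorphism (biholomorphism) of complex analytic germs. \end{enumerate}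
   Context: For a field $k$ of characteristic $0$ (not necessarily algebraically closed), $n\ge 2$ and $\mathbf{a}=(a_1,\ldots,a_n)\in(\mathbb{N}_{\geq 2})^n$ (integers $a_i\ge 2$), put \[ B_{\mathbf{a},k}:=\frac{k[X_1,\ldots,X_n]}{(X_1^{a_1}+\cdots+X_n^{a_n})},\qquad V_{\mathbf{a},k}:=\operatorname{Spec}(B_{\mathbf{a},k}), \] the Brieskorn--Pham hypersurface ring and the Brieskorn--Pham variety over $k$; $\cong_k$ is isomorphism of $k$-schemes. When $k=\mathbb{C}$, write $V_{\mathbf{a}}=V_{\mathbf{a},\mathbb{C}}$ and let $\mathbf{0}_{\mathbf{a}}\in V_{\mathbf{a}}$ be the origin. $V^{\rm an}_{\mathbf{a}}:=(V_{\mathbf{a}},\mathbf{0}_{\mathbf{a}})$ is the complex analytic germ at the origin and $\widehat{V}_{\mathbf{a}}$ is its formal completion; they are respectively defined by the local $\mathbb{C}$-algebras \[ B^{\rm an}_{\mathbf{a}}=\frac{\mathbb{C}\{X_1,\ldots,X_n\}}{(X_1^{a_1}+\cdots+X_n^{a_n})},\qquad \widehat{B}_{\mathbf{a}}=\frac{\mathbb{C}[[X_1,\ldots,X_n]]}{(X_1^{a_1}+\cdots+X_n^{a_n})}, \] where $\mathbb{C}\{\cdot\}$ denotes convergent power series. An algebroid space is the formal space defined by an ideal in a formal power series ring over $\mathbb{C}$, i.e. it corresponds to a quotient $\mathbb{C}[[X_1,\ldots,X_n]]/I$; isomorphisms of algebroid spaces correspond to isomorphisms of these $\mathbb{C}$-algebras.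 Two analytic germs $(X,x)$ and $(Y,y)$ are isomorphic if there are open neighbourhoods of $x$ in $X$ and of $y$ in $Y$ (Euclidean topology) and an isomorphism of analytic spaces between them sending $x$ to $y$. *)

theory Defs
  imports "HOL-Analysis.Analysis" "HOL-Algebra.QuotRing" "HOL-Algebra.Module"
    "HOL-Library.Poly_Mapping"
begin

section \<open>Algebras over a field\<close>

text \<open>
  Fields are types, so that the scalars of a \<open>'k\<close>-algebra \<open>A :: ('k, 'a) module\<close> are all of
  \<open>UNIV :: 'k set\<close>.
\<close>

definition alg_iso :: "('k, 'a) module \<Rightarrow> ('k, 'b) module \<Rightarrow> ('a \<Rightarrow> 'b) \<Rightarrow> bool" where
  "alg_iso A B h \<longleftrightarrow>
     h \<in> ring_iso A B \<and> (\<forall>c. \<forall>x\<in>carrier A. h (c \<odot>\<^bsub>A\<^esub> x) = c \<odot>\<^bsub>B\<^esub> h x)"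

definition alg_isomorphic :: "('k, 'a) module \<Rightarrow> ('k, 'b) module \<Rightarrow> bool" where
  "alg_isomorphic A B \<longleftrightarrow> (\<exists>h. alg_iso A B h)"

definition quot_alg :: "('k, 'a) module \<Rightarrow> 'a set \<Rightarrow> ('k, 'a set) module" where
  "quot_alg A I =
     ring.extend (A Quot I) (module.fields (\<lambda>c X. \<Union>x\<in>X. I +>\<^bsub>A\<^esub> (c \<odot>\<^bsub>A\<^esub> x)))"


section \<open>Ringed spaces over a field\<close>

text \<open>
  A sheaf of \<open>'k\<close>-algebras is given as the sheaf of sections of its espace etale: a section over
  an open set \<open>U\<close> is a function on \<open>U\<close> (extensional, with \<open>undefined\<close> outside \<open>U\<close>) whose value
  at \<open>p\<close> lies in the stalk at \<open>p\<close>. Algebra operations are pointwise, and restriction of sections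
  is restriction of functions.
\<close>

record ('k, 'p, 's) ringed_space =
  rs_top :: "'p topology"
  rs_stalk :: "'p \<Rightarrow> ('k, 's) module"
  rs_sections :: "'p set \<Rightarrow> ('p \<Rightarrow> 's) set"

definition section_alg :: "('k, 'p, 's) ringed_space \<Rightarrow> 'p set \<Rightarrow> ('k, 'p \<Rightarrow> 's) module" where
  "section_alg X U =
     \<lparr>carrier = rs_sections X U,
      monoid.mult = (\<lambda>s t. \<lambda>p\<in>U. s p \<otimes>\<^bsub>rs_stalk X p\<^esub> t p),
      one = (\<lambda>p\<in>U. \<one>\<^bsub>rs_stalk X p\<^esub>),
      ring.zero = (\<lambda>p\<in>U. \<zero>\<^bsub>rs_stalk X p\<^esub>),
      add = (\<lambda>s t. \<lambda>p\<in>U. s p \<oplus>\<^bsub>rs_stalk X p\<^esub> t p),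
      smult = (\<lambda>c s. \<lambda>p\<in>U. c \<odot>\<^bsub>rs_stalk X p\<^esub> s p)\<rparr>"

text \<open>
  An isomorphism \<open>X \<rightarrow> Y\<close> is a homeomorphism \<open>f\<close> together with an isomorphism
  \<open>h : O\<^sub>Y \<rightarrow> f\<^sub>*O\<^sub>X\<close> of sheaves of \<open>'k\<close>-algebras. It induces isomorphisms on stalks, so that it is
  automatically an isomorphism of locally ringed spaces when \<open>X\<close> and \<open>Y\<close> are locally ringed.
  Compatibility with the structure morphisms to the spectrum of \<open>'k\<close> is the \<open>'k\<close>-linearity of \<open>h\<close>.
\<close>

definition rs_iso ::
  "('k, 'p, 's) ringed_space \<Rightarrow> ('k, 'q, 't) ringed_space \<Rightarrow> ('p \<Rightarrow> 'q) \<Rightarrow>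
   ('q set \<Rightarrow> ('q \<Rightarrow> 't) \<Rightarrow> ('p \<Rightarrow> 's)) \<Rightarrow> bool" where
  "rs_iso X Y f h \<longleftrightarrow>
     homeomorphic_map (rs_top X) (rs_top Y) f \<and>
     (\<forall>V. openin (rs_top Y) V \<longrightarrow>
        alg_iso (section_alg Y V) (section_alg X {p \<in> topspace (rs_top X). f p \<in> V}) (h V)) \<and>
     (\<forall>V W. openin (rs_top Y) V \<and> openin (rs_top Y) W \<and> W \<subseteq> V \<longrightarrow>
        (\<forall>s\<in>rs_sections Y V.
           h W (restrict s W) = restrict (h V s) {p \<in> topspace (rs_top X). f p \<in> W}))"

definition rs_isomorphic :: "('k, 'p, 's) ringed_space \<Rightarrow> ('k, 'q, 't) ringed_space \<Rightarrow> bool" where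
  "rs_isomorphic X Y \<longleftrightarrow> (\<exists>f h. rs_iso X Y f h)"

definition open_subspace ::
  "('k, 'p, 's) ringed_space \<Rightarrow> 'p set \<Rightarrow> ('k, 'p, 's) ringed_space" where
  "open_subspace X U = X\<lparr>rs_top := subtopology (rs_top X) U\<rparr>"

definition germ_isomorphic ::
  "('k, 'p, 's) ringed_space \<Rightarrow> 'p \<Rightarrow> ('k, 'q, 't) ringed_space \<Rightarrow> 'q \<Rightarrow> bool" where
  "germ_isomorphic X x Y y \<longleftrightarrow>
     (\<exists>U V f h. openin (rs_top X) U \<and> x \<in> U \<and> openin (rs_top Y) V \<and> y \<in> V \<and>
        rs_iso (open_subspace X U) (open_subspace Y V) f h \<and> f x = y)"


section \<open>Affine schemes\<close>

definition prime_spectrum :: "('k, 'a) module \<Rightarrow> 'a set set" where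
  "prime_spectrum A = {P. primeideal P A}"

definition zariski :: "('k, 'a) module \<Rightarrow> 'a set topology" where
  "zariski A =
     topology (\<lambda>U. \<exists>E\<subseteq>carrier A. U = prime_spectrum A - {P \<in> prime_spectrum A. E \<subseteq> P})"

lemma openin_zariski:
  "openin (zariski A) U \<longleftrightarrow>
     (\<exists>E\<subseteq>carrier A. U = prime_spectrum A - {P \<in> prime_spectrum A. E \<subseteq> P})"
proof -
  let ?D = "\<lambda>E. prime_spectrum A - {P \<in> prime_spectrum A. E \<subseteq> P}"
  have "istopology (\<lambda>U. \<exists>E\<subseteq>carrier A. U = ?D E)"
    unfolding istopology_def
  proof (intro conjI allI impI)
    fix S T
    assume "\<exists>E\<subseteq>carrier A. S = ?D E" "\<exists>E\<subseteq>carrier A. T = ?D E"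
    then obtain E F where E: "E \<subseteq> carrier A" "S = ?D E" and F: "F \<subseteq> carrier A" "T = ?D F"
      by auto
    let ?G = "{e \<otimes>\<^bsub>A\<^esub> f | e f. e \<in> E \<and> f \<in> F} \<inter> carrier A"
    have G_iff: "?G \<subseteq> P \<longleftrightarrow> E \<subseteq> P \<or> F \<subseteq> P" if P: "primeideal P A" for P
    proof -
      interpret primeideal P A by (rule P)
      show ?thesis
      proof
        assume G: "?G \<subseteq> P"
        show "E \<subseteq> P \<or> F \<subseteq> P"
        proof (rule ccontr)
          assume "\<not> (E \<subseteq> P \<or> F \<subseteq> P)"
          then obtain e f where ef: "e \<in> E" "e \<notin> P" "f \<in> F" "f \<notin> P" by auto
          then have "e \<in> carrier A" "f \<in> carrier A" using E F by auto
          then have "e \<otimes>\<^bsub>A\<^esub> f \<in> P" using ef G by blast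
          then show False using I_prime ef \<open>e \<in> carrier A\<close> \<open>f \<in> carrier A\<close> by blast
        qed
      next
        assume "E \<subseteq> P \<or> F \<subseteq> P"
        then show "?G \<subseteq> P" using E F I_l_closed I_r_closed by blast
      qed
    qed
    have "S \<inter> T = {P \<in> prime_spectrum A. \<not> (E \<subseteq> P \<or> F \<subseteq> P)}"
      unfolding E(2) F(2) by blast
    also have "\<dots> = {P \<in> prime_spectrum A. \<not> ?G \<subseteq> P}"
    proof (rule Collect_cong)
      fix P
      show "(P \<in> prime_spectrum A \<and> \<not> (E \<subseteq> P \<or> F \<subseteq> P)) \<longleftrightarrow>
            (P \<in> prime_spectrum A \<and> \<not> ?G \<subseteq> P)"
        using G_iff[of P] unfolding prime_spectrum_def mem_Collect_eq by argo
    qed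
    also have "\<dots> = ?D ?G" by blast
    finally have "S \<inter> T = ?D ?G" .
    then show "\<exists>E\<subseteq>carrier A. S \<inter> T = ?D E" by blast
  next
    fix K
    assume "\<forall>S\<in>K. \<exists>E\<subseteq>carrier A. S = ?D E"
    then obtain e where e: "\<And>S. S \<in> K \<Longrightarrow> e S \<subseteq> carrier A \<and> S = ?D (e S)"
      by metis
    have "\<Union>K = (\<Union>S\<in>K. ?D (e S))"
      using e by (metis (no_types, lifting) SUP_cong SUP_identity_eq)
    also have "\<dots> = ?D (\<Union>(e ` K))" by auto
    finally have "\<Union>K = ?D (\<Union>(e ` K))" .
    moreover have "\<Union>(e ` K) \<subseteq> carrier A" using e by blast
    ultimately show "\<exists>E\<subseteq>carrier A. \<Union>K = ?D E" by blast
  qed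
  then show ?thesis
    unfolding zariski_def by simp
qed

text \<open>The fraction \<open>r / s\<close> in the localisation at \<open>P\<close>, as an equivalence class of pairs.\<close>

definition loc_frac :: "('k, 'a) module \<Rightarrow> 'a set \<Rightarrow> 'a \<Rightarrow> 'a \<Rightarrow> ('a \<times> 'a) set" where
  "loc_frac A P r s =
     {(r', s'). r' \<in> carrier A \<and> s' \<in> carrier A - P \<and>
        (\<exists>t\<in>carrier A - P. t \<otimes>\<^bsub>A\<^esub> (r \<otimes>\<^bsub>A\<^esub> s') = t \<otimes>\<^bsub>A\<^esub> (r' \<otimes>\<^bsub>A\<^esub> s))}"

definition localization :: "('k, 'a) module \<Rightarrow> 'a set \<Rightarrow> ('k, ('a \<times> 'a) set) module" where
  "localization A P =
     \<lparr>carrier = {loc_frac A P r s | r s. r \<in> carrier A \<and> s \<in> carrier A - P},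
      monoid.mult = (\<lambda>X Y. \<Union>(r, s)\<in>X. \<Union>(r', s')\<in>Y. loc_frac A P (r \<otimes>\<^bsub>A\<^esub> r') (s \<otimes>\<^bsub>A\<^esub> s')),
      one = loc_frac A P \<one>\<^bsub>A\<^esub> \<one>\<^bsub>A\<^esub>,
      ring.zero = loc_frac A P \<zero>\<^bsub>A\<^esub> \<one>\<^bsub>A\<^esub>,
      add = (\<lambda>X Y. \<Union>(r, s)\<in>X. \<Union>(r', s')\<in>Y.
        loc_frac A P ((r \<otimes>\<^bsub>A\<^esub> s') \<oplus>\<^bsub>A\<^esub> (r' \<otimes>\<^bsub>A\<^esub> s)) (s \<otimes>\<^bsub>A\<^esub> s')),
      smult = (\<lambda>c X. \<Union>(r, s)\<in>X. loc_frac A P (c \<odot>\<^bsub>A\<^esub> r) s)\<rparr>"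

definition Spec :: "('k, 'a) module \<Rightarrow> ('k, 'a set, ('a \<times> 'a) set) ringed_space" where
  "Spec A =
     \<lparr>rs_top = zariski A,
      rs_stalk = localization A,
      rs_sections = (\<lambda>U. {s \<in> (\<Pi>\<^sub>E P\<in>U. carrier (localization A P)).
        \<forall>P\<in>U. \<exists>W r d. openin (zariski A) W \<and> P \<in> W \<and> W \<subseteq> U \<and>
          r \<in> carrier A \<and> d \<in> carrier A \<and>
          (\<forall>Q\<in>W. d \<notin> Q \<and> s Q = loc_frac A Q r d)})\<rparr>"


section \<open>Polynomials and power series in finitely many variables\<close>

text \<open>
  The variables are indexed by a type \<open>'n\<close>, so that \<open>n = CARD('n)\<close>. Exponent vectors of
  polynomials have type \<open>'n \<Rightarrow>\<^sub>0 nat\<close>, those of power series have type \<open>'n \<Rightarrow> nat\<close>.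
\<close>

definition poly_alg :: "('k::field, ('n::finite \<Rightarrow>\<^sub>0 nat) \<Rightarrow>\<^sub>0 'k) module" where
  "poly_alg =
     \<lparr>carrier = UNIV, monoid.mult = (*), one = 1, ring.zero = 0, add = (+),
      smult = (\<lambda>c p. Poly_Mapping.single 0 c * p)\<rparr>"

definition poly_var :: "'n::finite \<Rightarrow> ('n \<Rightarrow>\<^sub>0 nat) \<Rightarrow>\<^sub>0 'k::field" where
  "poly_var i = Poly_Mapping.single (Poly_Mapping.single i 1) 1"

definition fps_alg :: "('k::field, ('n::finite \<Rightarrow> nat) \<Rightarrow> 'k) module" where
  "fps_alg =
     \<lparr>carrier = UNIV,
      monoid.mult = (\<lambda>f g m. \<Sum>(i, j) | \<forall>v. i v + j v = m v. f i * g j),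
      one = (\<lambda>m. if m = (\<lambda>v. 0) then 1 else 0),
      ring.zero = (\<lambda>m. 0),
      add = (\<lambda>f g m. f m + g m),
      smult = (\<lambda>c f m. c * f m)\<rparr>"

definition fps_var :: "'n::finite \<Rightarrow> ('n \<Rightarrow> nat) \<Rightarrow> 'k::field" where
  "fps_var i = (\<lambda>m. if m = (\<lambda>v. if v = i then 1 else 0) then 1 else 0)"

definition conv_fps_alg :: "(complex, ('n::finite \<Rightarrow> nat) \<Rightarrow> complex) module" where
  "conv_fps_alg =
     fps_alg\<lparr>carrier := {c. \<exists>r>0. (\<lambda>m. norm (c m) * r ^ (\<Sum>i\<in>UNIV. m i)) summable_on UNIV}\<rparr>"


section \<open>Complex analytic hypersurfaces\<close>

definition has_expansion ::
  "(complex ^ 'n::finite \<Rightarrow> complex) \<Rightarrow> complex ^ 'n \<Rightarrow> (('n \<Rightarrow> nat) \<Rightarrow> complex) \<Rightarrow> bool" where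
  "has_expansion g p c \<longleftrightarrow>
     c \<in> carrier conv_fps_alg \<and>
     (\<forall>\<^sub>F z in nhds 0. ((\<lambda>m. c m * (\<Prod>i\<in>UNIV. (z $ i) ^ m i)) has_sum g (p + z)) UNIV)"

definition holomorphic_at :: "(complex ^ 'n::finite \<Rightarrow> complex) \<Rightarrow> complex ^ 'n \<Rightarrow> bool" where
  "holomorphic_at g p \<longleftrightarrow> (\<exists>c. has_expansion g p c)"

definition taylor ::
  "(complex ^ 'n::finite \<Rightarrow> complex) \<Rightarrow> complex ^ 'n \<Rightarrow> (('n \<Rightarrow> nat) \<Rightarrow> complex)" where
  "taylor g p = (THE c. has_expansion g p c)"

text \<open>
  The zero locus of \<open>F\<close> with the structure sheaf \<open>O/(F)\<close>, where \<open>O\<close> is the sheaf of holomorphic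
  functions on \<open>\<complex>\<^sup>n\<close>. The local ring of \<open>O\<close> at \<open>p\<close> is identified with the ring of convergent
  power series by means of the Taylor expansion at \<open>p\<close>.
\<close>

definition hypersurface_ideal ::
  "(complex ^ 'n::finite \<Rightarrow> complex) \<Rightarrow> complex ^ 'n \<Rightarrow> (('n \<Rightarrow> nat) \<Rightarrow> complex) set" where
  "hypersurface_ideal F p = PIdl\<^bsub>conv_fps_alg\<^esub> (taylor F p)"

definition hypersurface_stalk ::
  "(complex ^ 'n::finite \<Rightarrow> complex) \<Rightarrow> complex ^ 'n \<Rightarrow>
   (complex, (('n \<Rightarrow> nat) \<Rightarrow> complex) set) module" where
  "hypersurface_stalk F p = quot_alg conv_fps_alg (hypersurface_ideal F p)"

definition analytic_hypersurface ::
  "(complex ^ 'n::finite \<Rightarrow> complex) \<Rightarrow>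
   (complex, complex ^ 'n, (('n \<Rightarrow> nat) \<Rightarrow> complex) set) ringed_space" where
  "analytic_hypersurface F =
     \<lparr>rs_top = top_of_set {z. F z = 0},
      rs_stalk = hypersurface_stalk F,
      rs_sections = (\<lambda>U. {s \<in> (\<Pi>\<^sub>E p\<in>U. carrier (hypersurface_stalk F p)).
        \<forall>p\<in>U. \<exists>D g. open D \<and> p \<in> D \<and> D \<inter> {z. F z = 0} \<subseteq> U \<and> (\<forall>q\<in>D. holomorphic_at g q) \<and>
          (\<forall>q\<in>D \<inter> {z. F z = 0}. s q = hypersurface_ideal F q +>\<^bsub>conv_fps_alg\<^esub> taylor g q)})\<rparr>"


section \<open>Algebroid spaces\<close>

text \<open>
  The formal spectrum of the complete local ring \<open>\<complex>[[X\<^sub>1,\<dots>,X\<^sub>n]]/I\<close>: its only point is the closed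
  point, and its structure sheaf has that ring as global sections. No continuity is required of
  isomorphisms, since every ring isomorphism between local rings is a homeomorphism for the
  topologies defined by the powers of the maximal ideals.
\<close>

definition algebroid_space ::
  "(('n::finite \<Rightarrow> nat) \<Rightarrow> complex) set \<Rightarrow>
   (complex, unit, (('n \<Rightarrow> nat) \<Rightarrow> complex) set) ringed_space" where
  "algebroid_space I =
     \<lparr>rs_top = discrete_topology UNIV,
      rs_stalk = (\<lambda>_. quot_alg fps_alg I),
      rs_sections = (\<lambda>U. \<Pi>\<^sub>E p\<in>U. carrier (quot_alg fps_alg I))\<rparr>"


section \<open>Brieskorn--Pham hypersurfaces\<close>

definition BP_poly :: "('n::finite \<Rightarrow> nat) \<Rightarrow> ('n \<Rightarrow>\<^sub>0 nat) \<Rightarrow>\<^sub>0 'k::field" where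
  "BP_poly a = (\<Sum>i\<in>UNIV. poly_var i ^ a i)"

definition BP_ring ::
  "('n::finite \<Rightarrow> nat) \<Rightarrow> ('k::field, (('n \<Rightarrow>\<^sub>0 nat) \<Rightarrow>\<^sub>0 'k) set) module" where
  "BP_ring a = quot_alg poly_alg (PIdl\<^bsub>poly_alg\<^esub> (BP_poly a))"

definition BP_variety ::
  "('n::finite \<Rightarrow> nat) \<Rightarrow>
   ('k::field, (('n \<Rightarrow>\<^sub>0 nat) \<Rightarrow>\<^sub>0 'k) set set,
    ((('n \<Rightarrow>\<^sub>0 nat) \<Rightarrow>\<^sub>0 'k) set \<times> (('n \<Rightarrow>\<^sub>0 nat) \<Rightarrow>\<^sub>0 'k) set) set) ringed_space" where
  "BP_variety a = Spec (BP_ring a)"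

definition BP_fps :: "('n::finite \<Rightarrow> nat) \<Rightarrow> ('n \<Rightarrow> nat) \<Rightarrow> complex" where
  "BP_fps a = (\<Oplus>\<^bsub>fps_alg\<^esub>i\<in>UNIV. fps_var i [^]\<^bsub>fps_alg\<^esub> a i)"

definition BP_formal_ring ::
  "('n::finite \<Rightarrow> nat) \<Rightarrow> (complex, (('n \<Rightarrow> nat) \<Rightarrow> complex) set) module" where
  "BP_formal_ring a = quot_alg fps_alg (PIdl\<^bsub>fps_alg\<^esub> (BP_fps a))"

definition BP_algebroid ::
  "('n::finite \<Rightarrow> nat) \<Rightarrow> (complex, unit, (('n \<Rightarrow> nat) \<Rightarrow> complex) set) ringed_space" where
  "BP_algebroid a = algebroid_space (PIdl\<^bsub>fps_alg\<^esub> (BP_fps a))"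

definition BP_analytic ::
  "('n::finite \<Rightarrow> nat) \<Rightarrow>
   (complex, complex ^ 'n, (('n \<Rightarrow> nat) \<Rightarrow> complex) set) ringed_space" where
  "BP_analytic a = analytic_hypersurface (\<lambda>z. \<Sum>i\<in>UNIV. (z $ i) ^ a i)"

definition perm_equiv :: "('n::finite \<Rightarrow> nat) \<Rightarrow> ('n \<Rightarrow> nat) \<Rightarrow> bool" where
  "perm_equiv a b \<longleftrightarrow> (\<exists>\<pi>. bij \<pi> \<and> b = a \<circ> \<pi>)"

end

theory Submission
  imports Defs "HOL-Computational_Algebra.Polynomial"
begin

text \<open>
  Let \<open>f\<^sub>b\<close> be the Brieskorn--Pham polynomial with exponents \<open>b\<close>. An isomorphism onto a ring modulo
  \<open>f\<^sub>b\<close> has, by the chain rule, a Jacobian matrix that is invertible modulo the Jacobian ideal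
  \<open>(X\<^sub>i\<^bsup>b\<^sub>i - 1\<^esup>)\<close>, so that it carries the Jacobian ideal of \<open>f\<^sub>a\<close> into that of \<open>f\<^sub>b\<close>, and it
  respects the filtration by the powers of the ideal of the origin. The Hilbert function of the Jacobian
  quotient counts the points of a given degree in the box \<open>\<Prod>\<^sub>i [0, a\<^sub>i - 1)\<close>, and its generating
  function \<open>\<Prod>\<^sub>i (1 - t\<^bsup>a\<^sub>i - 1\<^esup>) / (1 - t)\<close> determines the multiset of the \<open>a\<^sub>i\<close>. The argument is the
  same for polynomials and for formal and convergent power series. Isomorphic spectra have isomorphic
  global sections, and isomorphic analytic germs have isomorphic stalks.
\<close>

section \<open>Counting the points of a box by degree\<close>

text \<open>Differentiation does not preserve the ideal of the relations, so the chain rule is read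
  modulo the larger monomial ideal J = (X_i^(b_i - 1)). It contains f_b, since X_i^(b_i - 1) divides
  X_i^(b_i), and hence also all derivatives of multiples of f_b. Surjectivity makes the Jacobian
  matrix invertible modulo J: differentiate elements whose images are the coordinates.
  Differentiating the image of f_a shows that the matrix kills the images of the X_i^(a_i - 1), up
  to nonzero factors, and a Nakayama argument puts these images into J; it stops because J contains
  all monomials of high degree. For polynomials this also forces the origin to go to the origin, as
  the image of X_i becomes nilpotent modulo J. For power series everything is truncated to
  polynomials, and the order of a series has to be controlled without assuming continuity. Each
  direction of the isomorphism gives one inequality of dimensions. They are compared modulo every
  power of the ideal of the origin, since the total dimension alone would only give the product of
  the a_i - 1.\<close>

lemma prod_one_minus_monom_expand:
  fixes M :: "nat multiset"
  assumes "\<And>x. x \<in># M \<Longrightarrow> c \<le> x" and "c \<ge> 1"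
  shows "monom 1 (Suc c) dvd
    (\<Prod>x\<in>#M. 1 - monom 1 x) - (1 - monom (of_nat (count M c)) c :: int poly)"
  using assms
proof (induction M)
  case empty
  then show ?case by simp
next
  case (add x M)
  define P :: "int poly" where "P = (\<Prod>x\<in>#M. 1 - monom 1 x)"
  define k :: int where "k = of_nat (count M c)"
  obtain q where q: "P = 1 - monom k c + monom 1 (Suc c) * q"
    using add unfolding P_def k_def by (auto simp: dvd_def algebra_simps)
  have "c \<le> x" using add by simp
  then consider "x = c" | y where "x = Suc c + y" by (metis add_Suc le_Suc_ex less_imp_Suc_add le_eq_less_or_eq)
  then show ?case
  proof cases
    case 1
    \<comment> \<open>The product of the two t^c terms is k t^(2c); with c = d + 1 it equals t^(c+1)
      times k t^d.\<close>
    obtain d where d: "c = Suc d" using \<open>c \<ge> 1\<close> by (cases c) auto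
    have "(1 - monom 1 x) * P - (1 - monom (1 + k) c) = monom 1 (Suc c) * (monom k d + (1 - monom 1 c) * q)"
      unfolding q using 1 d
      by (simp add: algebra_simps mult_monom flip: add_monom)
    then show ?thesis using 1 by (simp add: P_def k_def)
  next
    case 2
    have "(1 - monom 1 x) * P - (1 - monom k c) = monom 1 (Suc c) * (- monom 1 y * P + q)"
    proof -
      have "monom 1 x = monom 1 (Suc c) * (monom 1 y :: int poly)" using 2 by (simp add: mult_monom)
      then show ?thesis unfolding q by (simp add: algebra_simps)
    qed
    then show ?thesis using 2 by (simp add: P_def k_def)
  qed
qed

text \<open>Modulo t^(c+1) the factors with x > c are 1, and those with x = c multiply to 1 - count
  * t^c, because t^(2c) vanishes there for c \<ge> 1.\<close>

lemma prod_one_minus_monom_coeff: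
  fixes M :: "nat multiset"
  assumes "\<And>x. x \<in># M \<Longrightarrow> c \<le> x" and "c \<ge> 1"
  shows "coeff (\<Prod>x\<in>#M. 1 - monom 1 x :: int poly) c = - of_nat (count M c)"
proof -
  obtain q where q: "(\<Prod>x\<in>#M. 1 - monom 1 x) = (1 - monom (of_nat (count M c)) c :: int poly) + monom 1 (Suc c) * q"
    using prod_one_minus_monom_expand[OF assms] by (auto simp: dvd_def algebra_simps)
  show ?thesis unfolding q using \<open>c \<ge> 1\<close>
    by (simp add: coeff_monom_mult coeff_eq_0 del: monom_Suc)
qed

text \<open>The least exponent on either side can be read off with its multiplicity from one
  coefficient. A factor 1 - t^c is nonzero for c \<ge> 1 and cancels, integer polynomials being a
  domain; induction on the size does the rest.\<close>

lemma prod_one_minus_monom_inj: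
  fixes M N :: "nat multiset"
  assumes "\<And>x. x \<in># M \<Longrightarrow> 1 \<le> x" "\<And>x. x \<in># N \<Longrightarrow> 1 \<le> x"
    and "(\<Prod>x\<in>#M. 1 - monom 1 x :: int poly) = (\<Prod>x\<in>#N. 1 - monom 1 x)"
  shows "M = N"
  using assms
proof (induction "size M" arbitrary: M N rule: less_induct)
  case less
  show ?case
  proof (cases "M + N = {#}")
    case True
    then show ?thesis by simp
  next
    case False
    define c where "c = Min (set_mset (M + N))"
    have c: "c \<in># M + N" using False unfolding c_def by (intro Min_in) auto
    have le: "c \<le> x" if "x \<in># M + N" for x using that unfolding c_def by (intro Min_le) auto
    have c1: "c \<ge> 1" using c less.prems by auto
    have "count M c = count N c"
      using prod_one_minus_monom_coeff[of M c] prod_one_minus_monom_coeff[of N c] le c1 less.prems(3)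
      by auto
    then have mem: "c \<in># M" "c \<in># N" using c by (metis not_in_iff union_iff)+
    have nz: "1 - monom 1 c \<noteq> (0 :: int poly)"
    proof
      assume "1 - monom 1 c = (0 :: int poly)"
      then have "coeff (1 - monom 1 c :: int poly) c = 0" by simp
      then show False using c1 by simp
    qed
    obtain M' N' where MN: "M = add_mset c M'" "N = add_mset c N'"
      using mem by (meson multi_member_split)
    have "M' = N'"
    proof (rule less.hyps)
      show "size M' < size M" using MN by simp
      show "(\<Prod>x\<in>#M'. 1 - monom 1 x :: int poly) = (\<Prod>x\<in>#N'. 1 - monom 1 x)"
        using less.prems(3) nz unfolding MN by simp
    qed (use less.prems MN in auto)
    then show ?thesis using MN by simp
  qed
qed

lemma geometric_monom:
  "(\<Sum>e<c. monom 1 e) * (1 - monom 1 1) = (1 - monom 1 c :: int poly)"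
proof (induction c)
  case (Suc c)
  have "monom 1 c * (1 - monom 1 1) = (monom 1 c - monom 1 (Suc c) :: int poly)"
    by (simp add: right_diff_distrib mult_monom)
  then show ?case using Suc by (simp add: distrib_right)
qed simp

text \<open>Choosing one monomial from every factor is choosing a point of the box. With a_i - 1 for
  \<open>c i\<close> this is the Hilbert series of the Jacobian quotient.\<close>

lemma coeff_prod_geometric:
  fixes c :: "'n::finite \<Rightarrow> nat"
  shows "coeff (\<Prod>i\<in>UNIV. \<Sum>e<c i. monom 1 e :: int poly) j =
    of_nat (card {m. (\<forall>i. m i < c i) \<and> sum m UNIV = j})"
proof -
  have prod_monom: "(\<Prod>i\<in>A. monom 1 (m i)) = (monom 1 (sum m A) :: int poly)" if "finite A" for m :: "'n \<Rightarrow> nat" and A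
    using that by induction (simp_all add: mult_monom)
  have fin: "finite (\<Pi>\<^sub>E i\<in>UNIV. {..<c i})" by (intro finite_PiE) auto
  have "coeff (\<Prod>i\<in>UNIV. \<Sum>e<c i. monom 1 e :: int poly) j =
        coeff (\<Sum>m\<in>(\<Pi>\<^sub>E i\<in>UNIV. {..<c i}). \<Prod>i\<in>UNIV. monom 1 (m i)) j"
    by (subst prod_sum_PiE) auto
  also have "\<dots> = (\<Sum>m\<in>(\<Pi>\<^sub>E i\<in>UNIV. {..<c i}). if sum m UNIV = j then 1 else 0)"
    by (auto simp: prod_monom coeff_sum intro!: sum.cong)
  also have "\<dots> = of_nat (card ((\<Pi>\<^sub>E i\<in>UNIV. {..<c i}) \<inter> {m. sum m UNIV = j}))"
    using fin by (simp add: sum.If_cases)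
  also have "(\<Pi>\<^sub>E i\<in>UNIV. {..<c i}) \<inter> {m. sum m UNIV = j} = {m. (\<forall>i. m i < c i) \<and> sum m UNIV = j}"
    by (auto simp: PiE_UNIV_domain)
  finally show ?thesis .
qed

text \<open>Fibres over the same value have equal size, so bijections can be chosen fibre by fibre
  and glued.\<close>

lemma perm_of_image_mset_eq:
  fixes c d :: "'n::finite \<Rightarrow> nat"
  assumes "image_mset c (mset_set UNIV) = image_mset d (mset_set UNIV)"
  shows "\<exists>\<pi>. bij \<pi> \<and> d = c \<circ> \<pi>"
proof -
  have "\<exists>f. bij_betw f (d -` {v}) (c -` {v})" for v
  proof -
    have "card (d -` {v}) = card (c -` {v})"
      using arg_cong[OF assms, of "\<lambda>M. count M v"] by (simp add: count_image_mset vimage_def)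
    then show ?thesis by (intro finite_same_card_bij) auto
  qed
  then obtain F where F: "\<And>v. bij_betw (F v) (d -` {v}) (c -` {v})" by metis
  define \<pi> where "\<pi> i = F (d i) i" for i
  have c\<pi>: "c (\<pi> i) = d i" for i
    using bij_betwE[OF F[of "d i"]] unfolding \<pi>_def by auto
  have "inj \<pi>"
  proof (rule injI)
    fix i j assume eq: "\<pi> i = \<pi> j"
    then have "d i = d j" using c\<pi> by metis
    then show "i = j" using F[of "d i"] eq unfolding \<pi>_def bij_betw_def inj_on_def by auto
  qed
  then show ?thesis using c\<pi> by (intro exI[of _ \<pi>]) (auto simp: finite_UNIV_inj_surj bij_def fun_eq_iff)
qed

lemma finite_box: "finite {m :: 'n::finite \<Rightarrow> nat. (\<forall>i. m i < e i) \<and> P m}"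
proof (rule finite_subset)
  show "{m. (\<forall>i. m i < e i) \<and> P m} \<subseteq> (\<Pi>\<^sub>E i\<in>UNIV. {..<e i})" by (auto simp: PiE_UNIV_domain)
qed (intro finite_PiE; auto)

text \<open>The hypothesis is cumulative (degree below \<open>j\<close>), the form in which
  dimensions are compared later. Consecutive differences give the coefficients of the Hilbert
  series, and multiplying by (1 - t)^n turns the series into the product of the 1 - t^(c_i).\<close>

lemma perm_of_box_count_eq:
  fixes c d :: "'n::finite \<Rightarrow> nat"
  assumes pos: "\<And>i. c i \<ge> 1" "\<And>i. d i \<ge> 1"
    and eq: "\<And>j. card {m. (\<forall>i. m i < c i) \<and> sum m UNIV < j} =
      card {m. (\<forall>i. m i < d i) \<and> sum m UNIV < j}"
  shows "\<exists>\<pi>. bij \<pi> \<and> d = c \<circ> \<pi>"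
proof -
  have split: "card {m. (\<forall>i. m i < e i) \<and> sum m UNIV < Suc j} =
     card {m. (\<forall>i. m i < e i) \<and> sum m UNIV < j} + card {m. (\<forall>i. m i < e i) \<and> sum m UNIV = j}"
    for e :: "'n \<Rightarrow> nat" and j
    by (subst card_Un_disjoint[symmetric]) (auto intro!: finite_box arg_cong[of _ _ card])
  have "card {m. (\<forall>i. m i < c i) \<and> sum m UNIV = j} = card {m. (\<forall>i. m i < d i) \<and> sum m UNIV = j}" for j
    using split[of c j] split[of d j] eq[of j] eq[of "Suc j"] by simp
  then have "(\<Prod>i\<in>UNIV. \<Sum>e<c i. monom 1 e :: int poly) = (\<Prod>i\<in>UNIV. \<Sum>e<d i. monom 1 e)"
    by (intro poly_eqI) (simp add: coeff_prod_geometric)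
  then have "(\<Prod>i\<in>UNIV. (\<Sum>e<c i. monom 1 e) * (1 - monom 1 1)) =
      (\<Prod>i\<in>UNIV. (\<Sum>e<d i. monom 1 e) * (1 - monom 1 1 :: int poly))"
    by (simp add: prod.distrib)
  then have "(\<Prod>x\<in>#image_mset c (mset_set UNIV). 1 - monom 1 x :: int poly) =
      (\<Prod>x\<in>#image_mset d (mset_set UNIV). 1 - monom 1 x)"
    unfolding geometric_monom by (simp add: prod_unfold_prod_mset image_mset.compositionality comp_def)
  then have "image_mset c (mset_set UNIV) = image_mset d (mset_set UNIV)"
    by (intro prod_one_minus_monom_inj) (use pos in auto)
  then show ?thesis by (rule perm_of_image_mset_eq)
qed

section \<open>Polynomials and their partial derivatives\<close>

abbreviation lookup :: "('a \<Rightarrow>\<^sub>0 'b::zero) \<Rightarrow> 'a \<Rightarrow> 'b" where "lookup \<equiv> Poly_Mapping.lookup"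
abbreviation keys :: "('a \<Rightarrow>\<^sub>0 'b::zero) \<Rightarrow> 'a set" where "keys \<equiv> Poly_Mapping.keys"

section \<open>Ideals and congruences in a commutative ring\<close>

definition ideal_set :: "'a::comm_ring_1 set \<Rightarrow> bool" where
  "ideal_set K \<longleftrightarrow> 0 \<in> K \<and> (\<forall>x\<in>K. \<forall>y\<in>K. x + y \<in> K) \<and> (\<forall>x\<in>K. \<forall>r. r * x \<in> K)"

definition eqm :: "'a::comm_ring_1 set \<Rightarrow> 'a \<Rightarrow> 'a \<Rightarrow> bool" where
  "eqm K p q \<longleftrightarrow> p - q \<in> K"

lemma ideal_setD:
  assumes "ideal_set K"
  shows "0 \<in> K" "x \<in> K \<Longrightarrow> y \<in> K \<Longrightarrow> x + y \<in> K" "x \<in> K \<Longrightarrow> r * x \<in> K" "x \<in> K \<Longrightarrow> x * r \<in> K"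
    "x \<in> K \<Longrightarrow> - x \<in> K" "x \<in> K \<Longrightarrow> y \<in> K \<Longrightarrow> x - y \<in> K"
proof -
  show *: "0 \<in> K" "x \<in> K \<Longrightarrow> y \<in> K \<Longrightarrow> x + y \<in> K" "x \<in> K \<Longrightarrow> r * x \<in> K" for x y r
    using assms by (auto simp: ideal_set_def)
  show "x \<in> K \<Longrightarrow> x * r \<in> K" using *(3)[of x r] by (simp add: mult.commute)
  show m: "x \<in> K \<Longrightarrow> - x \<in> K" for x using *(3)[of x "-1"] by simp
  show "x \<in> K \<Longrightarrow> y \<in> K \<Longrightarrow> x - y \<in> K" using *(2)[of x "-y"] m[of y] by simp
qed

lemma ideal_set_sum: "ideal_set K \<Longrightarrow> (\<And>i. i \<in> A \<Longrightarrow> f i \<in> K) \<Longrightarrow> sum f A \<in> K"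
  by (induction A rule: infinite_finite_induct) (auto simp: ideal_setD)

lemma eqm_refl: "ideal_set K \<Longrightarrow> eqm K p p"
  by (simp add: eqm_def ideal_setD)

lemma eqm_sym: "ideal_set K \<Longrightarrow> eqm K p q \<Longrightarrow> eqm K q p"
  unfolding eqm_def using ideal_setD(5)[of K "p - q"] by simp

lemma eqm_trans: "ideal_set K \<Longrightarrow> eqm K p q \<Longrightarrow> eqm K q r \<Longrightarrow> eqm K p r"
  unfolding eqm_def using ideal_setD(2)[of K "p - q" "q - r"] by simp

lemma eqm_add: "ideal_set K \<Longrightarrow> eqm K p q \<Longrightarrow> eqm K r s \<Longrightarrow> eqm K (p + r) (q + s)"
  unfolding eqm_def using ideal_setD(2)[of K "p - q" "r - s"] by (simp add: algebra_simps)

lemma eqm_mult: "ideal_set K \<Longrightarrow> eqm K p q \<Longrightarrow> eqm K r s \<Longrightarrow> eqm K (p * r) (q * s)"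
  unfolding eqm_def
  using ideal_setD(2)[OF _ ideal_setD(3)[of K "p - q" r] ideal_setD(3)[of K "r - s" q]]
  by (simp add: algebra_simps)

lemma eqm_sum: "ideal_set K \<Longrightarrow> (\<And>i. i \<in> A \<Longrightarrow> eqm K (f i) (g i)) \<Longrightarrow> eqm K (sum f A) (sum g A)"
  unfolding eqm_def by (simp flip: sum_subtractf add: ideal_set_sum)

lemma eqm_mono: "eqm K p q \<Longrightarrow> K \<subseteq> J \<Longrightarrow> eqm J p q"
  by (auto simp: eqm_def)

lemma eqm_mem: "ideal_set K \<Longrightarrow> eqm K p q \<Longrightarrow> q \<in> K \<Longrightarrow> p \<in> K"
  unfolding eqm_def using ideal_setD(2)[of K "p - q" q] by simp

section \<open>Polynomials as sums of monomials\<close>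

lemma poly_mapping_sum_single:
  fixes p :: "'a \<Rightarrow>\<^sub>0 'b::comm_monoid_add"
  shows "(\<Sum>m\<in>keys p. Poly_Mapping.single m (lookup p m)) = p"
proof (rule poly_mapping_eqI)
  fix k
  have "lookup (\<Sum>m\<in>keys p. Poly_Mapping.single m (lookup p m)) k = (\<Sum>m\<in>keys p. if m = k then lookup p m else 0)"
    by (auto simp: lookup_sum lookup_single when_def intro!: sum.cong)
  also have "\<dots> = lookup p k" by (auto simp: in_keys_iff)
  finally show "lookup (\<Sum>m\<in>keys p. Poly_Mapping.single m (lookup p m)) k = lookup p k" .
qed

text \<open>For statements about monomial ideals: only monomials with exponent in \<open>S\<close>
  may enter the induction.\<close>

lemma poly_mapping_support_induct [consumes 1, case_names zero single add]:
  fixes p :: "'a \<Rightarrow>\<^sub>0 'b::comm_monoid_add"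
  assumes "keys p \<subseteq> S" and "P 0"
    and single: "\<And>m c. m \<in> S \<Longrightarrow> P (Poly_Mapping.single m c)"
    and add: "\<And>p q. P p \<Longrightarrow> P q \<Longrightarrow> P (p + q)"
  shows "P p"
proof -
  have "P (\<Sum>m\<in>A. Poly_Mapping.single m (lookup p m))" if "finite A" "A \<subseteq> S" for A
    using that by induction (auto intro: assms)
  from this[of "keys p"] show ?thesis using assms(1) by (simp add: poly_mapping_sum_single)
qed

lemma poly_mapping_single_induct [case_names single add]:
  fixes p :: "'a \<Rightarrow>\<^sub>0 'b::comm_monoid_add"
  assumes "\<And>m c. P (Poly_Mapping.single m c)"
    and add: "\<And>p q. P p \<Longrightarrow> P q \<Longrightarrow> P (p + q)"
  shows "P p"
  using subset_UNIV[of "keys p"] assms(1)[of undefined 0]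
  by (induction rule: poly_mapping_support_induct) (auto intro: assms)

definition mdeg :: "('n::finite \<Rightarrow>\<^sub>0 nat) \<Rightarrow> nat" where
  "mdeg m = (\<Sum>i\<in>UNIV. lookup m i)"

lemma mdeg_add: "mdeg (m + k) = mdeg m + mdeg k"
  by (simp add: mdeg_def lookup_add sum.distrib)

lemma mdeg_single [simp]: "mdeg (Poly_Mapping.single i k) = k"
  by (simp add: mdeg_def lookup_single when_def)

lemma mdeg_zero [simp]: "mdeg 0 = 0"
  by (simp add: mdeg_def)

lemma mdeg_eq_0_iff: "mdeg m = 0 \<longleftrightarrow> m = 0"
  by (auto simp: mdeg_def intro: poly_mapping_eqI)

lemma expo_split: "k \<le> lookup m i \<Longrightarrow> (m - Poly_Mapping.single i k) + Poly_Mapping.single i k = m" for m :: "'n \<Rightarrow>\<^sub>0 nat"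
  by (rule poly_mapping_eqI) (auto simp: lookup_add lookup_minus lookup_single when_def)

lemma expo_induct [case_names zero step]:
  fixes m :: "'n::finite \<Rightarrow>\<^sub>0 nat"
  assumes "P 0" and step: "\<And>i m. P m \<Longrightarrow> P (Poly_Mapping.single i 1 + m)"
  shows "P m"
proof (induction "mdeg m" arbitrary: m)
  case 0
  then show ?case using assms(1) mdeg_eq_0_iff by metis
next
  case (Suc d)
  then obtain i where "lookup m i \<noteq> 0" unfolding mdeg_def by force
  then have m: "(m - Poly_Mapping.single i 1) + Poly_Mapping.single i 1 = m" by (intro expo_split) auto
  then have "mdeg (m - Poly_Mapping.single i 1) + 1 = Suc d" using Suc.hyps(2) by (metis mdeg_add mdeg_single)
  then have "P (m - Poly_Mapping.single i 1)" using Suc.hyps(1) by simp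
  from step[OF this, of i] show ?case using m by (simp add: add.commute)
qed

type_synonym ('n, 'k) mpoly = "('n \<Rightarrow>\<^sub>0 nat) \<Rightarrow>\<^sub>0 'k"

text \<open>Constants and variables generate the ring. Suited to identities, such as the chain rule,
  that pass to products but are not evident on monomials.\<close>

lemma mpoly_induct [case_names const var add mult]:
  fixes p :: "('n::finite, 'k::field) mpoly"
  assumes const: "\<And>c. P (Poly_Mapping.single 0 c)" and var: "\<And>i. P (poly_var i)"
    and add: "\<And>p q. P p \<Longrightarrow> P q \<Longrightarrow> P (p + q)" and mult: "\<And>p q. P p \<Longrightarrow> P q \<Longrightarrow> P (p * q)"
  shows "P p"
proof (induction p rule: poly_mapping_single_induct)
  case (single m c)
  show ?case
  proof (induction m rule: expo_induct)
    case zero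
    show ?case by (rule const)
  next
    case (step i m)
    show ?case using mult[OF var[of i] step] by (simp add: poly_var_def mult_single)
  qed
qed (rule add)

text \<open>For \<open>S\<close> stable under adding exponents this is the monomial ideal spanned by
  \<open>S\<close>, with membership decided coefficient by coefficient.\<close>

definition supported :: "'a set \<Rightarrow> ('a \<Rightarrow>\<^sub>0 'k::zero) set" where
  "supported S = {p. keys p \<subseteq> S}"

lemma supported_mult:
  assumes "p \<in> supported S" "q \<in> supported T" "\<And>m k. m \<in> S \<Longrightarrow> k \<in> T \<Longrightarrow> m + k \<in> U"
  shows "p * q \<in> supported U"
  using assms keys_mult[of p q] unfolding supported_def by fast

lemma ideal_set_supported:
  fixes S :: "('a::comm_monoid_add) set"
  assumes "\<And>m k. m \<in> S \<Longrightarrow> k + m \<in> S"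
  shows "ideal_set (supported S :: ('a \<Rightarrow>\<^sub>0 'k::comm_ring_1) set)"
  unfolding ideal_set_def
proof (intro conjI ballI allI)
  show "x + y \<in> supported S" if "x \<in> supported S" "y \<in> supported S" for x y :: "'a \<Rightarrow>\<^sub>0 'k"
    using that Poly_Mapping.keys_add[of x y] unfolding supported_def by blast
  show "r * x \<in> supported S" if "x \<in> supported S" for r x :: "'a \<Rightarrow>\<^sub>0 'k"
    by (rule supported_mult[OF _ that, of r UNIV]) (use assms in \<open>auto simp: supported_def\<close>)
qed (simp add: supported_def)

section \<open>Formal partial derivatives\<close>

lift_definition partial :: "'n \<Rightarrow> ('n, 'k::field) mpoly \<Rightarrow> ('n::finite, 'k) mpoly" is
  "\<lambda>j p m. of_nat (lookup m j + 1) * p (m + Poly_Mapping.single j 1)"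
proof -
  fix j :: 'n and p :: "('n \<Rightarrow>\<^sub>0 nat) \<Rightarrow> 'k"
  assume "finite {m. p m \<noteq> 0}"
  then have "finite ((\<lambda>m. m + Poly_Mapping.single j 1) -` {m. p m \<noteq> 0})"
    by (rule finite_vimageI) (auto intro: injI)
  then show "finite {m. of_nat (lookup m j + 1) * p (m + Poly_Mapping.single j 1) \<noteq> 0}"
    by (rule rev_finite_subset) auto
qed

lemma partial_add: "partial j (p + q) = partial j p + partial j q"
  by (rule poly_mapping_eqI) (simp add: partial.rep_eq lookup_add algebra_simps)

lemma partial_diff: "partial j (p - q) = partial j p - partial j q"
  by (rule poly_mapping_eqI) (simp add: partial.rep_eq lookup_minus algebra_simps)

lemma partial_sum: "partial j (sum f A) = (\<Sum>i\<in>A. partial j (f i))"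
proof (induction A rule: infinite_finite_induct)
  case empty
  show ?case by (rule poly_mapping_eqI) (simp add: partial.rep_eq)
next
  case (infinite A)
  then show ?case by (auto intro!: poly_mapping_eqI simp: partial.rep_eq)
qed (simp add: partial_add)

text \<open>If X_j does not occur, the truncated subtraction leaves the exponent unchanged, but the
  coefficient is then \<open>of_nat 0\<close>.\<close>

lemma partial_single:
  fixes c :: "'b::field"
  shows "partial j (Poly_Mapping.single m c) = Poly_Mapping.single (m - Poly_Mapping.single j 1) (of_nat (lookup m j) * c)"
proof (rule poly_mapping_eqI)
  fix k
  have "m = k + Poly_Mapping.single j 1 \<longleftrightarrow> m - Poly_Mapping.single j 1 = k" if "lookup m j \<noteq> 0"
    using expo_split[of 1 m j] that by auto
  moreover have "1 + of_nat (lookup (m - Poly_Mapping.single j 1) j) = (of_nat (lookup m j) :: 'b)" if "lookup m j \<noteq> 0"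
    using that by (cases "lookup m j") (auto simp: lookup_minus lookup_single)
  ultimately  show "lookup (partial j (Poly_Mapping.single m c)) k =
      lookup (Poly_Mapping.single (m - Poly_Mapping.single j 1) (of_nat (lookup m j) * c)) k"
    by (cases "lookup m j = 0") (auto simp: partial.rep_eq lookup_single when_def lookup_add)
qed

text \<open>Both sides are bilinear, so comparing monomials is enough.\<close>

lemma partial_mult: "partial j (p * q) = partial j p * q + p * partial j q"
proof (induction p rule: poly_mapping_single_induct)
  case (single m c)
  show ?case
  proof (induction q rule: poly_mapping_single_induct)
    case (single k d)
    \<comment> \<open>Truncated subtraction may be moved onto a factor only if that factor contains
      X_j; otherwise a zero coefficient removes the term.\<close>
    have 1: "m + k - Poly_Mapping.single j 1 = m - Poly_Mapping.single j 1 + k" if "lookup m j \<noteq> 0"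
      using that by (intro poly_mapping_eqI) (auto simp: lookup_add lookup_minus lookup_single when_def)
    have 2: "m + k - Poly_Mapping.single j 1 = m + (k - Poly_Mapping.single j 1)" if "lookup k j \<noteq> 0"
      using that by (intro poly_mapping_eqI) (auto simp: lookup_add lookup_minus lookup_single when_def)
    consider "lookup m j = 0" "lookup k j = 0" | "lookup m j = 0" "lookup k j \<noteq> 0"
      | "lookup m j \<noteq> 0" "lookup k j = 0" | "lookup m j \<noteq> 0" "lookup k j \<noteq> 0" by blast
    then show ?case
      using 1 2 by cases (simp_all add: mult_single partial_single lookup_add single_add[symmetric] algebra_simps)
  qed (simp add: partial_add algebra_simps)
qed (simp add: partial_add algebra_simps)

text \<open>Exponents add up to 0 only if both are 0, so taking the constant term is evaluation at
  the origin.\<close>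

lemma lookup_mult_zero: "lookup (p * q) 0 = lookup p 0 * lookup q 0" for p q :: "('n, 'k::field) mpoly"
proof (induction p rule: poly_mapping_single_induct)
  case (single m c)
  show ?case
  proof (induction q rule: poly_mapping_single_induct)
    case (single k d)
    have "m + k = 0 \<longleftrightarrow> m = 0 \<and> k = 0"
      by (auto simp: poly_mapping_eq_iff lookup_add fun_eq_iff)
    then show ?case by (auto simp: mult_single lookup_single when_def)
  qed (simp add: lookup_add algebra_simps)
qed (simp add: lookup_add algebra_simps)

lemma lookup_power_zero: "lookup (p ^ k) 0 = lookup p 0 ^ k" for p :: "('n, 'k::field) mpoly"
  by (induction k) (simp_all add: lookup_mult_zero)

lemma poly_var_power: "poly_var i ^ k = Poly_Mapping.single (Poly_Mapping.single i k) (1 :: 'k::field)"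
  by (induction k) (simp_all add: poly_var_def mult_single single_add[symmetric])

lemma partial_BP_poly:
  "partial j (BP_poly a) = Poly_Mapping.single (Poly_Mapping.single j (a j - 1)) (of_nat (a j))"
proof -
  have "partial j (BP_poly a) = (\<Sum>i\<in>UNIV. if i = j then Poly_Mapping.single (Poly_Mapping.single j (a j - 1)) (of_nat (a j)) else 0)"
    unfolding BP_poly_def partial_sum poly_var_power partial_single
    by (rule sum.cong) (auto simp: lookup_single single_diff[symmetric])
  then show ?thesis by simp
qed

section \<open>Transfer of the Jacobian ideal\<close>

text \<open>\<open>supported (jac_expos a d)\<close> is the Jacobian ideal of f_a plus the d-th
  power of the ideal of the origin. Both are monomial ideals, because in characteristic 0 the factor
  a_i of the derivative a_i X_i^(a_i - 1) is a unit.\<close>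

definition jac_expos :: "('n::finite \<Rightarrow> nat) \<Rightarrow> nat \<Rightarrow> ('n \<Rightarrow>\<^sub>0 nat) set" where
  "jac_expos a d = {m. (\<exists>i. a i - 1 \<le> lookup m i) \<or> d \<le> mdeg m}"

lemma jac_expos_add: "m \<in> jac_expos a d \<Longrightarrow> k + m \<in> jac_expos a d"
  by (force simp: jac_expos_def lookup_add mdeg_add intro: trans_le_add2)

lemma ideal_set_jac: "ideal_set (supported (jac_expos a d) :: ('n::finite, 'k::field) mpoly set)"
  by (intro ideal_set_supported jac_expos_add)

text \<open>A monomial outside the Jacobian ideal has all exponents below a_i, hence degree below
  the sum of the a_i. From that degree on, the ideal is the Jacobian ideal itself.\<close>

lemma jac_expos_large:
  fixes a :: "'n::finite \<Rightarrow> nat"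
  assumes "sum a UNIV \<le> d" "sum a UNIV \<le> d'"
  shows "jac_expos a d = jac_expos a d'"
proof -
  have "\<exists>i. a i - 1 \<le> lookup m i" if "sum a UNIV \<le> mdeg m" for m
  proof (rule ccontr)
    assume *: "\<not> ?thesis"
    then have "lookup m i < a i" for i by (meson diff_le_self dual_order.trans leI)
    then have "mdeg m < sum a UNIV" unfolding mdeg_def by (intro sum_strict_mono) auto
    then show False using that by simp
  qed
  then show ?thesis using assms unfolding jac_expos_def by fastforce
qed

text \<open>
  An algebra homomorphism into \<open>k[X]/K\<close> is represented by an arbitrary map \<open>L\<close> choosing
  representatives, which is a homomorphism only modulo \<open>K\<close>; this avoids substitution of polynomials.
\<close>

locale hom_mod =
  fixes K :: "('n::finite, 'k::field_char_0) mpoly set" and L :: "('n, 'k) mpoly \<Rightarrow> ('n, 'k) mpoly"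
  assumes ideal_K: "ideal_set K"
    and L_add: "eqm K (L (p + q)) (L p + L q)"
    and L_mult: "eqm K (L (p * q)) (L p * L q)"
    and L_const: "eqm K (L (Poly_Mapping.single 0 c)) (Poly_Mapping.single 0 c)"
begin

lemma L_zero: "L 0 \<in> K"
  using L_const[of 0] by (simp add: eqm_def)

lemma L_power: "k > 0 \<Longrightarrow> eqm K (L (p ^ k)) (L p ^ k)"
proof (induction k)
  case (Suc k)
  show ?case
  proof (cases "k = 0")
    case False
    then show ?thesis
      using eqm_trans[OF ideal_K L_mult eqm_mult[OF ideal_K eqm_refl[OF ideal_K] Suc.IH]] by simp
  qed (simp add: eqm_refl ideal_K)
qed simp

text \<open>Since derivatives of elements of \<open>K\<close> lie in \<open>J\<close>,
  differentiation is well defined from classes modulo \<open>K\<close> to classes modulo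
  \<open>J\<close>. Both sides then obey the sum and the product rule, and constants and variables
  remain to be checked.\<close>

lemma chain_rule:
  assumes J: "ideal_set J" "K \<subseteq> J" and dK: "\<And>p. p \<in> K \<Longrightarrow> partial j p \<in> J"
  shows "eqm J (partial j (L q)) (\<Sum>i\<in>UNIV. L (partial i q) * partial j (L (poly_var i)))"
proof -
  note JR = eqm_refl[OF J(1)]
  note JT = eqm_trans[OF J(1)]
  have up: "eqm J p q" if "eqm K p q" for p q using that J(2) by (rule eqm_mono)
  have dup: "eqm J (partial j p) (partial j q)" if "eqm K p q" for p q
    using dK that unfolding eqm_def by (metis partial_diff)
  \<comment> \<open>The derivatives of a variable form a Kronecker delta; here such a sum collapses
    to one term, with \<open>L\<close> replaced by its value on constants.\<close>
  have L_ind: "eqm J (\<Sum>i\<in>UNIV. L (if i = l then Poly_Mapping.single 0 c else 0) * f i) (Poly_Mapping.single 0 c * f l)"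
    for c f and l :: 'n
  proof -
    have "eqm J (\<Sum>i\<in>UNIV. L (if i = l then Poly_Mapping.single 0 c else 0) * f i)
             (\<Sum>i\<in>UNIV. (if i = l then Poly_Mapping.single 0 c else 0) * f i)"
      using L_const[of c] L_const[of 0]
      by (intro eqm_sum[OF J(1)] eqm_mult[OF J(1)] JR) (auto intro: up)
    also have "(\<Sum>i\<in>UNIV. (if i = l then Poly_Mapping.single 0 c else 0) * f i) = Poly_Mapping.single 0 c * f l"
      by (subst sum.cong[OF refl, of _ _ "\<lambda>i. if i = l then Poly_Mapping.single 0 c * f l else 0"]) auto
    finally show ?thesis .
  qed
  show ?thesis
  proof (induction q rule: mpoly_induct)
    case (const c)
    have "eqm J (partial j (L (Poly_Mapping.single 0 c))) 0"
      using dup[OF L_const[of c]] by (simp add: partial_single)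
    moreover have "eqm J 0 (\<Sum>i\<in>UNIV. L (partial i (Poly_Mapping.single 0 c)) * partial j (L (poly_var i)))"
    proof -
      \<comment> \<open>All derivatives of a constant vanish; written as a delta with value 0 at an
        arbitrary index they fit \<open>L_ind\<close>.\<close>
      have p: "partial i (Poly_Mapping.single 0 c) = (if i = undefined then Poly_Mapping.single 0 0 else 0)" for i :: 'n
        by (simp add: partial_single)
      have "eqm J (\<Sum>i\<in>UNIV. L (partial i (Poly_Mapping.single 0 c)) * partial j (L (poly_var i)))
          (Poly_Mapping.single 0 0 * partial j (L (poly_var undefined)))"
        unfolding p by (rule L_ind)
      then have "eqm J (\<Sum>i\<in>UNIV. L (partial i (Poly_Mapping.single 0 c)) * partial j (L (poly_var i))) 0"
        by simp
      then show ?thesis by (rule eqm_sym[OF J(1)])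
    qed
    ultimately show ?case by (rule JT)
  next
    case (var l)
    have "partial i (poly_var l) = (if i = l then Poly_Mapping.single 0 (1::'k) else 0)" for i
      by (simp add: poly_var_def partial_single lookup_single)
    then have "eqm J (\<Sum>i\<in>UNIV. L (partial i (poly_var l)) * partial j (L (poly_var i))) (partial j (L (poly_var l)))"
      using L_ind[of l 1 "\<lambda>i. partial j (L (poly_var i))"] by simp
    then show ?case by (rule eqm_sym[OF J(1)])
  next
    case (add p q)
    let ?d = "\<lambda>i. partial j (L (poly_var i))"
    have 1: "eqm J (partial j (L (p + q))) (partial j (L p) + partial j (L q))"
      using dup[OF L_add] by (simp add: partial_add)
    have 2: "eqm J (partial j (L p) + partial j (L q))
        ((\<Sum>i\<in>UNIV. L (partial i p) * ?d i) + (\<Sum>i\<in>UNIV. L (partial i q) * ?d i))"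
      using add by (rule eqm_add[OF J(1)])
    have 3: "(\<Sum>i\<in>UNIV. L (partial i p) * ?d i) + (\<Sum>i\<in>UNIV. L (partial i q) * ?d i) =
        (\<Sum>i\<in>UNIV. (L (partial i p) + L (partial i q)) * ?d i)"
      by (simp add: distrib_right sum.distrib)
    have 4: "eqm J (\<Sum>i\<in>UNIV. (L (partial i p) + L (partial i q)) * ?d i)
         (\<Sum>i\<in>UNIV. L (partial i (p + q)) * ?d i)"
      unfolding partial_add using L_add
      by (intro eqm_sum[OF J(1)] eqm_mult[OF J(1)] JR) (auto intro: up eqm_sym[OF ideal_K])
    show ?case by (rule JT[OF 1 JT[OF 2[unfolded 3] 4]])
  next
    case (mult p q)
    let ?d = "\<lambda>i. partial j (L (poly_var i))"
    have 1: "eqm J (partial j (L (p * q))) (partial j (L p) * L q + L p * partial j (L q))"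
      using dup[OF L_mult] by (simp add: partial_mult)
    have 2: "eqm J (partial j (L p) * L q + L p * partial j (L q))
        ((\<Sum>i\<in>UNIV. L (partial i p) * ?d i) * L q + L p * (\<Sum>i\<in>UNIV. L (partial i q) * ?d i))"
      using mult by (intro eqm_add[OF J(1)] eqm_mult[OF J(1)] JR)
    have 3: "(\<Sum>i\<in>UNIV. L (partial i p) * ?d i) * L q + L p * (\<Sum>i\<in>UNIV. L (partial i q) * ?d i)
       = (\<Sum>i\<in>UNIV. (L (partial i p) * L q + L p * L (partial i q)) * ?d i)"
      by (simp add: sum_distrib_left sum_distrib_right sum.distrib algebra_simps)
    have 4: "eqm J (\<Sum>i\<in>UNIV. (L (partial i p) * L q + L p * L (partial i q)) * ?d i)
         (\<Sum>i\<in>UNIV. L (partial i (p * q)) * ?d i)"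
    proof (intro eqm_sum[OF J(1)] eqm_mult[OF J(1)] JR up)
      fix i
      have "eqm K (L (partial i p * q + p * partial i q)) (L (partial i p) * L q + L p * L (partial i q))"
        by (rule eqm_trans[OF ideal_K L_add]) (intro eqm_add[OF ideal_K] L_mult)
      then show "eqm K (L (partial i p) * L q + L p * L (partial i q)) (L (partial i (p * q)))"
        unfolding partial_mult by (rule eqm_sym[OF ideal_K])
    qed
    show ?case by (rule JT[OF 1 JT[OF 2[unfolded 3] 4]])
  qed
qed

end

text \<open>The filtration step: a factor without constant term raises \<open>d\<close> by
  one.\<close>

lemma add_deg_expos:
  assumes "1 \<le> mdeg m" "k \<in> jac_expos b d"
  shows "m + k \<in> jac_expos b (Suc d)"
  using assms by (force simp: jac_expos_def lookup_add mdeg_add intro: trans_le_add2)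

lemma supported_mdeg_pos:
  "lookup p 0 = 0 \<Longrightarrow> p \<in> supported {m. 1 \<le> mdeg m}"
  unfolding supported_def by (auto simp: in_keys_iff Suc_le_eq) (metis gr0I mdeg_eq_0_iff)

text \<open>As b_i - 1 \<ge> 1, the exponent 0 is not in the set: the ideal lies in the maximal
  ideal of the origin.\<close>

lemma lookup_zero_of_supported:
  assumes "p \<in> supported (jac_expos b d)" "\<And>i. 2 \<le> b i" "0 < d"
  shows "lookup p 0 = 0"
proof -
  have "0 \<notin> jac_expos b d"
    using assms(2,3) by (auto simp: jac_expos_def) (metis One_nat_def Suc_1 not_less_eq_eq)
  then show ?thesis using assms(1) by (auto simp: supported_def in_keys_iff)
qed

lemma lookup_sum_zero: "lookup (\<Sum>i\<in>A. f i * g i) 0 = (\<Sum>i\<in>A. lookup (f i) 0 * lookup (g i) 0)"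
  for f g :: "_ \<Rightarrow> ('n, 'k::field) mpoly"
  by (simp add: lookup_sum lookup_mult_zero)

text \<open>\<open>K\<close> stands for the multiples of f_b, or in the power series case for the
  polynomials that agree with such multiples in low degree. \<open>L\<close> is only a surjection
  killing f_a; an isomorphism is exploited by using the locale in both directions.\<close>

locale BP_hom = hom_mod K L
  for K :: "('n::finite, 'k::field_char_0) mpoly set" and L :: "('n, 'k) mpoly \<Rightarrow> ('n, 'k) mpoly" +
  fixes a b :: "'n \<Rightarrow> nat"
  assumes a2: "\<And>i. 2 \<le> a i" and b2: "\<And>i. 2 \<le> b i"
    and L_surj: "\<And>p. \<exists>q. eqm K (L q) p"
    and L_BP: "L (BP_poly a) \<in> K"
    and K_jac: "K \<subseteq> supported (jac_expos b (sum b UNIV))"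
    and partial_K: "\<And>j p. p \<in> K \<Longrightarrow> partial j p \<in> supported (jac_expos b (sum b UNIV))"
begin

abbreviation J :: "('n, 'k) mpoly set" where "J \<equiv> supported (jac_expos b (sum b UNIV))"

lemma sum_b_pos: "0 < sum b UNIV"
  using b2 by (intro sum_pos) (auto intro: less_le_trans[of 0 2])

lemma J_lookup_zero: "p \<in> J \<Longrightarrow> lookup p 0 = 0"
  using lookup_zero_of_supported b2 sum_b_pos by blast

lemma K_up: "eqm K p q \<Longrightarrow> eqm J p q"
  by (rule eqm_mono[OF _ K_jac])

text \<open>The Jacobian matrix of the images of the coordinates.\<close>

definition M :: "'n \<Rightarrow> 'n \<Rightarrow> ('n, 'k) mpoly" where "M j i = partial j (L (poly_var i))"

text \<open>The images of the generators a_i X_i^(a_i - 1) of the Jacobian ideal of f_a.\<close>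

definition g :: "'n \<Rightarrow> ('n, 'k) mpoly" where "g i = L (partial i (BP_poly a))"

text \<open>The chain rule at f_a: its image lies in \<open>K\<close>, so the derivatives of the
  image lie in \<open>J\<close>.\<close>

lemma M_g: "(\<Sum>i\<in>UNIV. M j i * g i) \<in> J"
proof -
  have "eqm J (partial j (L (BP_poly a))) (\<Sum>i\<in>UNIV. M j i * g i)"
    using chain_rule[OF ideal_set_jac K_jac partial_K, of j "BP_poly a"] by (simp add: M_def g_def mult.commute)
  then show ?thesis using partial_K[OF L_BP] by (rule eqm_mem[OF ideal_set_jac eqm_sym[OF ideal_set_jac]])
qed

text \<open>The chain rule at preimages q_l of the coordinates X_l, whose derivatives form the
  identity matrix. The inverse has the entries \<open>L (partial i (q l))\<close>.\<close>

lemma M_right_inverse: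
  "\<exists>N. \<forall>j l. eqm J (\<Sum>i\<in>UNIV. M j i * N i l) (if j = l then 1 else 0)"
proof -
  have "\<forall>l. \<exists>q. eqm K (L q) (poly_var l)" using L_surj by blast
  from choice[OF this] obtain q where "\<forall>l. eqm K (L (q l)) (poly_var l)" ..
  then have q: "\<And>l. eqm K (L (q l)) (poly_var l)" ..
  have "eqm J (\<Sum>i\<in>UNIV. M j i * L (partial i (q l))) (if j = l then 1 else 0)" for j l
  proof -
    have "eqm J (\<Sum>i\<in>UNIV. M j i * L (partial i (q l))) (partial j (L (q l)))"
      by (rule eqm_sym[OF ideal_set_jac])
        (use chain_rule[OF ideal_set_jac K_jac partial_K, of j "q l"] in \<open>simp add: M_def mult.commute\<close>)
    note T = eqm_trans[OF ideal_set_jac this]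
    have 2: "eqm J (partial j (L (q l))) (partial j (poly_var l))"
      using partial_K[of "L (q l) - poly_var l"] q[of l] unfolding eqm_def by (simp add: partial_diff)
    have 3: "partial j (poly_var l) = (if j = l then 1 else 0 :: ('n, 'k) mpoly)"
      by (simp add: poly_var_def partial_single lookup_single)
    show ?thesis by (rule T[OF 2, unfolded 3])
  qed
  then show ?thesis by (intro exI[of _ "\<lambda>i l. L (partial i (q l))"]) blast
qed

text \<open>Elements of \<open>J\<close> have no constant term, so the constant terms of
  \<open>M\<close> form an invertible matrix with inverse N0. The relation M g = 0 modulo
  \<open>J\<close>, multiplied by N0 and subtracted from g, leaves g = E g with E = 1 - N0 M, a
  matrix without constant terms.\<close>

lemma g_fixed:
  "\<exists>E. (\<forall>l i. lookup (E l i) 0 = 0) \<and> (\<forall>l. eqm J (g l) (\<Sum>i\<in>UNIV. E l i * g i))"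
proof -
  obtain N where N: "\<And>j l. eqm J (\<Sum>i\<in>UNIV. M j i * N i l) (if j = l then 1 else 0)"
    using M_right_inverse by blast
  define M0 N0 :: "'k^'n^'n" where "M0 = (\<chi> j i. lookup (M j i) 0)" and "N0 = (\<chi> i l. lookup (N i l) 0)"
  have "(\<Sum>i\<in>UNIV. lookup (M j i) 0 * lookup (N i l) 0) = (if j = l then 1 else 0)" for j l
    using J_lookup_zero[OF N[of j l, unfolded eqm_def]] by (simp add: lookup_minus lookup_sum_zero split: if_splits)
  then have "M0 ** N0 = mat 1"
    by (simp add: M0_def N0_def matrix_matrix_mult_def mat_def vec_eq_iff)
  \<comment> \<open>Over a field a right inverse of a square matrix is a left inverse, and the left
    one is needed to act on the relation M g = 0.\<close>
  then have "N0 ** M0 = mat 1" by (simp add: matrix_left_right_inverse)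
  then have inv: "(\<Sum>j\<in>UNIV. N0 $ l $ j * M0 $ j $ i) = (if l = i then 1 else 0)" for l i
    by (simp add: matrix_matrix_mult_def mat_def vec_eq_iff)
  define c :: "'n \<Rightarrow> 'n \<Rightarrow> ('n, 'k) mpoly" where "c l j = Poly_Mapping.single 0 (N0 $ l $ j)" for l j
  define E where "E l i = (if l = i then 1 else 0) - (\<Sum>j\<in>UNIV. c l j * M j i)" for l i
  have "lookup (E l i) 0 = 0" for l i
    using inv[of l i] by (simp add: E_def lookup_minus lookup_sum_zero c_def M0_def lookup_one)
  moreover have "eqm J (g l) (\<Sum>i\<in>UNIV. E l i * g i)" for l
  proof -
    have "(\<Sum>i\<in>UNIV. (\<Sum>j\<in>UNIV. c l j * M j i) * g i) = (\<Sum>j\<in>UNIV. c l j * (\<Sum>i\<in>UNIV. M j i * g i))"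
      unfolding sum_distrib_left sum_distrib_right by (subst sum.swap) (simp add: mult.assoc)
    also have "\<dots> \<in> J" by (intro ideal_set_sum ideal_setD(3) ideal_set_jac M_g)
    finally have *: "(\<Sum>i\<in>UNIV. (\<Sum>j\<in>UNIV. c l j * M j i) * g i) \<in> J" .
    have "(\<Sum>i\<in>UNIV. (if l = i then 1 else 0) * g i) = g l"
      by (subst sum.cong[OF refl, of _ _ "\<lambda>i. if l = i then g i else 0"]) auto
    then have "g l - (\<Sum>i\<in>UNIV. E l i * g i) = (\<Sum>i\<in>UNIV. (\<Sum>j\<in>UNIV. c l j * M j i) * g i)"
      unfolding E_def by (simp add: left_diff_distrib sum_subtractf)
    then show ?thesis using * by (simp add: eqm_def)
  qed
  ultimately show ?thesis by (intro exI[of _ E]) simp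
qed

text \<open>Nakayama by hand: each substitution of g = E g raises the power of the ideal of the
  origin by one, until the power added to the Jacobian ideal is already contained in it.\<close>

lemma g_mem: "g l \<in> J"
proof -
  obtain E where E: "\<And>l i. lookup (E l i) 0 = 0" "\<And>l. eqm J (g l) (\<Sum>i\<in>UNIV. E l i * g i)"
    using g_fixed by auto
  \<comment> \<open>At d = 0 the ideal is the whole ring. Up to d = sum b it contains
    \<open>J\<close>, so that congruences modulo \<open>J\<close> may be used in every step.\<close>
  have "g l \<in> supported (jac_expos b d)" if "d \<le> sum b UNIV" for d l
    using that
  proof (induction d arbitrary: l)
    case 0
    then show ?case by (simp add: supported_def jac_expos_def)
  next
    case (Suc d)
    have "(\<Sum>i\<in>UNIV. E l i * g i) \<in> supported (jac_expos b (Suc d))"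
    proof (intro ideal_set_sum ideal_set_jac)
      fix i
      have "g i \<in> supported (jac_expos b d)" using Suc by simp
      show "E l i * g i \<in> supported (jac_expos b (Suc d))"
        by (rule supported_mult[OF supported_mdeg_pos[OF E(1)] \<open>g i \<in> _\<close>]) (auto intro: add_deg_expos)
    qed
    moreover have "J \<subseteq> supported (jac_expos b (Suc d))"
      using Suc.prems by (auto simp: supported_def jac_expos_def)
    ultimately show ?case using eqm_mem[OF ideal_set_jac eqm_mono[OF E(2)]] by blast
  qed
  then show ?thesis by blast
qed

text \<open>Such a monomial is a multiple of the i-th derivative of f_a, whose image is known to lie
  in \<open>J\<close>.\<close>

lemma L_single_jac:
  assumes "m \<in> jac_expos a d" "a i - 1 \<le> lookup m i"
  shows "L (Poly_Mapping.single m c) \<in> J"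
proof -
  define k where "k = Poly_Mapping.single i (a i - 1)"
  \<comment> \<open>The factor a_i of the derivative is divided out, which requires characteristic
    0.\<close>
  have "partial i (BP_poly a) * Poly_Mapping.single (m - k) (c / of_nat (a i)) = Poly_Mapping.single m c"
    using expo_split[OF assms(2)] a2[of i]
    by (simp add: partial_BP_poly mult_single k_def add.commute)
  then have "eqm K (L (Poly_Mapping.single m c)) (g i * L (Poly_Mapping.single (m - k) (c / of_nat (a i))))"
    using L_mult[of "partial i (BP_poly a)" "Poly_Mapping.single (m - k) (c / of_nat (a i))"] by (simp add: g_def)
  then show ?thesis by (rule eqm_mem[OF ideal_set_jac K_up]) (intro ideal_setD(4) ideal_set_jac g_mem)
qed

text \<open>The image of X_i^(a_i - 1) lies in \<open>J\<close> and has no constant term; a_i \<ge>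
  2 makes this a positive power. So the origin is respected although a polynomial map could move it
  a priori.\<close>

lemma L_var_lookup_zero: "lookup (L (poly_var i)) 0 = 0"
proof -
  have "poly_var i ^ (a i - 1) = Poly_Mapping.single (Poly_Mapping.single i (a i - 1)) (1::'k)"
    by (rule poly_var_power)
  then have "L (poly_var i ^ (a i - 1)) \<in> J"
    using L_single_jac[of "Poly_Mapping.single i (a i - 1)" 0 i 1] by (simp add: jac_expos_def)
  moreover have "eqm J (L (poly_var i ^ (a i - 1))) (L (poly_var i) ^ (a i - 1))"
    using a2[of i] by (intro K_up L_power) auto
  ultimately have "L (poly_var i) ^ (a i - 1) \<in> J"
    using eqm_mem[OF ideal_set_jac eqm_sym[OF ideal_set_jac]] by blast
  from J_lookup_zero[OF this] show ?thesis by (simp add: lookup_power_zero)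
qed

text \<open>Each variable contributes a factor without constant term. The minimum appears because
  \<open>L\<close> is multiplicative only modulo \<open>K\<close>, which is contained in step sum b
  of the filtration.\<close>

lemma L_single_deg: "L (Poly_Mapping.single m c) \<in> supported (jac_expos b (min (mdeg m) (sum b UNIV)))"
proof (induction m rule: expo_induct)
  case (step i m)
  have 1: "eqm J (L (Poly_Mapping.single (Poly_Mapping.single i 1 + m) c)) (L (poly_var i) * L (Poly_Mapping.single m c))"
    using K_up[OF L_mult[of "poly_var i" "Poly_Mapping.single m c"]] by (simp add: poly_var_def mult_single)
  have 2: "L (poly_var i) * L (Poly_Mapping.single m c) \<in> supported (jac_expos b (Suc (min (mdeg m) (sum b UNIV))))"
    by (rule supported_mult[OF supported_mdeg_pos[OF L_var_lookup_zero] step]) (auto intro: add_deg_expos)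
  have sub: "supported (jac_expos b d) \<subseteq> supported (jac_expos b d')" if "d' \<le> d" for d d'
    using that by (auto simp: supported_def jac_expos_def)
  show ?case
    by (rule eqm_mem[OF ideal_set_jac eqm_mono[OF 1 sub] subsetD[OF sub 2]]) (simp_all add: mdeg_add)
qed (simp add: supported_def jac_expos_def)

text \<open>The two kinds of monomials in the source ideal are settled by
  \<open>L_single_jac\<close> and \<open>L_single_deg\<close>; additivity modulo \<open>K\<close>
  extends this to sums.\<close>

lemma L_jac:
  assumes "p \<in> supported (jac_expos a d)"
  shows "L p \<in> supported (jac_expos b (min d (sum b UNIV)))" (is "_ \<in> ?J'")
proof -
  have sub: "supported (jac_expos b e) \<subseteq> supported (jac_expos b e')" if "e' \<le> e" for e e'
    using that by (auto simp: supported_def jac_expos_def)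
  have JJ: "J \<subseteq> ?J'" by (intro sub) simp
  show ?thesis using assms unfolding supported_def[of "jac_expos a d"] mem_Collect_eq
  proof (induction p rule: poly_mapping_support_induct)
    case zero
    then show ?case using L_zero K_jac JJ by blast
  next
    case (single m c)
    then consider i where "a i - 1 \<le> lookup m i" | "d \<le> mdeg m" by (auto simp: jac_expos_def)
    then show ?case
    proof cases
      case 1
      then show ?thesis using L_single_jac[OF single 1] JJ by blast
    next
      case 2
      then show ?thesis
        by (intro subsetD[OF sub L_single_deg[of m c]]) simp
    qed
  next
    case (add p q)
    have "eqm ?J' (L (p + q)) (L p + L q)" using eqm_mono[OF K_up[OF L_add] JJ] .
    then show ?case by (rule eqm_mem[OF ideal_set_jac]) (intro ideal_setD(2) ideal_set_jac add)
  qed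
qed

end

section \<open>Dimension count modulo a monomial ideal\<close>

lemma bij_lookup: "bij (lookup :: ('n::finite \<Rightarrow>\<^sub>0 nat) \<Rightarrow> _)"
  by (rule bij_betw_byWitness[where f' = Abs_poly_mapping]) (auto simp: poly_mapping.lookup_inverse)

lemma lookup_image_jac_compl:
  fixes a :: "'n::finite \<Rightarrow> nat"
  shows "lookup ` (- jac_expos a d) = {m. (\<forall>i. m i < a i - 1) \<and> sum m UNIV < d}"
proof -
  have "m \<in> lookup ` (- jac_expos a d)" if "\<forall>i. m i < a i - 1" "sum m UNIV < d" for m
    using that by (intro image_eqI[of _ _ "Abs_poly_mapping m"]) (auto simp: jac_expos_def mdeg_def not_le)
  then show ?thesis by (auto simp: jac_expos_def mdeg_def not_le)
qed

lemma finite_jac_compl: "finite (- jac_expos a d :: ('n::finite \<Rightarrow>\<^sub>0 nat) set)"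
proof (rule finite_imageD)
  show "finite (lookup ` (- jac_expos a d))" unfolding lookup_image_jac_compl by (rule finite_box)
qed (use bij_lookup in \<open>auto simp: bij_def intro: inj_on_subset\<close>)

lemma card_jac_compl:
  fixes a :: "'n::finite \<Rightarrow> nat"
  shows "card {m. (\<forall>i. m i < a i - 1) \<and> sum m UNIV < d} = card (- jac_expos a d)"
  unfolding lookup_image_jac_compl[symmetric]
  by (rule card_image) (use bij_lookup in \<open>auto simp: bij_def intro: inj_on_subset\<close>)

text \<open>The linear projection onto the monomials in \<open>S\<close>. Its kernel is
  \<open>supported (- S)\<close>, so its image is a model of the quotient by a monomial ideal and no
  quotient space has to be formed.\<close>

lift_definition restrict_supp :: "'a set \<Rightarrow> ('a \<Rightarrow>\<^sub>0 'k::zero) \<Rightarrow> ('a \<Rightarrow>\<^sub>0 'k)" is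
  "\<lambda>S p m. if m \<in> S then p m else 0"
  by (erule rev_finite_subset) auto

lemma restrict_supp_add: "restrict_supp S (p + q) = restrict_supp S p + restrict_supp S q"
  for p q :: "'a \<Rightarrow>\<^sub>0 'k::monoid_add"
  by (rule poly_mapping_eqI) (simp add: restrict_supp.rep_eq lookup_add)

lemma restrict_supp_diff: "restrict_supp S (p - q) = restrict_supp S p - restrict_supp S q"
  for p q :: "'a \<Rightarrow>\<^sub>0 'k::ab_group_add"
  by (rule poly_mapping_eqI) (simp add: restrict_supp.rep_eq lookup_minus)

lemma restrict_supp_zero_iff: "restrict_supp S p = 0 \<longleftrightarrow> p \<in> supported (- S)"
  by (auto simp: poly_mapping_eq_iff fun_eq_iff restrict_supp.rep_eq supported_def in_keys_iff split: if_splits)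

lemma restrict_supp_const_mult:
  "restrict_supp S (Poly_Mapping.single 0 c * p) = Poly_Mapping.single 0 c * restrict_supp S p"
  for p :: "('n, 'k::field) mpoly"
  by (rule poly_mapping_eqI) (simp add: restrict_supp.rep_eq Poly_Mapping.map.rep_eq when_def flip: mult_map_scale_conv_mult)

interpretation mpoly_vs: vector_space "\<lambda>c p. Poly_Mapping.single 0 c * (p :: ('n::finite, 'k::field) mpoly)"
  by unfold_locales (auto simp: algebra_simps single_add mult_single simp flip: mult.assoc)

lemma mpoly_independent_monomials:
  "mpoly_vs.independent ((\<lambda>m. Poly_Mapping.single m 1 :: ('n::finite, 'k::field) mpoly) ` S)"
proof -
  have lin0: "\<forall>m\<in>T. u m = 0" if "finite T" "(\<Sum>m\<in>T. Poly_Mapping.single 0 (u m) * Poly_Mapping.single m (1::'k)) = 0"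
    for T and u :: "('n \<Rightarrow>\<^sub>0 nat) \<Rightarrow> 'k"
  proof
    fix k assume "k \<in> T"
    have "0 = lookup (\<Sum>m\<in>T. Poly_Mapping.single 0 (u m) * Poly_Mapping.single m (1::'k)) k" using that(2) by simp
    also have "\<dots> = (\<Sum>m\<in>T. if m = k then u m else 0)"
      by (auto simp: lookup_sum mult_single lookup_single when_def intro!: sum.cong)
    also have "\<dots> = u k" using \<open>finite T\<close> \<open>k \<in> T\<close> by simp
    finally show "u k = 0" ..
  qed
  have inj: "inj_on (\<lambda>m. Poly_Mapping.single m (1::'k)) A" for A :: "('n \<Rightarrow>\<^sub>0 nat) set"
    by (rule inj_onI) (metis lookup_single_eq lookup_single_not_eq zero_neq_one)
  show ?thesis
    unfolding mpoly_vs.independent_explicit_module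
  proof (intro allI impI)
    fix t u v
    assume t: "finite t" "t \<subseteq> (\<lambda>m. Poly_Mapping.single m (1::'k)) ` S"
      and 0: "(\<Sum>v\<in>t. Poly_Mapping.single 0 (u v) * v) = 0" and v: "v \<in> t"
    obtain T where T: "T \<subseteq> S" "t = (\<lambda>m. Poly_Mapping.single m 1) ` T" using t(2) by (meson subset_imageE)
    have "finite T" using t(1) T(2) inj finite_imageD by blast
    moreover have "(\<Sum>m\<in>T. Poly_Mapping.single 0 (u (Poly_Mapping.single m 1)) * Poly_Mapping.single m (1::'k)) = 0"
      using 0 unfolding T(2) by (simp add: sum.reindex[OF inj])
    ultimately show "u v = 0" using lin0[of T "\<lambda>m. u (Poly_Mapping.single m 1)"] v T(2) by auto
  qed
qed

text \<open>\<open>L\<close> induces a linear surjection between the two quotients by Jacobian ideal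
  plus degree \<open>d\<close>, whose dimensions are the two counts. Concretely, the projected
  images of the box monomials for \<open>a\<close> span a space containing the independent box
  monomials for \<open>b\<close>.\<close>

theorem (in BP_hom) card_box_le:
  "card {m. (\<forall>i. m i < b i - 1) \<and> sum m UNIV < d} \<le> card {m. (\<forall>i. m i < a i - 1) \<and> sum m UNIV < d}"
proof -
  let ?A = "- jac_expos a d" and ?B = "- jac_expos b d"
  let ?X = "\<lambda>m. Poly_Mapping.single m (1::'k)"
  let ?r = "restrict_supp ?B"
  define t where "t = (\<lambda>m. ?r (L (?X m))) ` ?A"
  \<comment> \<open>\<open>L_jac\<close> only reaches step min(d, sum b), but beyond sum b the
    ideals no longer change.\<close>
  have Jd: "supported (jac_expos b (min d (sum b UNIV))) \<subseteq> (supported (jac_expos b d) :: ('n, 'k) mpoly set)"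
    "J \<subseteq> supported (jac_expos b d)"
  proof -
    have "jac_expos b (min d (sum b UNIV)) \<subseteq> jac_expos b d" "jac_expos b (sum b UNIV) \<subseteq> jac_expos b d"
      using jac_expos_large[of b "sum b UNIV" d] by (cases "d \<le> sum b UNIV"; auto simp: jac_expos_def min_def)+
    then show "supported (jac_expos b (min d (sum b UNIV))) \<subseteq> (supported (jac_expos b d) :: ('n, 'k) mpoly set)"
      "J \<subseteq> supported (jac_expos b d)" by (auto simp: supported_def)
  qed
  have r_eq: "?r p = ?r q" if "eqm J p q" for p q
  proof -
    have "?r (p - q) = 0" unfolding restrict_supp_zero_iff using that Jd(2) by (auto simp: eqm_def)
    then show ?thesis by (simp add: restrict_supp_diff)
  qed
  have r_eqK: "?r p = ?r q" if "eqm K p q" for p q using r_eq[OF K_up[OF that]] .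
  have r_add: "?r (L (p + q)) = ?r (L p) + ?r (L q)" for p q
    using r_eqK[OF L_add] by (simp add: restrict_supp_add)
  \<comment> \<open>\<open>L\<close> itself need not be linear, but its composition with the
    projection is, because the projection kills \<open>K\<close>.\<close>
  have r_single: "?r (L (Poly_Mapping.single m c)) = Poly_Mapping.single 0 c * ?r (L (?X m))" for m c
  proof -
    have "?r (L (Poly_Mapping.single 0 c * ?X m)) = ?r (L (Poly_Mapping.single 0 c) * L (?X m))"
      by (rule r_eqK[OF L_mult])
    also have "\<dots> = ?r (Poly_Mapping.single 0 c * L (?X m))"
      by (rule r_eqK[OF eqm_mult[OF ideal_K L_const eqm_refl[OF ideal_K]]])
    finally show ?thesis by (simp add: mult_single restrict_supp_const_mult)
  qed
  have r_span: "?r (L q) \<in> mpoly_vs.span t" for q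
  proof (induction q rule: poly_mapping_single_induct)
    case (single m c)
    show ?case
    proof (cases "m \<in> ?A")
      case True
      then have "?r (L (?X m)) \<in> mpoly_vs.span t" unfolding t_def by (intro mpoly_vs.span_base) auto
      then show ?thesis by (subst r_single) (rule mpoly_vs.span_scale)
    next
      case False
      then have "L (Poly_Mapping.single m c) \<in> supported (jac_expos b (min d (sum b UNIV)))"
        by (intro L_jac) (auto simp: supported_def)
      then have "?r (L (Poly_Mapping.single m c)) = 0"
        unfolding restrict_supp_zero_iff using Jd(1) by auto
      then show ?thesis by (simp add: mpoly_vs.span_zero)
    qed
  qed (simp add: r_add mpoly_vs.span_add)
  have "?X ` ?B \<subseteq> mpoly_vs.span t"
  proof
    fix x assume "x \<in> ?X ` ?B"
    then obtain m where m: "m \<in> ?B" "x = ?X m" by auto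
    obtain q where q: "eqm K (L q) x" using L_surj by blast
    have "?r x = x"
      unfolding m(2) using m(1) by (intro poly_mapping_eqI) (auto simp: restrict_supp.rep_eq lookup_single when_def)
    then show "x \<in> mpoly_vs.span t" using r_span[of q] r_eqK[OF q] by simp
  qed
  moreover have "finite t" unfolding t_def using finite_jac_compl by blast
  ultimately have "card (?X ` ?B) \<le> card t"
    using mpoly_vs.independent_span_bound[OF _ mpoly_independent_monomials] by blast
  moreover have "card t \<le> card ?A" unfolding t_def by (intro card_image_le finite_jac_compl)
  moreover have "card (?X ` ?B) = card ?B"
    by (intro card_image inj_onI) (metis lookup_single_eq lookup_single_not_eq zero_neq_one)
  ultimately show ?thesis unfolding card_jac_compl by linarith
qed

section \<open>Algebras and their quotients\<close>

text \<open>The two axioms give \<open>c \<odot> x = (c \<odot> \<one>) \<otimes> x\<close>, so that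
  questions about scalars become questions about the product.\<close>

locale kalg = cring A for A :: "('k, 'a) module" (structure) +
  assumes smult_closed [simp, intro]: "x \<in> carrier A \<Longrightarrow> c \<odot> x \<in> carrier A"
    and smult_assoc: "x \<in> carrier A \<Longrightarrow> y \<in> carrier A \<Longrightarrow> (c \<odot> x) \<otimes> y = c \<odot> (x \<otimes> y)"
begin

lemma smult_conv_mult: "x \<in> carrier A \<Longrightarrow> c \<odot> x = (c \<odot> \<one>) \<otimes> x"
  by (simp add: smult_assoc)

lemma smult_ideal: "ideal I A \<Longrightarrow> x \<in> I \<Longrightarrow> c \<odot> x \<in> I"
  by (metis ideal.I_l_closed ideal.Icarr one_closed smult_closed smult_conv_mult)

end

text \<open>The ring axioms do not see the record extension; this carries them from
  \<open>A Quot I\<close> to the algebra record built on it.\<close>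

lemma cring_cong:
  fixes R :: "('a, 'r) ring_scheme" and S :: "('a, 's) ring_scheme"
  assumes "cring R" "carrier S = carrier R" "monoid.mult S = monoid.mult R" "one S = one R"
    "ring.zero S = ring.zero R" "add S = add R"
  shows "cring S"
proof -
  interpret R: cring R by fact
  note eq = assms(2-6)
  show ?thesis
  proof (rule cringI)
    show "abelian_group S"
    proof (rule abelian_groupI)
      show "\<exists>y\<in>carrier S. y \<oplus>\<^bsub>S\<^esub> x = \<zero>\<^bsub>S\<^esub>" if "x \<in> carrier S" for x
        using that R.l_neg[of x] R.a_inv_closed[of x] unfolding eq by blast
    qed (simp_all add: eq R.a_ac)
    show "comm_monoid S"
      by (rule comm_monoidI) (simp_all add: eq R.m_ac)
  qed (auto simp: eq R.l_distr)
qed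

lemma quot_alg_simps:
  "carrier (quot_alg A I) = a_rcosets\<^bsub>A\<^esub> I"
  "monoid.mult (quot_alg A I) = rcoset_mult A I"
  "\<one>\<^bsub>quot_alg A I\<^esub> = I +>\<^bsub>A\<^esub> \<one>\<^bsub>A\<^esub>"
  "\<zero>\<^bsub>quot_alg A I\<^esub> = I"
  "add (quot_alg A I) = set_add A"
  by (simp_all add: quot_alg_def ring.defs module.defs FactRing_def)

context kalg begin

lemma coset_eq_iff:
  assumes "ideal I A" "x \<in> carrier A" "y \<in> carrier A"
  shows "I +> x = I +> y \<longleftrightarrow> x \<ominus> y \<in> I"
proof -
  interpret ideal I A by fact
  show ?thesis
    using assms a_rcos_module_minus[OF ring_axioms, of y x] a_repr_independence'[of x y] a_repr_independenceD[of x y]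
    by blast
qed

lemma quot_carrier_iff: "X \<in> carrier (quot_alg A I) \<longleftrightarrow> (\<exists>x\<in>carrier A. X = I +> x)"
  by (auto simp: quot_alg_simps A_RCOSETS_def')

lemma quot_ops:
  assumes "ideal I A" "x \<in> carrier A" "y \<in> carrier A"
  shows "(I +> x) \<otimes>\<^bsub>quot_alg A I\<^esub> (I +> y) = I +> (x \<otimes> y)"
    and "(I +> x) \<oplus>\<^bsub>quot_alg A I\<^esub> (I +> y) = I +> (x \<oplus> y)"
proof -
  interpret ideal I A by fact
  show "(I +> x) \<otimes>\<^bsub>quot_alg A I\<^esub> (I +> y) = I +> (x \<otimes> y)"
    using assms by (simp add: quot_alg_simps rcoset_mult_add)
  show "(I +> x) \<oplus>\<^bsub>quot_alg A I\<^esub> (I +> y) = I +> (x \<oplus> y)"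
    using assms by (simp add: quot_alg_simps a_rcos_sum)
qed

text \<open>The scalar multiple of a coset is a union over all its representatives; all of them give
  the same coset, so the union is that coset.\<close>

lemma quot_smult:
  assumes "ideal I A" "x \<in> carrier A"
  shows "c \<odot>\<^bsub>quot_alg A I\<^esub> (I +> x) = I +> (c \<odot> x)"
proof -
  interpret ideal I A by fact
  have "I +> (c \<odot> z) = I +> (c \<odot> x)" if "z \<in> I +> x" for z
  proof -
    have z: "z \<in> carrier A" using that assms(2) a_elemrcos_carrier by blast
    have "z \<ominus> x \<in> I" using a_rcos_module_minus[OF ring_axioms assms(2) z] that by simp
    then have "c \<odot> (z \<ominus> x) \<in> I" by (rule smult_ideal[OF assms(1)])
    moreover have "c \<odot> (z \<ominus> x) = c \<odot> z \<ominus> c \<odot> x"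
    proof -
      have "c \<odot> (z \<ominus> x) = (c \<odot> \<one>) \<otimes> (z \<ominus> x)" using z assms by (intro smult_conv_mult) auto
      also have "\<dots> = (c \<odot> \<one>) \<otimes> z \<ominus> (c \<odot> \<one>) \<otimes> x"
        using z assms by (simp add: minus_eq r_distr r_minus)
      finally show ?thesis using z assms by (simp add: smult_assoc)
    qed
    ultimately show ?thesis using z assms by (subst coset_eq_iff) auto
  qed
  moreover have "x \<in> I +> x" using assms(2) by (rule a_rcos_self)
  ultimately have "(\<Union>z\<in>I +> x. I +> (c \<odot> z)) = I +> (c \<odot> x)" by blast
  then show "c \<odot>\<^bsub>quot_alg A I\<^esub> (I +> x) = I +> (c \<odot> x)"
    by (simp add: quot_alg_def ring.defs module.defs)
qed

lemma kalg_quot: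
  assumes "ideal I A"
  shows "kalg (quot_alg A I)"
proof (intro kalg.intro kalg_axioms.intro)
  have "cring (A Quot I)" by (rule ideal.quotient_is_cring[OF assms is_cring])
  then show "cring (quot_alg A I)"
    by (rule cring_cong) (simp_all add: quot_alg_simps FactRing_def)
  show "c \<odot>\<^bsub>quot_alg A I\<^esub> X \<in> carrier (quot_alg A I)" if "X \<in> carrier (quot_alg A I)" for c X
  proof -
    obtain x where "x \<in> carrier A" "X = I +> x" using \<open>X \<in> _\<close> unfolding quot_carrier_iff by blast
    then show ?thesis unfolding quot_carrier_iff by (intro bexI[of _ "c \<odot> x"]) (simp_all add: quot_smult[OF assms])
  qed
  show "c \<odot>\<^bsub>quot_alg A I\<^esub> X \<otimes>\<^bsub>quot_alg A I\<^esub> Y = c \<odot>\<^bsub>quot_alg A I\<^esub> (X \<otimes>\<^bsub>quot_alg A I\<^esub> Y)"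
    if "X \<in> carrier (quot_alg A I)" "Y \<in> carrier (quot_alg A I)" for c X Y
    using that unfolding quot_carrier_iff by (auto simp: quot_ops[OF assms] quot_smult[OF assms] smult_assoc)
qed

end

section \<open>Isomorphisms of algebras and of their quotients\<close>

lemma alg_iso_trans: "alg_iso A B f \<Longrightarrow> alg_iso B C g \<Longrightarrow> alg_iso A C (g \<circ> f)"
  unfolding alg_iso_def using ring_iso_set_trans[of f A B g C] ring_iso_memE(1)[of f A B] by auto

lemma alg_iso_sym:
  assumes "kalg A" "alg_iso A B h"
  shows "alg_iso B A (inv_into (carrier A) h)"
  unfolding alg_iso_def
proof (intro conjI allI ballI)
  interpret kalg A by fact
  have h: "h \<in> ring_iso A B" "\<And>c x. x \<in> carrier A \<Longrightarrow> h (c \<odot>\<^bsub>A\<^esub> x) = c \<odot>\<^bsub>B\<^esub> h x"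
    using assms by (auto simp: alg_iso_def)
  show "inv_into (carrier A) h \<in> ring_iso B A" by (rule ring_iso_set_sym[OF ring_axioms h(1)])
  fix c y assume y: "y \<in> carrier B"
  have bij: "bij_betw h (carrier A) (carrier B)" by (rule ring_iso_memE(5)[OF h(1)])
  then obtain x where x: "x \<in> carrier A" "y = h x" using y by (auto simp: bij_betw_def)
  then show "inv_into (carrier A) h (c \<odot>\<^bsub>B\<^esub> y) = c \<odot>\<^bsub>A\<^esub> inv_into (carrier A) h y"
    using bij by (simp flip: h(2) add: bij_betw_inv_into_left)
qed

lemma alg_isomorphic_sym: "kalg A \<Longrightarrow> alg_isomorphic A B \<Longrightarrow> alg_isomorphic B A"
  unfolding alg_isomorphic_def using alg_iso_sym by blast

lemma alg_isomorphic_trans: "alg_isomorphic A B \<Longrightarrow> alg_isomorphic B C \<Longrightarrow> alg_isomorphic A C"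
  unfolding alg_isomorphic_def using alg_iso_trans by blast

lemma image_coset:
  assumes h: "alg_iso A B h" and I: "ideal I A" and x: "x \<in> carrier A"
  shows "h ` (I +>\<^bsub>A\<^esub> x) = h ` I +>\<^bsub>B\<^esub> h x"
proof -
  note hom = ring_iso_memE[OF conjunct1[OF h[unfolded alg_iso_def]]]
  have Isub: "I \<subseteq> carrier A" using I by (simp add: ideal.Icarr subsetI)
  have "h ` (I +>\<^bsub>A\<^esub> x) = (\<lambda>i. h (i \<oplus>\<^bsub>A\<^esub> x)) ` I" by (auto simp: a_r_coset_def')
  also have "\<dots> = (\<lambda>i. h i \<oplus>\<^bsub>B\<^esub> h x) ` I" by (rule image_cong) (use Isub x hom(3) in blast)+
  also have "\<dots> = h ` I +>\<^bsub>B\<^esub> h x" by (auto simp: a_r_coset_def')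
  finally show ?thesis .
qed

lemma image_PIdl:
  assumes h: "alg_iso A B h" and f: "f \<in> carrier A"
  shows "h ` (PIdl\<^bsub>A\<^esub> f) = PIdl\<^bsub>B\<^esub> (h f)"
proof -
  note hom = ring_iso_memE[OF conjunct1[OF h[unfolded alg_iso_def]]]
  show ?thesis
  proof (intro equalityI subsetI)
    fix y assume "y \<in> PIdl\<^bsub>B\<^esub> (h f)"
    then obtain z where "z \<in> carrier B" "y = z \<otimes>\<^bsub>B\<^esub> h f" by (auto simp: cgenideal_def)
    moreover from this obtain x where x: "x \<in> carrier A" "z = h x" using hom(5) by (auto simp: bij_betw_def)
    ultimately have "y = h (x \<otimes>\<^bsub>A\<^esub> f)" by (simp add: hom(2) f)
    moreover have "x \<otimes>\<^bsub>A\<^esub> f \<in> PIdl\<^bsub>A\<^esub> f" using x by (auto simp: cgenideal_def)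
    ultimately show "y \<in> h ` (PIdl\<^bsub>A\<^esub> f)" by blast
  qed (use hom(1,2) f in \<open>auto simp: cgenideal_def\<close>)
qed

text \<open>Cosets are sets, so the induced isomorphism is the image map, and it inherits
  injectivity from \<open>image h\<close> on subsets of the carrier.\<close>

lemma alg_iso_quot:
  assumes A: "kalg A" and B: "kalg B" and I: "ideal I A" and h: "alg_iso A B h"
    and J: "ideal (h ` I) B"
  shows "alg_iso (quot_alg A I) (quot_alg B (h ` I)) (image h)"
proof -
  interpret A: kalg A by fact
  interpret B: kalg B by fact
  note hom = ring_iso_memE[OF conjunct1[OF h[unfolded alg_iso_def]]]
  have smul: "h (c \<odot>\<^bsub>A\<^esub> x) = c \<odot>\<^bsub>B\<^esub> h x" if "x \<in> carrier A" for c x using h that by (auto simp: alg_iso_def)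
  note im = image_coset[OF h I]
  note qA = A.quot_ops[OF I] A.quot_smult[OF I] and qB = B.quot_ops[OF J] B.quot_smult[OF J]
  have "image h \<in> ring_iso (quot_alg A I) (quot_alg B (h ` I))"
  proof (rule ring_iso_memI)
    fix X assume "X \<in> carrier (quot_alg A I)"
    then show "h ` X \<in> carrier (quot_alg B (h ` I))"
      unfolding A.quot_carrier_iff B.quot_carrier_iff using im hom(1) by blast
  next
    fix X Y assume "X \<in> carrier (quot_alg A I)" "Y \<in> carrier (quot_alg A I)"
    then obtain x y where *: "x \<in> carrier A" "y \<in> carrier A" "X = I +>\<^bsub>A\<^esub> x" "Y = I +>\<^bsub>A\<^esub> y"
      unfolding A.quot_carrier_iff by blast
    show "h ` (X \<otimes>\<^bsub>quot_alg A I\<^esub> Y) = h ` X \<otimes>\<^bsub>quot_alg B (h ` I)\<^esub> h ` Y"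
      using * by (simp add: qA qB im hom)
    show "h ` (X \<oplus>\<^bsub>quot_alg A I\<^esub> Y) = h ` X \<oplus>\<^bsub>quot_alg B (h ` I)\<^esub> h ` Y"
      using * by (simp add: qA qB im hom)
  next
    show "h ` \<one>\<^bsub>quot_alg A I\<^esub> = \<one>\<^bsub>quot_alg B (h ` I)\<^esub>"
      by (simp add: quot_alg_simps im hom(4))
  next
    have bij: "bij_betw h (carrier A) (carrier B)" by (rule hom(5))
    have "inj_on (image h) (carrier (quot_alg A I))"
    proof (rule inj_on_subset[OF inj_on_image_Pow])
      show "inj_on h (carrier A)" using bij by (simp add: bij_betw_def)
      have "abelian_subgroup I A" by (intro abelian_subgroupI3 ideal.axioms(1)[OF I] A.abelian_group_axioms)
      then show "carrier (quot_alg A I) \<subseteq> Pow (carrier A)"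
        using abelian_subgroup.a_rcosets_carrier by (fastforce simp: quot_alg_simps)
    qed
    moreover have "image h ` carrier (quot_alg A I) = carrier (quot_alg B (h ` I))"
    proof (intro equalityI subsetI)
      fix Y assume "Y \<in> carrier (quot_alg B (h ` I))"
      then obtain y where y: "y \<in> carrier B" "Y = h ` I +>\<^bsub>B\<^esub> y" unfolding B.quot_carrier_iff by blast
      then obtain x where x: "x \<in> carrier A" "y = h x" using bij by (auto simp: bij_betw_def)
      then have "Y = h ` (I +>\<^bsub>A\<^esub> x)" using y im by simp
      moreover have "I +>\<^bsub>A\<^esub> x \<in> carrier (quot_alg A I)" using x A.quot_carrier_iff by blast
      ultimately show "Y \<in> image h ` carrier (quot_alg A I)" by (rule image_eqI)
    next
      fix Y assume "Y \<in> image h ` carrier (quot_alg A I)"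
      then obtain x where x: "x \<in> carrier A" "Y = h ` (I +>\<^bsub>A\<^esub> x)" by (auto simp: A.quot_carrier_iff)
      then have "Y = h ` I +>\<^bsub>B\<^esub> h x" using im by simp
      then show "Y \<in> carrier (quot_alg B (h ` I))" using x(1) hom(1) B.quot_carrier_iff by blast
    qed
    ultimately show "bij_betw (image h) (carrier (quot_alg A I)) (carrier (quot_alg B (h ` I)))"
      by (simp add: bij_betw_def)
  qed
  moreover have "\<forall>c. \<forall>X\<in>carrier (quot_alg A I).
      h ` (c \<odot>\<^bsub>quot_alg A I\<^esub> X) = c \<odot>\<^bsub>quot_alg B (h ` I)\<^esub> h ` X"
  proof (intro allI ballI)
    fix c X assume "X \<in> carrier (quot_alg A I)"
    then obtain x where x: "x \<in> carrier A" "X = I +>\<^bsub>A\<^esub> x" unfolding A.quot_carrier_iff by blast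
    show "h ` (c \<odot>\<^bsub>quot_alg A I\<^esub> X) = c \<odot>\<^bsub>quot_alg B (h ` I)\<^esub> h ` X"
      unfolding x(2) by (simp only: qA(3) qB(3) im hom(1) smul x(1) A.smult_closed)
  qed
  ultimately show ?thesis by (simp add: alg_iso_def)
qed

lemma alg_iso_quot_PIdl:
  assumes A: "kalg A" and B: "kalg B" and h: "alg_iso A B h" and f: "f \<in> carrier A"
  shows "alg_isomorphic (quot_alg A (PIdl\<^bsub>A\<^esub> f)) (quot_alg B (PIdl\<^bsub>B\<^esub> (h f)))"
proof -
  interpret A: kalg A by fact
  interpret B: kalg B by fact
  note hom = ring_iso_memE[OF conjunct1[OF h[unfolded alg_iso_def]]]
  note im = image_PIdl[OF h f]
  show ?thesis
    using alg_iso_quot[OF A B A.cgenideal_ideal[OF f] h] B.cgenideal_ideal[OF hom(1)[OF f]]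
    unfolding im alg_isomorphic_def by blast
qed

text \<open>The map \<open>H\<close> induces a surjective homomorphism \<open>A \<rightarrow> B/J\<close>.\<close>

locale quot_hom = A?: kalg A + B?: kalg B + ideal J B
  for A :: "('k, 'a) module" and B :: "('k, 'b) module" and J and H :: "'a \<Rightarrow> 'b" +
  assumes H_closed: "x \<in> carrier A \<Longrightarrow> H x \<in> carrier B"
    and H_add: "x \<in> carrier A \<Longrightarrow> y \<in> carrier A \<Longrightarrow> H (x \<oplus>\<^bsub>A\<^esub> y) \<ominus>\<^bsub>B\<^esub> (H x \<oplus>\<^bsub>B\<^esub> H y) \<in> J"
    and H_mult: "x \<in> carrier A \<Longrightarrow> y \<in> carrier A \<Longrightarrow> H (x \<otimes>\<^bsub>A\<^esub> y) \<ominus>\<^bsub>B\<^esub> (H x \<otimes>\<^bsub>B\<^esub> H y) \<in> J"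
    and H_const: "H (c \<odot>\<^bsub>A\<^esub> \<one>\<^bsub>A\<^esub>) \<ominus>\<^bsub>B\<^esub> (c \<odot>\<^bsub>B\<^esub> \<one>\<^bsub>B\<^esub>) \<in> J"
    and H_surj: "\<And>y. y \<in> carrier B \<Longrightarrow> \<exists>x\<in>carrier A. H x \<ominus>\<^bsub>B\<^esub> y \<in> J"

text \<open>Choosing a representative of every image coset turns an isomorphism of quotients into a
  map of the rings, a homomorphism only modulo \<open>J\<close>.\<close>

lemma alg_iso_lift:
  assumes A: "kalg A" and B: "kalg B" and I: "ideal I A" and J: "ideal J B"
    and h: "alg_iso (quot_alg A I) (quot_alg B J) h"
  obtains H where "quot_hom A B J H" "\<And>x. x \<in> I \<Longrightarrow> H x \<in> J"
proof -
  interpret A: kalg A by fact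
  interpret B: kalg B by fact
  note hom = ring_iso_memE[OF conjunct1[OF h[unfolded alg_iso_def]]]
  have smul: "h (c \<odot>\<^bsub>quot_alg A I\<^esub> X) = c \<odot>\<^bsub>quot_alg B J\<^esub> h X" if "X \<in> carrier (quot_alg A I)" for c X
    using h that by (auto simp: alg_iso_def)
  note qA = A.quot_ops[OF I] A.quot_smult[OF I] and qB = B.quot_ops[OF J] B.quot_smult[OF J]
  have cA: "I +>\<^bsub>A\<^esub> x \<in> carrier (quot_alg A I)" if "x \<in> carrier A" for x using that A.quot_carrier_iff by blast
  have "\<forall>x. \<exists>y. x \<in> carrier A \<longrightarrow> y \<in> carrier B \<and> h (I +>\<^bsub>A\<^esub> x) = J +>\<^bsub>B\<^esub> y"
    using hom(1)[OF cA] B.quot_carrier_iff by blast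
  from choice[OF this] obtain H where H: "\<And>x. x \<in> carrier A \<Longrightarrow> H x \<in> carrier B"
    "\<And>x. x \<in> carrier A \<Longrightarrow> h (I +>\<^bsub>A\<^esub> x) = J +>\<^bsub>B\<^esub> H x" by blast
  have "quot_hom A B J H"
  proof (intro quot_hom.intro A B J quot_hom_axioms.intro)
    show "H x \<in> carrier B" if "x \<in> carrier A" for x using H that by blast
    fix x y assume xy: "x \<in> carrier A" "y \<in> carrier A"
    show "H (x \<oplus>\<^bsub>A\<^esub> y) \<ominus>\<^bsub>B\<^esub> (H x \<oplus>\<^bsub>B\<^esub> H y) \<in> J"
      using hom(3)[OF cA[OF xy(1)] cA[OF xy(2)]] xy H
      by (simp add: qA qB flip: B.coset_eq_iff[OF J])
    show "H (x \<otimes>\<^bsub>A\<^esub> y) \<ominus>\<^bsub>B\<^esub> (H x \<otimes>\<^bsub>B\<^esub> H y) \<in> J"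
      using hom(2)[OF cA[OF xy(1)] cA[OF xy(2)]] xy H
      by (simp add: qA qB flip: B.coset_eq_iff[OF J])
  next
    fix c
    have "h (I +>\<^bsub>A\<^esub> (c \<odot>\<^bsub>A\<^esub> \<one>\<^bsub>A\<^esub>)) = J +>\<^bsub>B\<^esub> (c \<odot>\<^bsub>B\<^esub> \<one>\<^bsub>B\<^esub>)"
      using smul[OF cA[OF A.one_closed], of c] hom(4) by (simp add: qA(3) qB(3) quot_alg_simps)
    then show "H (c \<odot>\<^bsub>A\<^esub> \<one>\<^bsub>A\<^esub>) \<ominus>\<^bsub>B\<^esub> (c \<odot>\<^bsub>B\<^esub> \<one>\<^bsub>B\<^esub>) \<in> J"
      using H by (simp flip: B.coset_eq_iff[OF J])
  next
    fix y assume y: "y \<in> carrier B"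
    then have "J +>\<^bsub>B\<^esub> y \<in> h ` carrier (quot_alg A I)"
      using hom(5) B.quot_carrier_iff by (auto simp: bij_betw_def)
    then obtain x where "x \<in> carrier A" "h (I +>\<^bsub>A\<^esub> x) = J +>\<^bsub>B\<^esub> y" using A.quot_carrier_iff by auto
    then show "\<exists>x\<in>carrier A. H x \<ominus>\<^bsub>B\<^esub> y \<in> J" using H y by (auto simp flip: B.coset_eq_iff[OF J])
  qed
  moreover have "H x \<in> J" if "x \<in> I" for x
  proof -
    have x: "x \<in> carrier A" using that I by (simp add: ideal.Icarr)
    have I0: "I +>\<^bsub>A\<^esub> x = I +>\<^bsub>A\<^esub> \<zero>\<^bsub>A\<^esub>" using x that by (simp add: A.coset_eq_iff[OF I] A.minus_eq)
    have s: "abelian_subgroup I A" "abelian_subgroup J B"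
      by (intro abelian_subgroupI3 ideal.axioms(1) I J A.abelian_group_axioms B.abelian_group_axioms)+
    have zI: "I +>\<^bsub>A\<^esub> \<zero>\<^bsub>A\<^esub> = \<zero>\<^bsub>quot_alg A I\<^esub>" "J +>\<^bsub>B\<^esub> \<zero>\<^bsub>B\<^esub> = \<zero>\<^bsub>quot_alg B J\<^esub>"
      using abelian_subgroup.a_rcos_const[OF s(1)] abelian_subgroup.a_rcos_const[OF s(2)]
        additive_subgroup.zero_closed[OF ideal.axioms(1)[OF I]] additive_subgroup.zero_closed[OF ideal.axioms(1)[OF J]]
      by (auto simp: quot_alg_simps)
    have "h (I +>\<^bsub>A\<^esub> x) = J +>\<^bsub>B\<^esub> \<zero>\<^bsub>B\<^esub>"
      unfolding I0 zI
    proof (rule ring_hom_zero)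
      show "h \<in> ring_hom (quot_alg A I) (quot_alg B J)" using h by (simp add: alg_iso_def ring_iso_def)
      show "ring (quot_alg A I)" "ring (quot_alg B J)"
        using A.kalg_quot[OF I] B.kalg_quot[OF J] by (auto simp: kalg_def cring_def)
    qed
    then have "H x \<ominus>\<^bsub>B\<^esub> \<zero>\<^bsub>B\<^esub> \<in> J" using H x by (simp flip: B.coset_eq_iff[OF J])
    then show ?thesis using H x by (simp add: B.minus_eq)
  qed
  ultimately show ?thesis by (rule that)
qed

section \<open>The polynomial ring\<close>

lemma poly_alg_simps [simp]:
  "carrier poly_alg = UNIV" "monoid.mult poly_alg = (*)" "\<one>\<^bsub>poly_alg\<^esub> = 1" "\<zero>\<^bsub>poly_alg\<^esub> = 0"
  "add poly_alg = (+)" "smult poly_alg c p = Poly_Mapping.single 0 c * p"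
  by (simp_all add: poly_alg_def)

lemma cring_poly_alg: "cring (poly_alg :: ('k::field, ('n::finite, 'k) mpoly) module)"
proof (rule cringI)
  show "abelian_group (poly_alg :: ('k, ('n, 'k) mpoly) module)"
    by (rule abelian_groupI) (auto simp: algebra_simps intro: exI[of _ "- x" for x])
  show "comm_monoid (poly_alg :: ('k, ('n, 'k) mpoly) module)"
    by (rule comm_monoidI) (auto simp: algebra_simps)
qed (auto simp: algebra_simps)

lemma kalg_poly_alg: "kalg (poly_alg :: ('k::field, ('n::finite, 'k) mpoly) module)"
  by (intro kalg.intro kalg_axioms.intro cring_poly_alg) (auto simp: algebra_simps)

lemma minus_poly_alg [simp]: "p \<ominus>\<^bsub>poly_alg\<^esub> q = p - (q :: ('n::finite, 'k::field) mpoly)"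
proof -
  interpret kalg "poly_alg :: ('k, ('n, 'k) mpoly) module" by (rule kalg_poly_alg)
  have "\<ominus>\<^bsub>poly_alg\<^esub> q = - q" by (rule minus_equality) auto
  then show ?thesis by (simp add: minus_eq)
qed

lemma PIdl_poly_alg: "PIdl\<^bsub>poly_alg\<^esub> f = {w * f | w. True}"
  by (auto simp: cgenideal_def)

lemma ideal_PIdl_poly_alg: "ideal (PIdl\<^bsub>poly_alg\<^esub> f) poly_alg"
proof -
  interpret kalg poly_alg by (rule kalg_poly_alg)
  show ?thesis by (rule cgenideal_ideal) simp
qed

lemma ideal_set_PIdl: "ideal_set (PIdl\<^bsub>poly_alg\<^esub> f)"
  unfolding ideal_set_def PIdl_poly_alg
  by (auto simp: distrib_right[symmetric] mult.assoc[symmetric] intro: exI[of _ 0])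

lemma lookup_mult_single:
  fixes w :: "('n::finite, 'k::field) mpoly"
  shows "lookup (w * Poly_Mapping.single (Poly_Mapping.single i e) 1) m =
    (if e \<le> lookup m i then lookup w (m - Poly_Mapping.single i e) else 0)"
proof (induction w rule: poly_mapping_single_induct)
  case (single k c)
  have "k + Poly_Mapping.single i e = m \<longleftrightarrow> e \<le> lookup m i \<and> k = m - Poly_Mapping.single i e"
    using expo_split[of e m i] by (auto simp: lookup_add)
  then show ?case by (auto simp: mult_single lookup_single when_def)
qed (simp add: lookup_add distrib_right)

text \<open>If all m_i < a_i, no term survives: multiples of f_a have no monomials in that
  box.\<close>

lemma lookup_mult_BP_poly:
  fixes w :: "('n::finite, 'k::field) mpoly"
  shows "lookup (w * BP_poly a) m =
    (\<Sum>i\<in>UNIV. if a i \<le> lookup m i then lookup w (m - Poly_Mapping.single i (a i)) else 0)"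
  by (simp add: BP_poly_def sum_distrib_left lookup_sum poly_var_power lookup_mult_single)

lemma kalg_BP_ring: "kalg (BP_ring a :: ('k::field, ('n::finite, 'k) mpoly set) module)"
  unfolding BP_ring_def by (rule kalg.kalg_quot[OF kalg_poly_alg ideal_PIdl_poly_alg])

text \<open>An exponent outside \<open>jac_expos\<close> has all m_i < b_i - 1 and degree below sum
  b, so raising one entry by 1 stays within m_i < b_i and degree at most sum b. Hence the vanishing
  is required up to degree sum b inclusive.\<close>

lemma supported_jac_of_vanishing:
  assumes "\<And>m. (\<forall>i. lookup m i < b i) \<Longrightarrow> mdeg m \<le> sum b UNIV \<Longrightarrow> lookup p m = 0"
  shows "p \<in> supported (jac_expos b (sum b UNIV))" "partial j p \<in> supported (jac_expos b (sum b UNIV))"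
proof -
  have small: "(\<forall>i. lookup m i < b i - 1) \<and> mdeg m < sum b UNIV" if "m \<notin> jac_expos b (sum b UNIV)" for m
    using that by (auto simp: jac_expos_def not_le)
  show "p \<in> supported (jac_expos b (sum b UNIV))"
  proof -
    have "lookup p m = 0" if "m \<notin> jac_expos b (sum b UNIV)" for m
      using small[OF that] by (intro assms) (auto simp: less_diff_conv intro: less_imp_le Suc_lessD)
    then show ?thesis by (auto simp: supported_def in_keys_iff)
  qed
  have "lookup p (m + Poly_Mapping.single j 1) = 0" if "m \<notin> jac_expos b (sum b UNIV)" for m
  proof (rule assms)
    show "\<forall>i. lookup (m + Poly_Mapping.single j 1) i < b i"
      using small[OF that] by (auto simp: lookup_add lookup_single when_def less_diff_conv intro: Suc_lessD)
    show "mdeg (m + Poly_Mapping.single j 1) \<le> sum b UNIV" using small[OF that] by (simp add: mdeg_add)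
  qed
  then have "lookup (partial j p) m = 0" if "m \<notin> jac_expos b (sum b UNIV)" for m
    using that by (simp add: partial.rep_eq)
  then show "partial j p \<in> supported (jac_expos b (sum b UNIV))"
    by (auto simp: supported_def in_keys_iff)
qed

lemma BP_ring_iso_card_le:
  fixes a b :: "'n::finite \<Rightarrow> nat"
  assumes ab: "\<And>i. 2 \<le> a i" "\<And>i. 2 \<le> b i"
    and iso: "alg_isomorphic (BP_ring a :: ('k::field_char_0, _) module) (BP_ring b :: ('k, _) module)"
  shows "card {m. (\<forall>i. m i < b i - 1) \<and> sum m UNIV < d} \<le> card {m. (\<forall>i. m i < a i - 1) \<and> sum m UNIV < d}"
proof -
  let ?K = "PIdl\<^bsub>poly_alg\<^esub> (BP_poly b) :: ('n, 'k) mpoly set"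
  let ?I = "PIdl\<^bsub>poly_alg\<^esub> (BP_poly a) :: ('n, 'k) mpoly set"
  obtain h where h: "alg_iso (quot_alg poly_alg ?I) (quot_alg poly_alg ?K) h"
    using iso by (auto simp: alg_isomorphic_def BP_ring_def)
  obtain H where H: "quot_hom poly_alg poly_alg ?K H" "\<And>x. x \<in> ?I \<Longrightarrow> H x \<in> ?K"
    using alg_iso_lift[OF kalg_poly_alg kalg_poly_alg ideal_PIdl_poly_alg ideal_PIdl_poly_alg h] by blast
  interpret quot_hom poly_alg poly_alg ?K H by (rule H)
  have van: "lookup p m = 0" if "p \<in> ?K" "\<forall>i. lookup m i < b i" for p m
    using that by (auto simp: PIdl_poly_alg lookup_mult_BP_poly intro!: sum.neutral) (metis leD)
  interpret BP_hom ?K H a b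
  proof
    show "ideal_set ?K" by (rule ideal_set_PIdl)
    show "eqm ?K (H (p + q)) (H p + H q)" for p q using H_add[of p q] by (simp add: eqm_def)
    show "eqm ?K (H (p * q)) (H p * H q)" for p q using H_mult[of p q] by (simp add: eqm_def)
    show "eqm ?K (H (Poly_Mapping.single 0 c)) (Poly_Mapping.single 0 c)" for c
      using H_const[of c] by (simp add: eqm_def)
    show "\<exists>q. eqm ?K (H q) p" for p using H_surj[of p] by (auto simp: eqm_def)
    show "H (BP_poly a) \<in> ?K" by (rule H(2)) (auto simp: PIdl_poly_alg intro: exI[of _ 1])
    show "?K \<subseteq> supported (jac_expos b (sum b UNIV))"
      using supported_jac_of_vanishing(1) van by blast
    show "partial j p \<in> supported (jac_expos b (sum b UNIV))" if "p \<in> ?K" for j p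
      using supported_jac_of_vanishing(2) van that by blast
  qed (use ab in auto)
  show ?thesis by (rule card_box_le)
qed

text \<open>All entries are at least 2, so the box sides a_i - 1 are positive and a permutation
  matching them also matches the a_i.\<close>

lemma perm_equiv_of_card_le:
  fixes a b :: "'n::finite \<Rightarrow> nat"
  assumes "\<And>i. 2 \<le> a i" "\<And>i. 2 \<le> b i"
    and "\<And>d. card {m. (\<forall>i. m i < b i - 1) \<and> sum m UNIV < d} \<le> card {m. (\<forall>i. m i < a i - 1) \<and> sum m UNIV < d}"
    and "\<And>d. card {m. (\<forall>i. m i < a i - 1) \<and> sum m UNIV < d} \<le> card {m. (\<forall>i. m i < b i - 1) \<and> sum m UNIV < d}"
  shows "perm_equiv a b"
proof -
  have "1 \<le> a i - 1" "1 \<le> b i - 1" for i using assms(1,2)[of i] by linarith+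
  then have "\<exists>\<pi>. bij \<pi> \<and> (\<lambda>i. b i - 1) = (\<lambda>i. a i - 1) \<circ> \<pi>"
    by (intro perm_of_box_count_eq antisym assms(3,4))
  then obtain \<pi> where \<pi>: "bij \<pi>" "\<And>i. b i - 1 = a (\<pi> i) - 1" by (auto simp: fun_eq_iff)
  have "b i = a (\<pi> i)" for i using \<pi>(2)[of i] assms(1)[of "\<pi> i"] assms(2)[of i] by linarith
  then show ?thesis using \<pi>(1) by (auto simp: perm_equiv_def fun_eq_iff)
qed

theorem BP_ring_iso_imp_perm:
  fixes a b :: "'n::finite \<Rightarrow> nat"
  assumes "\<And>i. 2 \<le> a i" "\<And>i. 2 \<le> b i"
    and iso: "alg_isomorphic (BP_ring a :: ('k::field_char_0, _) module) (BP_ring b :: ('k, _) module)"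
  shows "perm_equiv a b"
  by (rule perm_equiv_of_card_le[OF assms(1,2)])
    (use BP_ring_iso_card_le assms alg_isomorphic_sym[OF kalg_BP_ring iso] in blast)+

text \<open>The inner \<open>map_key\<close> relabels the variables of an exponent, the outer one
  reindexes the coefficients. As \<open>map_key\<close> pulls back, X_i goes to X_(\<sigma> i) for a
  bijection \<sigma>.\<close>

definition perm_poly :: "('n::finite \<Rightarrow> 'n) \<Rightarrow> ('n, 'k::field) mpoly \<Rightarrow> ('n, 'k) mpoly" where
  "perm_poly \<sigma> = Poly_Mapping.map_key (Poly_Mapping.map_key \<sigma>)"

lemma map_key_expo_bij:
  fixes \<sigma> :: "'n::finite \<Rightarrow> 'n"
  assumes "bij \<sigma>"
  shows "bij (Poly_Mapping.map_key \<sigma> :: ('n \<Rightarrow>\<^sub>0 nat) \<Rightarrow> _)"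
proof (rule bij_betw_byWitness[where f' = "Poly_Mapping.map_key (inv_into UNIV \<sigma>)"])
  have "inj \<sigma>" "inj (inv_into UNIV \<sigma>)" "\<sigma> \<circ> inv_into UNIV \<sigma> = id" "inv_into UNIV \<sigma> \<circ> \<sigma> = id"
    using assms by (simp_all add: bij_is_inj bij_imp_bij_inv bij_is_surj flip: surj_iff)
  then show "\<forall>m\<in>UNIV. Poly_Mapping.map_key (inv_into UNIV \<sigma>) (Poly_Mapping.map_key \<sigma> m) = (m :: 'n \<Rightarrow>\<^sub>0 nat)"
    "\<forall>m\<in>UNIV. Poly_Mapping.map_key \<sigma> (Poly_Mapping.map_key (inv_into UNIV \<sigma>) m) = (m :: 'n \<Rightarrow>\<^sub>0 nat)"
    by (simp_all add: map_key_compose map_key_id[folded id_def])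
qed auto

lemma perm_poly_single:
  assumes "bij \<sigma>"
  shows "perm_poly \<sigma> (Poly_Mapping.single (Poly_Mapping.map_key \<sigma> m) c) = Poly_Mapping.single m c"
  unfolding perm_poly_def using map_key_expo_bij[OF assms] by (intro map_key_single) (simp add: bij_is_inj)

lemma perm_poly_alg_iso:
  fixes \<sigma> :: "'n::finite \<Rightarrow> 'n"
  assumes \<sigma>: "bij \<sigma>"
  shows "alg_iso poly_alg poly_alg (perm_poly \<sigma> :: ('n, 'k::field) mpoly \<Rightarrow> _)"
proof -
  let ?t = "Poly_Mapping.map_key \<sigma> :: ('n \<Rightarrow>\<^sub>0 nat) \<Rightarrow> _"
  have t: "bij ?t" by (rule map_key_expo_bij[OF \<sigma>])
  have add: "perm_poly \<sigma> (p + q) = perm_poly \<sigma> p + (perm_poly \<sigma> q :: ('n, 'k) mpoly)" for p q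
    unfolding perm_poly_def using t by (simp add: map_key_plus bij_is_inj)
  have tadd: "?t (m + k) = ?t m + ?t k" for m k using \<sigma> by (simp add: map_key_plus bij_is_inj)
  have mult: "perm_poly \<sigma> (p * q) = perm_poly \<sigma> p * (perm_poly \<sigma> q :: ('n, 'k) mpoly)" for p q
  proof (induction p rule: poly_mapping_single_induct)
    case (single m c)
    obtain m' where m: "m = ?t m'" using t by (meson bij_pointE)
    show ?case
    proof (induction q rule: poly_mapping_single_induct)
      case (single k d)
      obtain k' where k: "k = ?t k'" using t by (meson bij_pointE)
      show ?case unfolding m k mult_single tadd[symmetric] perm_poly_single[OF \<sigma>] mult_single by simp
    qed (simp add: add distrib_left)
  qed (simp add: add distrib_right)
  have t0: "?t 0 = 0" using \<sigma> by (simp add: bij_is_inj)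
  have const: "perm_poly \<sigma> (Poly_Mapping.single 0 c) = Poly_Mapping.single 0 (c :: 'k)" for c
    using perm_poly_single[OF \<sigma>, of 0 c] unfolding t0 .
  have "bij (perm_poly \<sigma> :: ('n, 'k) mpoly \<Rightarrow> _)"
  proof (rule bij_betw_byWitness[where f' = "Poly_Mapping.map_key (inv_into UNIV ?t)"])
    have "inj ?t" "inj (inv_into UNIV ?t)" "?t \<circ> inv_into UNIV ?t = id" "inv_into UNIV ?t \<circ> ?t = id"
      using t by (simp_all add: bij_is_inj bij_imp_bij_inv bij_is_surj flip: surj_iff)
    then show "\<forall>p\<in>UNIV. Poly_Mapping.map_key (inv_into UNIV ?t) (perm_poly \<sigma> p) = (p :: ('n, 'k) mpoly)"
      "\<forall>p\<in>UNIV. perm_poly \<sigma> (Poly_Mapping.map_key (inv_into UNIV ?t) p) = (p :: ('n, 'k) mpoly)"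
      unfolding perm_poly_def by (simp_all add: map_key_compose map_key_id[folded id_def])
  qed auto
  then show ?thesis
    unfolding alg_iso_def using const[of 1] by (auto intro!: ring_iso_memI simp: add mult const)
qed

lemma perm_imp_BP_ring_iso:
  fixes a b :: "'n::finite \<Rightarrow> nat"
  assumes "perm_equiv a b"
  shows "alg_isomorphic (BP_ring a :: ('k::field, _) module) (BP_ring b :: ('k, _) module)"
proof -
  obtain \<pi> where \<pi>: "bij \<pi>" "b = a \<circ> \<pi>" using assms by (auto simp: perm_equiv_def)
  \<comment> \<open>The inverse is taken because the summand X_(\<pi> i)^(a (\<pi> i)) of f_a has to
    go to X_i^(b i).\<close>
  have \<sigma>: "bij (inv_into UNIV \<pi>)" using \<pi>(1) by (rule bij_imp_bij_inv)
  have single: "perm_poly (inv_into UNIV \<pi>) (Poly_Mapping.single (Poly_Mapping.single (\<pi> i) e) 1) =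
      Poly_Mapping.single (Poly_Mapping.single i e) (1::'k)" for i e
  proof -
    have "Poly_Mapping.map_key (inv_into UNIV \<pi>) (Poly_Mapping.single i e) = Poly_Mapping.single (\<pi> i) e"
      using map_key_single[of "inv_into UNIV \<pi>" "\<pi> i" e] \<sigma> \<pi>(1) by (simp add: bij_is_inj)
    then show ?thesis using perm_poly_single[OF \<sigma>] by metis
  qed
  have sum: "perm_poly (inv_into UNIV \<pi>) (sum f A) = (\<Sum>i\<in>A. perm_poly (inv_into UNIV \<pi>) (f i :: ('n, 'k) mpoly))" for f and A :: "'n set"
    unfolding perm_poly_def using map_key_expo_bij[OF \<sigma>]
    by (induction A rule: infinite_finite_induct) (simp_all add: map_key_plus bij_is_inj)
  have "perm_poly (inv_into UNIV \<pi>) (BP_poly a) = (BP_poly b :: ('n, 'k) mpoly)"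
  proof -
    have "BP_poly a = (\<Sum>i\<in>UNIV. poly_var (\<pi> i) ^ a (\<pi> i) :: ('n, 'k) mpoly)"
      unfolding BP_poly_def by (rule sum.reindex_bij_betw[OF \<pi>(1), symmetric])
    then show ?thesis by (simp add: BP_poly_def poly_var_power sum single \<pi>(2))
  qed
  then show ?thesis
    using alg_iso_quot_PIdl[OF kalg_poly_alg kalg_poly_alg perm_poly_alg_iso[OF \<sigma>], of "BP_poly a :: ('n, 'k) mpoly"]
    by (simp add: BP_ring_def)
qed

section \<open>Affine schemes\<close>

lemma (in cring) idealI_closed:
  assumes sub: "I \<subseteq> carrier R" and zero: "\<zero> \<in> I"
    and add: "\<And>x y. x \<in> I \<Longrightarrow> y \<in> I \<Longrightarrow> x \<oplus> y \<in> I"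
    and mult: "\<And>x r. x \<in> I \<Longrightarrow> r \<in> carrier R \<Longrightarrow> r \<otimes> x \<in> I"
  shows "ideal I R"
proof (rule idealI)
  show "ring R" by (rule ring_axioms)
  show "subgroup I (add_monoid R)"
  proof
    show "inv\<^bsub>add_monoid R\<^esub> x \<in> I" if "x \<in> I" for x
    proof -
      have "(\<ominus> \<one>) \<otimes> x \<in> I" using that by (intro mult) auto
      moreover have "(\<ominus> \<one>) \<otimes> x = \<ominus> x" using that sub by (auto simp: l_minus)
      ultimately show ?thesis by (simp add: a_inv_def)
    qed
  qed (use sub zero add in auto)
  show "r \<otimes> x \<in> I" if "x \<in> I" "r \<in> carrier R" for x r using that by (rule mult)
  show "x \<otimes> r \<in> I" if "x \<in> I" "r \<in> carrier R" for x r
  proof -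
    have "x \<in> carrier R" using that(1) sub by blast
    then show ?thesis using mult[OF that] m_comm[of x r] that(2) by simp
  qed
qed

text \<open>By Zorn's lemma some ideal is maximal among those that contain \<open>I\<close> and miss
  all powers of \<open>e\<close>, and such an ideal is prime. The power with exponent 0 is included,
  which makes it proper.\<close>

lemma (in cring) exists_prime_avoiding_powers:
  assumes I: "ideal I R" and e: "e \<in> carrier R" and nin: "\<And>k::nat. e [^] k \<notin> I"
  shows "\<exists>P. primeideal P R \<and> I \<subseteq> P \<and> e \<notin> P"
proof -
  define F where "F = {J. ideal J R \<and> I \<subseteq> J \<and> (\<forall>k::nat. e [^] k \<notin> J)}"
  have "\<exists>M\<in>F. \<forall>X\<in>F. M \<subseteq> X \<longrightarrow> X = M"
  proof (rule subset_Zorn)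
    fix C assume C: "subset.chain F C"
    show "\<exists>U\<in>F. \<forall>X\<in>C. X \<subseteq> U"
    proof (cases "C = {}")
      case True
      have "I \<in> F" using I nin by (simp add: F_def)
      then show ?thesis using True by blast
    next
      case False
      have CF: "\<And>J. J \<in> C \<Longrightarrow> ideal J R \<and> I \<subseteq> J \<and> (\<forall>k::nat. e [^] k \<notin> J)"
        and lin: "\<And>J K. J \<in> C \<Longrightarrow> K \<in> C \<Longrightarrow> J \<subseteq> K \<or> K \<subseteq> J"
        using C unfolding F_def subset_chain_def by blast+
      have "ideal (\<Union>C) R"
      proof (rule idealI_closed)
        show "\<Union>C \<subseteq> carrier R"
        proof
          fix x assume "x \<in> \<Union>C"
          then obtain J where "J \<in> C" "x \<in> J" by blast
          then show "x \<in> carrier R" using CF[of J] ideal.Icarr[of J R x] by blast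
        qed
        obtain J0 where J0: "J0 \<in> C" using False by blast
        then have "\<zero> \<in> J0" using CF[of J0] additive_subgroup.zero_closed[of J0 R] ideal.axioms(1)[of J0 R] by blast
        then show "\<zero> \<in> \<Union>C" using J0 by blast
        fix x y assume "x \<in> \<Union>C" "y \<in> \<Union>C"
        then obtain J K where JK: "J \<in> C" "x \<in> J" "K \<in> C" "y \<in> K" by blast
        then obtain L where L: "L \<in> C" "x \<in> L" "y \<in> L" using lin[of J K] by blast
        then have "x \<oplus> y \<in> L"
          using CF[of L] additive_subgroup.a_closed[of L R x y] ideal.axioms(1)[of L R] by blast
        then show "x \<oplus> y \<in> \<Union>C" using L by blast
      next
        fix x r assume "x \<in> \<Union>C" "r \<in> carrier R"
        then obtain J where J: "J \<in> C" "x \<in> J" "r \<in> carrier R" by blast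
        then have "r \<otimes> x \<in> J" using CF[of J] ideal.I_l_closed[of J R x r] by blast
        then show "r \<otimes> x \<in> \<Union>C" using J by blast
      qed
      moreover have "I \<subseteq> \<Union>C" using False CF by blast
      moreover have "\<forall>k::nat. e [^] k \<notin> \<Union>C" using CF by blast
      ultimately have "\<Union>C \<in> F" unfolding F_def by simp
      then show ?thesis by blast
    qed
  qed
  then obtain M where M: "M \<in> F" and max: "\<And>X. X \<in> F \<Longrightarrow> M \<subseteq> X \<Longrightarrow> X = M" by blast
  interpret M: ideal M R using M by (simp add: F_def)
  \<comment> \<open>Maximality in usable form: adjoining any x outside \<open>M\<close> produces a
    power of \<open>e\<close>.\<close>
  have enl: "\<exists>(k::nat) m c. m \<in> M \<and> c \<in> carrier R \<and> e [^] k = m \<oplus> c \<otimes> x" if x: "x \<in> carrier R" "x \<notin> M" for x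
  proof -
    let ?N = "set_add R M (PIdl x)"
    have N: "ideal ?N R" by (intro add_ideals M.is_ideal cgenideal_ideal x)
    have sub: "M \<subseteq> ?N"
    proof
      fix m assume m: "m \<in> M"
      have "\<zero> \<in> PIdl x" using additive_subgroup.zero_closed[OF ideal.axioms(1)[OF cgenideal_ideal[OF x(1)]]] .
      moreover have "m = m \<oplus> \<zero>" using m by simp
      ultimately show "m \<in> ?N" using m unfolding set_add_def' by blast
    qed
    have "x \<in> ?N"
    proof -
      have "x \<in> PIdl x" by (rule cgenideal_self[OF x(1)])
      moreover have "x = \<zero> \<oplus> x" using x by simp
      ultimately show ?thesis using M.zero_closed unfolding set_add_def' by blast
    qed
    then have "?N \<notin> F" using max[of ?N] sub x(2) by blast
    then obtain k :: nat where "e [^] k \<in> ?N" using N sub M unfolding F_def by blast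
    then show ?thesis unfolding set_add_def' cgenideal_def by auto
  qed
  have "primeideal M R"
  proof (rule primeidealI)
    show "ideal M R" by (rule M.is_ideal)
    show "cring R" by (rule is_cring)
    have "e [^] (0::nat) \<notin> M" using M unfolding F_def by blast
    then show "carrier R \<noteq> M" by auto
    fix x y assume xy: "x \<in> carrier R" "y \<in> carrier R" "x \<otimes> y \<in> M"
    show "x \<in> M \<or> y \<in> M"
    proof (rule ccontr)
      assume "\<not> (x \<in> M \<or> y \<in> M)"
      then obtain k l :: nat and m c n d where
        1: "m \<in> M" "c \<in> carrier R" "e [^] k = m \<oplus> c \<otimes> x" and 2: "n \<in> M" "d \<in> carrier R" "e [^] l = n \<oplus> d \<otimes> y"
        using enl xy(1,2) by meson
      \<comment> \<open>Multiplying the two expressions puts a power of \<open>e\<close> into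
        \<open>M\<close>, since every term has a factor m, n or x y.\<close>
      have "e [^] (k + l) = (m \<oplus> c \<otimes> x) \<otimes> (n \<oplus> d \<otimes> y)"
        using e 1(3) 2(3) by (simp flip: nat_pow_mult)
      also have "\<dots> = (n \<oplus> d \<otimes> y) \<otimes> m \<oplus> (c \<otimes> x \<otimes> n \<oplus> (c \<otimes> d) \<otimes> (x \<otimes> y))"
        using 1 2 xy(1,2) M.Icarr by (simp add: r_distr l_distr m_ac a_ac)
      also have "\<dots> \<in> M"
      proof -
        have "(n \<oplus> d \<otimes> y) \<otimes> m \<in> M" using 1 2 xy M.Icarr by (intro M.I_l_closed) auto
        moreover have "c \<otimes> x \<otimes> n \<in> M" using 1 2 xy by (intro M.I_l_closed) auto
        moreover have "(c \<otimes> d) \<otimes> (x \<otimes> y) \<in> M" using M.I_l_closed[OF xy(3)] 1 2 by auto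
        ultimately show ?thesis by (intro M.a_closed)
      qed
      finally show False using M unfolding F_def by blast
    qed
  qed
  moreover have "e \<notin> M"
  proof
    assume "e \<in> M"
    then have "e [^] (1::nat) \<in> M" using e by simp
    then show False using M unfolding F_def by blast
  qed
  ultimately show ?thesis using M unfolding F_def by blast
qed

lemma (in cring) power_mem_of_primes:
  assumes "ideal I R" "e \<in> carrier R" "\<And>P. primeideal P R \<Longrightarrow> I \<subseteq> P \<Longrightarrow> e \<in> P"
  shows "\<exists>k::nat. e [^] k \<in> I"
  using exists_prime_avoiding_powers[OF assms(1,2)] assms(3) by blast

text \<open>The case e = 1, in which all powers coincide.\<close>

lemma (in cring) one_mem_of_no_prime:
  assumes "ideal I R" "\<And>P. primeideal P R \<Longrightarrow> \<not> I \<subseteq> P"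
  shows "\<one> \<in> I"
proof -
  have "\<exists>k::nat. \<one> [^] k \<in> I" using assms by (intro power_mem_of_primes) auto
  then show ?thesis by simp
qed

lemma primeideal_compl:
  fixes A (structure)
  assumes "primeideal P A"
  shows "\<one> \<in> carrier A - P" "s \<in> carrier A - P \<Longrightarrow> t \<in> carrier A - P \<Longrightarrow> s \<otimes> t \<in> carrier A - P"
    "s \<in> carrier A - P \<Longrightarrow> s [^] (k::nat) \<in> carrier A - P"
proof -
  interpret primeideal P A by fact
  interpret cring A by (rule is_cring)
  show 1: "\<one> \<in> carrier A - P" using I_notcarr one_imp_carrier by auto
  show 2: "s \<otimes> t \<in> carrier A - P" if "s \<in> carrier A - P" "t \<in> carrier A - P" for s t
    using that I_prime by blast
  show "s \<in> carrier A - P \<Longrightarrow> s [^] (k::nat) \<in> carrier A - P"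
    by (induction k) (use 1 2 in \<open>auto simp del: Diff_iff\<close>)
qed

section \<open>Localisation at a prime ideal\<close>

context kalg begin

lemma loc_frac_mem:
  assumes "primeideal P A" "r \<in> carrier A" "s \<in> carrier A - P"
  shows "(r, s) \<in> loc_frac A P r s"
  using assms primeideal_compl(1)[OF assms(1)] unfolding loc_frac_def by blast

text \<open>The content is transitivity of the relation between fractions: two multipliers t, u and
  a denominator b combine to the multiplier t u b, again outside the prime ideal.\<close>

lemma loc_frac_eq_iff:
  assumes P: "primeideal P A" and c: "r \<in> carrier A" "s \<in> carrier A - P" "r' \<in> carrier A" "s' \<in> carrier A - P"
  shows "loc_frac A P r s = loc_frac A P r' s' \<longleftrightarrow> (\<exists>t\<in>carrier A - P. t \<otimes> (r \<otimes> s') = t \<otimes> (r' \<otimes> s))"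
proof
  assume "loc_frac A P r s = loc_frac A P r' s'"
  then have "(r', s') \<in> loc_frac A P r s" using loc_frac_mem[OF P c(3,4)] by simp
  then show "\<exists>t\<in>carrier A - P. t \<otimes> (r \<otimes> s') = t \<otimes> (r' \<otimes> s)" by (simp add: loc_frac_def)
next
  have trans: "loc_frac A P a b \<subseteq> loc_frac A P a' b'"
    if ab: "a \<in> carrier A" "b \<in> carrier A - P" "a' \<in> carrier A" "b' \<in> carrier A - P"
      and t: "t \<in> carrier A - P" "t \<otimes> (a \<otimes> b') = t \<otimes> (a' \<otimes> b)" for a b a' b' t
  proof (clarify)
    fix x y assume "(x, y) \<in> loc_frac A P a b"
    then obtain u where u: "x \<in> carrier A" "y \<in> carrier A - P" "u \<in> carrier A - P" "u \<otimes> (a \<otimes> y) = u \<otimes> (x \<otimes> b)"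
      by (auto simp: loc_frac_def)
    have "(t \<otimes> u \<otimes> b) \<otimes> (a' \<otimes> y) = (u \<otimes> y) \<otimes> (t \<otimes> (a' \<otimes> b))" using ab t u by (simp add: m_ac)
    also have "\<dots> = (t \<otimes> b') \<otimes> (u \<otimes> (a \<otimes> y))" unfolding t(2)[symmetric] using ab t(1) u(1-3) by (simp add: m_ac)
    also have "\<dots> = (t \<otimes> u \<otimes> b) \<otimes> (x \<otimes> b')" unfolding u(4) using ab t(1) u(1-3) by (simp add: m_ac)
    finally have "(t \<otimes> u \<otimes> b) \<otimes> (a' \<otimes> y) = (t \<otimes> u \<otimes> b) \<otimes> (x \<otimes> b')" .
    moreover have "t \<otimes> u \<otimes> b \<in> carrier A - P" by (intro primeideal_compl(2)[OF P] t u ab)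
    ultimately show "(x, y) \<in> loc_frac A P a' b'" using u unfolding loc_frac_def by blast
  qed
  assume "\<exists>t\<in>carrier A - P. t \<otimes> (r \<otimes> s') = t \<otimes> (r' \<otimes> s)"
  then obtain t where t: "t \<in> carrier A - P" "t \<otimes> (r \<otimes> s') = t \<otimes> (r' \<otimes> s)" by blast
  show "loc_frac A P r s = loc_frac A P r' s'"
    by (rule equalityI; rule trans[OF _ _ _ _ t(1)]) (use c t in auto)
qed

lemma loc_frac_eqI:
  assumes P: "primeideal P A" and c: "r \<in> carrier A" "s \<in> carrier A - P" "r' \<in> carrier A" "s' \<in> carrier A - P"
    and "r \<otimes> s' = r' \<otimes> s"
  shows "loc_frac A P r s = loc_frac A P r' s'"
  unfolding loc_frac_eq_iff[OF P c] using assms(6) primeideal_compl(1)[OF P] by metis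

lemma loc_frac_memD:
  assumes P: "primeideal P A" and c: "r \<in> carrier A" "s \<in> carrier A - P" and m: "(x, y) \<in> loc_frac A P r s"
  shows "x \<in> carrier A" "y \<in> carrier A - P" "loc_frac A P x y = loc_frac A P r s"
proof -
  obtain t where t: "x \<in> carrier A" "y \<in> carrier A - P" "t \<in> carrier A - P" "t \<otimes> (r \<otimes> y) = t \<otimes> (x \<otimes> s)"
    using m unfolding loc_frac_def by blast
  then show "x \<in> carrier A" "y \<in> carrier A - P" by blast+
  show "loc_frac A P x y = loc_frac A P r s"
    unfolding loc_frac_eq_iff[OF P t(1,2) c] using t by metis
qed

lemma loc_carrierI:
  "r \<in> carrier A \<Longrightarrow> s \<in> carrier A - P \<Longrightarrow> loc_frac A P r s \<in> carrier (localization A P)"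
  unfolding localization_def by auto

lemma loc_carrierE:
  assumes "X \<in> carrier (localization A P)"
  obtains r s where "r \<in> carrier A" "s \<in> carrier A - P" "X = loc_frac A P r s"
  using assms unfolding localization_def by auto

text \<open>The operations are unions over all pairs of representatives, and they collapse to one
  class because every choice yields the same fraction.\<close>

lemma loc_ops:
  assumes P: "primeideal P A" and c: "r \<in> carrier A" "s \<in> carrier A - P" and c': "r' \<in> carrier A" "s' \<in> carrier A - P"
  shows "loc_frac A P r s \<otimes>\<^bsub>localization A P\<^esub> loc_frac A P r' s' = loc_frac A P (r \<otimes> r') (s \<otimes> s')"
    and "loc_frac A P r s \<oplus>\<^bsub>localization A P\<^esub> loc_frac A P r' s' =
      loc_frac A P ((r \<otimes> s') \<oplus> (r' \<otimes> s)) (s \<otimes> s')"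
proof -
  let ?X = "loc_frac A P r s" and ?Y = "loc_frac A P r' s'"
  have mem: "(r, s) \<in> ?X" "(r', s') \<in> ?Y" using loc_frac_mem P c c' by blast+
  have wd: "loc_frac A P (a \<otimes> a') (b \<otimes> b') = loc_frac A P (r \<otimes> r') (s \<otimes> s') \<and>
      loc_frac A P ((a \<otimes> b') \<oplus> (a' \<otimes> b)) (b \<otimes> b') = loc_frac A P ((r \<otimes> s') \<oplus> (r' \<otimes> s)) (s \<otimes> s')"
    if m: "(a, b) \<in> ?X" "(a', b') \<in> ?Y" for a b a' b'
  proof -
    note D = loc_frac_memD[OF P c m(1)] and D' = loc_frac_memD[OF P c' m(2)]
    obtain t where t: "t \<in> carrier A - P" "t \<otimes> (a \<otimes> s) = t \<otimes> (r \<otimes> b)"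
      using D(3) loc_frac_eq_iff[OF P D(1,2) c] by blast
    obtain u where u: "u \<in> carrier A - P" "u \<otimes> (a' \<otimes> s') = u \<otimes> (r' \<otimes> b')"
      using D'(3) loc_frac_eq_iff[OF P D'(1,2) c'] by blast
    have tu: "t \<otimes> u \<in> carrier A - P" by (intro primeideal_compl(2)[OF P] t u)
    note carr = D(1,2) D'(1,2) c c' t(1) u(1)
    have "(t \<otimes> u) \<otimes> ((a \<otimes> a') \<otimes> (s \<otimes> s')) = (t \<otimes> (a \<otimes> s)) \<otimes> (u \<otimes> (a' \<otimes> s'))" using carr by (simp add: m_ac)
    also have "\<dots> = (t \<otimes> u) \<otimes> ((r \<otimes> r') \<otimes> (b \<otimes> b'))" unfolding t(2) u(2) using carr by (simp add: m_ac)
    finally have 1: "(t \<otimes> u) \<otimes> ((a \<otimes> a') \<otimes> (s \<otimes> s')) = (t \<otimes> u) \<otimes> ((r \<otimes> r') \<otimes> (b \<otimes> b'))" .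
    have "(t \<otimes> u) \<otimes> (((a \<otimes> b') \<oplus> (a' \<otimes> b)) \<otimes> (s \<otimes> s')) =
        (u \<otimes> b' \<otimes> s') \<otimes> (t \<otimes> (a \<otimes> s)) \<oplus> (t \<otimes> b \<otimes> s) \<otimes> (u \<otimes> (a' \<otimes> s'))"
      using carr by (simp add: l_distr r_distr m_ac)
    also have "\<dots> = (t \<otimes> u) \<otimes> (((r \<otimes> s') \<oplus> (r' \<otimes> s)) \<otimes> (b \<otimes> b'))"
      unfolding t(2) u(2) using carr by (simp add: l_distr r_distr m_ac)
    finally have 2: "(t \<otimes> u) \<otimes> (((a \<otimes> b') \<oplus> (a' \<otimes> b)) \<otimes> (s \<otimes> s')) =
      (t \<otimes> u) \<otimes> (((r \<otimes> s') \<oplus> (r' \<otimes> s)) \<otimes> (b \<otimes> b'))" .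
    have bs: "b \<otimes> b' \<in> carrier A - P" "s \<otimes> s' \<in> carrier A - P"
      using carr by (auto intro!: primeideal_compl(2)[OF P] simp del: Diff_iff)
    have cc: "a \<otimes> a' \<in> carrier A" "r \<otimes> r' \<in> carrier A" "(a \<otimes> b') \<oplus> (a' \<otimes> b) \<in> carrier A"
       "(r \<otimes> s') \<oplus> (r' \<otimes> s) \<in> carrier A" using carr by auto
    show ?thesis
      unfolding loc_frac_eq_iff[OF P cc(1) bs(1) cc(2) bs(2)] loc_frac_eq_iff[OF P cc(3) bs(1) cc(4) bs(2)]
      using 1 2 tu by blast
  qed
  have "(\<Union>(a, b)\<in>?X. \<Union>(a', b')\<in>?Y. loc_frac A P (a \<otimes> a') (b \<otimes> b')) = loc_frac A P (r \<otimes> r') (s \<otimes> s')"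
  proof (intro equalityI subsetI)
    fix z assume "z \<in> loc_frac A P (r \<otimes> r') (s \<otimes> s')"
    then show "z \<in> (\<Union>(a, b)\<in>?X. \<Union>(a', b')\<in>?Y. loc_frac A P (a \<otimes> a') (b \<otimes> b'))" using mem by blast
  qed (use wd in auto)
  then show "loc_frac A P r s \<otimes>\<^bsub>localization A P\<^esub> loc_frac A P r' s' = loc_frac A P (r \<otimes> r') (s \<otimes> s')"
    by (simp add: localization_def)
  have "(\<Union>(a, b)\<in>?X. \<Union>(a', b')\<in>?Y. loc_frac A P ((a \<otimes> b') \<oplus> (a' \<otimes> b)) (b \<otimes> b')) =
      loc_frac A P ((r \<otimes> s') \<oplus> (r' \<otimes> s)) (s \<otimes> s')"
  proof (intro equalityI subsetI)
    fix z assume "z \<in> loc_frac A P ((r \<otimes> s') \<oplus> (r' \<otimes> s)) (s \<otimes> s')"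
    then show "z \<in> (\<Union>(a, b)\<in>?X. \<Union>(a', b')\<in>?Y. loc_frac A P ((a \<otimes> b') \<oplus> (a' \<otimes> b)) (b \<otimes> b'))" using mem by blast
  qed (use wd in auto)
  then show "loc_frac A P r s \<oplus>\<^bsub>localization A P\<^esub> loc_frac A P r' s' =
      loc_frac A P ((r \<otimes> s') \<oplus> (r' \<otimes> s)) (s \<otimes> s')"
    by (simp add: localization_def)
qed

lemma loc_smult:
  assumes P: "primeideal P A" and c: "r \<in> carrier A" "s \<in> carrier A - P"
  shows "a \<odot>\<^bsub>localization A P\<^esub> loc_frac A P r s = loc_frac A P (a \<odot> r) s"
proof -
  let ?X = "loc_frac A P r s"
  have mem: "(r, s) \<in> ?X" by (rule loc_frac_mem[OF P c])
  have wd: "loc_frac A P (a \<odot> x) y = loc_frac A P (a \<odot> r) s" if m: "(x, y) \<in> ?X" for x y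
  proof -
    note D = loc_frac_memD[OF P c m]
    obtain t where t: "t \<in> carrier A - P" "t \<otimes> (x \<otimes> s) = t \<otimes> (r \<otimes> y)"
      using D(3) loc_frac_eq_iff[OF P D(1,2) c] by blast
    have "t \<otimes> ((a \<odot> x) \<otimes> s) = (a \<odot> \<one>) \<otimes> (t \<otimes> (x \<otimes> s))"
      using D(1,2) c t(1) by (subst smult_conv_mult[of x]) (simp_all add: m_ac)
    also have "\<dots> = t \<otimes> ((a \<odot> r) \<otimes> y)"
      unfolding t(2) using D(1,2) c t(1) by (subst (2) smult_conv_mult) (simp_all add: m_ac)
    finally show ?thesis using D(1,2) c t(1) by (subst loc_frac_eq_iff[OF P]) auto
  qed
  have "(\<Union>(x, y)\<in>?X. loc_frac A P (a \<odot> x) y) = loc_frac A P (a \<odot> r) s"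
  proof (intro equalityI subsetI)
    fix z assume "z \<in> loc_frac A P (a \<odot> r) s"
    then show "z \<in> (\<Union>(x, y)\<in>?X. loc_frac A P (a \<odot> x) y)" using mem by blast
  qed (use wd in auto)
  then show ?thesis by (simp add: localization_def)
qed

section \<open>The Zariski topology and global sections\<close>

lemma topspace_zariski: "topspace (zariski A) = prime_spectrum A"
proof -
  have "openin (zariski A) (prime_spectrum A)"
    unfolding openin_zariski
    by (rule exI[of _ "{\<one>}"]) (use primeideal_compl(1) in \<open>auto simp: prime_spectrum_def\<close>)
  moreover have "U \<subseteq> prime_spectrum A" if "openin (zariski A) U" for U
    using that unfolding openin_zariski by auto
  ultimately show ?thesis by (meson openin_subset openin_topspace subset_antisym)
qed

lemma openin_zariski_basic:
  assumes "openin (zariski A) W" "P \<in> W"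
  obtains e where "e \<in> carrier A" "e \<notin> P" "\<And>Q. primeideal Q A \<Longrightarrow> e \<notin> Q \<Longrightarrow> Q \<in> W"
proof -
  obtain E where E: "E \<subseteq> carrier A" "W = prime_spectrum A - {P \<in> prime_spectrum A. E \<subseteq> P}"
    using assms(1) by (auto simp: openin_zariski)
  then obtain e where "e \<in> E" "e \<notin> P" using assms(2) by auto
  then show ?thesis using E by (intro that[of e]) (auto simp: prime_spectrum_def)
qed

definition const_section :: "'a \<Rightarrow> 'a set \<Rightarrow> ('a \<times> 'a) set" where
  "const_section x = (\<lambda>P\<in>prime_spectrum A. loc_frac A P x \<one>)"

text \<open>The elements t with t x = t y form an ideal. Equality of x/1 and y/1 at every prime says
  that no prime contains it, so it contains 1.\<close>

lemma const_section_inj: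
  assumes xy: "x \<in> carrier A" "y \<in> carrier A" and eq: "const_section x = const_section y"
  shows "x = y"
proof -
  let ?I = "{t \<in> carrier A. t \<otimes> x = t \<otimes> y}"
  have "ideal ?I A"
    by (rule idealI_closed) (use xy in \<open>auto simp: l_distr m_assoc\<close>)
  moreover have "\<not> ?I \<subseteq> P" if P: "primeideal P A" for P
  proof -
    have "loc_frac A P x \<one> = loc_frac A P y \<one>"
      using fun_cong[OF eq, of P] P by (simp add: const_section_def prime_spectrum_def)
    then obtain t where "t \<in> carrier A - P" "t \<otimes> (x \<otimes> \<one>) = t \<otimes> (y \<otimes> \<one>)"
      using loc_frac_eq_iff[OF P xy(1) primeideal_compl(1)[OF P] xy(2) primeideal_compl(1)[OF P]] by blast
    then show ?thesis using xy by auto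
  qed
  ultimately have "\<one> \<in> ?I" by (rule one_mem_of_no_prime)
  then show ?thesis using xy by simp
qed

text \<open>The elements that equalise the cross products form an ideal. A prime containing it must
  contain e f, since elsewhere the fractions agree; hence a power of e f belongs to it.\<close>

lemma frac_eq_on_basic_opens:
  assumes e: "e \<in> carrier A" "f \<in> carrier A" and r: "r \<in> carrier A" "q \<in> carrier A"
    and eq: "\<And>Q. primeideal Q A \<Longrightarrow> e \<notin> Q \<Longrightarrow> f \<notin> Q \<Longrightarrow>
      loc_frac A Q r (e [^] (k::nat)) = loc_frac A Q q (f [^] (l::nat))"
  shows "\<exists>N::nat. (e \<otimes> f) [^] N \<otimes> (r \<otimes> f [^] l) = (e \<otimes> f) [^] N \<otimes> (q \<otimes> e [^] k)"
proof -
  let ?I = "{t \<in> carrier A. t \<otimes> (r \<otimes> f [^] l) = t \<otimes> (q \<otimes> e [^] k)}"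
  have "ideal ?I A"
    by (rule idealI_closed) (use e r in \<open>auto simp: l_distr m_assoc\<close>)
  moreover have "e \<otimes> f \<in> P" if P: "primeideal P A" and sub: "?I \<subseteq> P" for P
  proof (rule ccontr)
    assume n: "e \<otimes> f \<notin> P"
    interpret P: primeideal P A by (rule P)
    have n': "e \<in> carrier A - P" "f \<in> carrier A - P" using n e P.I_l_closed P.I_r_closed by blast+
    obtain t where "t \<in> carrier A - P" "t \<otimes> (r \<otimes> f [^] l) = t \<otimes> (q \<otimes> e [^] k)"
      using eq[OF P] n' loc_frac_eq_iff[OF P r(1) primeideal_compl(3)[OF P n'(1)] r(2) primeideal_compl(3)[OF P n'(2)]]
      by blast
    then show False using sub by blast
  qed
  ultimately have "\<exists>N::nat. (e \<otimes> f) [^] N \<in> ?I" using e by (intro power_mem_of_primes) auto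
  then show ?thesis by blast
qed

lemma Spec_simps:
  "rs_top (Spec A) = zariski A" "rs_stalk (Spec A) = localization A"
  by (simp_all add: Spec_def)

lemma Spec_sections_iff:
  "s \<in> rs_sections (Spec A) U \<longleftrightarrow> s \<in> (\<Pi>\<^sub>E P\<in>U. carrier (localization A P)) \<and>
     (\<forall>P\<in>U. \<exists>W r d. openin (zariski A) W \<and> P \<in> W \<and> W \<subseteq> U \<and> r \<in> carrier A \<and> d \<in> carrier A \<and>
        (\<forall>Q\<in>W. d \<notin> Q \<and> s Q = loc_frac A Q r d))"
  by (simp add: Spec_def)

lemma frac_rescale:
  assumes Q: "primeideal Q A" and "e \<in> carrier A" "e \<notin> Q" "r \<in> carrier A"
  shows "loc_frac A Q r (e [^] (k::nat)) = loc_frac A Q (e [^] N \<otimes> r) (e [^] (k + N))"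
proof (rule loc_frac_eqI[OF Q])
  have e: "e \<in> carrier A - Q" using assms by simp
  show "e [^] k \<in> carrier A - Q" "e [^] (k + N) \<in> carrier A - Q" by (rule primeideal_compl(3)[OF Q e])+
  show "r \<otimes> e [^] (k + N) = e [^] N \<otimes> r \<otimes> e [^] k"
    using assms by (simp add: m_ac flip: nat_pow_mult)
qed (use assms in auto)

text \<open>
  A local section that is a fraction on two basic open sets is a fraction on the basic open set of the
  sum. Hence the elements on whose basic open set a given global section is a fraction form an ideal,
  which lies in no prime ideal.
\<close>

lemma frac_glue:
  assumes e: "e \<in> carrier A" "f \<in> carrier A" and r: "r \<in> carrier A" "q \<in> carrier A"
    and s: "\<And>Q. primeideal Q A \<Longrightarrow> e \<notin> Q \<Longrightarrow> s Q = loc_frac A Q r (e [^] (k::nat))"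
    and t: "\<And>Q. primeideal Q A \<Longrightarrow> f \<notin> Q \<Longrightarrow> s Q = loc_frac A Q q (f [^] (l::nat))"
  shows "\<exists>p\<in>carrier A. \<exists>m::nat. \<forall>Q. primeideal Q A \<longrightarrow> e \<oplus> f \<notin> Q \<longrightarrow> s Q = loc_frac A Q p ((e \<oplus> f) [^] m)"
proof -
  obtain N :: nat where N: "(e \<otimes> f) [^] N \<otimes> (r \<otimes> f [^] l) = (e \<otimes> f) [^] N \<otimes> (q \<otimes> e [^] k)"
    using frac_eq_on_basic_opens[OF e r, of k l] s t by metis
  \<comment> \<open>Both fractions are expanded by the N-th powers, so that the cross products agree
    exactly and not only after multiplication by a power of e f.\<close>
  define x y r' q' where "x = e [^] (k + N)" and "y = f [^] (l + N)"
    and "r' = e [^] N \<otimes> r" and "q' = f [^] N \<otimes> q"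
  note defs = x_def y_def r'_def q'_def
  have c: "x \<in> carrier A" "y \<in> carrier A" "r' \<in> carrier A" "q' \<in> carrier A"
    unfolding defs using e r by auto
  have "r' \<otimes> y = (e \<otimes> f) [^] N \<otimes> (r \<otimes> f [^] l)"
    unfolding defs using e r by (simp add: nat_pow_distrib m_ac flip: nat_pow_mult)
  also have "\<dots> = q' \<otimes> x"
    unfolding defs N using e r by (simp add: nat_pow_distrib m_ac flip: nat_pow_mult)
  finally have ry: "r' \<otimes> y = q' \<otimes> x" .
  have sx: "s Q = loc_frac A Q r' x" if "primeideal Q A" "e \<notin> Q" for Q
    unfolding s[OF that] defs using that e r by (intro frac_rescale)
  have sy: "s Q = loc_frac A Q q' y" if "primeideal Q A" "f \<notin> Q" for Q
    unfolding t[OF that] defs using that e r by (intro frac_rescale)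
  \<comment> \<open>A prime containing the powers x and y contains e and f, hence e + f; so some
    power of e + f is c1 x + c2 y.\<close>
  let ?I = "set_add A (PIdl x) (PIdl y)"
  have I: "ideal ?I A" by (intro add_ideals cgenideal_ideal c)
  have "e \<oplus> f \<in> P" if P: "primeideal P A" and sub: "?I \<subseteq> P" for P
  proof (rule ccontr)
    assume n: "e \<oplus> f \<notin> P"
    interpret P: primeideal P A by (rule P)
    have z: "\<zero> \<in> PIdl x" "\<zero> \<in> PIdl y"
      using additive_subgroup.zero_closed[OF ideal.axioms(1)[OF cgenideal_ideal]] c by blast+
    have "x = x \<oplus> \<zero>" "y = \<zero> \<oplus> y" using c by simp_all
    then have "x \<in> ?I" "y \<in> ?I"
      unfolding set_add_def' using z cgenideal_self[OF c(1)] cgenideal_self[OF c(2)] by blast+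
    then have "x \<in> P" "y \<in> P" using sub by blast+
    then have "e \<in> P" "f \<in> P"
      unfolding defs using primeideal_compl(3)[OF P] e by blast+
    then show False using n by simp
  qed
  then obtain m :: nat where "(e \<oplus> f) [^] m \<in> ?I" using power_mem_of_primes[OF I, of "e \<oplus> f"] e by blast
  then obtain c1 c2 where cc: "c1 \<in> carrier A" "c2 \<in> carrier A" "(e \<oplus> f) [^] m = c1 \<otimes> x \<oplus> c2 \<otimes> y"
    unfolding set_add_def' cgenideal_def by auto
  \<comment> \<open>The numerator that the combination c1 x + c2 y of the denominators calls for: by
    r' y = q' x, the fraction p over that combination equals both r'/x and q'/y.\<close>
  define p where "p = c1 \<otimes> r' \<oplus> c2 \<otimes> q'"
  have p: "p \<in> carrier A" unfolding p_def using c cc by auto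
  have "s Q = loc_frac A Q p ((e \<oplus> f) [^] m)" if Q: "primeideal Q A" and n: "e \<oplus> f \<notin> Q" for Q
  proof -
    interpret Q: primeideal Q A by (rule Q)
    have efm: "(e \<oplus> f) [^] m \<in> carrier A - Q" using n e by (intro primeideal_compl(3)[OF Q]) auto
    show ?thesis
    proof (cases "e \<in> Q")
      case False
      have x: "x \<in> carrier A - Q" unfolding x_def using False e by (intro primeideal_compl(3)[OF Q]) auto
      have "r' \<otimes> (c1 \<otimes> x \<oplus> c2 \<otimes> y) = c1 \<otimes> r' \<otimes> x \<oplus> c2 \<otimes> (r' \<otimes> y)"
        using c cc(1,2) by (simp add: r_distr m_ac)
      also have "\<dots> = p \<otimes> x" unfolding ry p_def using c cc(1,2) by (simp add: l_distr m_assoc)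
      finally show ?thesis unfolding sx[OF Q False] using c cc(3) p x efm by (intro loc_frac_eqI[OF Q]) auto
    next
      case True
      then have f: "f \<notin> Q" using n by auto
      have y: "y \<in> carrier A - Q" unfolding y_def using f e by (intro primeideal_compl(3)[OF Q]) auto
      have "q' \<otimes> (c1 \<otimes> x \<oplus> c2 \<otimes> y) = c1 \<otimes> (q' \<otimes> x) \<oplus> c2 \<otimes> q' \<otimes> y"
        using c cc(1,2) by (simp add: r_distr m_ac)
      also have "\<dots> = p \<otimes> y" unfolding ry[symmetric] p_def using c cc(1,2) by (simp add: l_distr m_assoc)
      finally show ?thesis unfolding sy[OF Q f] using c cc(3) p y efm by (intro loc_frac_eqI[OF Q]) auto
    qed
  qed
  then show ?thesis using p by blast
qed

lemma global_section_const:
  assumes s: "s \<in> rs_sections (Spec A) (prime_spectrum A)"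
  shows "\<exists>x\<in>carrier A. s = const_section x"
proof -
  define G where "G = {e \<in> carrier A. \<exists>r\<in>carrier A. \<exists>k::nat. \<forall>Q. primeideal Q A \<longrightarrow> e \<notin> Q \<longrightarrow> s Q = loc_frac A Q r (e [^] k)}"
  have "ideal G A"
  proof (rule idealI_closed)
    have "\<zero> \<in> Q" if "primeideal Q A" for Q
      using additive_subgroup.zero_closed[OF ideal.axioms(1)[OF primeideal.axioms(1)[OF that]]] .
    then show "\<zero> \<in> G" unfolding G_def by auto
    show "e \<oplus> f \<in> G" if eG: "e \<in> G" and fG: "f \<in> G" for e f
    proof -
      obtain r and k :: nat where 1: "e \<in> carrier A" "r \<in> carrier A"
        "\<And>Q. primeideal Q A \<Longrightarrow> e \<notin> Q \<Longrightarrow> s Q = loc_frac A Q r (e [^] k)"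
        using eG unfolding G_def by blast
      obtain q and l :: nat where 2: "f \<in> carrier A" "q \<in> carrier A"
        "\<And>Q. primeideal Q A \<Longrightarrow> f \<notin> Q \<Longrightarrow> s Q = loc_frac A Q q (f [^] l)"
        using fG unfolding G_def by blast
      show ?thesis using frac_glue[OF 1(1) 2(1) 1(2) 2(2) 1(3) 2(3)] 1(1) 2(1) unfolding G_def by simp
    qed
    show "x \<otimes> e \<in> G" if eG: "e \<in> G" and xA: "x \<in> carrier A" for e x
    proof -
      obtain r and k :: nat where 1: "e \<in> carrier A" "r \<in> carrier A"
        "\<And>Q. primeideal Q A \<Longrightarrow> e \<notin> Q \<Longrightarrow> s Q = loc_frac A Q r (e [^] k)"
        using eG unfolding G_def by blast
      have "s Q = loc_frac A Q (x [^] k \<otimes> r) ((x \<otimes> e) [^] k)" if Q: "primeideal Q A" and n: "x \<otimes> e \<notin> Q" for Q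
      proof -
        interpret Q: primeideal Q A by (rule Q)
        have n': "x \<in> carrier A - Q" "e \<in> carrier A - Q"
          using n \<open>x \<in> carrier A\<close> 1(1) Q.I_l_closed Q.I_r_closed by blast+
        have p: "(x \<otimes> e) [^] k \<in> carrier A - Q" using n n' by (intro primeideal_compl(3)[OF Q]) auto
        have "s Q = loc_frac A Q r (e [^] k)" using 1(3)[OF Q] n'(2) by blast
        also have "\<dots> = loc_frac A Q (x [^] k \<otimes> r) ((x \<otimes> e) [^] k)"
          using primeideal_compl(3)[OF Q n'(2), of k] p 1(1,2) \<open>x \<in> carrier A\<close>
          by (intro loc_frac_eqI[OF Q]) (auto simp: nat_pow_distrib m_ac)
        finally show ?thesis .
      qed
      then show ?thesis using 1 xA unfolding G_def by auto
    qed
  qed (auto simp: G_def)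
  moreover have "\<not> G \<subseteq> P" if P: "primeideal P A" for P
  proof -
    obtain W r d where W: "openin (zariski A) W" "P \<in> W" "r \<in> carrier A" "d \<in> carrier A"
        "\<And>Q. Q \<in> W \<Longrightarrow> d \<notin> Q \<and> s Q = loc_frac A Q r d"
      using s P unfolding Spec_sections_iff by (metis mem_Collect_eq prime_spectrum_def)
    obtain e where e: "e \<in> carrier A" "e \<notin> P" "\<And>Q. primeideal Q A \<Longrightarrow> e \<notin> Q \<Longrightarrow> Q \<in> W"
      using openin_zariski_basic[OF W(1,2)] by blast
    \<comment> \<open>The basic open set of e d lies in \<open>W\<close>, and there r/d is rewritten
      as e r over the first power of e d.\<close>
    have "e \<otimes> d \<in> carrier A - P" using e W(2,4,5) by (intro primeideal_compl(2)[OF P]) auto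
    moreover have "s Q = loc_frac A Q (e \<otimes> r) ((e \<otimes> d) [^] (1::nat))" if Q: "primeideal Q A" and n: "e \<otimes> d \<notin> Q" for Q
    proof -
      interpret Q: primeideal Q A by (rule Q)
      have n': "e \<in> carrier A - Q" "d \<in> carrier A - Q"
        using n e(1) W(4) Q.I_l_closed Q.I_r_closed by blast+
      then have "s Q = loc_frac A Q r d" using e(3)[OF Q] W(5) by blast
      also have "\<dots> = loc_frac A Q (e \<otimes> r) ((e \<otimes> d) [^] (1::nat))"
        using n n' W(3) by (intro loc_frac_eqI[OF Q]) (auto simp: m_ac)
      finally show ?thesis .
    qed
    ultimately have "e \<otimes> d \<in> G" unfolding G_def using e(1) W(3) by blast
    then show ?thesis using \<open>e \<otimes> d \<in> carrier A - P\<close> by blast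
  qed
  \<comment> \<open>Membership of 1 means that the section is a single fraction with denominator a
    power of 1 on the whole spectrum.\<close>
  ultimately have "\<one> \<in> G" by (rule one_mem_of_no_prime)
  then obtain r and k :: nat where r: "r \<in> carrier A"
    "\<And>Q. primeideal Q A \<Longrightarrow> \<one> \<notin> Q \<Longrightarrow> s Q = loc_frac A Q r (\<one> [^] k)"
    unfolding G_def by blast
  have "s = const_section r"
  proof (rule extensionalityI[of _ "prime_spectrum A"])
    show "s \<in> extensional (prime_spectrum A)" using s unfolding Spec_sections_iff by (auto simp: PiE_def)
    show "s Q = const_section r Q" if "Q \<in> prime_spectrum A" for Q
      using r(2)[of Q] primeideal_compl(1)[of Q] that by (auto simp: prime_spectrum_def const_section_def)
  qed (simp add: const_section_def)
  then show ?thesis using r(1) by blast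
qed

lemma const_section_closed:
  assumes x: "x \<in> carrier A"
  shows "const_section x \<in> rs_sections (Spec A) (prime_spectrum A)"
  unfolding Spec_sections_iff
proof (intro conjI ballI)
  show "const_section x \<in> (\<Pi>\<^sub>E P\<in>prime_spectrum A. carrier (localization A P))"
    unfolding const_section_def using x primeideal_compl(1) by (auto simp: prime_spectrum_def intro!: loc_carrierI)
  fix P assume P: "P \<in> prime_spectrum A"
  show "\<exists>W r d. openin (zariski A) W \<and> P \<in> W \<and> W \<subseteq> prime_spectrum A \<and> r \<in> carrier A \<and> d \<in> carrier A \<and>
      (\<forall>Q\<in>W. d \<notin> Q \<and> const_section x Q = loc_frac A Q r d)"
  proof (intro exI conjI)
    show "openin (zariski A) (prime_spectrum A)" using openin_topspace[of "zariski A"] by (simp add: topspace_zariski)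
    show "\<forall>Q\<in>prime_spectrum A. \<one> \<notin> Q \<and> const_section x Q = loc_frac A Q x \<one>"
      using primeideal_compl(1) by (auto simp: prime_spectrum_def const_section_def)
  qed (use P x in auto)
qed

lemma alg_iso_global_sections:
  "alg_iso A (section_alg (Spec A) (prime_spectrum A)) const_section"
  unfolding alg_iso_def
proof (intro conjI allI ballI)
  let ?S = "section_alg (Spec A) (prime_spectrum A)"
  have carr: "carrier ?S = rs_sections (Spec A) (prime_spectrum A)" by (simp add: section_alg_def)
  show "const_section \<in> ring_iso A ?S"
  proof (rule ring_iso_memI)
    show "const_section x \<in> carrier ?S" if "x \<in> carrier A" for x using const_section_closed[OF that] carr by simp
    fix x y assume xy: "x \<in> carrier A" "y \<in> carrier A"
    show "const_section (x \<otimes> y) = const_section x \<otimes>\<^bsub>?S\<^esub> const_section y"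
      unfolding const_section_def section_alg_def Spec_simps
      using loc_ops(1)[OF _ xy(1) primeideal_compl(1) xy(2) primeideal_compl(1)]
      by (auto simp: prime_spectrum_def intro!: restrict_ext)
    show "const_section (x \<oplus> y) = const_section x \<oplus>\<^bsub>?S\<^esub> const_section y"
      unfolding const_section_def section_alg_def Spec_simps
      using loc_ops(2)[OF _ xy(1) primeideal_compl(1) xy(2) primeideal_compl(1)] xy
      by (auto simp: prime_spectrum_def intro!: restrict_ext)
  next
    show "const_section \<one> = \<one>\<^bsub>?S\<^esub>"
      unfolding const_section_def section_alg_def Spec_simps by (auto simp: localization_def)
    show "bij_betw const_section (carrier A) (carrier ?S)"
      unfolding bij_betw_def
    proof
      show "inj_on const_section (carrier A)" using const_section_inj by (auto intro: inj_onI)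
      show "const_section ` carrier A = carrier ?S"
        unfolding carr using const_section_closed global_section_const by blast
    qed
  qed
  fix c x assume x: "x \<in> carrier A"
  show "const_section (c \<odot> x) = c \<odot>\<^bsub>?S\<^esub> const_section x"
    unfolding const_section_def section_alg_def Spec_simps
    using loc_smult[OF _ x primeideal_compl(1)] by (auto simp: prime_spectrum_def intro!: restrict_ext)
qed

end

theorem rs_iso_Spec_imp_alg_iso:
  assumes A: "kalg A" and B: "kalg B" and iso: "rs_isomorphic (Spec A) (Spec B)"
  shows "alg_isomorphic A B"
proof -
  interpret A: kalg A by fact
  interpret B: kalg B by fact
  obtain f h where fh: "rs_iso (Spec A) (Spec B) f h" using iso by (auto simp: rs_isomorphic_def)
  have f: "homeomorphic_map (zariski A) (zariski B) f"
    using fh by (simp add: rs_iso_def A.Spec_simps B.Spec_simps)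
  have top: "openin (zariski B) (prime_spectrum B)"
    using openin_topspace[of "zariski B"] by (simp add: B.topspace_zariski)
  have "{p \<in> topspace (zariski A). f p \<in> prime_spectrum B} = prime_spectrum A"
    using homeomorphic_imp_surjective_map[OF f] by (auto simp: A.topspace_zariski B.topspace_zariski)
  moreover have "alg_iso (section_alg (Spec B) (prime_spectrum B))
      (section_alg (Spec A) {p \<in> topspace (zariski A). f p \<in> prime_spectrum B}) (h (prime_spectrum B))"
    using fh top by (simp add: rs_iso_def A.Spec_simps B.Spec_simps)
  ultimately have "alg_iso (section_alg (Spec B) (prime_spectrum B)) (section_alg (Spec A) (prime_spectrum A)) (h (prime_spectrum B))"
    by simp
  then have "alg_isomorphic B (section_alg (Spec A) (prime_spectrum A))"
    using B.alg_iso_global_sections alg_iso_trans unfolding alg_isomorphic_def by blast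
  moreover have "alg_isomorphic (section_alg (Spec A) (prime_spectrum A)) A"
    using A.alg_iso_global_sections alg_isomorphic_sym[OF A] unfolding alg_isomorphic_def by blast
  ultimately show ?thesis using alg_isomorphic_trans alg_isomorphic_sym[OF B] by blast
qed

section \<open>Functoriality of the spectrum for isomorphisms\<close>

text \<open>Both mutually inverse maps are kept, so that every lemma is also available with the
  roles exchanged and inverse constructions come for free.\<close>

locale alg_iso_pair = A?: kalg A + B?: kalg B for A :: "('k, 'a) module" and B :: "('k, 'b) module" +
  fixes \<alpha> :: "'a \<Rightarrow> 'b" and \<beta> :: "'b \<Rightarrow> 'a"
  assumes \<alpha>: "alg_iso A B \<alpha>" and \<beta>: "alg_iso B A \<beta>"
    and \<beta>\<alpha>: "\<And>x. x \<in> carrier A \<Longrightarrow> \<beta> (\<alpha> x) = x" and \<alpha>\<beta>: "\<And>y. y \<in> carrier B \<Longrightarrow> \<alpha> (\<beta> y) = y"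
begin

lemma alg_iso_pair_swap: "alg_iso_pair B A \<beta> \<alpha>"
  by (intro alg_iso_pair.intro alg_iso_pair_axioms.intro A.kalg_axioms B.kalg_axioms \<alpha> \<beta> \<alpha>\<beta> \<beta>\<alpha>)

lemma \<alpha>_ops:
  "x \<in> carrier A \<Longrightarrow> \<alpha> x \<in> carrier B"
  "x \<in> carrier A \<Longrightarrow> y \<in> carrier A \<Longrightarrow> \<alpha> (x \<otimes>\<^bsub>A\<^esub> y) = \<alpha> x \<otimes>\<^bsub>B\<^esub> \<alpha> y"
  "x \<in> carrier A \<Longrightarrow> y \<in> carrier A \<Longrightarrow> \<alpha> (x \<oplus>\<^bsub>A\<^esub> y) = \<alpha> x \<oplus>\<^bsub>B\<^esub> \<alpha> y"
  "\<alpha> \<one>\<^bsub>A\<^esub> = \<one>\<^bsub>B\<^esub>"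
  "x \<in> carrier A \<Longrightarrow> \<alpha> (c \<odot>\<^bsub>A\<^esub> x) = c \<odot>\<^bsub>B\<^esub> \<alpha> x"
  using ring_iso_memE(1-4)[of \<alpha> A B] \<alpha> by (auto simp: alg_iso_def)

lemma \<alpha>_inj: "x \<in> carrier A \<Longrightarrow> y \<in> carrier A \<Longrightarrow> \<alpha> x = \<alpha> y \<Longrightarrow> x = y"
  using \<beta>\<alpha> by metis

lemma \<alpha>_image_conv: "P \<subseteq> carrier A \<Longrightarrow> \<alpha> ` P = {y \<in> carrier B. \<beta> y \<in> P}"
proof (intro equalityI subsetI)
  fix y assume "y \<in> {y \<in> carrier B. \<beta> y \<in> P}"
  then show "y \<in> \<alpha> ` P" by (intro image_eqI[of _ _ "\<beta> y"]) (simp_all add: \<alpha>\<beta>)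
next
  fix y assume "P \<subseteq> carrier A" "y \<in> \<alpha> ` P"
  then obtain x where "x \<in> P" "x \<in> carrier A" "y = \<alpha> x" by auto
  then show "y \<in> {y \<in> carrier B. \<beta> y \<in> P}" by (simp add: \<alpha>_ops(1) \<beta>\<alpha>)
qed

lemma mem_\<alpha>_image_iff: "P \<subseteq> carrier A \<Longrightarrow> y \<in> carrier B \<Longrightarrow> y \<in> \<alpha> ` P \<longleftrightarrow> \<beta> y \<in> P"
  using \<alpha>_image_conv by simp

lemma primeideal_sub: "primeideal P A \<Longrightarrow> P \<subseteq> carrier A"
  by (rule subsetI) (rule ideal.Icarr[OF primeideal.axioms(1)])

text \<open>The image under \<alpha> is the preimage under \<beta>, and preimages of prime ideals
  are prime.\<close>

lemma primeideal_image:
  assumes "primeideal P A"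
  shows "primeideal (\<alpha> ` P) B"
proof -
  have "ring_hom_ring B A \<beta>"
    using \<beta> by (intro ring_hom_ringI2 A.ring_axioms B.ring_axioms) (simp add: alg_iso_def ring_iso_def)
  then have "primeideal {r \<in> carrier B. \<beta> r \<in> P} B"
    by (rule ring_hom_ring.primeideal_vimage[OF _ B.is_cring assms])
  then show ?thesis using \<alpha>_image_conv[OF primeideal_sub[OF assms]] by simp
qed

lemma \<alpha>_image_inverse: "P \<subseteq> carrier A \<Longrightarrow> \<beta> ` \<alpha> ` P = P"
  by (force simp: image_image \<beta>\<alpha> subset_iff)

lemma continuous_map_zariski: "continuous_map (zariski A) (zariski B) (image \<alpha>)"
  unfolding continuous_map_def
proof (intro conjI allI impI)
  show "image \<alpha> \<in> topspace (zariski A) \<rightarrow> topspace (zariski B)"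
    unfolding A.topspace_zariski B.topspace_zariski by (auto simp: prime_spectrum_def primeideal_image)
  fix V assume "openin (zariski B) V"
  then obtain E where E: "E \<subseteq> carrier B" "V = prime_spectrum B - {P \<in> prime_spectrum B. E \<subseteq> P}"
    unfolding openin_zariski by blast
  have "E \<subseteq> \<alpha> ` P \<longleftrightarrow> \<beta> ` E \<subseteq> P" if "primeideal P A" for P
    using E(1) \<alpha>_image_conv[OF primeideal_sub[OF that]] by auto
  then have "{P \<in> topspace (zariski A). \<alpha> ` P \<in> V} = prime_spectrum A - {P \<in> prime_spectrum A. \<beta> ` E \<subseteq> P}"
    unfolding A.topspace_zariski E(2) by (auto simp: prime_spectrum_def primeideal_image)
  moreover have "\<beta> ` E \<subseteq> carrier A"
    using E(1) alg_iso_pair.\<alpha>_ops(1)[OF alg_iso_pair_swap] by blast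
  ultimately show "openin (zariski A) {P \<in> topspace (zariski A). \<alpha> ` P \<in> V}"
    unfolding openin_zariski by blast
qed

text \<open>A fraction is a set of pairs and is carried over elementwise; multipliers on the other
  side are pulled back by \<beta>.\<close>

lemma image_loc_frac:
  assumes P: "primeideal P A" and r: "r \<in> carrier A" "s \<in> carrier A - P"
  shows "map_prod \<alpha> \<alpha> ` loc_frac A P r s = loc_frac B (\<alpha> ` P) (\<alpha> r) (\<alpha> s)"
proof -
  have sub: "P \<subseteq> carrier A" by (rule primeideal_sub[OF P])
  have compl: "\<alpha> x \<in> carrier B - \<alpha> ` P \<longleftrightarrow> x \<notin> P" if "x \<in> carrier A" for x
    using mem_\<alpha>_image_iff[OF sub \<alpha>_ops(1)[OF that]] that by (simp add: \<beta>\<alpha> \<alpha>_ops(1))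
  have eq: "(\<alpha> t \<otimes>\<^bsub>B\<^esub> (\<alpha> r \<otimes>\<^bsub>B\<^esub> \<alpha> y) = \<alpha> t \<otimes>\<^bsub>B\<^esub> (\<alpha> x \<otimes>\<^bsub>B\<^esub> \<alpha> s)) \<longleftrightarrow> t \<otimes>\<^bsub>A\<^esub> (r \<otimes>\<^bsub>A\<^esub> y) = t \<otimes>\<^bsub>A\<^esub> (x \<otimes>\<^bsub>A\<^esub> s)"
    if "t \<in> carrier A" "x \<in> carrier A" "y \<in> carrier A" for t x y
  proof -
    have c: "t \<otimes>\<^bsub>A\<^esub> (r \<otimes>\<^bsub>A\<^esub> y) \<in> carrier A" "t \<otimes>\<^bsub>A\<^esub> (x \<otimes>\<^bsub>A\<^esub> s) \<in> carrier A" using that r by auto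
    have "\<alpha> (t \<otimes>\<^bsub>A\<^esub> (r \<otimes>\<^bsub>A\<^esub> y)) = \<alpha> (t \<otimes>\<^bsub>A\<^esub> (x \<otimes>\<^bsub>A\<^esub> s)) \<longleftrightarrow> t \<otimes>\<^bsub>A\<^esub> (r \<otimes>\<^bsub>A\<^esub> y) = t \<otimes>\<^bsub>A\<^esub> (x \<otimes>\<^bsub>A\<^esub> s)"
      using \<alpha>_inj[OF c] by auto
    then show ?thesis using that r by (simp add: \<alpha>_ops)
  qed
  have mem: "(\<alpha> x, \<alpha> y) \<in> loc_frac B (\<alpha> ` P) (\<alpha> r) (\<alpha> s) \<longleftrightarrow> (x, y) \<in> loc_frac A P r s"
    if xy: "x \<in> carrier A" "y \<in> carrier A" for x y
  proof -
    have "(\<exists>t\<in>carrier B - \<alpha> ` P. t \<otimes>\<^bsub>B\<^esub> (\<alpha> r \<otimes>\<^bsub>B\<^esub> \<alpha> y) = t \<otimes>\<^bsub>B\<^esub> (\<alpha> x \<otimes>\<^bsub>B\<^esub> \<alpha> s)) \<longleftrightarrow>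
        (\<exists>t\<in>carrier A - P. t \<otimes>\<^bsub>A\<^esub> (r \<otimes>\<^bsub>A\<^esub> y) = t \<otimes>\<^bsub>A\<^esub> (x \<otimes>\<^bsub>A\<^esub> s))" (is "?L \<longleftrightarrow> ?R")
    proof
      assume ?L
      then obtain t where t: "t \<in> carrier B" "t \<notin> \<alpha> ` P" "t \<otimes>\<^bsub>B\<^esub> (\<alpha> r \<otimes>\<^bsub>B\<^esub> \<alpha> y) = t \<otimes>\<^bsub>B\<^esub> (\<alpha> x \<otimes>\<^bsub>B\<^esub> \<alpha> s)" by blast
      have bt: "\<beta> t \<in> carrier A" using t(1) alg_iso_pair.\<alpha>_ops(1)[OF alg_iso_pair_swap] by blast
      have "\<beta> t \<notin> P" using t(1,2) mem_\<alpha>_image_iff[OF sub] by blast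
      moreover have "\<beta> t \<otimes>\<^bsub>A\<^esub> (r \<otimes>\<^bsub>A\<^esub> y) = \<beta> t \<otimes>\<^bsub>A\<^esub> (x \<otimes>\<^bsub>A\<^esub> s)"
        using t(3) eq[OF bt xy] by (simp add: \<alpha>\<beta>[OF t(1)])
      ultimately show ?R using bt by blast
    next
      assume ?R
      then obtain t where t: "t \<in> carrier A" "t \<notin> P" "t \<otimes>\<^bsub>A\<^esub> (r \<otimes>\<^bsub>A\<^esub> y) = t \<otimes>\<^bsub>A\<^esub> (x \<otimes>\<^bsub>A\<^esub> s)" by blast
      then show ?L using eq[OF t(1) xy] compl[OF t(1)] by blast
    qed
    then show ?thesis using xy compl[OF xy(2)] \<alpha>_ops(1) unfolding loc_frac_def by auto
  qed
  show ?thesis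
  proof (intro equalityI subsetI)
    fix z assume "z \<in> map_prod \<alpha> \<alpha> ` loc_frac A P r s"
    then obtain x y where "z = (\<alpha> x, \<alpha> y)" "(x, y) \<in> loc_frac A P r s" by auto
    moreover from this have "x \<in> carrier A" "y \<in> carrier A" unfolding loc_frac_def by auto
    ultimately show "z \<in> loc_frac B (\<alpha> ` P) (\<alpha> r) (\<alpha> s)" using mem by blast
  next
    fix z assume z: "z \<in> loc_frac B (\<alpha> ` P) (\<alpha> r) (\<alpha> s)"
    obtain u v where uv: "z = (u, v)" "u \<in> carrier B" "v \<in> carrier B" using z unfolding loc_frac_def by auto
    have c: "\<beta> u \<in> carrier A" "\<beta> v \<in> carrier A"
      using uv alg_iso_pair.\<alpha>_ops(1)[OF alg_iso_pair_swap] by blast+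
    have "(\<beta> u, \<beta> v) \<in> loc_frac A P r s" using mem[OF c] z uv by (simp add: \<alpha>\<beta>)
    then have "map_prod \<alpha> \<alpha> (\<beta> u, \<beta> v) \<in> map_prod \<alpha> \<alpha> ` loc_frac A P r s" by (rule imageI)
    then show "z \<in> map_prod \<alpha> \<alpha> ` loc_frac A P r s" using uv by (simp add: \<alpha>\<beta>)
  qed
qed

definition pull :: "'a set set \<Rightarrow> ('b set \<Rightarrow> ('b \<times> 'b) set) \<Rightarrow> 'a set \<Rightarrow> ('a \<times> 'a) set" where
  "pull U s = (\<lambda>P\<in>U. map_prod \<beta> \<beta> ` s (\<alpha> ` P))"

definition preim :: "'b set set \<Rightarrow> 'a set set" where
  "preim V = {P \<in> prime_spectrum A. \<alpha> ` P \<in> V}"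

lemma preim_open: "openin (zariski B) V \<Longrightarrow> openin (zariski A) (preim V)"
  using continuous_map_zariski unfolding continuous_map_def preim_def A.topspace_zariski by blast

lemma pull_frac:
  assumes P: "primeideal P A" and r: "r \<in> carrier B" "d \<in> carrier B - \<alpha> ` P"
  shows "map_prod \<beta> \<beta> ` loc_frac B (\<alpha> ` P) r d = loc_frac A P (\<beta> r) (\<beta> d)" "\<beta> r \<in> carrier A" "\<beta> d \<in> carrier A - P"
proof -
  interpret swap: alg_iso_pair B A \<beta> \<alpha> by (rule alg_iso_pair_swap)
  show "map_prod \<beta> \<beta> ` loc_frac B (\<alpha> ` P) r d = loc_frac A P (\<beta> r) (\<beta> d)"
    using swap.image_loc_frac[OF primeideal_image[OF P] r] \<alpha>_image_inverse[OF primeideal_sub[OF P]] by simp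
  show "\<beta> r \<in> carrier A" "\<beta> d \<in> carrier A - P"
    using r swap.\<alpha>_ops(1) mem_\<alpha>_image_iff[OF primeideal_sub[OF P]] by auto
qed

lemma section_value:
  assumes s: "s \<in> rs_sections (Spec B) V" and P: "P \<in> preim V"
  obtains r d where "r \<in> carrier B" "d \<in> carrier B - \<alpha> ` P" "s (\<alpha> ` P) = loc_frac B (\<alpha> ` P) r d"
proof -
  have "s (\<alpha> ` P) \<in> carrier (localization B (\<alpha> ` P))"
    using s P unfolding B.Spec_sections_iff preim_def by auto
  then show ?thesis by (rule B.loc_carrierE) (rule that)
qed

lemma preim_prime: "P \<in> preim V \<Longrightarrow> primeideal P A"
  by (simp add: preim_def prime_spectrum_def)

lemma pull_closed:
  assumes s: "s \<in> rs_sections (Spec B) V"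
  shows "pull (preim V) s \<in> rs_sections (Spec A) (preim V)"
  unfolding A.Spec_sections_iff
proof (intro conjI ballI)
  show "pull (preim V) s \<in> (\<Pi>\<^sub>E P\<in>preim V. carrier (localization A P))"
  proof (rule PiE_I)
    fix P assume P: "P \<in> preim V"
    obtain r d where rd: "r \<in> carrier B" "d \<in> carrier B - \<alpha> ` P" "s (\<alpha> ` P) = loc_frac B (\<alpha> ` P) r d"
      using section_value[OF s P] .
    show "pull (preim V) s P \<in> carrier (localization A P)"
      using pull_frac[OF preim_prime[OF P] rd(1,2)] P by (simp add: pull_def rd(3) A.loc_carrierI)
  qed (simp add: pull_def)
  fix P assume P: "P \<in> preim V"
  obtain W r d where W: "openin (zariski B) W" "\<alpha> ` P \<in> W" "W \<subseteq> V" "r \<in> carrier B" "d \<in> carrier B"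
    "\<forall>Q\<in>W. d \<notin> Q \<and> s Q = loc_frac B Q r d"
    using s P unfolding B.Spec_sections_iff preim_def by (metis (no_types, lifting) mem_Collect_eq)
  show "\<exists>W r d. openin (zariski A) W \<and> P \<in> W \<and> W \<subseteq> preim V \<and> r \<in> carrier A \<and> d \<in> carrier A \<and>
        (\<forall>Q\<in>W. d \<notin> Q \<and> pull (preim V) s Q = loc_frac A Q r d)"
  proof (intro exI conjI)
    show "openin (zariski A) (preim W)" by (rule preim_open[OF W(1)])
    show "P \<in> preim W" using P W(2) by (simp add: preim_def)
    show sub: "preim W \<subseteq> preim V" using W(3) by (auto simp: preim_def)
    have d: "d \<in> carrier B - \<alpha> ` P" using W by blast
    show "\<beta> r \<in> carrier A" "\<beta> d \<in> carrier A" using pull_frac(2,3)[OF preim_prime[OF P] W(4) d] by auto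
    show "\<forall>Q\<in>preim W. \<beta> d \<notin> Q \<and> pull (preim V) s Q = loc_frac A Q (\<beta> r) (\<beta> d)"
    proof
      fix Q assume Q: "Q \<in> preim W"
      then have "\<alpha> ` Q \<in> W" by (simp add: preim_def)
      then have sq: "s (\<alpha> ` Q) = loc_frac B (\<alpha> ` Q) r d" and d: "d \<in> carrier B - \<alpha> ` Q" using W(5,6) by auto
      show "\<beta> d \<notin> Q \<and> pull (preim V) s Q = loc_frac A Q (\<beta> r) (\<beta> d)"
        using pull_frac[OF preim_prime[OF Q] W(4) d] subsetD[OF sub Q] by (simp add: pull_def sq)
    qed
  qed
qed

lemma image_prod_inverse: "X \<subseteq> carrier B \<times> carrier B \<Longrightarrow> map_prod \<alpha> \<alpha> ` map_prod \<beta> \<beta> ` X = X"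
  by (force simp: image_image \<alpha>\<beta> subset_iff)

lemma loc_frac_sub: "loc_frac B Q r d \<subseteq> carrier B \<times> carrier B"
  by (auto simp: loc_frac_def)

lemma preim_preim:
  assumes "V \<subseteq> prime_spectrum B"
  shows "alg_iso_pair.preim B \<beta> (preim V) = V"
proof -
  interpret swap: alg_iso_pair B A \<beta> \<alpha> by (rule alg_iso_pair_swap)
  have "\<beta> ` Q \<in> preim V \<longleftrightarrow> Q \<in> V" if "Q \<in> prime_spectrum B" for Q
    using that swap.primeideal_image[of Q] swap.\<alpha>_image_inverse[OF swap.primeideal_sub[of Q]]
    by (auto simp: preim_def prime_spectrum_def)
  then show ?thesis using assms by (auto simp: swap.preim_def)
qed

lemma pull_pull:
  assumes V: "V \<subseteq> prime_spectrum B" and s: "s \<in> rs_sections (Spec B) V"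
  shows "alg_iso_pair.pull \<beta> \<alpha> V (pull (preim V) s) = s"
proof -
  interpret swap: alg_iso_pair B A \<beta> \<alpha> by (rule alg_iso_pair_swap)
  show ?thesis
  proof (rule extensionalityI[of _ V])
    show "s \<in> extensional V" using s by (auto simp: B.Spec_sections_iff PiE_def)
    fix Q assume Q: "Q \<in> V"
    then have pQ: "primeideal Q B" using V by (auto simp: prime_spectrum_def)
    have inv: "\<alpha> ` \<beta> ` Q = Q" by (rule swap.\<alpha>_image_inverse[OF swap.primeideal_sub[OF pQ]])
    have bQ: "\<beta> ` Q \<in> preim V"
      using swap.primeideal_image[OF pQ] Q by (simp add: preim_def prime_spectrum_def inv)
    have "s Q \<in> carrier (localization B Q)" using s Q by (auto simp: B.Spec_sections_iff)
    then obtain r d where "s Q = loc_frac B Q r d" by (rule B.loc_carrierE)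
    then have "s Q \<subseteq> carrier B \<times> carrier B" by (simp only: loc_frac_sub)
    then show "swap.pull V (pull (preim V) s) Q = s Q"
      using Q bQ by (simp add: swap.pull_def pull_def inv image_prod_inverse)
  qed (simp add: swap.pull_def)
qed

text \<open>The inverse is \<open>pull\<close> of the exchanged pair. The operations are compared
  stalk by stalk on fractions.\<close>

lemma Spec_section_alg_iso:
  assumes V: "openin (zariski B) V"
  shows "alg_iso (section_alg (Spec B) V) (section_alg (Spec A) (preim V)) (pull (preim V))"
proof -
  interpret swap: alg_iso_pair B A \<beta> \<alpha> by (rule alg_iso_pair_swap)
  let ?S = "section_alg (Spec B) V" and ?T = "section_alg (Spec A) (preim V)"
  have VB: "V \<subseteq> prime_spectrum B" using openin_subset[OF V] by (simp add: B.topspace_zariski)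
  have carr: "carrier ?S = rs_sections (Spec B) V" "carrier ?T = rs_sections (Spec A) (preim V)"
    by (simp_all add: section_alg_def)
  have V': "P \<in> preim V \<Longrightarrow> \<alpha> ` P \<in> V" for P by (simp add: preim_def)
  have ring: "pull (preim V) \<in> ring_iso ?S ?T"
  proof (rule ring_iso_memI)
    show "pull (preim V) s \<in> carrier ?T" if "s \<in> carrier ?S" for s using that pull_closed unfolding carr by blast
    fix s t assume st: "s \<in> carrier ?S" "t \<in> carrier ?S"
    have vals: "\<exists>r d r' d'. r \<in> carrier B \<and> d \<in> carrier B - \<alpha> ` P \<and> r' \<in> carrier B \<and> d' \<in> carrier B - \<alpha> ` P \<and>
       s (\<alpha> ` P) = loc_frac B (\<alpha> ` P) r d \<and> t (\<alpha> ` P) = loc_frac B (\<alpha> ` P) r' d'" if P: "P \<in> preim V" for P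
      using section_value[OF st(1)[unfolded carr] P] section_value[OF st(2)[unfolded carr] P] by metis
    have op: "map_prod \<beta> \<beta> ` (s (\<alpha> ` P) \<otimes>\<^bsub>localization B (\<alpha> ` P)\<^esub> t (\<alpha> ` P)) =
        map_prod \<beta> \<beta> ` s (\<alpha> ` P) \<otimes>\<^bsub>localization A P\<^esub> map_prod \<beta> \<beta> ` t (\<alpha> ` P) \<and>
       map_prod \<beta> \<beta> ` (s (\<alpha> ` P) \<oplus>\<^bsub>localization B (\<alpha> ` P)\<^esub> t (\<alpha> ` P)) =
        map_prod \<beta> \<beta> ` s (\<alpha> ` P) \<oplus>\<^bsub>localization A P\<^esub> map_prod \<beta> \<beta> ` t (\<alpha> ` P)" if P: "P \<in> preim V" for P
    proof -
      note PP = preim_prime[OF P] and QP = primeideal_image[OF preim_prime[OF P]]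
      obtain r d r' d' where rd: "r \<in> carrier B" "d \<in> carrier B - \<alpha> ` P" and rd': "r' \<in> carrier B" "d' \<in> carrier B - \<alpha> ` P"
        and e: "s (\<alpha> ` P) = loc_frac B (\<alpha> ` P) r d" "t (\<alpha> ` P) = loc_frac B (\<alpha> ` P) r' d'"
        using vals[OF P] by blast
      note f = pull_frac[OF PP rd] and f' = pull_frac[OF PP rd']
      have dd: "d \<otimes>\<^bsub>B\<^esub> d' \<in> carrier B - \<alpha> ` P" by (rule primeideal_compl(2)[OF QP rd(2) rd'(2)])
      have rr: "r \<otimes>\<^bsub>B\<^esub> r' \<in> carrier B" "(r \<otimes>\<^bsub>B\<^esub> d') \<oplus>\<^bsub>B\<^esub> (r' \<otimes>\<^bsub>B\<^esub> d) \<in> carrier B" using rd rd' by auto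
      have d: "d \<in> carrier B" "d' \<in> carrier B" using rd rd' by auto
      show ?thesis
        unfolding e B.loc_ops[OF QP rd rd'] f(1) f'(1) A.loc_ops[OF PP f(2,3) f'(2,3)]
          pull_frac(1)[OF PP rr(1) dd] pull_frac(1)[OF PP rr(2) dd]
        using rd(1) rd'(1) d by (simp add: swap.\<alpha>_ops)
    qed
    show "pull (preim V) (s \<otimes>\<^bsub>?S\<^esub> t) = pull (preim V) s \<otimes>\<^bsub>?T\<^esub> pull (preim V) t"
      unfolding pull_def section_alg_def A.Spec_simps B.Spec_simps
      by (simp add: op V' cong: restrict_cong)
    show "pull (preim V) (s \<oplus>\<^bsub>?S\<^esub> t) = pull (preim V) s \<oplus>\<^bsub>?T\<^esub> pull (preim V) t"
      unfolding pull_def section_alg_def A.Spec_simps B.Spec_simps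
      by (simp add: op V' cong: restrict_cong)
  next
    have "map_prod \<beta> \<beta> ` \<one>\<^bsub>localization B (\<alpha> ` P)\<^esub> = \<one>\<^bsub>localization A P\<^esub>" if P: "P \<in> preim V" for P
      using pull_frac(1)[OF preim_prime[OF P] B.one_closed primeideal_compl(1)[OF primeideal_image[OF preim_prime[OF P]]]]
      by (simp add: localization_def swap.\<alpha>_ops(4))
    then show "pull (preim V) \<one>\<^bsub>?S\<^esub> = \<one>\<^bsub>?T\<^esub>"
      unfolding pull_def section_alg_def A.Spec_simps B.Spec_simps
      by (simp add: V' cong: restrict_cong)
    have pA: "preim V \<subseteq> prime_spectrum A" by (auto simp: preim_def)
    show "bij_betw (pull (preim V)) (carrier ?S) (carrier ?T)"
      unfolding carr
    proof (rule bij_betw_byWitness[where f' = "swap.pull V"])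
      show "\<forall>s\<in>rs_sections (Spec B) V. swap.pull V (pull (preim V) s) = s" using pull_pull[OF VB] by blast
      show "\<forall>t\<in>rs_sections (Spec A) (preim V). pull (preim V) (swap.pull V t) = t"
        using swap.pull_pull[OF pA] preim_preim[OF VB] by simp
      show "pull (preim V) ` rs_sections (Spec B) V \<subseteq> rs_sections (Spec A) (preim V)" using pull_closed by blast
      show "swap.pull V ` rs_sections (Spec A) (preim V) \<subseteq> rs_sections (Spec B) V"
        using swap.pull_closed[of _ "preim V"] preim_preim[OF VB] by auto
    qed
  qed
  moreover have "pull (preim V) (c \<odot>\<^bsub>?S\<^esub> s) = c \<odot>\<^bsub>?T\<^esub> pull (preim V) s" if s: "s \<in> carrier ?S" for c s
  proof -
    have "map_prod \<beta> \<beta> ` (c \<odot>\<^bsub>localization B (\<alpha> ` P)\<^esub> s (\<alpha> ` P)) = c \<odot>\<^bsub>localization A P\<^esub> map_prod \<beta> \<beta> ` s (\<alpha> ` P)"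
      if P: "P \<in> preim V" for P
    proof -
      note PP = preim_prime[OF P] and QP = primeideal_image[OF preim_prime[OF P]]
      obtain r d where rd: "r \<in> carrier B" "d \<in> carrier B - \<alpha> ` P" and e: "s (\<alpha> ` P) = loc_frac B (\<alpha> ` P) r d"
        using section_value[OF s[unfolded carr] P] .
      note f = pull_frac[OF PP rd]
      show ?thesis
        unfolding e B.loc_smult[OF QP rd] f(1) A.loc_smult[OF PP f(2,3)] pull_frac(1)[OF PP B.smult_closed[OF rd(1)] rd(2)]
        using rd(1) by (simp add: swap.\<alpha>_ops)
    qed
    then show ?thesis
      unfolding pull_def section_alg_def A.Spec_simps B.Spec_simps
      by (simp add: V' cong: restrict_cong)
  qed
  ultimately show ?thesis by (simp add: alg_iso_def)
qed

lemma rs_iso_Spec: "rs_iso (Spec A) (Spec B) (image \<alpha>) (\<lambda>V. pull (preim V))"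
  unfolding rs_iso_def A.Spec_simps B.Spec_simps
proof (intro conjI allI impI ballI)
  interpret swap: alg_iso_pair B A \<beta> \<alpha> by (rule alg_iso_pair_swap)
  have "homeomorphic_maps (zariski A) (zariski B) (image \<alpha>) (image \<beta>)"
    unfolding homeomorphic_maps_def A.topspace_zariski B.topspace_zariski
    using continuous_map_zariski swap.continuous_map_zariski \<alpha>_image_inverse[OF primeideal_sub]
      swap.\<alpha>_image_inverse[OF swap.primeideal_sub] by (auto simp: prime_spectrum_def)
  then show "homeomorphic_map (zariski A) (zariski B) (image \<alpha>)" using homeomorphic_map_maps by blast
  have pre: "{p \<in> topspace (zariski A). \<alpha> ` p \<in> V} = preim V" for V by (simp add: preim_def A.topspace_zariski)
  show "alg_iso (section_alg (Spec B) V) (section_alg (Spec A) {p \<in> topspace (zariski A). \<alpha> ` p \<in> V}) (pull (preim V))"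
    if "openin (zariski B) V" for V
    unfolding pre by (rule Spec_section_alg_iso[OF that])
  fix V W s assume W: "openin (zariski B) V \<and> openin (zariski B) W \<and> W \<subseteq> V" and "s \<in> rs_sections (Spec B) V"
  show "pull (preim W) (restrict s W) = restrict (pull (preim V) s) {p \<in> topspace (zariski A). \<alpha> ` p \<in> W}"
    unfolding pre
  proof (rule ext)
    fix P
    show "pull (preim W) (restrict s W) P = restrict (pull (preim V) s) (preim W) P"
    proof (cases "P \<in> preim W")
      case True
      then have "P \<in> preim V" "\<alpha> ` P \<in> W" using W by (auto simp: preim_def)
      then show ?thesis using True by (simp add: pull_def)
    qed (simp add: pull_def)
  qed
qed

end

theorem alg_iso_imp_rs_iso_Spec:
  assumes A: "kalg A" and B: "kalg B" and iso: "alg_isomorphic A B"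
  shows "rs_isomorphic (Spec A) (Spec B)"
proof -
  obtain h where h: "alg_iso A B h" using iso by (auto simp: alg_isomorphic_def)
  have bij: "bij_betw h (carrier A) (carrier B)" using h by (simp add: alg_iso_def ring_iso_def)
  have "alg_iso_pair A B h (inv_into (carrier A) h)"
    using bij by (intro alg_iso_pair.intro alg_iso_pair_axioms.intro A B h alg_iso_sym[OF A h])
      (simp_all add: bij_betw_inv_into_left bij_betw_inv_into_right)
  from alg_iso_pair.rs_iso_Spec[OF this] show ?thesis unfolding rs_isomorphic_def by blast
qed

section \<open>Power series in several variables\<close>

type_synonym ('n, 'k) mfps = "('n \<Rightarrow> nat) \<Rightarrow> 'k"

definition splits :: "('n \<Rightarrow> nat) \<Rightarrow> (('n \<Rightarrow> nat) \<times> ('n \<Rightarrow> nat)) set" where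
  "splits m = {(i, j). \<forall>v. i v + j v = m v}"

definition mfps_mult :: "('n, 'k::comm_ring_1) mfps \<Rightarrow> ('n, 'k) mfps \<Rightarrow> ('n, 'k) mfps" where
  "mfps_mult f g = (\<lambda>m. \<Sum>(i, j)\<in>splits m. f i * g j)"

lemma splits_conv_image: "splits m = (\<lambda>i. (i, \<lambda>v. m v - i v)) ` {i. \<forall>v. i v \<le> m v}"
proof -
  have "(i, j) \<in> splits m \<longleftrightarrow> (\<forall>v. i v \<le> m v) \<and> j = (\<lambda>v. m v - i v)" for i j
    by (auto simp: splits_def fun_eq_iff) (metis le_add1, metis diff_add_inverse)
  then show ?thesis by auto
qed

lemma finite_below: "finite {i :: 'n::finite \<Rightarrow> nat. \<forall>v. i v \<le> m v}"
  using finite_box[of "\<lambda>v. Suc (m v)" "\<lambda>_. True"] by (simp add: less_Suc_eq_le)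

lemma finite_splits: "finite (splits (m :: 'n::finite \<Rightarrow> nat))"
  unfolding splits_conv_image using finite_below by (rule finite_imageI)

lemma mfps_mult_conv_below:
  fixes f g :: "('n::finite, 'k::comm_ring_1) mfps"
  shows "mfps_mult f g m = (\<Sum>i | \<forall>v. i v \<le> m v. f i * g (\<lambda>v. m v - i v))"
  unfolding mfps_mult_def splits_conv_image by (subst sum.reindex) (auto simp: inj_on_def)

lemma mfps_mult_commute: "mfps_mult f g = mfps_mult g (f :: ('n::finite, 'k::comm_ring_1) mfps)"
proof
  fix m
  have "(\<Sum>(i, j)\<in>splits m. f i * g j) = (\<Sum>(i, j)\<in>splits m. g i * f j)"
    by (rule sum.reindex_bij_witness[of _ prod.swap prod.swap]) (auto simp: splits_def add.commute mult.commute)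
  then show "mfps_mult f g m = mfps_mult g f m" by (simp add: mfps_mult_def)
qed

lemma mfps_mult_assoc: "mfps_mult (mfps_mult f g) h = mfps_mult f (mfps_mult g (h :: ('n::finite, 'k::comm_ring_1) mfps))"
proof
  fix m :: "'n \<Rightarrow> nat"
  have fs: "finite (splits k)" for k :: "'n \<Rightarrow> nat" by (rule finite_splits)
  have "mfps_mult (mfps_mult f g) h m = (\<Sum>p\<in>splits m. \<Sum>q\<in>splits (fst p). f (fst q) * g (snd q) * h (snd p))"
    by (simp add: mfps_mult_def sum_distrib_right case_prod_beta)
  also have "\<dots> = (\<Sum>(p, q)\<in>(SIGMA p:splits m. splits (fst p)). f (fst q) * g (snd q) * h (snd p))"
    by (rule sum.Sigma) (auto simp: fs)
  \<comment> \<open>Both index sets enumerate the triples of exponents with sum m; the witnesses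
    move the middle one from one bracket to the other.\<close>
  also have "\<dots> = (\<Sum>(p, q)\<in>(SIGMA p:splits m. splits (snd p)). f (fst p) * (g (fst q) * h (snd q)))"
    by (rule sum.reindex_bij_witness[of _
          "\<lambda>(p, q). ((\<lambda>v. fst p v + fst q v, snd q), (fst p, fst q))"
          "\<lambda>(p, q). ((fst q, \<lambda>v. snd q v + snd p v), (snd q, snd p))"])
      (auto simp: splits_def fun_eq_iff algebra_simps)
  also have "\<dots> = (\<Sum>p\<in>splits m. \<Sum>q\<in>splits (snd p). f (fst p) * (g (fst q) * h (snd q)))"
    by (rule sum.Sigma[symmetric]) (auto simp: fs)
  also have "\<dots> = mfps_mult f (mfps_mult g h) m"
    by (simp add: mfps_mult_def sum_distrib_left case_prod_beta)
  finally show "mfps_mult (mfps_mult f g) h m = mfps_mult f (mfps_mult g h) m" .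
qed

lemma mfps_mult_add: "mfps_mult (\<lambda>m. f m + g m) h = (\<lambda>m. mfps_mult f h m + mfps_mult g h m)"
  by (simp add: mfps_mult_def fun_eq_iff distrib_right sum.distrib case_prod_beta)

lemma mfps_mult_add_right: "mfps_mult h (\<lambda>m. f m + g m) = (\<lambda>m. mfps_mult h f m + mfps_mult h g m)"
  by (simp add: mfps_mult_def fun_eq_iff distrib_left sum.distrib case_prod_beta)

lemma mfps_mult_scale: "mfps_mult (\<lambda>m. c * f m) h = (\<lambda>m. c * mfps_mult f h m)"
  by (simp add: mfps_mult_def fun_eq_iff sum_distrib_left case_prod_beta mult.assoc)

definition mfps_monom :: "('n \<Rightarrow> nat) \<Rightarrow> ('n, 'k::comm_ring_1) mfps" where
  "mfps_monom k = (\<lambda>m. if m = k then 1 else 0)"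

lemma if_if_conj: "(P \<and> Q \<longleftrightarrow> R) \<Longrightarrow> (if P then if Q then x else y else y) = (if R then x else y)"
  by auto

lemma mfps_mult_monom:
  fixes f :: "('n::finite, 'k::comm_ring_1) mfps"
  shows "mfps_mult f (mfps_monom k) m = (if \<forall>v. k v \<le> m v then f (\<lambda>v. m v - k v) else 0)"
proof -
  have "mfps_mult f (mfps_monom k) m = mfps_mult (mfps_monom k) f m" by (simp add: mfps_mult_commute)
  also have "\<dots> = (\<Sum>i | \<forall>v. i v \<le> m v. if i = k then f (\<lambda>v. m v - k v) else 0)"
    unfolding mfps_mult_conv_below mfps_monom_def by (rule sum.cong) auto
  also have "\<dots> = (if \<forall>v. k v \<le> m v then f (\<lambda>v. m v - k v) else 0)"
    by (simp add: sum.delta' finite_below)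
  finally show ?thesis .
qed

lemma mfps_mult_one: "mfps_mult (mfps_monom (\<lambda>v. 0)) f = (f :: ('n::finite, 'k::comm_ring_1) mfps)"
  by (subst mfps_mult_commute) (simp add: fun_eq_iff mfps_mult_monom)

lemma mfps_mult_zero_coeff: "mfps_mult f g (\<lambda>v. 0) = f (\<lambda>v. 0) * g (\<lambda>v. 0)"
  for f g :: "('n, 'k::comm_ring_1) mfps"
proof -
  have "splits (\<lambda>v::'n. 0) = {(\<lambda>v. 0, \<lambda>v. 0)}" by (auto simp: splits_def)
  then show ?thesis by (simp add: mfps_mult_def)
qed

section \<open>Degrees in products of power series\<close>

abbreviation fdeg :: "('n::finite \<Rightarrow> nat) \<Rightarrow> nat" where "fdeg m \<equiv> sum m UNIV"

lemma fdeg_splits: "(i, j) \<in> splits m \<Longrightarrow> fdeg i + fdeg j = fdeg m"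
  by (simp add: splits_def flip: sum.distrib)

lemma mfps_mult_cong_deg:
  assumes "\<And>m. fdeg m < N \<Longrightarrow> f m = f' m" "\<And>m. fdeg m < N \<Longrightarrow> g m = g' m" "fdeg m < N"
  shows "mfps_mult f g m = mfps_mult f' g' m"
  unfolding mfps_mult_def
proof (rule sum.cong[OF refl])
  fix p assume "p \<in> splits m"
  moreover obtain i j where "p = (i, j)" by (cases p)
  ultimately show "(case p of (i, j) \<Rightarrow> f i * g j) = (case p of (i, j) \<Rightarrow> f' i * g' j)"
    using fdeg_splits[of i j m] assms by simp
qed

text \<open>Without a constant term in \<open>f\<close>, only coefficients of \<open>g\<close> of
  degree strictly below that of \<open>m\<close> contribute, so one degree is gained.\<close>

lemma mfps_mult_cong_deg_Suc:
  assumes "\<And>m. fdeg m < N \<Longrightarrow> g m = g' m" "f (\<lambda>v. 0) = 0" "fdeg m < Suc N"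
  shows "mfps_mult f g m = mfps_mult f g' m"
  unfolding mfps_mult_def
proof (rule sum.cong[OF refl])
  fix p assume p: "p \<in> splits m"
  obtain i j where ij: "p = (i, j)" by (cases p)
  show "(case p of (i, j) \<Rightarrow> f i * g j) = (case p of (i, j) \<Rightarrow> f i * g' j)"
  proof (cases "i = (\<lambda>v. 0)")
    case False
    then obtain v where "i v \<noteq> 0" by auto
    moreover have "i v \<le> fdeg i" by (rule member_le_sum) auto
    ultimately have "fdeg i > 0" by simp
    then have "fdeg j < N" using fdeg_splits[of i j m] p ij assms(3) by simp
    then show ?thesis using assms(1) ij by simp
  qed (use assms(2) ij in simp)
qed

text \<open>One record with varying carrier, so that formal and convergent series share their
  operations and one development.\<close>

abbreviation sub_fps :: "('n::finite, 'k::field) mfps set \<Rightarrow> ('k, ('n, 'k) mfps) module" where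
  "sub_fps C \<equiv> fps_alg\<lparr>carrier := C\<rparr>"

lemma fps_alg_simps [simp]:
  "carrier fps_alg = UNIV"
  "monoid.mult fps_alg = mfps_mult"
  "\<one>\<^bsub>fps_alg\<^esub> = mfps_monom (\<lambda>v. 0)"
  "\<zero>\<^bsub>fps_alg\<^esub> = (\<lambda>m. 0)"
  "f \<oplus>\<^bsub>fps_alg\<^esub> g = (\<lambda>m. f m + g m)"
  "smult fps_alg c f = (\<lambda>m. c * f m)"
  by (simp_all add: fps_alg_def mfps_mult_def mfps_monom_def splits_def fun_eq_iff)

lemma fps_alg_sub: "fps_alg = sub_fps UNIV"
  by (simp add: fps_alg_def)

definition unit_expo :: "'n \<Rightarrow> nat \<Rightarrow> 'n \<Rightarrow> nat" where
  "unit_expo i k = (\<lambda>v. if v = i then k else 0)"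

lemma fps_var_eq: "fps_var i = mfps_monom (unit_expo i 1)"
  by (simp add: fps_var_def mfps_monom_def unit_expo_def del: One_nat_def)

text \<open>Exponents of polynomials and of series have different types; for finitely many variables
  \<open>Abs_poly_mapping\<close> is a two-sided inverse of \<open>lookup\<close>.\<close>

definition mfps_of_poly :: "('n::finite, 'k::field) mpoly \<Rightarrow> ('n, 'k) mfps" where
  "mfps_of_poly p = (\<lambda>m. lookup p (Abs_poly_mapping m))"

lemma lookup_Abs_expo [simp]: "lookup (Abs_poly_mapping (m :: 'n::finite \<Rightarrow> nat)) = m"
  by (simp add: fun_eq_iff)

lemma mfps_of_poly_lookup [simp]: "mfps_of_poly p (lookup m) = lookup p m"
  by (simp add: mfps_of_poly_def poly_mapping.lookup_inverse)

lemma mfps_eq_lookupI: "(\<And>m. f (lookup m) = g (lookup m)) \<Longrightarrow> f = (g :: ('n::finite, 'k) mfps)"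
  by (metis ext lookup_Abs_expo)

lemma mfps_of_poly_add: "mfps_of_poly (p + q) = (\<lambda>m. mfps_of_poly p m + mfps_of_poly q m)"
  by (simp add: mfps_of_poly_def lookup_add)

lemma mfps_of_poly_sum: "mfps_of_poly (sum f S) = (\<lambda>m. \<Sum>i\<in>S. mfps_of_poly (f i) m)"
  by (simp add: mfps_of_poly_def lookup_sum)

lemma mfps_of_poly_single: "mfps_of_poly (Poly_Mapping.single k c) = (\<lambda>m. c * mfps_monom (lookup k) m)"
  by (rule mfps_eq_lookupI) (auto simp: lookup_single when_def mfps_monom_def poly_mapping.lookup_inject)

lemma mfps_of_BP_poly_sum: "mfps_of_poly (BP_poly a) = (\<lambda>m. \<Sum>i\<in>UNIV. mfps_monom (unit_expo i (a i)) m)"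
proof -
  have l: "lookup (Poly_Mapping.single i k) = unit_expo i k" for i :: 'n and k :: nat
    by (auto simp: lookup_single unit_expo_def when_def)
  show ?thesis
    unfolding BP_poly_def poly_var_power mfps_of_poly_sum mfps_of_poly_single l by simp
qed

lemma mfps_of_poly_mult: "mfps_of_poly (p * q) = mfps_mult (mfps_of_poly p) (mfps_of_poly q)"
proof (induction p rule: poly_mapping_single_induct)
  case (single k c)
  show ?case
  proof (induction q rule: poly_mapping_single_induct)
    case (single l d)
    have "mfps_mult (mfps_monom (lookup k)) (mfps_monom (lookup l)) = (mfps_monom (lookup (k + l)) :: ('a, 'b) mfps)"
    proof
      fix m
      have "(\<forall>v. lookup l v \<le> m v) \<and> (\<lambda>v. m v - lookup l v) = lookup k \<longleftrightarrow> m = lookup (k + l)"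
        by (auto simp: fun_eq_iff lookup_add) (metis add.commute le_add_diff_inverse)
      then show "mfps_mult (mfps_monom (lookup k)) (mfps_monom (lookup l)) m = (mfps_monom (lookup (k + l)) m :: 'b)"
        unfolding mfps_mult_monom by (auto simp: mfps_monom_def)
    qed
    then show ?case
      by (simp add: mult_single mfps_of_poly_single mfps_mult_scale mfps_mult_commute[of _ "\<lambda>m. d * _ m"]
          mfps_mult_commute[of "mfps_monom (lookup l)"] mult.assoc)
  qed (simp add: distrib_left mfps_of_poly_add mfps_mult_add_right)
qed (simp add: distrib_right mfps_of_poly_add mfps_mult_add)

lemma finite_mdeg_less: "finite {m :: 'n::finite \<Rightarrow>\<^sub>0 nat. mdeg m < N}"
proof (rule finite_imageD)
  have "lookup ` {m. mdeg m < N} \<subseteq> {m :: 'n \<Rightarrow> nat. (\<forall>i. m i < N) \<and> True}"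
  proof (clarsimp simp: mdeg_def)
    fix m :: "'n \<Rightarrow>\<^sub>0 nat" and i
    assume "(\<Sum>i\<in>UNIV. lookup m i) < N"
    moreover have "lookup m i \<le> (\<Sum>i\<in>UNIV. lookup m i)" by (rule member_le_sum) auto
    ultimately show "lookup m i < N" by simp
  qed
  then show "finite (lookup ` {m :: 'n \<Rightarrow>\<^sub>0 nat. mdeg m < N})" by (rule finite_subset) (rule finite_box)
qed (use bij_lookup in \<open>auto simp: bij_def intro: inj_on_subset\<close>)

lift_definition mfps_trunc :: "nat \<Rightarrow> ('n::finite, 'k::field) mfps \<Rightarrow> ('n, 'k) mpoly" is
  "\<lambda>N f m. if mdeg m < N then f (lookup m) else 0"
  by (rule finite_subset[OF _ finite_mdeg_less]) auto

lemma mdeg_conv_fdeg: "mdeg m = fdeg (lookup m)"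
  by (simp add: mdeg_def)

text \<open>Covers both all series and the convergent ones. \<open>C_shift\<close> divides selected
  monomials by a monomial, for writing a series without constant term as a sum of X_i g_i;
  \<open>C_geometric\<close> is the series of 1 / (c - X_i), for inverting X_i - c.\<close>

locale fps_subalgebra =
  fixes C :: "('n::finite, 'k::field_char_0) mfps set"
  assumes C_add: "f \<in> C \<Longrightarrow> g \<in> C \<Longrightarrow> (\<lambda>m. f m + g m) \<in> C"
    and C_mult: "f \<in> C \<Longrightarrow> g \<in> C \<Longrightarrow> mfps_mult f g \<in> C"
    and C_scale: "f \<in> C \<Longrightarrow> (\<lambda>m. c * f m) \<in> C"
    and C_monom: "mfps_monom k \<in> C"
    and C_shift: "f \<in> C \<Longrightarrow> (\<lambda>m. if S m then f (\<lambda>v. m v + k v) else 0) \<in> C"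
    and C_geometric: "c \<noteq> 0 \<Longrightarrow> (\<lambda>m. if m = unit_expo i (m i) then (1 / c) ^ Suc (m i) else 0) \<in> C"
begin

abbreviation A :: "('k, ('n, 'k) mfps) module" where "A \<equiv> sub_fps C"

lemma C_zero: "(\<lambda>m. 0) \<in> C"
  using C_scale[OF C_monom, of 0] by simp

lemma kalg_A: "kalg A"
proof (intro kalg.intro kalg_axioms.intro cringI)
  show "abelian_group A"
  proof (rule abelian_groupI)
    show "\<exists>g\<in>carrier A. g \<oplus>\<^bsub>A\<^esub> f = \<zero>\<^bsub>A\<^esub>" if "f \<in> carrier A" for f
      using that C_scale[of f "-1"] by (intro bexI[of _ "\<lambda>m. -1 * f m"]) auto
  qed (auto simp: C_add C_zero add_ac)
  show "comm_monoid A"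
    by (rule comm_monoidI) (auto simp: C_mult C_monom mfps_mult_assoc mfps_mult_one intro: mfps_mult_commute)
qed (auto simp: mfps_mult_add C_scale mfps_mult_scale)

sublocale A: kalg A by (rule kalg_A)

lemma A_minus [simp]: "f \<in> C \<Longrightarrow> g \<in> C \<Longrightarrow> f \<ominus>\<^bsub>A\<^esub> g = (\<lambda>m. f m - g m)"
proof -
  assume fg: "f \<in> C" "g \<in> C"
  have "\<ominus>\<^bsub>A\<^esub> g = (\<lambda>m. -1 * g m)"
    using fg C_scale[of g "-1"] by (intro A.minus_equality) auto
  then show ?thesis by (simp add: A.minus_eq)
qed

lemma C_of_poly: "mfps_of_poly p \<in> C"
proof (induction p rule: poly_mapping_single_induct)
  case (single m c)
  show ?case unfolding mfps_of_poly_single by (intro C_scale C_monom)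
qed (simp add: mfps_of_poly_add C_add)

lemma A_pow_monom: "mfps_monom (unit_expo i 1) [^]\<^bsub>A\<^esub> (k::nat) = mfps_monom (unit_expo i k)"
proof (induction k)
  case 0
  show ?case by (simp add: unit_expo_def)
next
  case (Suc k)
  have "mfps_mult (mfps_monom (unit_expo i k)) (mfps_monom (unit_expo i 1)) = (mfps_monom (unit_expo i (Suc k)) :: ('n, 'k) mfps)"
  proof
    fix m
    have "(\<forall>v. unit_expo i 1 v \<le> m v) \<and> (\<lambda>v. m v - unit_expo i 1 v) = unit_expo i k \<longleftrightarrow> m = unit_expo i (Suc k)"
      by (auto simp: fun_eq_iff unit_expo_def split: if_splits)
    then show "mfps_mult (mfps_monom (unit_expo i k)) (mfps_monom (unit_expo i 1)) m = (mfps_monom (unit_expo i (Suc k)) m :: 'k)"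
      unfolding mfps_mult_monom unfolding mfps_monom_def by (rule if_if_conj)
  qed
  then show ?case using Suc by simp
qed

lemma A_finsum: "finite S \<Longrightarrow> (\<And>i. i \<in> S \<Longrightarrow> f i \<in> C) \<Longrightarrow> finsum A f S = (\<lambda>m. \<Sum>i\<in>S. f i m)"
  by (induction S rule: finite_induct) (auto simp: A.finsum_insert Pi_def)

lemma mfps_of_BP_poly: "mfps_of_poly (BP_poly a) = (\<Oplus>\<^bsub>A\<^esub>i\<in>UNIV. fps_var i [^]\<^bsub>A\<^esub> a i)"
  by (simp add: mfps_of_BP_poly_sum fps_var_eq A_pow_monom A_finsum C_monom del: One_nat_def)

abbreviation BP :: "('n \<Rightarrow> nat) \<Rightarrow> ('n, 'k) mfps" where "BP a \<equiv> mfps_of_poly (BP_poly a)"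

abbreviation IBP :: "('n \<Rightarrow> nat) \<Rightarrow> ('n, 'k) mfps set" where "IBP a \<equiv> PIdl\<^bsub>A\<^esub> (BP a)"

lemma ideal_IBP: "ideal (IBP a) A"
  by (rule A.cgenideal_ideal) (simp add: C_of_poly)

lemma IBP_iff: "F \<in> IBP a \<longleftrightarrow> (\<exists>w\<in>C. F = mfps_mult w (BP a))"
  by (auto simp: cgenideal_def)

text \<open>Every monomial of f_b has some exponent at least b_v, which persists in all its
  multiples.\<close>

lemma IBP_vanish:
  assumes F: "F \<in> IBP b" and m: "\<And>i. m i < b i"
  shows "F m = 0"
proof -
  obtain w where w: "F = mfps_mult w (BP b)" using F IBP_iff by blast
  have "F m = (\<Sum>(i, j)\<in>splits m. w i * BP b j)" by (simp add: w mfps_mult_def)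
  also have "\<dots> = 0"
  proof (intro sum.neutral ballI, clarsimp)
    fix i j assume "(i, j) \<in> splits m" and "BP b j \<noteq> 0"
    have nle: "\<not> b v \<le> j v" for v
    proof -
      have "i v + j v = m v" using \<open>(i, j) \<in> splits m\<close> by (simp add: splits_def)
      then show ?thesis using m[of v] by linarith
    qed
    \<comment> \<open>The factor 1 makes the formula for coefficients of multiples of f_b applicable
      to f_b itself.\<close>
    then have "lookup (1 * BP_poly b) (Abs_poly_mapping j) = (0 :: 'k)"
      unfolding lookup_mult_BP_poly by (intro sum.neutral) (simp add: nle)
    then have "BP b j = 0" by (simp add: mfps_of_poly_def)
    then show "w i = 0" using \<open>BP b j \<noteq> 0\<close> by simp
  qed
  finally show ?thesis .
qed

text \<open>Agreement with an element of the ideal up to terms of degree at least \<open>N\<close>.\<close>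

definition near :: "('n \<Rightarrow> nat) \<Rightarrow> nat \<Rightarrow> ('n, 'k) mfps \<Rightarrow> bool" where
  "near b N G \<longleftrightarrow> (\<exists>F\<in>IBP b. \<forall>m. fdeg m < N \<longrightarrow> G m = F m)"

lemma near_IBP: "F \<in> IBP b \<Longrightarrow> near b N F"
  by (auto simp: near_def)

lemma IBP_add: "F \<in> IBP b \<Longrightarrow> G \<in> IBP b \<Longrightarrow> (\<lambda>m. F m + G m) \<in> IBP b"
  using additive_subgroup.a_closed[OF ideal.axioms(1)[OF ideal_IBP], of F b G] by simp

lemma IBP_mult: "F \<in> IBP b \<Longrightarrow> x \<in> C \<Longrightarrow> mfps_mult x F \<in> IBP b"
  using ideal.I_l_closed[OF ideal_IBP, of F b x] by simp

lemma IBP_scale: "F \<in> IBP b \<Longrightarrow> (\<lambda>m. c * F m) \<in> IBP b"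
  using A.smult_ideal[OF ideal_IBP, of F b c] by simp

lemma near_add: "near b N F \<Longrightarrow> near b N G \<Longrightarrow> near b N (\<lambda>m. F m + G m)"
  unfolding near_def
proof (elim bexE)
  fix F' G' assume "F' \<in> IBP b" "G' \<in> IBP b" "\<forall>m. fdeg m < N \<longrightarrow> F m = F' m" "\<forall>m. fdeg m < N \<longrightarrow> G m = G' m"
  then show "\<exists>H\<in>IBP b. \<forall>m. fdeg m < N \<longrightarrow> F m + G m = H m"
    by (intro bexI[of _ "\<lambda>m. F' m + G' m"] IBP_add) auto
qed

lemma near_scale: "near b N F \<Longrightarrow> near b N (\<lambda>m. c * F m)"
  unfolding near_def
proof (elim bexE)
  fix F' assume "F' \<in> IBP b" "\<forall>m. fdeg m < N \<longrightarrow> F m = F' m"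
  then show "\<exists>H\<in>IBP b. \<forall>m. fdeg m < N \<longrightarrow> c * F m = H m"
    by (intro bexI[of _ "\<lambda>m. c * F' m"] IBP_scale) auto
qed

lemma near_diff: "near b N (\<lambda>m. F m - G m) \<Longrightarrow> near b N G \<Longrightarrow> near b N F"
  using near_add[of b N "\<lambda>m. F m - G m" G] by simp

lemma near_mult: "near b N F \<Longrightarrow> x \<in> C \<Longrightarrow> near b N (mfps_mult x F)"
  unfolding near_def
proof (elim bexE)
  fix F' assume "F' \<in> IBP b" "\<forall>m. fdeg m < N \<longrightarrow> F m = F' m" "x \<in> C"
  then show "\<exists>H\<in>IBP b. \<forall>m. fdeg m < N \<longrightarrow> mfps_mult x F m = H m"
    by (intro bexI[of _ "mfps_mult x F'"] IBP_mult allI impI mfps_mult_cong_deg) auto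
qed

lemma near_mult_Suc: "near b N F \<Longrightarrow> x \<in> C \<Longrightarrow> x (\<lambda>v. 0) = 0 \<Longrightarrow> near b (Suc N) (mfps_mult x F)"
  unfolding near_def
proof (elim bexE)
  fix F' assume "F' \<in> IBP b" "\<forall>m. fdeg m < N \<longrightarrow> F m = F' m" "x \<in> C" "x (\<lambda>v. 0) = 0"
  then show "\<exists>H\<in>IBP b. \<forall>m. fdeg m < Suc N \<longrightarrow> mfps_mult x F m = H m"
    by (intro bexI[of _ "mfps_mult x F'"] IBP_mult allI impI mfps_mult_cong_deg_Suc) auto
qed

lemma near_cong: "near b N F \<Longrightarrow> (\<And>m. fdeg m < N \<Longrightarrow> G m = F m) \<Longrightarrow> near b N G"
  by (auto simp: near_def)

abbreviation X :: "'n \<Rightarrow> ('n, 'k) mfps" where "X i \<equiv> mfps_monom (unit_expo i 1)"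

text \<open>The inverse is minus the geometric series with coefficient 1/c^(k+1) at X_i^k.\<close>

lemma X_minus_const_unit:
  assumes "c \<noteq> 0"
  shows "\<exists>U\<in>C. mfps_mult (\<lambda>m. X i m + (- c) * mfps_monom (\<lambda>v. 0) m) U = mfps_monom (\<lambda>v. 0)"
proof -
  define V where "V = (\<lambda>m. if m = unit_expo i (m i) then (1 / c) ^ Suc (m i) else 0)"
  have V: "V \<in> C" unfolding V_def by (rule C_geometric[OF assms])
  define U where "U = (\<lambda>m. -1 * V m)"
  have "U \<in> C" unfolding U_def by (rule C_scale[OF V])
  moreover have "mfps_mult (\<lambda>m. X i m + (- c) * mfps_monom (\<lambda>v. 0) m) U m = mfps_monom (\<lambda>v. 0) m" for m
  proof -
    have "mfps_mult (X i) U m = (if \<forall>v. unit_expo i 1 v \<le> m v then U (\<lambda>v. m v - unit_expo i 1 v) else 0)"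
      by (subst mfps_mult_commute) (rule mfps_mult_monom)
    also have "(\<forall>v. unit_expo i 1 v \<le> m v) \<longleftrightarrow> m i \<noteq> 0" by (auto simp: unit_expo_def)
    finally have 1: "mfps_mult (X i) U m = (if m i \<noteq> 0 then U (\<lambda>v. m v - unit_expo i 1 v) else 0)" .
    have 2: "mfps_mult (\<lambda>m. (- c) * mfps_monom (\<lambda>v. 0) m) U m = - c * U m"
      by (simp only: mfps_mult_scale mfps_mult_one)
    have eq: "(\<lambda>v. m v - unit_expo i 1 v) = unit_expo i (m i - 1) \<longleftrightarrow> m = unit_expo i (m i)" if "m i \<noteq> 0"
      using that by (auto simp: fun_eq_iff unit_expo_def)
    have "U (\<lambda>v. m v - unit_expo i 1 v) = (if m = unit_expo i (m i) then - ((1 / c) ^ m i) else 0)" if "m i \<noteq> 0"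
    proof -
      have mi: "(\<lambda>v. m v - unit_expo i 1 v) i = m i - 1" by (simp add: unit_expo_def)
      show ?thesis unfolding U_def V_def mi eq[OF that] using that by simp
    qed
    moreover have "m = (\<lambda>v. 0) \<longleftrightarrow> m = unit_expo i (m i) \<and> m i = 0"
      by (auto simp: fun_eq_iff unit_expo_def) metis
    ultimately have "(if m i \<noteq> 0 then U (\<lambda>v. m v - unit_expo i 1 v) else 0) - c * U m = mfps_monom (\<lambda>v. 0) m"
      using assms by (auto simp: U_def V_def mfps_monom_def)
    then show ?thesis unfolding mfps_mult_add 1 2 by simp
  qed
  ultimately show ?thesis by blast
qed

text \<open>Every monomial of positive degree is assigned one variable dividing it, and X_i g_i
  collects those assigned to i. Exactly one variable is divided out, so the order of vanishing drops
  by one only.\<close>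

lemma monom_decomposition:
  assumes G: "G \<in> C" "G (\<lambda>v. 0) = 0"
  shows "\<exists>g. (\<forall>i. g i \<in> C) \<and> (\<forall>i N. (\<forall>m. fdeg m < Suc N \<longrightarrow> G m = 0) \<longrightarrow> (\<forall>m. fdeg m < N \<longrightarrow> g i m = 0))
    \<and> G = (\<lambda>m. \<Sum>i\<in>UNIV. mfps_mult (X i) (g i) m)"
proof -
  define sel where "sel m = (SOME v. m v \<noteq> 0)" for m :: "'n \<Rightarrow> nat"
  have sel: "m (sel m) \<noteq> 0" if "m \<noteq> (\<lambda>v. 0)" for m
    unfolding sel_def by (rule someI_ex) (use that in auto)
  define g where "g i = (\<lambda>m. if sel (\<lambda>v. m v + unit_expo i 1 v) = i then G (\<lambda>v. m v + unit_expo i 1 v) else 0)" for i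
  have "g i \<in> C" for i unfolding g_def by (rule C_shift[OF G(1)])
  moreover have "g i m = 0" if "\<forall>m. fdeg m < Suc N \<longrightarrow> G m = 0" "fdeg m < N" for i N m
  proof -
    have "fdeg (\<lambda>v. m v + unit_expo i 1 v) < Suc N" using that(2) by (simp add: sum.distrib unit_expo_def)
    then show ?thesis using that(1) by (simp add: g_def)
  qed
  moreover have "G m = (\<Sum>i\<in>UNIV. mfps_mult (X i) (g i) m)" for m
  proof -
    have "mfps_mult (X i) (g i) m = (if m i \<noteq> 0 \<and> sel m = i then G m else 0)" for i
    proof -
      have "mfps_mult (X i) (g i) m = (if \<forall>v. unit_expo i 1 v \<le> m v then g i (\<lambda>v. m v - unit_expo i 1 v) else 0)"
        by (subst mfps_mult_commute) (rule mfps_mult_monom)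
      moreover have "(\<forall>v. unit_expo i 1 v \<le> m v) \<longleftrightarrow> m i \<noteq> 0" by (auto simp: unit_expo_def)
      moreover have "(\<lambda>v. m v - unit_expo i 1 v + unit_expo i 1 v) = m" if "m i \<noteq> 0"
        using that by (auto simp: unit_expo_def fun_eq_iff)
      ultimately show ?thesis by (simp add: g_def)
    qed
    then have "(\<Sum>i\<in>UNIV. mfps_mult (X i) (g i) m) = (\<Sum>i\<in>UNIV. if i = sel m then (if m i \<noteq> 0 then G m else 0) else 0)"
      by (intro sum.cong) auto
    also have "\<dots> = (if m (sel m) \<noteq> 0 then G m else 0)" by simp
    also have "\<dots> = G m" using sel[of m] G(2) by (cases "m = (\<lambda>v. 0)") auto
    finally show ?thesis ..
  qed
  ultimately show ?thesis by (intro exI[of _ g]) (auto simp: fun_eq_iff)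
qed

end

locale fps_quot_hom = fps_subalgebra C for C :: "('n::finite, 'k::field_char_0) mfps set" +
  fixes a b :: "'n \<Rightarrow> nat" and H
  assumes qh: "quot_hom A A (IBP b) H" and H_IBP: "\<And>x. x \<in> IBP a \<Longrightarrow> H x \<in> IBP b"
    and a2: "\<And>i. 2 \<le> a i" and b2: "\<And>i. 2 \<le> b i"
begin

lemma H_C: "x \<in> C \<Longrightarrow> H x \<in> C"
  using quot_hom.H_closed[OF qh] by simp

lemma H_add_diff: "x \<in> C \<Longrightarrow> y \<in> C \<Longrightarrow> (\<lambda>m. H (\<lambda>m. x m + y m) m - (H x m + H y m)) \<in> IBP b"
  using quot_hom.H_add[OF qh, of x y] by (simp add: H_C C_add)

lemma H_mult_diff: "x \<in> C \<Longrightarrow> y \<in> C \<Longrightarrow> (\<lambda>m. H (mfps_mult x y) m - mfps_mult (H x) (H y) m) \<in> IBP b"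
  using quot_hom.H_mult[OF qh, of x y] by (simp add: H_C C_mult)

lemma H_const_diff: "(\<lambda>m. H (\<lambda>m. c * mfps_monom (\<lambda>v. 0) m) m - c * mfps_monom (\<lambda>v. 0) m) \<in> IBP b"
  using quot_hom.H_const[OF qh, of c] by (simp add: H_C C_scale C_monom)

lemma H_surj_diff: "y \<in> C \<Longrightarrow> \<exists>x\<in>C. (\<lambda>m. H x m - y m) \<in> IBP b"
  using quot_hom.H_surj[OF qh, of y] by (auto simp: H_C)

lemma H_zero: "H (\<lambda>m. 0) \<in> IBP b"
  using H_const_diff[of 0] by simp

lemma IBP_zero_coeff: "F \<in> IBP b \<Longrightarrow> F (\<lambda>v. 0) = 0"
  by (rule IBP_vanish) (use b2 in \<open>auto intro: less_le_trans[of 0 2]\<close>)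

text \<open>Elements of \<open>IBP b\<close> have no constant term, so \<open>H\<close> followed by
  evaluation at the origin respects sums, products and constants exactly.\<close>

lemma H_zero_coeff:
  shows "x \<in> C \<Longrightarrow> y \<in> C \<Longrightarrow> H (\<lambda>m. x m + y m) (\<lambda>v. 0) = H x (\<lambda>v. 0) + H y (\<lambda>v. 0)"
    and "x \<in> C \<Longrightarrow> y \<in> C \<Longrightarrow> H (mfps_mult x y) (\<lambda>v. 0) = H x (\<lambda>v. 0) * H y (\<lambda>v. 0)"
    and "H (\<lambda>m. c * mfps_monom (\<lambda>v. 0) m) (\<lambda>v. 0) = c"
  using IBP_zero_coeff[OF H_add_diff, of x y] IBP_zero_coeff[OF H_mult_diff, of x y] IBP_zero_coeff[OF H_const_diff, of c]
  by (simp_all add: mfps_mult_zero_coeff) (simp add: mfps_monom_def)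

text \<open>If the image of X_i had constant term c \<noteq> 0, then X_i - c would be a unit whose
  image vanishes at the origin.\<close>

lemma H_X_zero_coeff: "H (X i) (\<lambda>v. 0) = 0"
proof (rule ccontr)
  let ?c = "H (X i) (\<lambda>v. 0)"
  assume "?c \<noteq> 0"
  then obtain U where U: "U \<in> C" "mfps_mult (\<lambda>m. X i m + (- ?c) * mfps_monom (\<lambda>v. 0) m) U = mfps_monom (\<lambda>v. 0)"
    using X_minus_const_unit by blast
  have c: "(\<lambda>m. (- ?c) * mfps_monom (\<lambda>v. 0) m) \<in> C" by (intro C_scale C_monom)
  have "1 = H (mfps_mult (\<lambda>m. X i m + (- ?c) * mfps_monom (\<lambda>v. 0) m) U) (\<lambda>v. 0)"
    unfolding U(2) using H_zero_coeff(3)[of 1] by simp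
  also have "\<dots> = H (\<lambda>m. X i m + (- ?c) * mfps_monom (\<lambda>v. 0) m) (\<lambda>v. 0) * H U (\<lambda>v. 0)"
    by (rule H_zero_coeff(2)[OF C_add[OF C_monom c] U(1)])
  also have "H (\<lambda>m. X i m + (- ?c) * mfps_monom (\<lambda>v. 0) m) (\<lambda>v. 0) = ?c + - ?c"
    unfolding H_zero_coeff(1)[OF C_monom c] H_zero_coeff(3) ..
  finally show False by simp
qed

text \<open>Continuity for the powers of the maximal ideal is proved, not assumed: a series of order
  at least N + 1 is a sum of X_i g_i with g_i of order at least N, and the image of X_i has no
  constant term, so each step gains a degree.\<close>

lemma H_near:
  assumes "G \<in> C" "\<And>m. fdeg m < N \<Longrightarrow> G m = 0"
  shows "near b N (H G)"
  using assms
proof (induction N arbitrary: G)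
  case 0
  then show ?case using H_zero by (auto simp: near_def)
next
  case (Suc N)
  have "G (\<lambda>v. 0) = 0" using Suc.prems(2)[of "\<lambda>v. 0"] by simp
  then obtain g where g: "\<And>i. g i \<in> C" "\<And>i m. fdeg m < N \<Longrightarrow> g i m = 0" "G = (\<lambda>m. \<Sum>i\<in>UNIV. mfps_mult (X i) (g i) m)"
    using monom_decomposition[OF Suc.prems(1)] Suc.prems(2) by blast
  have XgC: "mfps_mult (X i) (g i) \<in> C" for i by (intro C_mult C_monom g)
  have near_term: "near b (Suc N) (H (mfps_mult (X i) (g i)))" for i
  proof (rule near_diff[OF near_IBP[OF H_mult_diff[OF C_monom g(1)]]])
    show "near b (Suc N) (mfps_mult (H (X i)) (H (g i)))"
      by (intro near_mult_Suc Suc.IH g H_C C_monom H_X_zero_coeff)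
  qed
  have "(\<lambda>m. \<Sum>i\<in>S. mfps_mult (X i) (g i) m) \<in> C \<and> near b (Suc N) (H (\<lambda>m. \<Sum>i\<in>S. mfps_mult (X i) (g i) m))" if "finite S" for S
    using that
  proof (induction S rule: finite_induct)
    case empty
    show ?case using near_IBP[OF H_zero] C_zero by simp
  next
    case (insert i S)
    then have S: "(\<lambda>m. \<Sum>i\<in>S. mfps_mult (X i) (g i) m) \<in> C" by blast
    have "near b (Suc N) (H (\<lambda>m. mfps_mult (X i) (g i) m + (\<Sum>i\<in>S. mfps_mult (X i) (g i) m)))"
      by (rule near_diff[OF near_IBP[OF H_add_diff[OF XgC S]]]) (intro near_add near_term conjunct2[OF insert.IH])
    then show ?case using insert.hyps C_add[OF XgC S] by simp
  qed
  from this[of UNIV] show ?case unfolding g(3) by simp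
qed

text \<open>One more than sum b, so that degree sum b is still visible: partial derivatives are
  taken after truncation and lose one degree.\<close>

abbreviation deg_bound :: nat where "deg_bound \<equiv> Suc (sum b UNIV)"

text \<open>The polynomials in \<open>IBP b\<close> plus all terms of degree at least
  \<open>deg_bound\<close>.\<close>

definition K :: "('n, 'k) mpoly set" where "K = {p. near b deg_bound (mfps_of_poly p)}"

definition L :: "('n, 'k) mpoly \<Rightarrow> ('n, 'k) mpoly" where "L p = mfps_trunc deg_bound (H (mfps_of_poly p))"

lemma mfps_of_L: "fdeg m < deg_bound \<Longrightarrow> mfps_of_poly (L p) m = H (mfps_of_poly p) m"
  by (simp add: L_def mfps_of_poly_def mfps_trunc.rep_eq mdeg_conv_fdeg)

lemma mfps_of_poly_diff: "mfps_of_poly (p - q) = (\<lambda>m. mfps_of_poly p m - mfps_of_poly q m)"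
  by (simp add: mfps_of_poly_def lookup_minus)

lemma ideal_K: "ideal_set K"
  unfolding ideal_set_def K_def
  using near_IBP[OF H_zero] near_scale[of b deg_bound _ 0]
  by (auto simp: mfps_of_poly_add mfps_of_poly_mult C_of_poly mfps_of_poly_def[of 0] intro!: near_add near_mult)

text \<open>Sums and products below \<open>deg_bound\<close> depend only on the terms below
  \<open>deg_bound\<close>, so truncating the values of \<open>H\<close> costs nothing modulo
  \<open>K\<close>.\<close>

lemma BP_hom_KL: "BP_hom K L a b"
proof
  show "ideal_set K" by (rule ideal_K)
  fix p q :: "('n, 'k) mpoly"
  show "eqm K (L (p + q)) (L p + L q)"
    unfolding eqm_def K_def mem_Collect_eq
    by (rule near_cong[OF near_IBP[OF H_add_diff[OF C_of_poly C_of_poly, of p q]]])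
      (simp add: mfps_of_poly_diff mfps_of_poly_add mfps_of_L)
  show "eqm K (L (p * q)) (L p * L q)"
    unfolding eqm_def K_def mem_Collect_eq
  proof (rule near_cong[OF near_IBP[OF H_mult_diff[OF C_of_poly C_of_poly, of p q]]])
    fix m :: "'n \<Rightarrow> nat" assume m: "fdeg m < deg_bound"
    have "mfps_mult (mfps_of_poly (L p)) (mfps_of_poly (L q)) m = mfps_mult (H (mfps_of_poly p)) (H (mfps_of_poly q)) m"
      by (rule mfps_mult_cong_deg[OF _ _ m]) (simp_all add: mfps_of_L)
    then show "mfps_of_poly (L (p * q) - L p * L q) m =
        H (mfps_mult (mfps_of_poly p) (mfps_of_poly q)) m - mfps_mult (H (mfps_of_poly p)) (H (mfps_of_poly q)) m"
      using m by (simp add: mfps_of_poly_diff mfps_of_poly_mult mfps_of_L)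
  qed
next
  fix c :: 'k
  have s: "mfps_of_poly (Poly_Mapping.single 0 c) = (\<lambda>m. c * mfps_monom (\<lambda>v. 0) m :: 'k)"
    by (simp add: mfps_of_poly_single zero_poly_mapping.rep_eq)
  show "eqm K (L (Poly_Mapping.single 0 c)) (Poly_Mapping.single 0 c)"
    unfolding eqm_def K_def mem_Collect_eq
    by (rule near_cong[OF near_IBP[OF H_const_diff[of c]]]) (simp add: mfps_of_poly_diff mfps_of_L s)
next
  show "2 \<le> a i" "2 \<le> b i" for i by (rule a2 b2)+
next
  fix p :: "('n, 'k) mpoly"
  obtain G where G: "G \<in> C" "(\<lambda>m. H G m - mfps_of_poly p m) \<in> IBP b"
    using H_surj_diff[OF C_of_poly] by blast
  \<comment> \<open>The preimage \<open>G\<close> is only a series. Its tail \<open>D\<close> beyond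
    the truncation is sent close to the ideal by \<open>H_near\<close>, so the polynomial
    \<open>q\<close> has the required image modulo \<open>K\<close>.\<close>
  define q where "q = mfps_trunc deg_bound G"
  define D where "D = (\<lambda>m. G m + -1 * mfps_of_poly q m)"
  have D: "D \<in> C" unfolding D_def by (intro C_add C_scale C_of_poly G)
  have nD: "near b deg_bound (H D)"
    by (rule H_near[OF D]) (simp add: D_def q_def mfps_of_poly_def mfps_trunc.rep_eq mdeg_conv_fdeg)
  have "near b deg_bound (\<lambda>m. H G m - (H (mfps_of_poly q) m + H D m))"
    using near_IBP[OF H_add_diff[OF C_of_poly[of q] D]] by (simp add: D_def)
  from near_add[OF near_IBP[OF G(2)] near_scale[OF near_add[OF this nD]]]
  have "near b deg_bound (\<lambda>m. (H G m - mfps_of_poly p m) + -1 * ((H G m - (H (mfps_of_poly q) m + H D m)) + H D m))"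
    .
  then have "near b deg_bound (\<lambda>m. H (mfps_of_poly q) m - mfps_of_poly p m)" by (simp add: algebra_simps)
  then have "eqm K (L q) p"
    unfolding eqm_def K_def mem_Collect_eq
    by (rule near_cong) (simp add: mfps_of_poly_diff mfps_of_L)
  then show "\<exists>q. eqm K (L q) p" ..
next
  have "BP a \<in> IBP a" by (rule A.cgenideal_self) (simp add: C_of_poly)
  then have "H (BP a) \<in> IBP b" by (rule H_IBP)
  then show "L (BP_poly a) \<in> K"
    unfolding K_def mem_Collect_eq by (rule near_cong[OF near_IBP]) (simp add: mfps_of_L)
next
  \<comment> \<open>Degrees up to sum b lie strictly below \<open>deg_bound\<close>, where
    \<open>p\<close> agrees with an element of the ideal.\<close>
  have van: "lookup p m = 0" if pK: "p \<in> K" and m: "\<forall>i. lookup m i < b i" "mdeg m \<le> sum b UNIV" for p m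
  proof -
    obtain F where F: "F \<in> IBP b" "\<forall>m. fdeg m < deg_bound \<longrightarrow> mfps_of_poly p m = F m"
      using pK by (auto simp: K_def near_def)
    have "lookup p m = F (lookup m)"
      using F(2)[rule_format, of "lookup m"] m(2) by (simp add: mdeg_conv_fdeg)
    then show ?thesis using IBP_vanish[OF F(1)] m(1) by simp
  qed
  show "K \<subseteq> supported (jac_expos b (sum b UNIV))" using supported_jac_of_vanishing(1) van by blast
  show "partial j p \<in> supported (jac_expos b (sum b UNIV))" if "p \<in> K" for j p
    using supported_jac_of_vanishing(2) van that by blast
qed

end

context fps_subalgebra begin

lemma BP_iso_card_le:
  assumes "\<And>i. 2 \<le> a i" "\<And>i. 2 \<le> b i" and iso: "alg_isomorphic (quot_alg A (IBP a)) (quot_alg A (IBP b))"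
  shows "card {m. (\<forall>i. m i < b i - 1) \<and> sum m UNIV < d} \<le> card {m. (\<forall>i. m i < a i - 1) \<and> sum m UNIV < d}"
proof -
  obtain h where h: "alg_iso (quot_alg A (IBP a)) (quot_alg A (IBP b)) h" using iso by (auto simp: alg_isomorphic_def)
  obtain H where H: "quot_hom A A (IBP b) H" "\<And>x. x \<in> IBP a \<Longrightarrow> H x \<in> IBP b"
    using alg_iso_lift[OF kalg_A kalg_A ideal_IBP ideal_IBP h] by blast
  interpret fps_quot_hom C a b H
    by (intro fps_quot_hom.intro fps_quot_hom_axioms.intro fps_subalgebra_axioms H assms(1,2))
  interpret BP_hom K L a b by (rule BP_hom_KL)
  show ?thesis by (rule card_box_le)
qed

theorem BP_iso_imp_perm:
  assumes "\<And>i. 2 \<le> a i" "\<And>i. 2 \<le> b i" and iso: "alg_isomorphic (quot_alg A (IBP a)) (quot_alg A (IBP b))"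
  shows "perm_equiv a b"
  by (rule perm_equiv_of_card_le[OF assms(1,2)])
    (use BP_iso_card_le assms alg_isomorphic_sym[OF A.kalg_quot[OF ideal_IBP] iso] in blast)+

end

section \<open>Convergent power series\<close>

definition pdisc :: "real \<Rightarrow> complex ^ 'n::finite \<Rightarrow> bool" where
  "pdisc r z \<longleftrightarrow> (\<forall>i. norm (z $ i) \<le> r)"

definition zpow :: "'a::comm_ring_1 ^ 'n::finite \<Rightarrow> ('n \<Rightarrow> nat) \<Rightarrow> 'a" where
  "zpow z m = (\<Prod>i\<in>UNIV. (z $ i) ^ m i)"

text \<open>For r \<ge> 0 this is absolute convergence on the closed polydisc of radius
  \<open>r\<close>, tested at its corner (r,...,r).\<close>

definition abs_conv :: "real \<Rightarrow> ('n::finite, complex) mfps \<Rightarrow> bool" where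
  "abs_conv r c \<longleftrightarrow> (\<lambda>m. norm (c m) * r ^ fdeg m) summable_on UNIV"

lemma eventually_nhds_zero_iff_pdisc:
  "(\<forall>\<^sub>F z in nhds 0. P z) \<longleftrightarrow> (\<exists>r>0. \<forall>z :: complex ^ 'n::finite. pdisc r z \<longrightarrow> P z)"
proof
  assume "\<forall>\<^sub>F z in nhds 0. P z"
  then obtain e where e: "e > 0" "\<And>z. dist z 0 < e \<Longrightarrow> P z" by (auto simp: eventually_nhds_metric)
  \<comment> \<open>The norm is at most the sum of the n coordinate norms, each at most e/(2n), so
    it stays below e.\<close>
  define r where "r = e / (2 * real CARD('n))"
  have "P z" if "pdisc r z" for z :: "complex ^ 'n"
  proof (rule e(2))
    have "norm z \<le> (\<Sum>i\<in>UNIV. norm (z $ i))" unfolding norm_vec_def by (rule L2_set_le_sum) auto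
    also have "\<dots> \<le> (\<Sum>i\<in>(UNIV :: 'n set). r)" using that by (intro sum_mono) (simp add: pdisc_def)
    also have "\<dots> < e" using e(1) by (simp add: r_def)
    finally show "dist z 0 < e" by simp
  qed
  moreover have "r > 0" using e(1) by (simp add: r_def)
  ultimately show "\<exists>r>0. \<forall>z :: complex ^ 'n. pdisc r z \<longrightarrow> P z" by blast
next
  assume "\<exists>r>0. \<forall>z :: complex ^ 'n. pdisc r z \<longrightarrow> P z"
  then obtain r where r: "r > 0" "\<And>z :: complex ^ 'n. pdisc r z \<Longrightarrow> P z" by blast
  show "\<forall>\<^sub>F z in nhds 0. P z"
    unfolding eventually_nhds_metric
  proof (intro exI conjI allI impI)
    fix z :: "complex ^ 'n" assume "dist z 0 < r"
    then have "norm (z $ i) \<le> r" for i using Finite_Cartesian_Product.norm_nth_le[of z i] by simp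
    then show "P z" using r(2) by (simp add: pdisc_def)
  qed (rule r(1))
qed

lemma norm_zpow_le: "pdisc r z \<Longrightarrow> norm (zpow z m) \<le> r ^ fdeg m"
proof -
  assume "pdisc r z"
  then have "(\<Prod>i\<in>UNIV. norm (z $ i) ^ m i) \<le> (\<Prod>i\<in>UNIV. r ^ m i)"
    by (intro prod_mono) (auto simp: pdisc_def intro: power_mono)
  then show ?thesis by (simp add: zpow_def prod_norm[symmetric] norm_power power_sum)
qed

lemma abs_conv_mono:
  assumes "abs_conv r c" "0 \<le> s" "s \<le> r"
  shows "abs_conv s c"
  unfolding abs_conv_def
  by (rule summable_on_comparison_test[OF assms(1)[unfolded abs_conv_def]])
    (use assms in \<open>auto intro!: mult_left_mono power_mono\<close>)

lemma abs_conv_summable: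
  assumes "abs_conv r c" "pdisc r z"
  shows "(\<lambda>m. norm (c m * zpow z m)) summable_on UNIV"
  by (rule summable_on_comparison_test[OF assms(1)[unfolded abs_conv_def]])
    (auto simp: norm_mult intro!: mult_left_mono norm_zpow_le assms)

definition ev :: "('n::finite, complex) mfps \<Rightarrow> complex ^ 'n \<Rightarrow> complex" where
  "ev c z = infsum (\<lambda>m. c m * zpow z m) UNIV"

lemma abs_conv_has_sum:
  assumes "abs_conv r c" "pdisc r z"
  shows "((\<lambda>m. c m * zpow z m) has_sum ev c z) UNIV"
  unfolding ev_def by (rule has_sum_infsum) (rule abs_summable_summable[OF abs_conv_summable[OF assms]])

lemma conv_iff: "c \<in> carrier conv_fps_alg \<longleftrightarrow> (\<exists>r>0. abs_conv r c)"
  by (simp add: conv_fps_alg_def abs_conv_def)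

text \<open>The Cauchy product: the absolutely convergent double sum over all pairs is regrouped by
  the sum of the two exponents.\<close>

lemma has_sum_splits:
  fixes F G :: "('n::finite \<Rightarrow> nat) \<Rightarrow> 'a::{real_normed_field, banach}"
  assumes F: "(\<lambda>m. norm (F m)) summable_on UNIV" and G: "(\<lambda>m. norm (G m)) summable_on UNIV"
  shows "((\<lambda>m. \<Sum>(i, j)\<in>splits m. F i * G j) has_sum (infsum F UNIV * infsum G UNIV)) UNIV"
proof -
  let ?P = "\<lambda>(i, j). F i * G j"
  have Fs: "(F has_sum infsum F UNIV) UNIV" and Gs: "(G has_sum infsum G UNIV) UNIV"
    using abs_summable_summable[OF F] abs_summable_summable[OF G] by auto
  have "?P abs_summable_on (UNIV \<times> UNIV)"
  proof (rule summable_on_SigmaI)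
    show "((\<lambda>y. norm (?P (x, y))) has_sum (norm (F x) * infsum (\<lambda>y. norm (G y)) UNIV)) UNIV" for x
      using has_sum_cmult_right[OF has_sum_infsum[OF G], of "norm (F x)"] by (simp add: norm_mult)
    show "(\<lambda>x. norm (F x) * infsum (\<lambda>y. norm (G y)) UNIV) summable_on UNIV" by (rule summable_on_cmult_left[OF F])
  qed auto
  then have "?P summable_on (UNIV \<times> UNIV)" by (rule abs_summable_summable)
  then have "(?P has_sum (infsum F UNIV * infsum G UNIV)) (UNIV \<times> UNIV)"
    by (rule has_sum_SigmaI[rotated 2])
      (use has_sum_cmult_right[OF Gs] has_sum_cmult_left[OF Fs] in auto)
  moreover have "bij_betw snd (Sigma UNIV splits) (UNIV \<times> (UNIV :: ('n \<Rightarrow> nat) set))"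
    by (rule bij_betw_byWitness[where f' = "\<lambda>(i, j). (\<lambda>v. i v + j v, (i, j))"]) (auto simp: splits_def)
  ultimately have "((\<lambda>x. ?P (snd x)) has_sum (infsum F UNIV * infsum G UNIV)) (Sigma UNIV splits)"
    by (simp only: has_sum_reindex_bij_betw)
  then show ?thesis
    by (rule has_sum_SigmaD) (auto simp: case_prod_beta intro!: has_sum_finiteI finite_splits)
qed

text \<open>The product is dominated by the Cauchy product of the two series of norms at radius
  \<open>r\<close>.\<close>

lemma abs_conv_mult:
  assumes f: "abs_conv r f" and g: "abs_conv r g" and r: "0 \<le> r"
  shows "abs_conv r (mfps_mult f g)"
  unfolding abs_conv_def
proof (rule summable_on_comparison_test)
  let ?F = "\<lambda>m. norm (f m) * r ^ fdeg m" and ?G = "\<lambda>m. norm (g m) * r ^ fdeg m"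
  show "(\<lambda>m. \<Sum>(i, j)\<in>splits m. ?F i * ?G j) summable_on UNIV"
    using f g r by (intro has_sum_imp_summable[OF has_sum_splits]) (simp_all add: abs_conv_def)
  fix m
  have "norm (mfps_mult f g m) \<le> (\<Sum>(i, j)\<in>splits m. norm (f i) * norm (g j))"
    unfolding mfps_mult_def by (rule order_trans[OF norm_sum]) (simp add: case_prod_beta norm_mult)
  then have "norm (mfps_mult f g m) * r ^ fdeg m \<le> (\<Sum>(i, j)\<in>splits m. norm (f i) * norm (g j)) * r ^ fdeg m"
    using r by (intro mult_right_mono) auto
  also have "\<dots> = (\<Sum>(i, j)\<in>splits m. ?F i * ?G j)"
    unfolding sum_distrib_right
    by (intro sum.cong refl) (auto simp: fdeg_splits[symmetric] power_add)
  finally show "norm (mfps_mult f g m) * r ^ fdeg m \<le> (\<Sum>(i, j)\<in>splits m. ?F i * ?G j)" .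
qed (use r in auto)

lemma zpow_splits: "(i, j) \<in> splits m \<Longrightarrow> zpow z i * zpow z j = zpow z m"
  by (simp add: zpow_def splits_def flip: prod.distrib power_add)

lemma ev_mult:
  assumes "abs_conv r f" "abs_conv r g" "pdisc r z"
  shows "ev (mfps_mult f g) z = ev f z * ev g z"
proof -
  have "((\<lambda>m. \<Sum>(i, j)\<in>splits m. (f i * zpow z i) * (g j * zpow z j)) has_sum (ev f z * ev g z)) UNIV"
    unfolding ev_def by (intro has_sum_splits abs_conv_summable[OF assms(1,3)] abs_conv_summable[OF assms(2,3)])
  also have "(\<lambda>m. \<Sum>(i, j)\<in>splits m. (f i * zpow z i) * (g j * zpow z j)) = (\<lambda>m. mfps_mult f g m * zpow z m)"
    unfolding mfps_mult_def sum_distrib_right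
    by (intro ext sum.cong refl) (auto simp: zpow_splits[symmetric])
  finally show ?thesis unfolding ev_def by (rule infsumI)
qed

lemma abs_conv_add: "abs_conv r f \<Longrightarrow> abs_conv r g \<Longrightarrow> 0 \<le> r \<Longrightarrow> abs_conv r (\<lambda>m. f m + g m)"
  unfolding abs_conv_def
  by (rule summable_on_comparison_test[OF summable_on_add[of "\<lambda>m. norm (f m) * r ^ fdeg m" _ "\<lambda>m. norm (g m) * r ^ fdeg m"]])
    (auto simp: distrib_right[symmetric] intro!: mult_right_mono norm_triangle_ineq)

lemma abs_conv_scale: "abs_conv r f \<Longrightarrow> abs_conv r (\<lambda>m. c * f m)"
  unfolding abs_conv_def using summable_on_cmult_right[of "\<lambda>m. norm (f m) * r ^ fdeg m" UNIV "norm c"]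
  by (simp add: norm_mult mult.assoc)

lemma abs_conv_monom: "abs_conv r (mfps_monom k)"
  unfolding abs_conv_def
  by (rule finite_nonzero_values_imp_summable_on) (auto simp: mfps_monom_def intro: finite_subset[of _ "{k}"])

text \<open>The shifted terms are a subfamily of the original ones, up to the constant factor 1 /
  r^(degree of k).\<close>

lemma abs_conv_shift:
  assumes "abs_conv r f" "0 < r"
  shows "abs_conv r (\<lambda>m. if S m then f (\<lambda>v. m v + k v) else 0)"
  unfolding abs_conv_def
proof (rule summable_on_comparison_test)
  let ?s = "\<lambda>m v. m v + k v"
  have "inj ?s" by (auto simp: inj_def fun_eq_iff)
  have "(\<lambda>m. norm (f m) * r ^ fdeg m) summable_on range ?s"
    using assms(1) unfolding abs_conv_def by (rule summable_on_subset) auto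
  then have "(\<lambda>m. norm (f (?s m)) * r ^ fdeg (?s m)) summable_on UNIV"
    by (subst (asm) summable_on_reindex[OF \<open>inj ?s\<close>]) (simp add: o_def)
  from summable_on_cmult_left[OF this, of "inverse (r ^ fdeg k)"]
  show "(\<lambda>m. norm (f (?s m)) * r ^ fdeg m) summable_on UNIV"
    using assms(2) by (simp add: sum.distrib power_add field_simps)
qed (use assms in auto)

text \<open>At radius |c|/2 the terms form a geometric series of ratio 1/2.\<close>

lemma abs_conv_geometric:
  assumes "c \<noteq> 0"
  shows "abs_conv (norm c / 2) (\<lambda>m. if m = unit_expo i (m i) then (1 / c) ^ Suc (m i) else 0)" (is "abs_conv ?r ?f")
  unfolding abs_conv_def
proof -
  have inj: "inj (unit_expo i)" by (rule injI) (metis unit_expo_def)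
  have "(\<lambda>k::nat. inverse (norm c) * (1 / 2) ^ k) summable_on UNIV"
    by (intro summable_nonneg_imp_summable_on summable_mult summable_geometric) auto
  also have "(\<lambda>k::nat. inverse (norm c) * (1 / 2) ^ k) = (\<lambda>m. norm (?f m) * ?r ^ fdeg m) \<circ> unit_expo i"
  proof
    fix k
    have u: "unit_expo i k i = k" "fdeg (unit_expo i k) = k" by (simp_all add: unit_expo_def)
    have n: "norm ((1 / c) ^ Suc k) = inverse (norm c) * inverse (norm c) ^ k"
      by (simp add: norm_mult norm_power norm_divide inverse_eq_divide)
    have "inverse (norm c) ^ k * ?r ^ k = (1 / 2) ^ k"
      using assms unfolding power_mult_distrib[symmetric] by simp
    then show "inverse (norm c) * (1 / 2) ^ k = ((\<lambda>m. norm (?f m) * ?r ^ fdeg m) \<circ> unit_expo i) k"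
      by (simp only: o_apply u n simp_thms if_True mult.assoc)
  qed
  finally have "(\<lambda>m. norm (?f m) * ?r ^ fdeg m) summable_on range (unit_expo i)"
    by (subst summable_on_reindex[OF inj])
  then show "(\<lambda>m. norm (?f m) * ?r ^ fdeg m) summable_on UNIV"
    by (rule summable_on_cong_neutral[THEN iffD1, rotated -1]) (auto split: if_splits)
qed

lemma abs_conv_common:
  assumes "f \<in> carrier conv_fps_alg" "g \<in> carrier conv_fps_alg"
  obtains r where "r > 0" "abs_conv r f" "abs_conv r g"
proof -
  obtain r s where "r > 0" "abs_conv r f" "s > 0" "abs_conv s g" using assms by (auto simp: conv_iff)
  then show ?thesis using abs_conv_mono[of r f "min r s"] abs_conv_mono[of s g "min r s"] by (intro that[of "min r s"]) auto
qed

abbreviation Cv :: "('n::finite, complex) mfps set" where "Cv \<equiv> carrier conv_fps_alg"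

lemma conv_fps_alg_sub: "conv_fps_alg = sub_fps Cv"
  by (simp add: conv_fps_alg_def)

interpretation cv: fps_subalgebra "Cv :: ('n::finite, complex) mfps set"
proof
  fix f g :: "('n, complex) mfps" and c :: complex and k :: "'n \<Rightarrow> nat" and S and i :: 'n
  show "(\<lambda>m. f m + g m) \<in> Cv" "mfps_mult f g \<in> Cv" if fg: "f \<in> Cv" "g \<in> Cv"
  proof -
    obtain r where r: "r > 0" "abs_conv r f" "abs_conv r g" by (rule abs_conv_common[OF fg])
    then show "(\<lambda>m. f m + g m) \<in> Cv" "mfps_mult f g \<in> Cv"
      using abs_conv_add[of r f g] abs_conv_mult[of r f g] unfolding conv_iff by auto
  qed
  show "(\<lambda>m. c * f m) \<in> Cv" if "f \<in> Cv" using that abs_conv_scale unfolding conv_iff by blast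
  show "mfps_monom k \<in> Cv" using abs_conv_monom[of 1 k] unfolding conv_iff by (intro exI[of _ 1]) simp
  show "(\<lambda>m. if S m then f (\<lambda>v. m v + k v) else 0) \<in> Cv" if "f \<in> Cv"
    using that abs_conv_shift unfolding conv_iff by blast
  show "(\<lambda>m. if m = unit_expo i (m i) then (1 / c) ^ Suc (m i) else 0) \<in> Cv" if "c \<noteq> 0"
    using abs_conv_geometric[OF that, of i] that unfolding conv_iff by (intro exI[of _ "norm c / 2"]) simp
qed

interpretation formal: fps_subalgebra "UNIV :: ('n::finite, complex) mfps set"
  by unfold_locales auto

text \<open>The identity theorem in one variable, taken from formal power series with positive
  radius of convergence.\<close>

lemma powser_unique_zero:
  fixes a :: "nat \<Rightarrow> complex"
  assumes r: "r > 0" and a: "\<And>z. norm z \<le> r \<Longrightarrow> ((\<lambda>n. a n * z ^ n) has_sum 0) UNIV"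
  shows "a n = 0"
proof -
  have sums: "(\<lambda>n. a n * z ^ n) sums 0" if "norm z \<le> r" for z using has_sum_imp_sums[OF a[OF that]] .
  have "conv_radius a \<ge> norm (of_real r :: complex)"
    using sums[of "of_real r"] r by (intro conv_radius_geI) (auto simp: sums_iff)
  then have rad: "fps_conv_radius (Abs_fps a) > 0"
    using r by (simp add: fps_conv_radius_def) (metis abs_of_pos ereal_less(2) less_le_trans)
  have "eventually (\<lambda>z. eval_fps (Abs_fps a) z = eval_fps 0 z) (nhds 0)"
    unfolding eventually_nhds_metric
    using sums r by (intro exI[of _ r]) (auto simp: eval_fps_def sums_iff)
  then have "Abs_fps a = 0" using rad by (intro eval_fps_eqD) auto
  then show ?thesis by (metis fps_nth_Abs_fps fps_zero_nth)
qed

text \<open>Induction on the set of variables whose exponents are fixed. To fix the exponent of one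
  more variable, the series is read as a power series in that variable alone; it vanishes on a disc,
  so each coefficient, itself a series in the remaining variables, vanishes.\<close>

lemma has_sum_zero_partial:
  fixes c :: "('n::finite, complex) mfps"
  assumes r: "r > 0" and c: "abs_conv r c" and z: "\<And>z. pdisc r z \<Longrightarrow> ((\<lambda>m. c m * zpow z m) has_sum 0) UNIV"
    and S: "finite S" and pz: "pdisc r z"
  shows "((\<lambda>m'. c m' * (\<Prod>i\<in>- S. (z $ i) ^ m' i)) has_sum 0) {m'. \<forall>i\<in>S. m' i = m i}"
  using S pz
proof (induction S arbitrary: m z rule: finite_induct)
  case empty
  then show ?case using z by (simp add: zpow_def)
next
  case (insert j S)
  define E where "E k = {m'. (\<forall>i\<in>S. m' i = m i) \<and> m' j = k}" for k :: nat
  let ?p = "\<lambda>m'. \<Prod>i\<in>- insert j S. (z $ i) ^ m' i"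
  have sumE: "(\<lambda>m'. c m' * ?p m') summable_on E k" for k
  proof (rule abs_summable_summable, rule summable_on_comparison_test)
    \<comment> \<open>The degree contributed by the fixed exponents. Dividing by r^?e compares the
      partial monomials with the full ones.\<close>
    let ?e = "k + (\<Sum>i\<in>S. m i)"
    show "(\<lambda>m'. (norm (c m') * r ^ fdeg m') * inverse (r ^ ?e)) summable_on E k"
      by (intro summable_on_cmult_left) (rule summable_on_subset[OF c[unfolded abs_conv_def]], simp)
    fix m' assume m': "m' \<in> E k"
    have "norm (?p m') \<le> (\<Prod>i\<in>- insert j S. r ^ m' i)"
      unfolding prod_norm[symmetric] norm_power using insert.prems by (intro prod_mono) (auto simp: pdisc_def intro: power_mono)
    also have "\<dots> = r ^ (\<Sum>i\<in>- insert j S. m' i)" by (simp add: power_sum)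
    also have "\<dots> = r ^ fdeg m' * inverse (r ^ ?e)"
    proof -
      have "fdeg m' = (\<Sum>i\<in>- insert j S. m' i) + (\<Sum>i\<in>insert j S. m' i)"
        using sum.union_disjoint[of "- insert j S" "insert j S" m'] by (simp add: Compl_partition2 Un_commute del: Compl_insert)
      moreover have "(\<Sum>i\<in>insert j S. m' i) = ?e" using m' insert.hyps by (simp add: E_def)
      ultimately show ?thesis using r by (simp add: power_add field_simps)
    qed
    finally show "norm (c m' * ?p m') \<le> (norm (c m') * r ^ fdeg m') * inverse (r ^ ?e)"
      by (simp add: norm_mult mult_left_mono mult.assoc)
  qed auto
  define b where "b k = infsum (\<lambda>m'. c m' * ?p m') (E k)" for k
  have hb: "((\<lambda>m'. c m' * ?p m') has_sum b k) (E k)" for k unfolding b_def by (rule has_sum_infsum[OF sumE])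
  have "((\<lambda>k. b k * t ^ k) has_sum 0) UNIV" if t: "norm t \<le> r" for t
  proof (rule has_sum_SigmaD)
    \<comment> \<open>The j-th coordinate becomes the free variable t; the polydisc condition
      survives because |t| \<le> r.\<close>
    define w where "w = (\<chi> i. if i = j then t else z $ i)"
    have w: "pdisc r w" using insert.prems t by (simp add: pdisc_def w_def)
    have "(\<Prod>i\<in>- S. (w $ i) ^ m' i) = ?p m' * t ^ m' j" for m'
    proof -
      have "- S = insert j (- insert j S)" using insert.hyps by auto
      then have "(\<Prod>i\<in>- S. (w $ i) ^ m' i) = (w $ j) ^ m' j * (\<Prod>i\<in>- insert j S. (w $ i) ^ m' i)"
        by (metis (no_types, lifting) ComplD finite insertI1 prod.insert)
      also have "(\<Prod>i\<in>- insert j S. (w $ i) ^ m' i) = ?p m'" by (rule prod.cong) (auto simp: w_def)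
      finally show ?thesis by (simp add: w_def)
    qed
    then have "((\<lambda>m'. c m' * (?p m' * t ^ m' j)) has_sum 0) {m'. \<forall>i\<in>S. m' i = m i}"
      using insert.IH[OF w, of m] by simp
    moreover have "bij_betw snd (Sigma UNIV E) {m'. \<forall>i\<in>S. m' i = m i}"
      by (rule bij_betw_byWitness[where f' = "\<lambda>m'. (m' j, m')"]) (auto simp: E_def)
    ultimately show "((\<lambda>x. c (snd x) * (?p (snd x) * t ^ (snd x) j)) has_sum 0) (Sigma UNIV E)"
      by (subst has_sum_reindex_bij_betw[where g = snd])
    fix k
    have "((\<lambda>m'. c m' * ?p m' * t ^ k) has_sum b k * t ^ k) (E k)" by (rule has_sum_cmult_left[OF hb])
    then show "((\<lambda>y. c (snd (k, y)) * (?p (snd (k, y)) * t ^ snd (k, y) j)) has_sum b k * t ^ k) (E k)"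
      by (rule has_sum_cong[THEN iffD1, rotated]) (simp add: E_def)
  qed
  then have "b (m j) = 0" by (rule powser_unique_zero[OF r])
  moreover have "E (m j) = {m'. \<forall>i\<in>insert j S. m' i = m i}" by (auto simp: E_def)
  ultimately show ?case using hb[of "m j"] by simp
qed

lemma abs_conv_zero_unique:
  fixes c :: "('n::finite, complex) mfps"
  assumes "r > 0" "abs_conv r c" and "\<And>z. pdisc r z \<Longrightarrow> ev c z = 0"
  shows "c = (\<lambda>m. 0)"
proof
  fix m
  have z0: "pdisc r (0 :: complex ^ 'n)" using assms(1) by (simp add: pdisc_def)
  have "((\<lambda>m'. c m' * (\<Prod>i\<in>- UNIV. ((0 :: complex ^ 'n) $ i) ^ m' i)) has_sum 0) {m'. \<forall>i\<in>UNIV. m' i = m i}"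
    by (rule has_sum_zero_partial[OF assms(1,2) _ _ z0]) (use abs_conv_has_sum[OF assms(2)] assms(3) in auto)
  moreover have "{m'. \<forall>i\<in>UNIV. m' i = m i} = {m}" by auto
  ultimately have "(c has_sum 0) {m}" by simp
  moreover have "(c has_sum c m) {m}" by (rule has_sum_finiteI) auto
  ultimately show "c m = 0" using has_sum_unique by blast
qed

section \<open>Expansions of holomorphic functions\<close>

lemma has_expansion_iff:
  "has_expansion g p c \<longleftrightarrow> (\<exists>r>0. abs_conv r c \<and> (\<forall>z. pdisc r z \<longrightarrow> g (p + z) = ev c z))"
proof
  assume "has_expansion g p c"
  then obtain r s where r: "r > 0" "abs_conv r c" and s: "s > 0"
    "\<And>z. pdisc s z \<Longrightarrow> ((\<lambda>m. c m * zpow z m) has_sum g (p + z)) UNIV"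
    unfolding has_expansion_def eventually_nhds_zero_iff_pdisc conv_iff zpow_def by blast
  have "g (p + z) = ev c z" if "pdisc (min r s) z" for z
  proof -
    have "pdisc r z" "pdisc s z" using that by (auto simp: pdisc_def)
    then show ?thesis using has_sum_unique[OF s(2) abs_conv_has_sum[OF r(2)]] by blast
  qed
  then show "\<exists>r>0. abs_conv r c \<and> (\<forall>z. pdisc r z \<longrightarrow> g (p + z) = ev c z)"
    using r s abs_conv_mono[OF r(2), of "min r s"] by (intro exI[of _ "min r s"]) auto
next
  assume "\<exists>r>0. abs_conv r c \<and> (\<forall>z. pdisc r z \<longrightarrow> g (p + z) = ev c z)"
  then obtain r where r: "r > 0" "abs_conv r c" "\<And>z. pdisc r z \<Longrightarrow> g (p + z) = ev c z" by blast
  then have "((\<lambda>m. c m * zpow z m) has_sum g (p + z)) UNIV" if "pdisc r z" for z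
    using abs_conv_has_sum[OF r(2) that] that by simp
  then show "has_expansion g p c"
    unfolding has_expansion_def eventually_nhds_zero_iff_pdisc conv_iff using r by (auto simp: zpow_def)
qed

lemma pdisc_mono: "pdisc r z \<Longrightarrow> r \<le> s \<Longrightarrow> pdisc s z"
  by (auto simp: pdisc_def intro: order_trans)

lemma has_expansion_conv: "has_expansion g p c \<Longrightarrow> c \<in> Cv"
  by (simp add: has_expansion_def)

lemma ev_add: "abs_conv r c \<Longrightarrow> abs_conv r d \<Longrightarrow> pdisc r z \<Longrightarrow> ev (\<lambda>m. c m + d m) z = ev c z + ev d z"
  using has_sum_add[OF abs_conv_has_sum abs_conv_has_sum, of r c z r d z]
  unfolding ev_def[of "\<lambda>m. c m + d m"] by (intro infsumI) (simp add: distrib_right)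

lemma ev_scale: "abs_conv r c \<Longrightarrow> pdisc r z \<Longrightarrow> ev (\<lambda>m. k * c m) z = k * ev c z"
  using has_sum_cmult_right[OF abs_conv_has_sum, of r c z k]
  unfolding ev_def[of "\<lambda>m. k * c m"] by (intro infsumI) (simp add: mult.assoc)

lemma ev_monom: "ev (mfps_monom k) z = zpow z k"
  unfolding ev_def
proof (rule infsumI)
  have "((\<lambda>m. mfps_monom k m * zpow z m) has_sum zpow z k) {k}"
    by (rule has_sum_finiteI) (auto simp: mfps_monom_def)
  then show "((\<lambda>m. mfps_monom k m * zpow z m) has_sum zpow z k) UNIV"
    by (rule has_sum_cong_neutral[THEN iffD1, rotated -1]) (auto simp: mfps_monom_def)
qed

lemma has_expansion_common:
  assumes "has_expansion g p c" "has_expansion h p d"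
  shows "\<exists>r>0. abs_conv r c \<and> abs_conv r d \<and> (\<forall>z. pdisc r z \<longrightarrow> g (p + z) = ev c z \<and> h (p + z) = ev d z)"
proof -
  obtain r s where r: "r > 0" "abs_conv r c" "\<And>z. pdisc r z \<Longrightarrow> g (p + z) = ev c z"
    and s: "s > 0" "abs_conv s d" "\<And>z. pdisc s z \<Longrightarrow> h (p + z) = ev d z"
    using assms unfolding has_expansion_iff by blast
  have "g (p + z) = ev c z \<and> h (p + z) = ev d z" if z: "pdisc (min r s) z" for z
    using r(3)[OF pdisc_mono[OF z]] s(3)[OF pdisc_mono[OF z]] by simp
  then show ?thesis
    using r s abs_conv_mono[OF r(2), of "min r s"] abs_conv_mono[OF s(2), of "min r s"]
    by (intro exI[of _ "min r s"]) auto
qed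

lemma eventually_nhds_translate:
  "(\<forall>\<^sub>F z in nhds p. P z) \<longleftrightarrow> (\<forall>\<^sub>F z in nhds 0. P (p + z))" for p :: "'a::real_normed_vector"
proof
  assume "\<forall>\<^sub>F z in nhds p. P z"
  then show "\<forall>\<^sub>F z in nhds 0. P (p + z)" by (auto simp: eventually_nhds_metric dist_norm)
next
  assume "\<forall>\<^sub>F z in nhds 0. P (p + z)"
  then obtain e where e: "e > 0" "\<And>z. dist z 0 < e \<Longrightarrow> P (p + z)" by (auto simp: eventually_nhds_metric)
  have "P y" if "dist y p < e" for y using e(2)[of "y - p"] that by (simp add: dist_norm)
  then show "\<forall>\<^sub>F z in nhds p. P z" using e(1) by (auto simp: eventually_nhds_metric)
qed

lemma has_expansion_add:
  assumes "has_expansion g p c" "has_expansion h p d"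
  shows "has_expansion (\<lambda>z. g z + h z) p (\<lambda>m. c m + d m)"
proof -
  obtain r where r: "r > 0" "abs_conv r c" "abs_conv r d"
    "\<And>z. pdisc r z \<Longrightarrow> g (p + z) = ev c z" "\<And>z. pdisc r z \<Longrightarrow> h (p + z) = ev d z"
    using has_expansion_common[OF assms] by blast
  then show ?thesis unfolding has_expansion_iff using abs_conv_add[OF r(2,3)] ev_add[OF r(2,3)]
    by (intro exI[of _ r]) auto
qed

lemma has_expansion_mult:
  assumes "has_expansion g p c" "has_expansion h p d"
  shows "has_expansion (\<lambda>z. g z * h z) p (mfps_mult c d)"
proof -
  obtain r where r: "r > 0" "abs_conv r c" "abs_conv r d"
    "\<And>z. pdisc r z \<Longrightarrow> g (p + z) = ev c z" "\<And>z. pdisc r z \<Longrightarrow> h (p + z) = ev d z"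
    using has_expansion_common[OF assms] by blast
  then show ?thesis unfolding has_expansion_iff using abs_conv_mult[OF r(2,3)] ev_mult[OF r(2,3)]
    by (intro exI[of _ r]) auto
qed

lemma has_expansion_scale:
  assumes "has_expansion g p c"
  shows "has_expansion (\<lambda>z. k * g z) p (\<lambda>m. k * c m)"
proof -
  obtain r where r: "r > 0" "abs_conv r c" "\<And>z. pdisc r z \<Longrightarrow> g (p + z) = ev c z"
    using assms unfolding has_expansion_iff by blast
  then show ?thesis unfolding has_expansion_iff using abs_conv_scale[OF r(2)] ev_scale[OF r(2)]
    by (intro exI[of _ r]) auto
qed

lemma has_expansion_one: "has_expansion (\<lambda>z. 1) p (mfps_monom (\<lambda>v. 0))"
  unfolding has_expansion_iff ev_monom by (intro exI[of _ 1]) (simp add: abs_conv_monom zpow_def)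

lemma has_expansion_zero: "has_expansion (\<lambda>z. 0) p (\<lambda>m. 0)"
  using has_expansion_scale[OF has_expansion_one, of 0] by simp

lemma zpow_unit_expo: "zpow z (unit_expo i k) = (z $ i) ^ k"
proof -
  have "zpow z (unit_expo i k) = (\<Prod>j\<in>UNIV. if j = i then (z $ i) ^ k else 1)"
    unfolding zpow_def by (intro prod.cong) (auto simp: unit_expo_def)
  then show ?thesis by simp
qed

lemma has_expansion_coord:
  "has_expansion (\<lambda>z. z $ i) p (\<lambda>m. p $ i * mfps_monom (\<lambda>v. 0) m + mfps_monom (unit_expo i 1) m)"
proof -
  have "has_expansion (\<lambda>z. z $ i - p $ i) p (mfps_monom (unit_expo i 1))"
    unfolding has_expansion_iff ev_monom zpow_unit_expo by (intro exI[of _ 1]) (simp add: abs_conv_monom)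
  from has_expansion_add[OF has_expansion_scale[OF has_expansion_one, of "p $ i"] this] show ?thesis by simp
qed

lemma has_expansion_coord_power_zero: "has_expansion (\<lambda>z. (z $ i) ^ k) 0 (mfps_monom (unit_expo i k))"
  unfolding has_expansion_iff ev_monom zpow_unit_expo by (intro exI[of _ 1]) (simp add: abs_conv_monom)

lemma has_expansion_sum:
  "finite S \<Longrightarrow> (\<And>i. i \<in> S \<Longrightarrow> has_expansion (g i) p (c i)) \<Longrightarrow>
    has_expansion (\<lambda>z. \<Sum>i\<in>S. g i z) p (\<lambda>m. \<Sum>i\<in>S. c i m)"
  by (induction S rule: finite_induct) (auto intro: has_expansion_zero has_expansion_add)

lemma has_expansion_cong:
  assumes "has_expansion g p c" "\<forall>\<^sub>F z in nhds p. g z = h z"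
  shows "has_expansion h p c"
proof -
  have "\<forall>\<^sub>F z in nhds 0. g (p + z) = h (p + z)"
    using assms(2) by (simp add: eventually_nhds_translate[of _ p])
  then obtain s where s: "s > 0" "\<And>z. pdisc s z \<Longrightarrow> g (p + z) = h (p + z)"
    unfolding eventually_nhds_zero_iff_pdisc by blast
  obtain r where r: "r > 0" "abs_conv r c" "\<And>z. pdisc r z \<Longrightarrow> g (p + z) = ev c z"
    using assms(1) unfolding has_expansion_iff by blast
  have "h (p + z) = ev c z" if z: "pdisc (min r s) z" for z
    using r(3)[OF pdisc_mono[OF z]] s(2)[OF pdisc_mono[OF z]] by simp
  then show ?thesis
    unfolding has_expansion_iff using r s abs_conv_mono[OF r(2), of "min r s"]
    by (intro exI[of _ "min r s"]) auto
qed

lemma has_expansion_unique: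
  assumes "has_expansion g p c" "has_expansion g p d"
  shows "c = d"
proof -
  have "has_expansion (\<lambda>z. g z + -1 * g z) p (\<lambda>m. c m + -1 * d m)"
    by (intro has_expansion_add has_expansion_scale assms)
  then obtain r where "r > 0" "abs_conv r (\<lambda>m. c m + -1 * d m)" "\<And>z. pdisc r z \<Longrightarrow> ev (\<lambda>m. c m + -1 * d m) z = 0"
    unfolding has_expansion_iff by auto
  from fun_cong[OF abs_conv_zero_unique[OF this]] show ?thesis by (auto simp: fun_eq_iff)
qed

lemma taylor_eq: "has_expansion g p c \<Longrightarrow> taylor g p = c"
  unfolding taylor_def using has_expansion_unique by (intro the_equality) blast+

lemma holomorphic_at_taylor: "holomorphic_at g p \<Longrightarrow> has_expansion g p (taylor g p)"
  unfolding holomorphic_at_def using taylor_eq by blast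

lemma has_expansion_ev:
  assumes "c \<in> Cv"
  shows "has_expansion (\<lambda>z. ev c (z - p)) p c"
  using assms unfolding has_expansion_iff conv_iff by auto

lemma has_expansion_locally_eq:
  assumes "has_expansion g p c" "has_expansion h p c"
  shows "\<forall>\<^sub>F z in nhds p. g z = h z"
proof -
  obtain r where r: "r > 0" "abs_conv r c" "abs_conv r c"
    "\<And>z. pdisc r z \<Longrightarrow> g (p + z) = ev c z" "\<And>z. pdisc r z \<Longrightarrow> h (p + z) = ev c z"
    using has_expansion_common[OF assms] by blast
  then have "\<forall>\<^sub>F z in nhds 0. g (p + z) = h (p + z)" unfolding eventually_nhds_zero_iff_pdisc by auto
  then show ?thesis by (simp add: eventually_nhds_translate[of _ p])
qed

lemma holomorphic_at_mult: "holomorphic_at g p \<Longrightarrow> holomorphic_at h p \<Longrightarrow> holomorphic_at (\<lambda>z. g z * h z) p"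
  unfolding holomorphic_at_def using has_expansion_mult by blast

lemma holomorphic_at_add: "holomorphic_at g p \<Longrightarrow> holomorphic_at h p \<Longrightarrow> holomorphic_at (\<lambda>z. g z + h z) p"
  unfolding holomorphic_at_def using has_expansion_add by blast

lemma holomorphic_at_scale: "holomorphic_at g p \<Longrightarrow> holomorphic_at (\<lambda>z. k * g z) p"
  unfolding holomorphic_at_def using has_expansion_scale by blast

lemma holomorphic_at_BP: "holomorphic_at (\<lambda>z :: complex ^ 'n::finite. \<Sum>i\<in>UNIV. (z $ i) ^ a i) p"
proof -
  have pow: "\<exists>c. has_expansion (\<lambda>z :: complex ^ 'n. (z $ i) ^ k) p c" for i k
  proof (induction k)
    case 0
    show ?case using has_expansion_one by auto
  next
    case (Suc k)
    then obtain c where "has_expansion (\<lambda>z :: complex ^ 'n. (z $ i) ^ k) p c" by blast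
    from has_expansion_mult[OF has_expansion_coord[of i] this] show ?case unfolding power_Suc by blast
  qed
  then have "\<forall>i. \<exists>c. has_expansion (\<lambda>z :: complex ^ 'n. (z $ i) ^ a i) p c" by blast
  from choice[OF this] obtain c where "\<forall>i. has_expansion (\<lambda>z :: complex ^ 'n. (z $ i) ^ a i) p (c i)" ..
  then have "has_expansion (\<lambda>z :: complex ^ 'n. \<Sum>i\<in>UNIV. (z $ i) ^ a i) p (\<lambda>m. \<Sum>i\<in>UNIV. c i m)"
    by (intro has_expansion_sum) auto
  then show ?thesis unfolding holomorphic_at_def by blast
qed

lemma taylor_BP_zero: "taylor (\<lambda>z :: complex ^ 'n::finite. \<Sum>i\<in>UNIV. (z $ i) ^ a i) 0 = mfps_of_poly (BP_poly a)"
  unfolding mfps_of_BP_poly_sum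
  by (intro taylor_eq has_expansion_sum has_expansion_coord_power_zero) auto

subsection \<open>Re-expansion at nearby points\<close>

text \<open>The binomial coefficients of m + k over k, indexed by the two parts so that they fit
  sums over \<open>splits\<close>.\<close>

definition multi_choose :: "('n::finite \<Rightarrow> nat) \<Rightarrow> ('n \<Rightarrow> nat) \<Rightarrow> 'a::comm_semiring_1" where
  "multi_choose m k = (\<Prod>i\<in>UNIV. of_nat ((m i + k i) choose k i))"

text \<open>The one-variable binomial theorem in each coordinate, with the product of the sums
  multiplied out.\<close>

lemma zpow_add_expand:
  fixes x y :: "'a::comm_ring_1 ^ 'n::finite"
  shows "zpow (x + y) n = (\<Sum>(m, k)\<in>splits n. multi_choose m k * zpow x m * zpow y k)"
proof -
  have "zpow (x + y) n = (\<Prod>i\<in>UNIV. \<Sum>l\<in>{..n i}. of_nat (n i choose l) * (x $ i) ^ l * (y $ i) ^ (n i - l))"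
    by (simp add: zpow_def binomial_ring)
  also have "\<dots> = (\<Sum>m\<in>(\<Pi>\<^sub>E i\<in>UNIV. {..n i}). \<Prod>i\<in>UNIV. of_nat (n i choose m i) * (x $ i) ^ m i * (y $ i) ^ (n i - m i))"
    by (rule prod_sum_PiE) auto
  also have "(\<Pi>\<^sub>E i\<in>UNIV. {..n i}) = {m. \<forall>i. m i \<le> n i}" by (auto simp: PiE_UNIV_domain)
  also have "(\<Sum>m\<in>{m. \<forall>i. m i \<le> n i}. \<Prod>i\<in>UNIV. of_nat (n i choose m i) * (x $ i) ^ m i * (y $ i) ^ (n i - m i)) =
      (\<Sum>m\<in>{m. \<forall>i. m i \<le> n i}. multi_choose m (\<lambda>i. n i - m i) * zpow x m * zpow y (\<lambda>i. n i - m i))"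
  proof (rule sum.cong[OF refl])
    fix m assume "m \<in> {m. \<forall>i. m i \<le> n i}"
    then have "n i choose m i = (m i + (n i - m i)) choose (n i - m i)" for i
      using binomial_symmetric[of "m i" "n i"] by simp
    then show "(\<Prod>i\<in>UNIV. of_nat (n i choose m i) * (x $ i) ^ m i * (y $ i) ^ (n i - m i)) =
        multi_choose m (\<lambda>i. n i - m i) * zpow x m * zpow y (\<lambda>i. n i - m i)"
      by (simp add: multi_choose_def zpow_def prod.distrib)
  qed
  also have "\<dots> = (\<Sum>(m, k)\<in>splits n. multi_choose m k * zpow x m * zpow y k)"
    unfolding splits_conv_image by (subst sum.reindex) (auto simp: inj_on_def)
  finally show ?thesis .
qed

lemma norm_multi_choose: "norm (multi_choose m k :: complex) = multi_choose m k"
  by (simp add: multi_choose_def prod_norm[symmetric])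

lemma multi_choose_nonneg: "0 \<le> (multi_choose m k :: real)"
  by (simp add: multi_choose_def prod_nonneg)

lemma bij_betw_splits_pairs: "bij_betw snd (Sigma UNIV splits) (UNIV \<times> (UNIV :: ('n \<Rightarrow> nat) set))"
  by (rule bij_betw_byWitness[where f' = "\<lambda>(i, j). (\<lambda>v. i v + j v, (i, j))"]) (auto simp: splits_def)

text \<open>For fixed n = m + k the terms add up to |c_n| (2s)^|n|, by the binomial theorem at
  (s,...,s) + (s,...,s). This is the origin of the radius 2s.\<close>

lemma double_series_summable:
  fixes c :: "('n::finite, complex) mfps"
  assumes c: "abs_conv (2 * s) c" and s: "s > 0"
  shows "(\<lambda>(m, k). norm (c (\<lambda>v. m v + k v)) * multi_choose m k * s ^ fdeg m * s ^ fdeg k) summable_on (UNIV \<times> UNIV)"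
proof -
  let ?T = "\<lambda>(m, k). norm (c (\<lambda>v. m v + k v)) * multi_choose m k * s ^ fdeg m * s ^ fdeg k"
  have "(\<lambda>x. norm (c (fst x)) * (case snd x of (m, k) \<Rightarrow> multi_choose m k * s ^ fdeg m * s ^ fdeg k)) summable_on (Sigma UNIV splits)"
  proof (rule summable_on_SigmaI)
    fix n :: "'n \<Rightarrow> nat"
    let ?u = "(\<chi> i. s) :: real ^ 'n"
    have z: "zpow ?u m = s ^ fdeg m" for m :: "'n \<Rightarrow> nat" by (simp add: zpow_def power_sum)
    have "zpow (?u + ?u) n = (2 * s) ^ fdeg n" by (simp add: zpow_def power_sum)
    then have "(2 * s) ^ fdeg n = (\<Sum>(m, k)\<in>splits n. multi_choose m k * s ^ fdeg m * s ^ fdeg k)"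
      using zpow_add_expand[of ?u ?u n] by (simp add: z)
    then show "((\<lambda>y. norm (c (fst (n, y))) * (case snd (n, y) of (m, k) \<Rightarrow> multi_choose m k * s ^ fdeg m * s ^ fdeg k))
        has_sum (norm (c n) * (2 * s) ^ fdeg n)) (splits n)"
      by (intro has_sum_finiteI finite_splits) (simp add: sum_distrib_left)
  next
    show "(\<lambda>n. norm (c n) * (2 * s) ^ fdeg n) summable_on UNIV" using c by (simp add: abs_conv_def)
    show "0 \<le> norm (c (fst (n, y))) * (case snd (n, y) of (m, k) \<Rightarrow> multi_choose m k * s ^ fdeg m * s ^ fdeg k)" for n y
      using s by (auto simp: case_prod_beta multi_choose_nonneg)
  qed
  also have "?this \<longleftrightarrow> (\<lambda>x. ?T (snd x)) summable_on (Sigma UNIV splits)"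
    by (rule summable_on_cong) (auto simp: splits_def mult.assoc simp flip: fun_eq_iff)
  also have "\<dots> \<longleftrightarrow> ?T summable_on (UNIV \<times> UNIV)"
    by (rule summable_on_reindex_bij_betw[OF bij_betw_splits_pairs])
  finally show ?thesis .
qed

text \<open>The coefficient at k of the new series is the sum over m of binom(m + k, k) c_(m+k) q^m.
  It comes from expanding (q + z)^n and exchanging the order of an absolutely convergent double
  sum.\<close>

lemma re_expansion:
  fixes c :: "('n::finite, complex) mfps"
  assumes c: "abs_conv (2 * s) c" and s: "s > 0" and q: "pdisc s q"
  shows "\<exists>d. has_expansion (ev c) q d"
proof -
  let ?N = "\<lambda>(k, m). norm (c (\<lambda>v. m v + k v)) * multi_choose m k * s ^ fdeg m * s ^ fdeg k"
  have N: "?N summable_on (UNIV \<times> UNIV)"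
    using double_series_summable[OF c s] by (subst (asm) summable_on_swap) (simp add: case_prod_unfold)
  let ?t = "\<lambda>k m. c (\<lambda>v. m v + k v) * multi_choose m k * zpow q m"
  have t_bound: "norm (?t k m) * s ^ fdeg k \<le> ?N (k, m)" for k m
  proof -
    have "norm (?t k m) \<le> norm (c (\<lambda>v. m v + k v)) * multi_choose m k * s ^ fdeg m"
      unfolding norm_mult norm_multi_choose
      by (intro mult_left_mono norm_zpow_le q mult_nonneg_nonneg multi_choose_nonneg) auto
    then have "norm (?t k m) * s ^ fdeg k \<le> norm (c (\<lambda>v. m v + k v)) * multi_choose m k * s ^ fdeg m * s ^ fdeg k"
      using s by (intro mult_right_mono) auto
    then show ?thesis unfolding prod.case .
  qed
  have inner: "(\<lambda>m. norm (?t k m)) summable_on UNIV" for k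
  proof (rule summable_on_comparison_test)
    have "(\<lambda>m. ?N (k, m)) summable_on UNIV"
      using summable_on_SigmaD1[of "\<lambda>k m. ?N (k, m)" UNIV "\<lambda>_. UNIV" k] N by (simp add: case_prod_unfold)
    then show "(\<lambda>m. ?N (k, m) * inverse (s ^ fdeg k)) summable_on UNIV" by (rule summable_on_cmult_left)
    show "norm (?t k m) \<le> ?N (k, m) * inverse (s ^ fdeg k)" for m
      using t_bound[where k = k and m = m] s by (simp add: field_simps)
  qed auto
  define d where "d k = infsum (?t k) UNIV" for k
  have hd: "(?t k has_sum d k) UNIV" for k
    unfolding d_def by (rule has_sum_infsum[OF abs_summable_summable[OF inner]])
  have "abs_conv s d"
    unfolding abs_conv_def
  proof (rule summable_on_comparison_test)
    show "(\<lambda>k. infsum (\<lambda>m. ?N (k, m)) UNIV) summable_on UNIV"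
      by (rule summable_on_SigmaD[OF N])
        (use summable_on_SigmaD1[of "\<lambda>k m. ?N (k, m)" UNIV "\<lambda>_. UNIV"] N in \<open>simp add: case_prod_unfold\<close>)
    fix k
    have sN: "(\<lambda>m. ?N (k, m)) summable_on UNIV"
      using summable_on_SigmaD1[of "\<lambda>k m. ?N (k, m)" UNIV "\<lambda>_. UNIV" k] N by (simp add: case_prod_unfold)
    have "norm (d k) \<le> infsum (\<lambda>m. norm (?t k m)) UNIV"
      unfolding d_def by (rule norm_infsum_bound[OF inner])
    then have "norm (d k) * s ^ fdeg k \<le> infsum (\<lambda>m. norm (?t k m)) UNIV * s ^ fdeg k"
      using s by (intro mult_right_mono) auto
    also have "\<dots> = infsum (\<lambda>m. norm (?t k m) * s ^ fdeg k) UNIV"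
      by (simp add: infsum_cmult_left')
    also have "\<dots> \<le> infsum (\<lambda>m. ?N (k, m)) UNIV"
      by (rule infsum_mono[OF summable_on_cmult_left[OF inner] sN]) (rule t_bound)
    finally show "norm (d k) * s ^ fdeg k \<le> infsum (\<lambda>m. ?N (k, m)) UNIV" .
  qed (use s in auto)
  moreover have "ev c (q + z) = ev d z" if z: "pdisc s z" for z
  proof -
    let ?f = "\<lambda>(k, m). ?t k m * zpow z k"
    have fs: "?f summable_on (UNIV \<times> UNIV)"
    proof (rule abs_summable_summable, rule summable_on_comparison_test[OF N])
      fix x :: "('n \<Rightarrow> nat) \<times> ('n \<Rightarrow> nat)"
      obtain k m where x: "x = (k, m)" by (cases x)
      have "norm (?f (k, m)) \<le> norm (?t k m) * s ^ fdeg k"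
        by (simp add: norm_mult[of _ "zpow z k"] mult_left_mono norm_zpow_le z)
      then show "norm (?f x) \<le> ?N x" unfolding x using t_bound[where k = k and m = m] by linarith
    qed auto
    then have "(?f has_sum infsum ?f (UNIV \<times> UNIV)) (UNIV \<times> UNIV)" by (rule has_sum_infsum)
    note h = this
    have 1: "((\<lambda>k. d k * zpow z k) has_sum infsum ?f (UNIV \<times> UNIV)) UNIV"
      by (rule has_sum_SigmaD[OF h]) (use has_sum_cmult_left[OF hd] in simp)
    \<comment> \<open>The same double sum, taken along the total exponent n = m + k, gives back the
      original series at q + z.\<close>
    have "((\<lambda>(m, k). ?t k m * zpow z k) has_sum infsum ?f (UNIV \<times> UNIV)) (UNIV \<times> UNIV)"
      using h by (subst (asm) has_sum_swap) (simp add: case_prod_unfold)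
    then have "((\<lambda>x. (\<lambda>(m, k). ?t k m * zpow z k) (snd x)) has_sum infsum ?f (UNIV \<times> UNIV)) (Sigma UNIV splits)"
      by (subst has_sum_reindex_bij_betw[OF bij_betw_splits_pairs])
    then have "((\<lambda>n. c n * zpow (q + z) n) has_sum infsum ?f (UNIV \<times> UNIV)) UNIV"
    proof (rule has_sum_SigmaD)
      fix n :: "'n \<Rightarrow> nat"
      have "c n * zpow (q + z) n = (\<Sum>x\<in>splits n. (\<lambda>(m, k). ?t k m * zpow z k) x)"
        unfolding zpow_add_expand sum_distrib_left
        by (rule sum.cong) (auto simp: splits_def mult.assoc simp flip: fun_eq_iff)
      then show "((\<lambda>y. (\<lambda>(m, k). ?t k m * zpow z k) (snd (n, y))) has_sum c n * zpow (q + z) n) (splits n)"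
        by (intro has_sum_finiteI finite_splits) simp
    qed
    then show ?thesis using 1 unfolding ev_def by (simp add: infsumI)
  qed
  ultimately show ?thesis unfolding has_expansion_iff using s by (intro exI[of _ d] exI[of _ s]) auto
qed

lemma has_expansion_translate: "has_expansion g (q - p) d \<longleftrightarrow> has_expansion (\<lambda>z. g (z - p)) q d"
  unfolding has_expansion_def by (simp add: algebra_simps)

text \<open>Re-expansion works at all points within half the radius of absolute convergence.\<close>

lemma holomorphic_at_ev_near:
  assumes "c \<in> Cv"
  shows "\<exists>D. open D \<and> p \<in> D \<and> (\<forall>q\<in>D. holomorphic_at (\<lambda>z. ev c (z - p)) q)"
proof -
  obtain r where r: "r > 0" "abs_conv r c" using assms by (auto simp: conv_iff)
  then have "\<exists>d. has_expansion (\<lambda>z. ev c (z - p)) q d" if "pdisc (r / 2) (q - p)" for q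
    using re_expansion[of "r / 2" c "q - p"] that by (simp add: has_expansion_translate)
  then have "\<forall>\<^sub>F z in nhds 0. holomorphic_at (\<lambda>z. ev c (z - p)) (p + z)"
    unfolding eventually_nhds_zero_iff_pdisc holomorphic_at_def using r by (intro exI[of _ "r / 2"]) auto
  then have "\<forall>\<^sub>F q in nhds p. holomorphic_at (\<lambda>z. ev c (z - p)) q"
    by (simp add: eventually_nhds_translate[of _ p])
  then show ?thesis unfolding eventually_nhds by blast
qed

section \<open>Germs of analytic hypersurfaces\<close>

lemma conv_fps_alg_simps [simp]:
  "monoid.mult conv_fps_alg = mfps_mult"
  "\<one>\<^bsub>conv_fps_alg\<^esub> = mfps_monom (\<lambda>v. 0)"
  "f \<oplus>\<^bsub>conv_fps_alg\<^esub> g = (\<lambda>m. f m + g m)"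
  "smult conv_fps_alg c f = (\<lambda>m. c * f m)"
  by (simp_all add: conv_fps_alg_def)

lemma kalg_conv: "kalg conv_fps_alg"
  using cv.kalg_A by (simp flip: conv_fps_alg_sub)

lemma minus_conv [simp]: "f \<in> Cv \<Longrightarrow> g \<in> Cv \<Longrightarrow> f \<ominus>\<^bsub>conv_fps_alg\<^esub> g = (\<lambda>m. f m - g m)"
  using cv.A_minus[of f g] by (simp flip: conv_fps_alg_sub)

interpretation R: kalg conv_fps_alg by (rule kalg_conv)

locale hypersurface =
  fixes F :: "complex ^ 'n::finite \<Rightarrow> complex"
  assumes holo: "holomorphic_at F p"
begin

abbreviation "rsp \<equiv> analytic_hypersurface F"
abbreviation "Z \<equiv> {z. F z = 0}"
abbreviation "I \<equiv> hypersurface_ideal F"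
abbreviation "St \<equiv> hypersurface_stalk F"
abbreviation "cls p c \<equiv> hypersurface_ideal F p +>\<^bsub>conv_fps_alg\<^esub> c"
abbreviation "sec \<equiv> rs_sections (analytic_hypersurface F)"

lemma taylor_F_conv: "taylor F p \<in> Cv"
  using holomorphic_at_taylor[OF holo] has_expansion_conv by blast

lemma ideal_I: "ideal (I p) conv_fps_alg"
  unfolding hypersurface_ideal_def by (rule R.cgenideal_ideal[OF taylor_F_conv])

lemma kalg_St: "kalg (St p)"
  unfolding hypersurface_stalk_def by (rule R.kalg_quot[OF ideal_I])

lemma cls_eq_iff: "c \<in> Cv \<Longrightarrow> d \<in> Cv \<Longrightarrow> cls p c = cls p d \<longleftrightarrow> (\<exists>w\<in>Cv. (\<lambda>m. c m - d m) = mfps_mult w (taylor F p))"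
  by (subst R.coset_eq_iff[OF ideal_I]) (auto simp: hypersurface_ideal_def cgenideal_def)

lemma St_carrier: "x \<in> carrier (St p) \<longleftrightarrow> (\<exists>c\<in>Cv. x = cls p c)"
  by (simp add: hypersurface_stalk_def R.quot_carrier_iff)

lemma cls_ops:
  assumes "c \<in> Cv" "d \<in> Cv"
  shows "cls p c \<otimes>\<^bsub>St p\<^esub> cls p d = cls p (mfps_mult c d)" "cls p c \<oplus>\<^bsub>St p\<^esub> cls p d = cls p (\<lambda>m. c m + d m)"
  using R.quot_ops[OF ideal_I assms] by (simp_all add: hypersurface_stalk_def)

lemma cls_smult: "c \<in> Cv \<Longrightarrow> k \<odot>\<^bsub>St p\<^esub> cls p c = cls p (\<lambda>m. k * c m)"
  using R.quot_smult[OF ideal_I] by (simp add: hypersurface_stalk_def)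

lemma St_one: "\<one>\<^bsub>St p\<^esub> = cls p (mfps_monom (\<lambda>v. 0))"
  by (simp add: hypersurface_stalk_def quot_alg_simps)

lemma sec_iff:
  "s \<in> sec U \<longleftrightarrow> s \<in> (\<Pi>\<^sub>E p\<in>U. carrier (St p)) \<and>
     (\<forall>p\<in>U. \<exists>D g. open D \<and> p \<in> D \<and> D \<inter> Z \<subseteq> U \<and> (\<forall>q\<in>D. holomorphic_at g q) \<and>
        (\<forall>q\<in>D \<inter> Z. s q = cls q (taylor g q)))"
  by (simp add: analytic_hypersurface_def)

lemma sec_stalk: "s \<in> sec U \<Longrightarrow> p \<in> U \<Longrightarrow> s p \<in> carrier (St p)"
  by (auto simp: sec_iff)

lemma sec_rep:
  assumes "s \<in> sec U" "p \<in> U"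
  obtains D g where "open D" "p \<in> D" "D \<inter> Z \<subseteq> U" "\<And>q. q \<in> D \<Longrightarrow> holomorphic_at g q"
    "\<And>q. q \<in> D \<Longrightarrow> F q = 0 \<Longrightarrow> s q = cls q (taylor g q)"
  using assms unfolding sec_iff by (metis (mono_tags, lifting) IntI mem_Collect_eq)

lemma taylor_conv: "holomorphic_at g p \<Longrightarrow> taylor g p \<in> Cv"
  using holomorphic_at_taylor has_expansion_conv by blast

text \<open>Sections are locally classes of functions; an operation on stalks that comes from an
  operation \<phi> on functions therefore preserves them. Products, sums and scalar multiples are
  instances.\<close>

lemma sec_binop:
  assumes s: "s \<in> sec U" and t: "t \<in> sec U"
    and \<phi>: "\<And>q g h. holomorphic_at g q \<Longrightarrow> holomorphic_at h q \<Longrightarrow>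
      holomorphic_at (\<phi> g h) q \<and> op q (cls q (taylor g q)) (cls q (taylor h q)) = cls q (taylor (\<phi> g h) q)"
  shows "(\<lambda>q\<in>U. op q (s q) (t q)) \<in> sec U"
proof -
  have loc: "\<exists>D g. open D \<and> p \<in> D \<and> D \<inter> Z \<subseteq> U \<and> (\<forall>q\<in>D. holomorphic_at g q) \<and>
        (\<forall>q\<in>D \<inter> Z. op q (s q) (t q) = cls q (taylor g q))" if p: "p \<in> U" for p
  proof -
    obtain D g where D: "open D" "p \<in> D" "D \<inter> Z \<subseteq> U" "\<And>q. q \<in> D \<Longrightarrow> holomorphic_at g q"
      "\<And>q. q \<in> D \<Longrightarrow> F q = 0 \<Longrightarrow> s q = cls q (taylor g q)" by (rule sec_rep[OF s p]) blast
    obtain E h where E: "open E" "p \<in> E" "E \<inter> Z \<subseteq> U" "\<And>q. q \<in> E \<Longrightarrow> holomorphic_at h q"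
      "\<And>q. q \<in> E \<Longrightarrow> F q = 0 \<Longrightarrow> t q = cls q (taylor h q)" by (rule sec_rep[OF t p]) blast
    show ?thesis
    proof (intro exI conjI ballI)
      show "open (D \<inter> E)" "p \<in> D \<inter> E" "D \<inter> E \<inter> Z \<subseteq> U" using D E by auto
      show "holomorphic_at (\<phi> g h) q" if "q \<in> D \<inter> E" for q using \<phi>[of g q h] D(4) E(4) that by blast
      show "op q (s q) (t q) = cls q (taylor (\<phi> g h) q)" if q: "q \<in> D \<inter> E \<inter> Z" for q
        using \<phi>[of g q h] D(4)[of q] E(4)[of q] D(5)[of q] E(5)[of q] q by simp
    qed
  qed
  show ?thesis
    unfolding sec_iff
  proof (intro conjI ballI)
    show "(\<lambda>q\<in>U. op q (s q) (t q)) \<in> (\<Pi>\<^sub>E p\<in>U. carrier (St p))"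
    proof (rule restrict_PiE_iff[THEN iffD2], intro ballI)
      fix p assume p: "p \<in> U"
      obtain D g where D: "p \<in> D" "\<And>q. q \<in> D \<Longrightarrow> holomorphic_at g q" "D \<inter> Z \<subseteq> U" "open D"
        "\<And>q. q \<in> D \<Longrightarrow> F q = 0 \<Longrightarrow> s q = cls q (taylor g q)" by (rule sec_rep[OF s p]) blast
      obtain c where c: "c \<in> Cv" "s p = cls p c" using sec_stalk[OF s p] St_carrier by blast
      obtain d where d: "d \<in> Cv" "t p = cls p d" using sec_stalk[OF t p] St_carrier by blast
      \<comment> \<open>The stalk value at a single point is represented by the sum of a convergent
        series, so that the hypothesis on \<phi> applies to it.\<close>
      have ec: "holomorphic_at (\<lambda>z. ev c (z - p)) p" "taylor (\<lambda>z. ev c (z - p)) p = c"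
        using has_expansion_ev[OF c(1)] taylor_eq by (auto simp: holomorphic_at_def)
      have ed: "holomorphic_at (\<lambda>z. ev d (z - p)) p" "taylor (\<lambda>z. ev d (z - p)) p = d"
        using has_expansion_ev[OF d(1)] taylor_eq by (auto simp: holomorphic_at_def)
      show "op p (s p) (t p) \<in> carrier (St p)"
        using \<phi>[OF ec(1) ed(1)] taylor_conv unfolding ec(2) ed(2) c(2) d(2) St_carrier by blast
    qed
    fix p assume p: "p \<in> U"
    obtain D g where D: "open D" "p \<in> D" "D \<inter> Z \<subseteq> U" "\<forall>q\<in>D. holomorphic_at g q"
        "\<forall>q\<in>D \<inter> Z. op q (s q) (t q) = cls q (taylor g q)" using loc[OF p] by blast
    then show "\<exists>D g. open D \<and> p \<in> D \<and> D \<inter> Z \<subseteq> U \<and> (\<forall>q\<in>D. holomorphic_at g q) \<and>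
        (\<forall>q\<in>D \<inter> Z. (\<lambda>q\<in>U. op q (s q) (t q)) q = cls q (taylor g q))"
      by (intro exI[of _ D] exI[of _ g]) auto
  qed
qed

lemma sec_mult: "s \<in> sec U \<Longrightarrow> t \<in> sec U \<Longrightarrow> (\<lambda>q\<in>U. s q \<otimes>\<^bsub>St q\<^esub> t q) \<in> sec U"
  by (rule sec_binop[where \<phi> = "\<lambda>g h z. g z * h z"])
    (auto simp: cls_ops taylor_conv holomorphic_at_mult taylor_eq[OF has_expansion_mult[OF holomorphic_at_taylor holomorphic_at_taylor]])

lemma sec_add: "s \<in> sec U \<Longrightarrow> t \<in> sec U \<Longrightarrow> (\<lambda>q\<in>U. s q \<oplus>\<^bsub>St q\<^esub> t q) \<in> sec U"
  by (rule sec_binop[where \<phi> = "\<lambda>g h z. g z + h z"])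
    (auto simp: cls_ops taylor_conv holomorphic_at_add taylor_eq[OF has_expansion_add[OF holomorphic_at_taylor holomorphic_at_taylor]])

text \<open>Treated as a binary operation that ignores its second argument.\<close>

lemma sec_smult: "s \<in> sec U \<Longrightarrow> (\<lambda>q\<in>U. k \<odot>\<^bsub>St q\<^esub> s q) \<in> sec U"
  by (rule sec_binop[where \<phi> = "\<lambda>g h z. k * g z" and op = "\<lambda>q x y. k \<odot>\<^bsub>St q\<^esub> x"])
    (auto simp: cls_smult taylor_conv holomorphic_at_scale taylor_eq[OF has_expansion_scale[OF holomorphic_at_taylor]])

lemma open_Z_iff: "openin (top_of_set Z) W \<longleftrightarrow> (\<exists>D. open D \<and> W = D \<inter> Z)"
  by (auto simp: openin_open)

lemma sec_restrict:
  assumes s: "s \<in> sec U" and D: "open D" "D \<inter> Z \<subseteq> U"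
  shows "restrict s (D \<inter> Z) \<in> sec (D \<inter> Z)"
  unfolding sec_iff
proof (intro conjI ballI)
  show "restrict s (D \<inter> Z) \<in> (\<Pi>\<^sub>E p\<in>D \<inter> Z. carrier (St p))"
    using sec_stalk[OF s] D(2) by auto
  fix p assume p: "p \<in> D \<inter> Z"
  then have "p \<in> U" using D(2) by blast
  obtain E g where E: "open E" "p \<in> E" "E \<inter> Z \<subseteq> U" "\<And>q. q \<in> E \<Longrightarrow> holomorphic_at g q"
    "\<And>q. q \<in> E \<Longrightarrow> F q = 0 \<Longrightarrow> s q = cls q (taylor g q)" by (rule sec_rep[OF s \<open>p \<in> U\<close>]) blast
  show "\<exists>E g. open E \<and> p \<in> E \<and> E \<inter> Z \<subseteq> D \<inter> Z \<and> (\<forall>q\<in>E. holomorphic_at g q) \<and>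
        (\<forall>q\<in>E \<inter> Z. restrict s (D \<inter> Z) q = cls q (taylor g q))"
    using E D(1) p by (intro exI[of _ "D \<inter> E"] exI[of _ g]) auto
qed

text \<open>A convergent series representing x sums to a function holomorphic near p, and its
  classes form the section.\<close>

lemma sec_exists:
  assumes x: "x \<in> carrier (St p)" and p: "p \<in> Z"
  shows "\<exists>D s. open D \<and> p \<in> D \<and> s \<in> sec (D \<inter> Z) \<and> s p = x"
proof -
  obtain c where c: "c \<in> Cv" "x = cls p c" using x St_carrier by blast
  from holomorphic_at_ev_near[OF c(1), of p]
  obtain D where "open D \<and> p \<in> D \<and> (\<forall>q\<in>D. holomorphic_at (\<lambda>z. ev c (z - p)) q)" ..
  then have D: "open D" "p \<in> D" "\<And>q. q \<in> D \<Longrightarrow> holomorphic_at (\<lambda>z. ev c (z - p)) q" by simp_all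
  define s where "s = (\<lambda>q\<in>D \<inter> Z. cls q (taylor (\<lambda>z. ev c (z - p)) q))"
  have "s \<in> sec (D \<inter> Z)"
    unfolding sec_iff
  proof (intro conjI ballI)
    show "s \<in> (\<Pi>\<^sub>E p\<in>D \<inter> Z. carrier (St p))"
      unfolding s_def using taylor_conv[OF D(3)] St_carrier by auto
    fix p' assume "p' \<in> D \<inter> Z"
    then show "\<exists>E g. open E \<and> p' \<in> E \<and> E \<inter> Z \<subseteq> D \<inter> Z \<and> (\<forall>q\<in>E. holomorphic_at g q) \<and> (\<forall>q\<in>E \<inter> Z. s q = cls q (taylor g q))"
      using D by (intro exI[of _ D] exI[of _ "\<lambda>z. ev c (z - p)"]) (auto simp: s_def)
  qed
  moreover have "s p = x" using D p c(2) taylor_eq[OF has_expansion_ev[OF c(1)]] by (simp add: s_def)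
  ultimately show ?thesis using D by blast
qed

text \<open>A stalk value is a germ. If g and h represent the sections, equality at p says that g -
  h = w F as series at p; the sum of \<open>w\<close> is holomorphic near p and the equation holds
  between functions there, so expanding it at each nearby zero of \<open>F\<close> gives equality at
  that point.\<close>

lemma sec_eq_near:
  assumes s: "s \<in> sec U" "p \<in> U" and t: "t \<in> sec U'" "p \<in> U'" and eq: "s p = t p" and p: "p \<in> Z"
  shows "\<exists>D. open D \<and> p \<in> D \<and> D \<inter> Z \<subseteq> U \<inter> U' \<and> (\<forall>q\<in>D \<inter> Z. s q = t q)"
proof -
  obtain D g where D: "open D" "p \<in> D" "D \<inter> Z \<subseteq> U" "\<And>q. q \<in> D \<Longrightarrow> holomorphic_at g q"
    "\<And>q. q \<in> D \<Longrightarrow> F q = 0 \<Longrightarrow> s q = cls q (taylor g q)" by (rule sec_rep[OF s]) blast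
  obtain E h where E: "open E" "p \<in> E" "E \<inter> Z \<subseteq> U'" "\<And>q. q \<in> E \<Longrightarrow> holomorphic_at h q"
    "\<And>q. q \<in> E \<Longrightarrow> F q = 0 \<Longrightarrow> t q = cls q (taylor h q)" by (rule sec_rep[OF t]) blast
  have diff: "has_expansion (\<lambda>z. g z + -1 * h z) q (\<lambda>m. taylor g q m + -1 * taylor h q m)" if "q \<in> D" "q \<in> E" for q
    using D(4)[OF that(1)] E(4)[OF that(2)] by (intro has_expansion_add has_expansion_scale holomorphic_at_taylor)
  have "cls p (taylor g p) = cls p (taylor h p)" using D(5)[OF D(2)] E(5)[OF E(2)] p eq by simp
  then obtain w where w: "w \<in> Cv" "(\<lambda>m. taylor g p m - taylor h p m) = mfps_mult w (taylor F p)"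
    using cls_eq_iff[OF taylor_conv[OF D(4)[OF D(2)]] taylor_conv[OF E(4)[OF E(2)]], of p] by blast
  define \<omega> where "\<omega> = (\<lambda>z. ev w (z - p))"
  from holomorphic_at_ev_near[OF w(1), of p]
  obtain O1 where "open O1 \<and> p \<in> O1 \<and> (\<forall>q\<in>O1. holomorphic_at (\<lambda>z. ev w (z - p)) q)" ..
  then have O1: "open O1" "p \<in> O1" "\<And>q. q \<in> O1 \<Longrightarrow> holomorphic_at \<omega> q" by (simp_all add: \<omega>_def)
  have \<omega>: "has_expansion \<omega> p w" unfolding \<omega>_def by (rule has_expansion_ev[OF w(1)])
  have "has_expansion (\<lambda>z. \<omega> z * F z) p (\<lambda>m. taylor g p m + -1 * taylor h p m)"
    using has_expansion_mult[OF \<omega> holomorphic_at_taylor[OF holo]] w(2) by simp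
  from has_expansion_locally_eq[OF this diff[OF D(2) E(2)]]
  obtain O2 where O2: "open O2" "p \<in> O2" "\<And>q. q \<in> O2 \<Longrightarrow> \<omega> q * F q = g q + -1 * h q"
    unfolding eventually_nhds by blast
  let ?D = "D \<inter> E \<inter> O1 \<inter> O2"
  have "s q = t q" if q: "q \<in> ?D" "F q = 0" for q
  proof -
    have "has_expansion (\<lambda>z. \<omega> z * F z) q (mfps_mult (taylor \<omega> q) (taylor F q))"
      using O1(3)[of q] q by (intro has_expansion_mult holomorphic_at_taylor holo) auto
    moreover have "\<forall>\<^sub>F z in nhds q. \<omega> z * F z = g z + -1 * h z"
      unfolding eventually_nhds using O2 q by blast
    ultimately have "has_expansion (\<lambda>z. g z + -1 * h z) q (mfps_mult (taylor \<omega> q) (taylor F q))"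
      by (rule has_expansion_cong)
    from has_expansion_unique[OF this diff] have "(\<lambda>m. taylor g q m - taylor h q m) = mfps_mult (taylor \<omega> q) (taylor F q)"
      using q by simp
    then have "cls q (taylor g q) = cls q (taylor h q)"
      using q O1(3)[of q] D(4)[of q] E(4)[of q] by (subst cls_eq_iff) (auto intro: taylor_conv)
    then show ?thesis using D(5)[of q] E(5)[of q] q by simp
  qed
  then show ?thesis using D(1-3) E(1-3) O1(1,2) O2(1,2) by (intro exI[of _ ?D]) auto
qed

end

section \<open>The stalk isomorphism induced by an isomorphism of germs\<close>

locale germ_iso = X?: hypersurface F + Y?: hypersurface G
  for F G :: "complex ^ 'n::finite \<Rightarrow> complex" +
  fixes U V :: "(complex ^ 'n) set" and f h p
  assumes U: "openin (top_of_set X.Z) U" and V: "openin (top_of_set Y.Z) V" and pU: "p \<in> U" and fpV: "f p \<in> V"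
    and iso: "rs_iso (open_subspace X.rsp U) (open_subspace Y.rsp V) f h"
begin

definition pre :: "(complex ^ 'n) set \<Rightarrow> (complex ^ 'n) set" where "pre W = {x \<in> U. f x \<in> W}"

lemma tops: "rs_top (open_subspace X.rsp U) = subtopology (top_of_set X.Z) U"
  "rs_top (open_subspace Y.rsp V) = subtopology (top_of_set Y.Z) V"
  by (simp_all add: open_subspace_def analytic_hypersurface_def)

lemma UZ: "U \<subseteq> X.Z" and VZ: "V \<subseteq> Y.Z"
  using openin_subset[OF U] openin_subset[OF V] by simp_all

lemma topspaces: "topspace (subtopology (top_of_set X.Z) U) = U" "topspace (subtopology (top_of_set Y.Z) V) = V"
  using UZ VZ by auto

lemma open_sub_iff:
  "openin (subtopology (top_of_set X.Z) U) N \<longleftrightarrow> openin (top_of_set X.Z) N \<and> N \<subseteq> U"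
  "openin (subtopology (top_of_set Y.Z) V) W \<longleftrightarrow> openin (top_of_set Y.Z) W \<and> W \<subseteq> V"
  using U V by (auto simp: openin_open_subtopology)

lemma homeo: "homeomorphic_map (subtopology (top_of_set X.Z) U) (subtopology (top_of_set Y.Z) V) f"
  using iso by (simp add: rs_iso_def tops)

lemma f_inj: "inj_on f U" and f_image: "f ` U = V"
  using homeomorphic_imp_injective_map[OF homeo] homeomorphic_imp_surjective_map[OF homeo]
  unfolding topspaces by blast+

lemma image_open: "openin (top_of_set X.Z) N \<Longrightarrow> N \<subseteq> U \<Longrightarrow> openin (top_of_set Y.Z) (f ` N) \<and> f ` N \<subseteq> V \<and> pre (f ` N) = N"
proof -
  assume N: "openin (top_of_set X.Z) N" "N \<subseteq> U"
  have "open_map (subtopology (top_of_set X.Z) U) (subtopology (top_of_set Y.Z) V) f"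
    using homeo homeomorphic_imp_open_map by blast
  then have "openin (subtopology (top_of_set Y.Z) V) (f ` N)"
    using N by (simp add: open_map_def open_sub_iff)
  moreover have "pre (f ` N) = N" using N(2) f_inj by (auto simp: pre_def inj_on_def)
  ultimately show ?thesis by (simp add: open_sub_iff)
qed

lemma section_algs: "section_alg (open_subspace X.rsp U) N = section_alg X.rsp N"
  "section_alg (open_subspace Y.rsp V) W = section_alg Y.rsp W"
  by (simp_all add: section_alg_def open_subspace_def)

lemma h_iso: "openin (top_of_set Y.Z) W \<Longrightarrow> W \<subseteq> V \<Longrightarrow> alg_iso (section_alg Y.rsp W) (section_alg X.rsp (pre W)) (h W)"
  using iso unfolding rs_iso_def tops topspaces section_algs open_sub_iff pre_def by blast

lemma h_restrict:
  assumes "openin (top_of_set Y.Z) W" "W \<subseteq> V" "openin (top_of_set Y.Z) W'" "W' \<subseteq> W" "s \<in> Y.sec W"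
  shows "h W' (restrict s W') = restrict (h W s) (pre W')"
proof -
  have secs: "rs_sections (open_subspace Y.rsp V) W = Y.sec W" by (simp add: open_subspace_def)
  have "\<forall>V' W. openin (rs_top (open_subspace Y.rsp V)) V' \<and> openin (rs_top (open_subspace Y.rsp V)) W \<and> W \<subseteq> V' \<longrightarrow>
      (\<forall>s\<in>rs_sections (open_subspace Y.rsp V) V'. h W (restrict s W) =
        restrict (h V' s) {x \<in> topspace (rs_top (open_subspace X.rsp U)). f x \<in> W})"
    using iso unfolding rs_iso_def by (elim conjE)
  from this[rule_format, of W W' s] show ?thesis
    using assms unfolding tops topspaces open_sub_iff pre_def secs by simp
qed

lemma section_alg_simps:
  "carrier (section_alg Y.rsp W) = Y.sec W" "carrier (section_alg X.rsp W) = X.sec W"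
  "s \<otimes>\<^bsub>section_alg Y.rsp W\<^esub> t = (\<lambda>q\<in>W. s q \<otimes>\<^bsub>Y.St q\<^esub> t q)"
  "s \<oplus>\<^bsub>section_alg Y.rsp W\<^esub> t = (\<lambda>q\<in>W. s q \<oplus>\<^bsub>Y.St q\<^esub> t q)"
  "s \<otimes>\<^bsub>section_alg X.rsp W\<^esub> t = (\<lambda>q\<in>W. s q \<otimes>\<^bsub>X.St q\<^esub> t q)"
  "s \<oplus>\<^bsub>section_alg X.rsp W\<^esub> t = (\<lambda>q\<in>W. s q \<oplus>\<^bsub>X.St q\<^esub> t q)"
  "c \<odot>\<^bsub>section_alg Y.rsp W\<^esub> s = (\<lambda>q\<in>W. c \<odot>\<^bsub>Y.St q\<^esub> s q)"
  "c \<odot>\<^bsub>section_alg X.rsp W\<^esub> s = (\<lambda>q\<in>W. c \<odot>\<^bsub>X.St q\<^esub> s q)"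
  "\<one>\<^bsub>section_alg Y.rsp W\<^esub> = (\<lambda>q\<in>W. \<one>\<^bsub>Y.St q\<^esub>)" "\<one>\<^bsub>section_alg X.rsp W\<^esub> = (\<lambda>q\<in>W. \<one>\<^bsub>X.St q\<^esub>)"
  by (simp_all add: section_alg_def analytic_hypersurface_def)

text \<open>A representative of a germ at \<open>f p\<close>, taken inside \<open>V\<close>, where
  the sheaf map is defined.\<close>

definition nbhd_section :: "(complex ^ 'n) set \<Rightarrow> (complex ^ 'n \<Rightarrow> (('n \<Rightarrow> nat) \<Rightarrow> complex) set) \<Rightarrow> bool" where
  "nbhd_section W s \<longleftrightarrow> openin (top_of_set Y.Z) W \<and> W \<subseteq> V \<and> f p \<in> W \<and> s \<in> Y.sec W"

lemma nbhd_section_restrict: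
  assumes "nbhd_section W s" "openin (top_of_set Y.Z) W'" "W' \<subseteq> W" "f p \<in> W'"
  shows "nbhd_section W' (restrict s W')" "h W' (restrict s W') p = h W s p" "restrict s W' (f p) = s (f p)"
proof -
  obtain D where D: "open D" "W' = D \<inter> Y.Z" using assms(2) Y.open_Z_iff by blast
  then show "nbhd_section W' (restrict s W')"
    using assms Y.sec_restrict[of s W D] unfolding nbhd_section_def by auto
  have "p \<in> pre W'" using pU assms(4) by (simp add: pre_def)
  then show "h W' (restrict s W') p = h W s p"
    using h_restrict[of W W' s] assms unfolding nbhd_section_def by simp
qed (use assms in simp)

lemma nbhd_section_exists:
  assumes "y \<in> carrier (Y.St (f p))"
  shows "\<exists>W s. nbhd_section W s \<and> s (f p) = y"
proof -
  have fZ: "f p \<in> Y.Z" using fpV VZ by blast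
  obtain D s where D: "open D" "f p \<in> D" "s \<in> Y.sec (D \<inter> Y.Z)" "s (f p) = y"
    using Y.sec_exists[OF assms fZ] by blast
  obtain E where E: "open E" "V = E \<inter> Y.Z" using V Y.open_Z_iff by blast
  have "restrict s ((D \<inter> E) \<inter> Y.Z) \<in> Y.sec ((D \<inter> E) \<inter> Y.Z)"
    using D E by (intro Y.sec_restrict[OF D(3)]) auto
  moreover have "openin (top_of_set Y.Z) ((D \<inter> E) \<inter> Y.Z)" using D E Y.open_Z_iff by blast
  moreover have "f p \<in> (D \<inter> E) \<inter> Y.Z" using D fpV E fZ by blast
  ultimately have "nbhd_section ((D \<inter> E) \<inter> Y.Z) (restrict s ((D \<inter> E) \<inter> Y.Z))"
    unfolding nbhd_section_def using E by blast
  moreover have "restrict s ((D \<inter> E) \<inter> Y.Z) (f p) = y" using D(4) \<open>f p \<in> (D \<inter> E) \<inter> Y.Z\<close> by simp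
  ultimately show ?thesis by blast
qed

lemma nbhd_section_common:
  assumes "nbhd_section W s" "nbhd_section W' s'"
  shows "\<exists>W0 s0 s0'. nbhd_section W0 s0 \<and> nbhd_section W0 s0' \<and> s0 (f p) = s (f p) \<and> s0' (f p) = s' (f p) \<and>
    h W0 s0 p = h W s p \<and> h W0 s0' p = h W' s' p"
proof -
  have W: "openin (top_of_set Y.Z) (W \<inter> W')" "f p \<in> W \<inter> W'" using assms by (auto simp: nbhd_section_def)
  show ?thesis
    using nbhd_section_restrict[OF assms(1) W(1) _ W(2)] nbhd_section_restrict[OF assms(2) W(1) _ W(2)]
    by (intro exI[of _ "W \<inter> W'"] exI[of _ "restrict s (W \<inter> W')"] exI[of _ "restrict s' (W \<inter> W')"]) simp
qed

lemma h_section: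
  assumes "nbhd_section W s"
  shows "h W s \<in> X.sec (pre W)" "p \<in> pre W" "h W s p \<in> carrier (X.St p)"
proof -
  have "alg_iso (section_alg Y.rsp W) (section_alg X.rsp (pre W)) (h W)"
    using assms h_iso by (simp add: nbhd_section_def)
  then show 1: "h W s \<in> X.sec (pre W)"
    using assms ring_iso_memE(1)[of "h W" "section_alg Y.rsp W" "section_alg X.rsp (pre W)" s]
    by (simp add: alg_iso_def section_alg_simps nbhd_section_def)
  show 2: "p \<in> pre W" using assms pU by (simp add: pre_def nbhd_section_def)
  show "h W s p \<in> carrier (X.St p)" by (rule X.sec_stalk[OF 1 2])
qed

text \<open>Sections with the same value at \<open>f p\<close> agree near \<open>f p\<close>, and
  \<open>h\<close> commutes with restriction.\<close>

lemma h_value_cong: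
  assumes s: "nbhd_section W s" and t: "nbhd_section W' t" and eq: "s (f p) = t (f p)"
  shows "h W s p = h W' t p"
proof -
  obtain D where D: "open D" "f p \<in> D" "D \<inter> Y.Z \<subseteq> W \<inter> W'" "\<forall>q\<in>D \<inter> Y.Z. s q = t q"
    using Y.sec_eq_near[of s W "f p" t W'] s t eq fpV VZ unfolding nbhd_section_def by blast
  have W0: "openin (top_of_set Y.Z) (D \<inter> Y.Z)" "f p \<in> D \<inter> Y.Z" using D Y.open_Z_iff fpV VZ by blast+
  have "restrict s (D \<inter> Y.Z) = restrict t (D \<inter> Y.Z)" using D(4) by (intro restrict_ext) blast
  then show ?thesis
    using nbhd_section_restrict(2)[OF s W0(1) _ W0(2)] nbhd_section_restrict(2)[OF t W0(1) _ W0(2)] D(3) by simp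
qed

text \<open>Equality of the images at p spreads to a neighbourhood of p. Since \<open>f\<close> is
  open and injective on \<open>U\<close>, this is the preimage of an open set of the target, over
  which \<open>h\<close> is injective.\<close>

lemma h_value_inj:
  assumes s: "nbhd_section W s" and t: "nbhd_section W t" and eq: "h W s p = h W t p"
  shows "s (f p) = t (f p)"
proof -
  have pZ: "p \<in> X.Z" using pU UZ by blast
  obtain D where D: "open D" "p \<in> D" "D \<inter> X.Z \<subseteq> pre W" "\<forall>q\<in>D \<inter> X.Z. h W s q = h W t q"
    using X.sec_eq_near[OF h_section(1)[OF s] h_section(2)[OF s] h_section(1)[OF t] h_section(2)[OF t] eq pZ] by blast
  let ?N = "D \<inter> X.Z"
  have N: "openin (top_of_set X.Z) ?N" "?N \<subseteq> U" using D X.open_Z_iff by (auto simp: pre_def)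
  note W1 = image_open[OF N]
  have sub: "f ` ?N \<subseteq> W" using D(3) by (auto simp: pre_def)
  have fp: "f p \<in> f ` ?N" using D(2) pZ by blast
  have "h (f ` ?N) (restrict s (f ` ?N)) = restrict (h W s) ?N"
    using h_restrict[of W "f ` ?N" s] s W1 sub unfolding nbhd_section_def by simp
  also have "\<dots> = restrict (h W t) ?N" using D(4) by (intro restrict_ext) blast
  also have "\<dots> = h (f ` ?N) (restrict t (f ` ?N))"
    using h_restrict[of W "f ` ?N" t] t W1 sub unfolding nbhd_section_def by simp
  finally have eq': "h (f ` ?N) (restrict s (f ` ?N)) = h (f ` ?N) (restrict t (f ` ?N))" .
  have "inj_on (h (f ` ?N)) (Y.sec (f ` ?N))"
    using h_iso[of "f ` ?N"] W1 by (simp add: alg_iso_def ring_iso_def bij_betw_def section_alg_simps)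
  moreover have "restrict s (f ` ?N) \<in> Y.sec (f ` ?N)" "restrict t (f ` ?N) \<in> Y.sec (f ` ?N)"
    using nbhd_section_restrict(1)[OF s _ sub fp] nbhd_section_restrict(1)[OF t _ sub fp] W1 by (auto simp: nbhd_section_def)
  ultimately have "restrict s (f ` ?N) = restrict t (f ` ?N)" using eq' by (auto dest: inj_onD)
  from fun_cong[OF this, of "f p"] show ?thesis using fp by simp
qed

text \<open>x extends to a section near p, and over the image of that neighbourhood \<open>h\<close>
  is onto.\<close>

lemma h_value_surj:
  assumes x: "x \<in> carrier (X.St p)"
  shows "\<exists>W s. nbhd_section W s \<and> h W s p = x"
proof -
  have pZ: "p \<in> X.Z" using pU UZ by blast
  obtain D t where D: "open D" "p \<in> D" "t \<in> X.sec (D \<inter> X.Z)" "t p = x" using X.sec_exists[OF x pZ] by blast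
  obtain E where E: "open E" "U = E \<inter> X.Z" using U X.open_Z_iff by blast
  let ?N = "(D \<inter> E) \<inter> X.Z"
  have N: "openin (top_of_set X.Z) ?N" "?N \<subseteq> U" using D E X.open_Z_iff by blast+
  note W = image_open[OF N]
  have t: "restrict t ?N \<in> X.sec ?N" using D E by (intro X.sec_restrict[OF D(3)]) auto
  have pN: "p \<in> ?N" using D pU E by blast
  have "h (f ` ?N) ` Y.sec (f ` ?N) = X.sec ?N"
    using h_iso[of "f ` ?N"] W by (simp add: alg_iso_def ring_iso_def bij_betw_def section_alg_simps)
  then have "restrict t ?N \<in> h (f ` ?N) ` Y.sec (f ` ?N)" using t by simp
  then obtain s where s: "s \<in> Y.sec (f ` ?N)" "h (f ` ?N) s = restrict t ?N" by (elim imageE) simp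
  have "nbhd_section (f ` ?N) s" unfolding nbhd_section_def using W s(1) pN by blast
  moreover have "h (f ` ?N) s p = x" using s(2) D(4) pN by simp
  ultimately show ?thesis by blast
qed

text \<open>The choice is immaterial by \<open>h_value_cong\<close>: the image depends only on the
  germ \<open>y\<close>.\<close>

definition stalk_map :: "(('n \<Rightarrow> nat) \<Rightarrow> complex) set \<Rightarrow> (('n \<Rightarrow> nat) \<Rightarrow> complex) set" where
  "stalk_map y = (SOME x. \<exists>W s. nbhd_section W s \<and> s (f p) = y \<and> x = h W s p)"

lemma stalk_map_eq:
  assumes "nbhd_section W s"
  shows "stalk_map (s (f p)) = h W s p"
  unfolding stalk_map_def by (rule some_equality) (use assms h_value_cong in blast)+

theorem stalk_map_iso: "alg_iso (Y.St (f p)) (X.St p) stalk_map"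
  unfolding alg_iso_def
proof (intro conjI allI ballI ring_iso_memI)
  show "stalk_map y \<in> carrier (X.St p)" if "y \<in> carrier (Y.St (f p))" for y
    using nbhd_section_exists[OF that] stalk_map_eq h_section(3) by metis
  fix y y' assume y: "y \<in> carrier (Y.St (f p))" "y' \<in> carrier (Y.St (f p))"
  obtain W1 s1 where 1: "nbhd_section W1 s1" "s1 (f p) = y" using nbhd_section_exists[OF y(1)] by blast
  obtain W2 s2 where 2: "nbhd_section W2 s2" "s2 (f p) = y'" using nbhd_section_exists[OF y(2)] by blast
  obtain W s t where st: "nbhd_section W s" "nbhd_section W t" "s (f p) = y" "t (f p) = y'"
    using nbhd_section_common[OF 1(1) 2(1)] 1(2) 2(2) by auto
  have sW: "s \<in> Y.sec W" "t \<in> Y.sec W" "f p \<in> W" "openin (top_of_set Y.Z) W" "W \<subseteq> V" using st by (auto simp: nbhd_section_def)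
  note hom = ring_iso_memE[OF conjunct1[OF h_iso[OF sW(4,5), unfolded alg_iso_def]], unfolded section_alg_simps]
  have pW: "p \<in> pre W" by (rule h_section(2)[OF st(1)])
  have m: "nbhd_section W (\<lambda>q\<in>W. s q \<otimes>\<^bsub>Y.St q\<^esub> t q)" "nbhd_section W (\<lambda>q\<in>W. s q \<oplus>\<^bsub>Y.St q\<^esub> t q)"
    using sW Y.sec_mult[OF sW(1,2)] Y.sec_add[OF sW(1,2)] by (simp_all add: nbhd_section_def)
  show "stalk_map (y \<otimes>\<^bsub>Y.St (f p)\<^esub> y') = stalk_map y \<otimes>\<^bsub>X.St p\<^esub> stalk_map y'"
    using stalk_map_eq[OF m(1)] hom(2)[OF sW(1,2)] stalk_map_eq[OF st(1)] stalk_map_eq[OF st(2)] st(3,4) sW(3) pW by simp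
  show "stalk_map (y \<oplus>\<^bsub>Y.St (f p)\<^esub> y') = stalk_map y \<oplus>\<^bsub>X.St p\<^esub> stalk_map y'"
    using stalk_map_eq[OF m(2)] hom(3)[OF sW(1,2)] stalk_map_eq[OF st(1)] stalk_map_eq[OF st(2)] st(3,4) sW(3) pW by simp
next
  have "\<one>\<^bsub>Y.St (f p)\<^esub> \<in> carrier (Y.St (f p))" using Y.kalg_St by (simp add: kalg_def cring_def ring_def monoid.one_closed)
  then obtain W s where s: "nbhd_section W s" "s (f p) = \<one>\<^bsub>Y.St (f p)\<^esub>" using nbhd_section_exists by blast
  have sW: "s \<in> Y.sec W" "f p \<in> W" "openin (top_of_set Y.Z) W" "W \<subseteq> V" using s by (auto simp: nbhd_section_def)
  note hom = ring_iso_memE[OF conjunct1[OF h_iso[OF sW(3,4), unfolded alg_iso_def]], unfolded section_alg_simps]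
  have "(\<lambda>q\<in>W. \<one>\<^bsub>Y.St q\<^esub>) \<in> Y.sec W"
  proof -
    obtain D where D: "open D" "W = D \<inter> Y.Z" using sW(3) Y.open_Z_iff by blast
    have "holomorphic_at (\<lambda>z. 1) q" "taylor (\<lambda>z. 1) q = mfps_monom (\<lambda>v. 0)" for q :: "complex ^ 'n"
      using has_expansion_one taylor_eq by (auto simp: holomorphic_at_def)
    moreover have "Y.cls x (mfps_monom (\<lambda>v. 0)) \<in> carrier (Y.St x)" for x
      using Y.St_carrier cv.C_monom by blast
    ultimately show ?thesis
      unfolding Y.sec_iff Y.St_one using D by (auto intro!: exI[of _ D] exI[of _ "\<lambda>z. 1"])
  qed
  then have "nbhd_section W (\<lambda>q\<in>W. \<one>\<^bsub>Y.St q\<^esub>)" using sW by (simp add: nbhd_section_def)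
  from stalk_map_eq[OF this] show "stalk_map \<one>\<^bsub>Y.St (f p)\<^esub> = \<one>\<^bsub>X.St p\<^esub>"
    using hom(4) sW(2) h_section(2)[OF s(1)] by simp
next
  show "bij_betw stalk_map (carrier (Y.St (f p))) (carrier (X.St p))"
    unfolding bij_betw_def
  proof
    show "inj_on stalk_map (carrier (Y.St (f p)))"
    proof (rule inj_onI)
      fix y y' assume y: "y \<in> carrier (Y.St (f p))" "y' \<in> carrier (Y.St (f p))" and eq: "stalk_map y = stalk_map y'"
      obtain W1 s1 where 1: "nbhd_section W1 s1" "s1 (f p) = y" using nbhd_section_exists[OF y(1)] by blast
      obtain W2 s2 where 2: "nbhd_section W2 s2" "s2 (f p) = y'" using nbhd_section_exists[OF y(2)] by blast
      obtain W s t where st: "nbhd_section W s" "nbhd_section W t" "s (f p) = y" "t (f p) = y'"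
        using nbhd_section_common[OF 1(1) 2(1)] 1(2) 2(2) by auto
      show "y = y'"
        using h_value_inj[OF st(1,2)] eq stalk_map_eq[OF st(1)] stalk_map_eq[OF st(2)] st(3,4) by simp
    qed
    show "stalk_map ` carrier (Y.St (f p)) = carrier (X.St p)"
    proof (intro equalityI subsetI)
      fix x assume "x \<in> carrier (X.St p)"
      then obtain W s where s: "nbhd_section W s" "h W s p = x" using h_value_surj by blast
      have "s (f p) \<in> carrier (Y.St (f p))" using s(1) Y.sec_stalk[of s W "f p"] by (simp add: nbhd_section_def)
      then show "x \<in> stalk_map ` carrier (Y.St (f p))"
        using stalk_map_eq[OF s(1)] s(2) by (intro image_eqI[of _ _ "s (f p)"]) simp_all
    next
      fix x assume "x \<in> stalk_map ` carrier (Y.St (f p))"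
      then obtain y where y: "y \<in> carrier (Y.St (f p))" "x = stalk_map y" by blast
      obtain W s where "nbhd_section W s" "s (f p) = y" using nbhd_section_exists[OF y(1)] by blast
      then show "x \<in> carrier (X.St p)" using y(2) stalk_map_eq h_section(3) by metis
    qed
  qed
next
  fix c y assume y: "y \<in> carrier (Y.St (f p))"
  obtain W s where s: "nbhd_section W s" "s (f p) = y" using nbhd_section_exists[OF y] by blast
  have sW: "s \<in> Y.sec W" "f p \<in> W" "openin (top_of_set Y.Z) W" "W \<subseteq> V" using s by (auto simp: nbhd_section_def)
  have "h W (c \<odot>\<^bsub>section_alg Y.rsp W\<^esub> s) = c \<odot>\<^bsub>section_alg X.rsp (pre W)\<^esub> h W s"
    using h_iso[OF sW(3,4)] sW(1) by (simp add: alg_iso_def section_alg_simps)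
  moreover have "nbhd_section W (\<lambda>q\<in>W. c \<odot>\<^bsub>Y.St q\<^esub> s q)"
    using sW Y.sec_smult[OF sW(1)] by (simp add: nbhd_section_def)
  ultimately show "stalk_map (c \<odot>\<^bsub>Y.St (f p)\<^esub> y) = c \<odot>\<^bsub>X.St p\<^esub> stalk_map y"
    using stalk_map_eq[of W "\<lambda>q\<in>W. c \<odot>\<^bsub>Y.St q\<^esub> s q"] stalk_map_eq[OF s(1)] s(2) sW(2) h_section(2)[OF s(1)]
    by (simp add: section_alg_simps)
qed

end

lemma germ_iso_imp_stalk_iso:
  fixes F G :: "complex ^ 'n::finite \<Rightarrow> complex"
  assumes F: "\<And>p. holomorphic_at F p" and G: "\<And>p. holomorphic_at G p"
    and iso: "germ_isomorphic (analytic_hypersurface F) p (analytic_hypersurface G) q"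
  shows "alg_isomorphic (hypersurface_stalk G q) (hypersurface_stalk F p)"
proof -
  obtain U V f h where *: "openin (rs_top (analytic_hypersurface F)) U" "p \<in> U" "openin (rs_top (analytic_hypersurface G)) V" "q \<in> V"
    "rs_iso (open_subspace (analytic_hypersurface F) U) (open_subspace (analytic_hypersurface G) V) f h" "f p = q"
    using iso unfolding germ_isomorphic_def by blast
  have "germ_iso F G U V f h p"
    by (intro germ_iso.intro hypersurface.intro germ_iso_axioms.intro F G)
      (use * in \<open>simp_all add: analytic_hypersurface_def\<close>)
  from germ_iso.stalk_map_iso[OF this] show ?thesis using *(6) unfolding alg_isomorphic_def by blast
qed

text \<open>The stalk map runs from the target germ to the source germ, hence \<open>b\<close> comes
  first in the conclusion.\<close>

theorem BP_germ_iso_imp_perm: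
  fixes a b :: "'n::finite \<Rightarrow> nat"
  assumes "\<And>i. 2 \<le> a i" "\<And>i. 2 \<le> b i" and iso: "germ_isomorphic (BP_analytic a) 0 (BP_analytic b) 0"
  shows "perm_equiv b a"
proof (rule cv.BP_iso_imp_perm[OF assms(2,1)])
  have "alg_isomorphic (hypersurface_stalk (\<lambda>z. \<Sum>i\<in>UNIV. (z $ i) ^ b i) 0) (hypersurface_stalk (\<lambda>z. \<Sum>i\<in>UNIV. (z $ i) ^ a i) 0)"
    using iso unfolding BP_analytic_def by (rule germ_iso_imp_stalk_iso[OF holomorphic_at_BP holomorphic_at_BP])
  then show "alg_isomorphic (quot_alg cv.A (cv.IBP b)) (quot_alg cv.A (cv.IBP a))"
    by (simp add: hypersurface_stalk_def hypersurface_ideal_def taylor_BP_zero flip: conv_fps_alg_sub)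
qed

section \<open>Permutations of the variables\<close>

text \<open>For a bijection \<pi> this renames X_i to X_(\<pi> i); on values it is composition with
  \<open>permute_vec \<pi>\<close>.\<close>

definition permute :: "('n \<Rightarrow> 'n) \<Rightarrow> ('n, 'k) mfps \<Rightarrow> ('n, 'k) mfps" where
  "permute \<pi> c = (\<lambda>m. c (m \<circ> \<pi>))"

definition permute_vec :: "('n::finite \<Rightarrow> 'n) \<Rightarrow> 'a ^ 'n \<Rightarrow> 'a ^ 'n" where
  "permute_vec \<pi> z = (\<chi> i. z $ \<pi> i)"

lemma permute_vec_nth [simp]: "permute_vec \<pi> z $ i = z $ \<pi> i"
  by (simp add: permute_vec_def)

lemma permute_vec_add: "permute_vec \<pi> (x + y) = permute_vec \<pi> x + permute_vec \<pi> (y :: 'a::plus ^ 'n)"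
  by (simp add: vec_eq_iff)

lemma comp_inv_into:
  assumes "bij \<pi>"
  shows "m \<circ> \<pi> \<circ> inv_into UNIV \<pi> = m" "m \<circ> inv_into UNIV \<pi> \<circ> \<pi> = m"
  using assms by (simp_all add: fun_eq_iff bij_is_surj surj_f_inv_f bij_is_inj inv_f_f)

lemma permute_inverse:
  assumes "bij \<pi>"
  shows "permute (inv_into UNIV \<pi>) (permute \<pi> c) = c" "permute \<pi> (permute (inv_into UNIV \<pi>) c) = c"
  by (simp_all add: permute_def comp_inv_into[OF assms])

lemma permute_vec_inverse:
  assumes "bij \<pi>"
  shows "permute_vec (inv_into UNIV \<pi>) (permute_vec \<pi> z) = z" "permute_vec \<pi> (permute_vec (inv_into UNIV \<pi>) z) = z"
  using assms by (simp_all add: vec_eq_iff bij_is_surj surj_f_inv_f bij_is_inj inv_f_f)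

lemma bij_comp_expo:
  fixes \<pi> :: "'n \<Rightarrow> 'n"
  assumes "bij \<pi>"
  shows "bij (\<lambda>m :: 'n \<Rightarrow> nat. m \<circ> \<pi>)"
  by (rule bij_betw_byWitness[where f' = "\<lambda>m. m \<circ> inv_into UNIV \<pi>"]) (auto simp only: comp_inv_into[OF assms])

lemma permute_mult:
  fixes f g :: "('n::finite, 'k::comm_ring_1) mfps"
  assumes "bij \<pi>"
  shows "permute \<pi> (mfps_mult f g) = mfps_mult (permute \<pi> f) (permute \<pi> g)"
proof
  fix m :: "'n \<Rightarrow> nat"
  let ?\<rho> = "inv_into UNIV \<pi>"
  have "(\<Sum>(i, j)\<in>splits (m \<circ> \<pi>). f i * g j) = (\<Sum>(i, j)\<in>splits m. f (i \<circ> \<pi>) * g (j \<circ> \<pi>))"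
  proof (rule sum.reindex_bij_witness[of _ "\<lambda>(i, j). (i \<circ> \<pi>, j \<circ> \<pi>)" "\<lambda>(i, j). (i \<circ> ?\<rho>, j \<circ> ?\<rho>)"])
    fix p assume p: "p \<in> splits (m \<circ> \<pi>)"
    obtain i j where ij: "p = (i, j)" by (cases p)
    have "i (?\<rho> v) + j (?\<rho> v) = m v" for v
    proof -
      have "i (?\<rho> v) + j (?\<rho> v) = m (\<pi> (?\<rho> v))" using p ij by (simp add: splits_def)
      then show ?thesis using assms by (simp add: bij_is_surj surj_f_inv_f)
    qed
    then show "(case p of (i, j) \<Rightarrow> (i \<circ> ?\<rho>, j \<circ> ?\<rho>)) \<in> splits m" by (simp add: splits_def ij)
  qed (auto simp: comp_inv_into[OF assms] splits_def)
  then show "permute \<pi> (mfps_mult f g) m = mfps_mult (permute \<pi> f) (permute \<pi> g) m"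
    by (simp add: permute_def mfps_mult_def)
qed

lemma permute_unit_expo:
  assumes "bij \<pi>"
  shows "permute \<pi> (mfps_monom (unit_expo i k)) = mfps_monom (unit_expo (\<pi> i) k)"
proof
  fix m
  have "m \<circ> \<pi> = unit_expo i k \<longleftrightarrow> m \<circ> \<pi> = unit_expo (\<pi> i) k \<circ> \<pi>"
    using bij_is_inj[OF assms] by (simp add: unit_expo_def fun_eq_iff inj_eq)
  also have "\<dots> \<longleftrightarrow> m = unit_expo (\<pi> i) k"
    by (rule inj_eq[OF bij_is_inj[OF bij_comp_expo[OF assms]]])
  finally show "permute \<pi> (mfps_monom (unit_expo i k)) m = mfps_monom (unit_expo (\<pi> i) k) m"
    by (simp add: permute_def mfps_monom_def)
qed

lemma permute_BP:
  assumes "bij \<pi>"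
  shows "permute \<pi> (mfps_of_poly (BP_poly (a \<circ> \<pi>))) = mfps_of_poly (BP_poly a)"
proof
  fix m
  have "permute \<pi> (mfps_of_poly (BP_poly (a \<circ> \<pi>))) m = (\<Sum>i\<in>UNIV. permute \<pi> (mfps_monom (unit_expo i (a (\<pi> i)))) m)"
    by (simp add: mfps_of_BP_poly_sum permute_def)
  also have "\<dots> = (\<Sum>i\<in>UNIV. mfps_monom (unit_expo (\<pi> i) (a (\<pi> i))) m)"
    by (simp only: permute_unit_expo[OF assms])
  also have "\<dots> = (\<Sum>i\<in>UNIV. mfps_monom (unit_expo i (a i)) m)"
    by (rule sum.reindex_bij_betw[OF assms])
  finally show "permute \<pi> (mfps_of_poly (BP_poly (a \<circ> \<pi>))) m = mfps_of_poly (BP_poly a) m"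
    by (simp add: mfps_of_BP_poly_sum)
qed

lemma permute_alg_iso:
  fixes C :: "('n::finite, 'k::field) mfps set"
  assumes \<pi>: "bij \<pi>" and C: "\<And>c. permute \<pi> c \<in> C \<longleftrightarrow> c \<in> C"
  shows "alg_iso (sub_fps C) (sub_fps C) (permute \<pi>)"
  unfolding alg_iso_def
proof (intro conjI allI ballI ring_iso_memI)
  have zero: "m \<circ> \<pi> = (\<lambda>v. 0) \<longleftrightarrow> m = (\<lambda>v. 0)" for m :: "'n \<Rightarrow> nat"
  proof -
    have "m \<circ> \<pi> = (\<lambda>v. 0) \<longleftrightarrow> m \<circ> \<pi> = (\<lambda>v. 0) \<circ> \<pi>" by (simp add: comp_def)
    also have "\<dots> \<longleftrightarrow> m = (\<lambda>v. 0)" by (rule inj_eq[OF bij_is_inj[OF bij_comp_expo[OF \<pi>]]])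
    finally show ?thesis .
  qed
  show "permute \<pi> \<one>\<^bsub>sub_fps C\<^esub> = \<one>\<^bsub>sub_fps C\<^esub>"
    by (simp add: permute_def mfps_monom_def zero)
  have inj: "inj_on (permute \<pi>) C" by (rule inj_on_inverseI[of _ "permute (inv_into UNIV \<pi>)"]) (rule permute_inverse(1)[OF \<pi>])
  have "c \<in> permute \<pi> ` C" if "c \<in> C" for c
  proof (rule image_eqI)
    show "c = permute \<pi> (permute (inv_into UNIV \<pi>) c)" by (simp only: permute_inverse(2)[OF \<pi>])
    show "permute (inv_into UNIV \<pi>) c \<in> C" using that C[of "permute (inv_into UNIV \<pi>) c"] unfolding permute_inverse(2)[OF \<pi>] by blast
  qed
  then show "bij_betw (permute \<pi>) (carrier (sub_fps C)) (carrier (sub_fps C))"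
    using inj C by (auto simp: bij_betw_def)
qed (simp_all add: permute_mult[OF \<pi>] C, simp_all add: permute_def)

lemma fdeg_comp: "bij \<pi> \<Longrightarrow> fdeg (m \<circ> \<pi>) = fdeg m"
  using sum.reindex_bij_betw[of \<pi> UNIV UNIV m] by simp

lemma abs_conv_permute:
  assumes "bij \<pi>"
  shows "abs_conv r (permute \<pi> c) \<longleftrightarrow> abs_conv r c"
proof -
  have "abs_conv r (permute \<pi> c) \<longleftrightarrow> (\<lambda>m. norm (c (m \<circ> \<pi>)) * r ^ fdeg (m \<circ> \<pi>)) summable_on UNIV"
    unfolding abs_conv_def permute_def fdeg_comp[OF assms] ..
  also have "\<dots> \<longleftrightarrow> abs_conv r c"
    unfolding abs_conv_def by (rule summable_on_reindex_bij_betw[OF bij_comp_expo[OF assms]])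
  finally show ?thesis .
qed

lemma zpow_permute: "bij \<pi> \<Longrightarrow> zpow (permute_vec \<pi> z) (m \<circ> \<pi>) = zpow z m"
  using prod.reindex_bij_betw[of \<pi> UNIV UNIV "\<lambda>i. (z $ i) ^ m i"] by (simp add: zpow_def)

lemma ev_permute:
  assumes "bij \<pi>"
  shows "ev (permute \<pi> c) z = ev c (permute_vec \<pi> z)"
proof -
  have "ev (permute \<pi> c) z = infsum (\<lambda>m. c (m \<circ> \<pi>) * zpow (permute_vec \<pi> z) (m \<circ> \<pi>)) UNIV"
    unfolding ev_def permute_def zpow_permute[OF assms] ..
  also have "\<dots> = ev c (permute_vec \<pi> z)"
    unfolding ev_def by (rule infsum_reindex_bij_betw[OF bij_comp_expo[OF assms]])
  finally show ?thesis .
qed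

lemma permute_conv: "bij \<pi> \<Longrightarrow> permute \<pi> c \<in> Cv \<longleftrightarrow> c \<in> Cv"
  by (simp add: conv_iff abs_conv_permute)

lemma permute_conv_iso: "bij \<pi> \<Longrightarrow> alg_iso conv_fps_alg conv_fps_alg (permute \<pi>)"
  using permute_alg_iso[of \<pi> Cv] permute_conv[of \<pi>] by (simp flip: conv_fps_alg_sub)

lemma has_expansion_permute:
  assumes \<pi>: "bij \<pi>" and g: "has_expansion g (permute_vec \<pi> p) c"
  shows "has_expansion (\<lambda>z. g (permute_vec \<pi> z)) p (permute \<pi> c)"
proof -
  obtain r where r: "r > 0" "abs_conv r c" "\<And>z. pdisc r z \<Longrightarrow> g (permute_vec \<pi> p + z) = ev c z"
    using g has_expansion_iff by blast
  have "pdisc r (permute_vec \<pi> z)" if "pdisc r z" for z using that by (simp add: pdisc_def)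
  then show ?thesis using r
    by (auto simp: has_expansion_iff abs_conv_permute[OF \<pi>] ev_permute[OF \<pi>] permute_vec_add intro!: exI[of _ r])
qed

lemma holomorphic_at_permute:
  assumes \<pi>: "bij \<pi>" and g: "holomorphic_at g (permute_vec \<pi> p)"
  shows "holomorphic_at (\<lambda>z. g (permute_vec \<pi> z)) p"
    "taylor (\<lambda>z. g (permute_vec \<pi> z)) p = permute \<pi> (taylor g (permute_vec \<pi> p))"
proof -
  note has_expansion_permute[OF \<pi> holomorphic_at_taylor[OF g]]
  then show "holomorphic_at (\<lambda>z. g (permute_vec \<pi> z)) p"
    "taylor (\<lambda>z. g (permute_vec \<pi> z)) p = permute \<pi> (taylor g (permute_vec \<pi> p))"
    by (auto simp: holomorphic_at_def taylor_eq)
qed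

lemma continuous_permute_vec: "continuous_on S (permute_vec \<pi> :: complex ^ 'n::finite \<Rightarrow> complex ^ 'n)"
  unfolding permute_vec_def by (intro continuous_intros)

lemma open_permute_vimage: "open D \<Longrightarrow> open (permute_vec \<pi> -` D)" for D :: "(complex ^ 'n::finite) set"
  using continuous_permute_vec[of UNIV \<pi>] by (simp add: continuous_on_open_vimage)

text \<open>The second hypersurface is the zero set of \<open>G\<close> after a permutation of the
  coordinates. This gives an isomorphism of the whole ringed spaces, not only of germs.\<close>

locale hypersurface_permute = Y: hypersurface G for G :: "complex ^ 'n::finite \<Rightarrow> complex" +
  fixes \<pi> :: "'n \<Rightarrow> 'n"
  assumes \<pi>: "bij \<pi>"
begin

abbreviation F :: "complex ^ 'n \<Rightarrow> complex" where "F \<equiv> \<lambda>z. G (permute_vec \<pi> z)"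

sublocale X: hypersurface F
  by unfold_locales (rule holomorphic_at_permute(1)[OF \<pi> Y.holo])

text \<open>The Taylor series of \<open>F\<close> at p is the permuted Taylor series of
  \<open>G\<close> at the permuted point, and an automorphism maps a principal ideal to the one
  generated by the image.\<close>

lemma ideal_image: "permute \<pi> ` Y.I (permute_vec \<pi> p) = X.I p"
  unfolding hypersurface_ideal_def holomorphic_at_permute(2)[OF \<pi> Y.holo]
  by (rule image_PIdl[OF permute_conv_iso[OF \<pi>] Y.taylor_F_conv])

lemma cls_image: "c \<in> Cv \<Longrightarrow> permute \<pi> ` Y.cls (permute_vec \<pi> p) c = X.cls p (permute \<pi> c)"
  unfolding ideal_image[symmetric] by (rule image_coset[OF permute_conv_iso[OF \<pi>] Y.ideal_I])

lemma stalk_iso: "alg_iso (Y.St (permute_vec \<pi> p)) (X.St p) (image (permute \<pi>))"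
proof -
  have "ideal (permute \<pi> ` Y.I (permute_vec \<pi> p)) conv_fps_alg"
    unfolding ideal_image by (rule X.ideal_I)
  from alg_iso_quot[OF kalg_conv kalg_conv Y.ideal_I permute_conv_iso[OF \<pi>] this]
  show ?thesis unfolding ideal_image by (simp add: hypersurface_stalk_def)
qed

abbreviation pre :: "(complex ^ 'n) set \<Rightarrow> (complex ^ 'n) set" where
  "pre V \<equiv> {p \<in> X.Z. permute_vec \<pi> p \<in> V}"

definition pull :: "(complex ^ 'n) set \<Rightarrow> (complex ^ 'n \<Rightarrow> (('n \<Rightarrow> nat) \<Rightarrow> complex) set) \<Rightarrow>
    complex ^ 'n \<Rightarrow> (('n \<Rightarrow> nat) \<Rightarrow> complex) set" where
  "pull V s = (\<lambda>p\<in>pre V. permute \<pi> ` s (permute_vec \<pi> p))"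

lemma stalk_iso_carrier: "x \<in> carrier (Y.St (permute_vec \<pi> p)) \<Longrightarrow> permute \<pi> ` x \<in> carrier (X.St p)"
  using stalk_iso[of p] by (auto simp: alg_iso_def ring_iso_def ring_hom_def)

lemma sec_pull:
  assumes s: "s \<in> Y.sec V"
  shows "pull V s \<in> X.sec (pre V)"
  unfolding X.sec_iff
proof (intro conjI ballI)
  show "pull V s \<in> (\<Pi>\<^sub>E p\<in>pre V. carrier (X.St p))"
    unfolding pull_def using Y.sec_stalk[OF s] stalk_iso_carrier by auto
  fix p assume p: "p \<in> pre V"
  then have "permute_vec \<pi> p \<in> V" by simp
  from Y.sec_rep[OF s this] obtain D g where D: "open D" "permute_vec \<pi> p \<in> D" "D \<inter> Y.Z \<subseteq> V"
    "\<And>q. q \<in> D \<Longrightarrow> holomorphic_at g q" "\<And>q. q \<in> D \<Longrightarrow> G q = 0 \<Longrightarrow> s q = Y.cls q (taylor g q)" by metis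
  let ?D = "permute_vec \<pi> -` D" and ?g = "\<lambda>z. g (permute_vec \<pi> z)"
  have "pull V s q = X.cls q (taylor ?g q)" if q: "q \<in> ?D \<inter> X.Z" for q
  proof -
    have q': "permute_vec \<pi> q \<in> D" "G (permute_vec \<pi> q) = 0" using q by auto
    then have "q \<in> pre V" using D(3) by auto
    then have "pull V s q = permute \<pi> ` Y.cls (permute_vec \<pi> q) (taylor g (permute_vec \<pi> q))"
      using D(5)[OF q'] by (simp add: pull_def)
    also have "\<dots> = X.cls q (taylor ?g q)"
      unfolding cls_image[OF Y.taylor_conv[OF D(4)[OF q'(1)]]] holomorphic_at_permute(2)[OF \<pi> D(4)[OF q'(1)]] ..
    finally show ?thesis .
  qed
  moreover have "holomorphic_at ?g q" if "q \<in> ?D" for q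
    using holomorphic_at_permute(1)[OF \<pi> D(4)] that by simp
  moreover have "open ?D" "p \<in> ?D" "?D \<inter> X.Z \<subseteq> pre V" using D open_permute_vimage by auto
  ultimately show "\<exists>D g. open D \<and> p \<in> D \<and> D \<inter> X.Z \<subseteq> pre V \<and> (\<forall>q\<in>D. holomorphic_at g q) \<and>
        (\<forall>q\<in>D \<inter> X.Z. pull V s q = X.cls q (taylor g q))" by (intro exI[of _ ?D] exI[of _ ?g]) auto
qed

lemma G_eq: "(\<lambda>z. F (permute_vec (inv_into UNIV \<pi>) z)) = G"
  by (simp add: permute_vec_inverse[OF \<pi>])

text \<open>Permuting \<open>F\<close> by the inverse gives \<open>G\<close> back, so the same
  construction with the roles exchanged yields the preimage of \<open>t\<close>.\<close>

lemma pull_surj: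
  assumes V: "V \<subseteq> Y.Z" and t: "t \<in> X.sec (pre V)"
  shows "\<exists>s\<in>Y.sec V. pull V s = t"
proof -
  let ?\<rho> = "inv_into UNIV \<pi>"
  interpret inv: hypersurface_permute F ?\<rho> by unfold_locales (rule bij_imp_bij_inv[OF \<pi>])
  have V': "{q \<in> {z. F (permute_vec ?\<rho> z) = 0}. permute_vec ?\<rho> q \<in> pre V} = V"
    using V by (auto simp: permute_vec_inverse[OF \<pi>])
  have "inv.pull (pre V) t \<in> Y.sec V" using inv.sec_pull[OF t] unfolding V' unfolding G_eq .
  moreover have "pull V (inv.pull (pre V) t) = t"
  proof
    fix p
    show "pull V (inv.pull (pre V) t) p = t p"
    proof (cases "p \<in> pre V")
      case True
      then have "permute_vec \<pi> p \<in> V" by simp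
      then have "pull V (inv.pull (pre V) t) p = permute \<pi> ` permute ?\<rho> ` t p"
        unfolding pull_def inv.pull_def V' using True by (simp add: permute_vec_inverse[OF \<pi>])
      then show ?thesis by (simp add: image_image permute_inverse[OF \<pi>])
    next
      case False
      have "t \<in> (\<Pi>\<^sub>E p\<in>pre V. carrier (X.St p))" using t unfolding X.sec_iff by (rule conjunct1)
      then have "t p = undefined" using False by (rule PiE_arb)
      then show ?thesis unfolding pull_def[of V] by (simp only: restrict_apply False if_False)
    qed
  qed
  ultimately show ?thesis by blast
qed

lemma pull_inj:
  assumes V: "V \<subseteq> Y.Z"
  shows "inj_on (pull V) (Y.sec V)"
proof (rule inj_onI)
  fix s t assume st: "s \<in> Y.sec V" "t \<in> Y.sec V" and eq: "pull V s = pull V t"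
  have ext: "s \<in> (\<Pi>\<^sub>E p\<in>V. carrier (Y.St p))" "t \<in> (\<Pi>\<^sub>E p\<in>V. carrier (Y.St p))"
    using st unfolding Y.sec_iff by auto
  show "s = t"
  proof (rule PiE_ext[OF ext])
    fix q assume q: "q \<in> V"
    let ?p = "permute_vec (inv_into UNIV \<pi>) q"
    have p: "?p \<in> pre V" using q V by (auto simp: permute_vec_inverse[OF \<pi>])
    have "pull V s ?p = pull V t ?p" by (simp add: eq)
    then have "permute \<pi> ` s q = permute \<pi> ` t q"
      using p by (simp add: pull_def permute_vec_inverse[OF \<pi>])
    moreover have "inj (permute \<pi> :: ('n, complex) mfps \<Rightarrow> _)"
      by (rule inj_on_inverseI[of _ "permute (inv_into UNIV \<pi>)"]) (rule permute_inverse(1)[OF \<pi>])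
    ultimately show "s q = t q" by (simp add: inj_image_eq_iff)
  qed
qed

lemma pull_alg_iso:
  assumes V: "V \<subseteq> Y.Z"
  shows "alg_iso (section_alg Y.rsp V) (section_alg X.rsp (pre V)) (pull V)"
proof -
  have st: "rs_stalk Y.rsp = Y.St" "rs_stalk X.rsp = X.St"
    by (simp_all add: analytic_hypersurface_def)
  have hom: "permute \<pi> ` (x \<otimes>\<^bsub>Y.St (permute_vec \<pi> p)\<^esub> y) = permute \<pi> ` x \<otimes>\<^bsub>X.St p\<^esub> permute \<pi> ` y"
    "permute \<pi> ` (x \<oplus>\<^bsub>Y.St (permute_vec \<pi> p)\<^esub> y) = permute \<pi> ` x \<oplus>\<^bsub>X.St p\<^esub> permute \<pi> ` y"
    "permute \<pi> ` (c \<odot>\<^bsub>Y.St (permute_vec \<pi> p)\<^esub> x) = c \<odot>\<^bsub>X.St p\<^esub> permute \<pi> ` x"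
    "permute \<pi> ` \<one>\<^bsub>Y.St (permute_vec \<pi> p)\<^esub> = \<one>\<^bsub>X.St p\<^esub>"
    if "x \<in> carrier (Y.St (permute_vec \<pi> p))" "y \<in> carrier (Y.St (permute_vec \<pi> p))" for x y p c
    using stalk_iso[of p] that by (auto simp: alg_iso_def ring_iso_def ring_hom_def)
  have one: "permute \<pi> ` \<one>\<^bsub>Y.St (permute_vec \<pi> p)\<^esub> = \<one>\<^bsub>X.St p\<^esub>" for p
    using stalk_iso[of p] by (simp add: alg_iso_def ring_iso_def ring_hom_def)
  have bij: "bij_betw (pull V) (Y.sec V) (X.sec (pre V))"
    unfolding bij_betw_def using pull_inj[OF V] sec_pull pull_surj[OF V] by blast
  show ?thesis
    unfolding alg_iso_def
  proof (intro conjI allI ballI ring_iso_memI)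
    fix s t c assume st': "s \<in> carrier (section_alg Y.rsp V)"
    then have s: "s \<in> Y.sec V" by (simp add: section_alg_def)
    have sv: "s q \<in> carrier (Y.St q)" if "q \<in> V" for q using Y.sec_stalk[OF s that] .
    show "pull V s \<in> carrier (section_alg X.rsp (pre V))"
      using sec_pull[OF s] by (simp add: section_alg_def)
    show "pull V (c \<odot>\<^bsub>section_alg Y.rsp V\<^esub> s) = c \<odot>\<^bsub>section_alg X.rsp (pre V)\<^esub> pull V s"
      unfolding pull_def section_alg_def st by (rule ext) (simp add: restrict_def hom(3)[OF sv sv])
    assume "t \<in> carrier (section_alg Y.rsp V)"
    then have t: "t \<in> Y.sec V" by (simp add: section_alg_def)
    have tv: "t q \<in> carrier (Y.St q)" if "q \<in> V" for q using Y.sec_stalk[OF t that] .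
    show "pull V (s \<otimes>\<^bsub>section_alg Y.rsp V\<^esub> t) = pull V s \<otimes>\<^bsub>section_alg X.rsp (pre V)\<^esub> pull V t"
      unfolding pull_def section_alg_def st by (rule ext) (simp add: restrict_def hom(1) sv tv)
    show "pull V (s \<oplus>\<^bsub>section_alg Y.rsp V\<^esub> t) = pull V s \<oplus>\<^bsub>section_alg X.rsp (pre V)\<^esub> pull V t"
      unfolding pull_def section_alg_def st by (rule ext) (simp add: restrict_def hom(2) sv tv)
  next
    show "pull V \<one>\<^bsub>section_alg Y.rsp V\<^esub> = \<one>\<^bsub>section_alg X.rsp (pre V)\<^esub>"
      unfolding pull_def section_alg_def st by (rule ext) (simp add: restrict_def one)
    show "bij_betw (pull V) (carrier (section_alg Y.rsp V)) (carrier (section_alg X.rsp (pre V)))"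
      using bij by (simp add: section_alg_def)
  qed
qed

theorem permute_rs_iso: "rs_iso X.rsp Y.rsp (permute_vec \<pi>) pull"
proof -
  have tops: "rs_top X.rsp = top_of_set X.Z" "rs_top Y.rsp = top_of_set Y.Z"
    by (simp_all add: analytic_hypersurface_def)
  have "homeomorphism X.Z Y.Z (permute_vec \<pi>) (permute_vec (inv_into UNIV \<pi>))"
    by (rule homeomorphismI) (auto simp: continuous_permute_vec permute_vec_inverse[OF \<pi>])
  then have homeo: "homeomorphic_map (top_of_set X.Z) (top_of_set Y.Z) (permute_vec \<pi>)"
    by (auto simp: homeomorphic_map_maps homeomorphic_maps_def homeomorphism_def image_subset_iff)
  have sub: "openin (top_of_set Y.Z) V \<Longrightarrow> V \<subseteq> Y.Z" for V using openin_subset[of "top_of_set Y.Z" V] by simp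
  have "pull W (restrict s W) = restrict (pull V s) (pre W)" if "W \<subseteq> V" for V W s
    unfolding pull_def using that by (auto simp: restrict_def fun_eq_iff)
  then show ?thesis
    unfolding rs_iso_def tops using homeo pull_alg_iso[OF sub] by auto
qed

end

lemma rs_iso_imp_germ_isomorphic:
  assumes "rs_iso X Y f h" "x \<in> topspace (rs_top X)"
  shows "germ_isomorphic X x Y (f x)"
proof -
  have whole: "open_subspace S (topspace (rs_top S)) = S" for S :: "('a, 'b, 'c) ringed_space"
    by (simp add: open_subspace_def)
  \<comment> \<open>The same fact at a second type: a local fact is monomorphic in its type
    variables, and the two spaces have different points and stalks.\<close>
  have whole': "open_subspace S (topspace (rs_top S)) = S" for S :: "('a, 'd, 'e) ringed_space"
    by (simp add: open_subspace_def)
  have "f x \<in> topspace (rs_top Y)"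
    using assms homeomorphic_imp_surjective_map[of "rs_top X" "rs_top Y" f] by (auto simp: rs_iso_def)
  then show ?thesis
    unfolding germ_isomorphic_def
    using assms by (intro exI[of _ "topspace (rs_top X)"] exI[of _ "topspace (rs_top Y)"] exI[of _ f] exI[of _ h])
      (simp add: whole whole')
qed

lemma perm_imp_BP_germ_iso:
  fixes a b :: "'n::finite \<Rightarrow> nat"
  assumes a: "\<And>i. 2 \<le> a i" and ab: "perm_equiv a b"
  shows "germ_isomorphic (BP_analytic a) 0 (BP_analytic b) 0"
proof -
  obtain \<pi> where bp: "bij \<pi>" "b = a \<circ> \<pi>" using ab by (auto simp: perm_equiv_def)
  let ?G = "\<lambda>z :: complex ^ 'n. \<Sum>i\<in>UNIV. (z $ i) ^ b i"
  interpret hypersurface_permute ?G \<pi>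
    by unfold_locales (rule holomorphic_at_BP, rule bp(1))
  \<comment> \<open>The permuted equation has exponents a (\<pi> i) on the coordinates \<pi> i;
    reindexing the sum restores the equation for \<open>a\<close>.\<close>
  have F: "F = (\<lambda>z. \<Sum>i\<in>UNIV. (z $ i) ^ a i)"
  proof
    fix z
    show "F z = (\<Sum>i\<in>UNIV. (z $ i) ^ a i)"
      using sum.reindex_bij_betw[OF bp(1), of "\<lambda>i. (z $ i) ^ a i"] by (simp add: bp(2))
  qed
  have "rs_iso (BP_analytic a) (BP_analytic b) (permute_vec \<pi>) pull"
    using permute_rs_iso unfolding F by (simp add: BP_analytic_def)
  moreover have "0 \<in> topspace (rs_top (BP_analytic a))"
  proof -
    have "0 < a i" for i using a[of i] by simp
    then show ?thesis by (simp add: zero_power BP_analytic_def analytic_hypersurface_def)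
  qed
  ultimately have "germ_isomorphic (BP_analytic a) 0 (BP_analytic b) (permute_vec \<pi> 0)"
    by (rule rs_iso_imp_germ_isomorphic)
  moreover have "permute_vec \<pi> 0 = (0 :: complex ^ 'n)" by (simp add: vec_eq_iff)
  ultimately show ?thesis by simp
qed

section \<open>Formal completions\<close>

lemma kalg_fps: "kalg (fps_alg :: (complex, ('n::finite, complex) mfps) module)"
  using formal.kalg_A by (simp flip: fps_alg_sub)

lemma BP_fps_eq: "BP_fps a = mfps_of_poly (BP_poly a)"
  using formal.mfps_of_BP_poly[of a] by (simp add: BP_fps_def flip: fps_alg_sub)

lemma BP_formal_iso_imp_perm:
  assumes "\<And>i. 2 \<le> a i" "\<And>i. 2 \<le> b i" "alg_isomorphic (BP_formal_ring a) (BP_formal_ring b)"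
  shows "perm_equiv a b"
  using formal.BP_iso_imp_perm[of a b] assms by (simp add: BP_formal_ring_def BP_fps_eq flip: fps_alg_sub)

lemma perm_equiv_sym:
  assumes "perm_equiv a b"
  shows "perm_equiv b a"
proof -
  obtain \<pi> where \<pi>: "bij \<pi>" "b = a \<circ> \<pi>" using assms by (auto simp: perm_equiv_def)
  then have "a = b \<circ> inv_into UNIV \<pi>" using comp_inv_into(1)[OF \<pi>(1), of a] by simp
  then show ?thesis using bij_imp_bij_inv[OF \<pi>(1)] by (auto simp: perm_equiv_def)
qed

lemma perm_imp_BP_formal_iso:
  assumes "perm_equiv a b"
  shows "alg_isomorphic (BP_formal_ring a) (BP_formal_ring b)"
proof -
  obtain \<pi> where \<pi>: "bij \<pi>" "a = b \<circ> \<pi>" using perm_equiv_sym[OF assms] by (auto simp: perm_equiv_def)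
  have "alg_iso fps_alg fps_alg (permute \<pi> :: ('a, complex) mfps \<Rightarrow> _)"
    using permute_alg_iso[OF \<pi>(1), of UNIV] by (simp flip: fps_alg_sub)
  from alg_iso_quot_PIdl[OF kalg_fps kalg_fps this, of "BP_fps a"]
  show ?thesis by (simp add: BP_formal_ring_def BP_fps_eq \<pi>(2) permute_BP[OF \<pi>(1)])
qed

section \<open>Algebroid spaces and their global sections\<close>

lemma algebroid_simps:
  "rs_top (algebroid_space I) = discrete_topology UNIV"
  "rs_stalk (algebroid_space I) = (\<lambda>_. quot_alg fps_alg I)"
  "rs_sections (algebroid_space I) V = (\<Pi>\<^sub>E p\<in>V. carrier (quot_alg fps_alg I))"
  by (simp_all add: algebroid_space_def)

text \<open>A section over the only point is a function on \<open>unit\<close>, hence determined by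
  one element of the ring.\<close>

lemma algebroid_global_sections:
  "alg_iso (quot_alg fps_alg I) (section_alg (algebroid_space I) UNIV) (\<lambda>x _. x)"
  unfolding alg_iso_def
proof (intro conjI allI ballI ring_iso_memI)
  let ?Q = "carrier (quot_alg fps_alg I)"
  have "(\<Pi>\<^sub>E p\<in>(UNIV :: unit set). ?Q) = (\<lambda>x _. x) ` ?Q"
  proof (intro equalityI subsetI)
    fix s assume "s \<in> (\<Pi>\<^sub>E p\<in>(UNIV :: unit set). ?Q)"
    then have "s () \<in> ?Q" by (rule PiE_mem) simp
    moreover have "s = (\<lambda>_. s ())" by (rule ext) simp
    ultimately show "s \<in> (\<lambda>x _. x) ` ?Q" by (rule rev_image_eqI)
  qed auto
  then show "bij_betw (\<lambda>x _. x) ?Q (carrier (section_alg (algebroid_space I) UNIV))"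
    by (auto simp: bij_betw_def inj_on_def section_alg_def algebroid_simps fun_eq_iff)
qed (auto simp: section_alg_def algebroid_simps)

lemma algebroid_iso_imp_alg_iso:
  assumes "rs_isomorphic (algebroid_space I) (algebroid_space J)"
    and I: "kalg (quot_alg fps_alg I)" and J: "kalg (quot_alg fps_alg J)"
  shows "alg_isomorphic (quot_alg fps_alg I) (quot_alg fps_alg J)"
proof -
  obtain f h where "rs_iso (algebroid_space I) (algebroid_space J) f h"
    using assms by (auto simp: rs_isomorphic_def)
  then have "alg_iso (section_alg (algebroid_space J) UNIV)
      (section_alg (algebroid_space I) {p \<in> topspace (rs_top (algebroid_space I)). f p \<in> UNIV}) (h UNIV)"
    unfolding rs_iso_def algebroid_simps by (metis openin_topspace topspace_discrete_topology)
  then have "alg_isomorphic (section_alg (algebroid_space J) UNIV) (section_alg (algebroid_space I) UNIV)"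
    by (auto simp: alg_isomorphic_def algebroid_simps)
  moreover have g: "alg_isomorphic (quot_alg fps_alg K) (section_alg (algebroid_space K) UNIV)" for K
    using algebroid_global_sections alg_isomorphic_def by blast
  ultimately have "alg_isomorphic (quot_alg fps_alg J) (section_alg (algebroid_space I) UNIV)"
    by (blast intro: alg_isomorphic_trans)
  then have "alg_isomorphic (quot_alg fps_alg J) (quot_alg fps_alg I)"
    using alg_isomorphic_sym[OF I g] by (rule alg_isomorphic_trans)
  then show ?thesis by (rule alg_isomorphic_sym[OF J])
qed

text \<open>The sheaf map goes against the map of spaces, so the algebra isomorphism is taken from
  \<open>J\<close> to \<open>I\<close>; on the single point the map is the identity.\<close>

lemma alg_iso_imp_algebroid_iso:
  assumes "alg_isomorphic (quot_alg fps_alg J) (quot_alg fps_alg I)"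
  shows "rs_isomorphic (algebroid_space I) (algebroid_space J)"
proof -
  let ?I = "quot_alg fps_alg I" and ?J = "quot_alg fps_alg J"
  obtain \<beta> where \<beta>: "alg_iso ?J ?I \<beta>" using assms by (auto simp: alg_isomorphic_def)
  have hom: "\<beta> (x \<otimes>\<^bsub>?J\<^esub> y) = \<beta> x \<otimes>\<^bsub>?I\<^esub> \<beta> y" "\<beta> (x \<oplus>\<^bsub>?J\<^esub> y) = \<beta> x \<oplus>\<^bsub>?I\<^esub> \<beta> y"
    if "x \<in> carrier ?J" "y \<in> carrier ?J" for x y
    using \<beta> that by (auto simp: alg_iso_def ring_iso_def ring_hom_def)
  have hom': "\<beta> (c \<odot>\<^bsub>?J\<^esub> x) = c \<odot>\<^bsub>?I\<^esub> \<beta> x" "\<beta> x \<in> carrier ?I" if "x \<in> carrier ?J" for x c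
    using \<beta> that by (auto simp: alg_iso_def ring_iso_def ring_hom_def)
  have one: "\<beta> \<one>\<^bsub>?J\<^esub> = \<one>\<^bsub>?I\<^esub>" and bij: "bij_betw \<beta> (carrier ?J) (carrier ?I)"
    using \<beta> by (auto simp: alg_iso_def ring_iso_def ring_hom_def)
  define h where "h = (\<lambda>(V :: unit set) s. \<lambda>p\<in>V. \<beta> (s p))"
  have iso: "alg_iso (section_alg (algebroid_space J) V) (section_alg (algebroid_space I) V) (h V)" for V
    unfolding alg_iso_def
  proof (intro conjI allI ballI ring_iso_memI)
    fix s t c assume "s \<in> carrier (section_alg (algebroid_space J) V)"
    then have s: "s \<in> (\<Pi>\<^sub>E p\<in>V. carrier ?J)" by (simp add: section_alg_def algebroid_simps)
    have sv: "s p \<in> carrier ?J" if "p \<in> V" for p using s that by (rule PiE_mem)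
    show "h V s \<in> carrier (section_alg (algebroid_space I) V)"
      using sv hom' by (simp add: h_def section_alg_def algebroid_simps)
    show "h V (c \<odot>\<^bsub>section_alg (algebroid_space J) V\<^esub> s) = c \<odot>\<^bsub>section_alg (algebroid_space I) V\<^esub> h V s"
      unfolding h_def section_alg_def algebroid_simps by (rule ext) (simp add: restrict_def hom' sv)
    assume "t \<in> carrier (section_alg (algebroid_space J) V)"
    then have t: "t \<in> (\<Pi>\<^sub>E p\<in>V. carrier ?J)" by (simp add: section_alg_def algebroid_simps)
    have tv: "t p \<in> carrier ?J" if "p \<in> V" for p using t that by (rule PiE_mem)
    show "h V (s \<otimes>\<^bsub>section_alg (algebroid_space J) V\<^esub> t) = h V s \<otimes>\<^bsub>section_alg (algebroid_space I) V\<^esub> h V t"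
      unfolding h_def section_alg_def algebroid_simps by (rule ext) (simp add: restrict_def hom sv tv)
    show "h V (s \<oplus>\<^bsub>section_alg (algebroid_space J) V\<^esub> t) = h V s \<oplus>\<^bsub>section_alg (algebroid_space I) V\<^esub> h V t"
      unfolding h_def section_alg_def algebroid_simps by (rule ext) (simp add: restrict_def hom sv tv)
  next
    show "h V \<one>\<^bsub>section_alg (algebroid_space J) V\<^esub> = \<one>\<^bsub>section_alg (algebroid_space I) V\<^esub>"
      unfolding h_def section_alg_def algebroid_simps by (rule ext) (simp add: restrict_def one)
    let ?S = "\<lambda>Q. \<Pi>\<^sub>E p\<in>V. carrier Q"
    let ?g = "\<lambda>t. \<lambda>p\<in>V. inv_into (carrier ?J) \<beta> (t p)"
    have "bij_betw (h V) (?S ?J) (?S ?I)"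
    proof (rule bij_betw_byWitness[where f' = ?g])
      show "\<forall>s\<in>?S ?J. ?g (h V s) = s"
      proof (intro ballI ext)
        fix s p assume s: "s \<in> ?S ?J"
        show "?g (h V s) p = s p"
        proof (cases "p \<in> V")
          case True
          then show ?thesis using bij_betw_inv_into_left[OF bij PiE_mem[OF s True]] by (simp add: h_def)
        next
          case False
          then show ?thesis using PiE_arb[OF s False] by simp
        qed
      qed
      show "\<forall>t\<in>?S ?I. h V (?g t) = t"
      proof (intro ballI ext)
        fix t p assume t: "t \<in> ?S ?I"
        show "h V (?g t) p = t p"
        proof (cases "p \<in> V")
          case True
          then show ?thesis using bij_betw_inv_into_right[OF bij PiE_mem[OF t True]] by (simp add: h_def)
        next
          case False
          then show ?thesis using PiE_arb[OF t False] by (simp add: h_def)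
        qed
      qed
      show "h V ` ?S ?J \<subseteq> ?S ?I"
      proof (rule image_subsetI)
        fix s assume "s \<in> ?S ?J"
        from hom'(2)[OF PiE_mem[OF this]] show "h V s \<in> ?S ?I" unfolding h_def restrict_PiE_iff by blast
      qed
      show "?g ` ?S ?I \<subseteq> ?S ?J"
      proof (rule image_subsetI)
        fix t assume "t \<in> ?S ?I"
        from bij_betw_apply[OF bij_betw_inv_into[OF bij] PiE_mem[OF this]] show "?g t \<in> ?S ?J"
          unfolding restrict_PiE_iff by blast
      qed
    qed
    then show "bij_betw (h V) (carrier (section_alg (algebroid_space J) V)) (carrier (section_alg (algebroid_space I) V))"
      by (simp add: section_alg_def algebroid_simps)
  qed
  have "rs_iso (algebroid_space I) (algebroid_space J) id h"
    unfolding rs_iso_def algebroid_simps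
  proof (intro conjI allI impI ballI)
    show "homeomorphic_map (discrete_topology UNIV) (discrete_topology UNIV) id"
      by (rule homeomorphic_map_id[THEN iffD2]) simp
  next
    fix V W :: "unit set" and s
    show "alg_iso (section_alg (algebroid_space J) V)
        (section_alg (algebroid_space I) {p \<in> topspace (discrete_topology UNIV). id p \<in> V}) (h V)"
    proof -
      have "{p \<in> topspace (discrete_topology (UNIV :: unit set)). id p \<in> V} = V"
        by (simp only: topspace_discrete_topology UNIV_I id_apply simp_thms Collect_mem_eq)
      then show ?thesis using iso[of V] by (simp only:)
    qed
    assume "openin (discrete_topology UNIV) V \<and> openin (discrete_topology UNIV) W \<and> W \<subseteq> V"
    then show "h W (restrict s W) = restrict (h V s) {p \<in> topspace (discrete_topology UNIV). id p \<in> W}"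
      by (auto simp: h_def restrict_def fun_eq_iff)
  qed
  then show ?thesis by (auto simp: rs_isomorphic_def)
qed

lemma kalg_BP_formal: "kalg (BP_formal_ring a)"
  unfolding BP_formal_ring_def
  by (rule kalg.kalg_quot[OF kalg_fps cring.cgenideal_ideal[OF kalg.axioms(1)[OF kalg_fps]]]) simp

lemma BP_algebroid_iso_iff:
  "rs_isomorphic (BP_algebroid a) (BP_algebroid b) \<longleftrightarrow> alg_isomorphic (BP_formal_ring a) (BP_formal_ring b)"
  using algebroid_iso_imp_alg_iso[of "PIdl\<^bsub>fps_alg\<^esub> (BP_fps a)" "PIdl\<^bsub>fps_alg\<^esub> (BP_fps b)"]
    alg_iso_imp_algebroid_iso[of "PIdl\<^bsub>fps_alg\<^esub> (BP_fps b)" "PIdl\<^bsub>fps_alg\<^esub> (BP_fps a)"]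
    kalg_BP_formal[of a] kalg_BP_formal[of b] alg_isomorphic_sym[OF kalg_BP_formal[of a], of "BP_formal_ring b"]
  unfolding BP_algebroid_def BP_formal_ring_def by blast

theorem theorem3:
  fixes a b :: "'n::finite \<Rightarrow> nat"
  assumes "CARD('n) \<ge> 2"
    and "\<And>i. a i \<ge> 2" and "\<And>i. b i \<ge> 2"
  shows
    "((alg_isomorphic (BP_ring a :: ('k::field_char_0, _) module) (BP_ring b :: ('k, _) module)
         \<longleftrightarrow> rs_isomorphic (BP_variety a :: ('k, _, _) ringed_space)
               (BP_variety b :: ('k, _, _) ringed_space)) \<and>
      (rs_isomorphic (BP_variety a :: ('k, _, _) ringed_space)
           (BP_variety b :: ('k, _, _) ringed_space)
         \<longleftrightarrow> perm_equiv a b)) \<and>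
     ((alg_isomorphic (BP_formal_ring a) (BP_formal_ring b)
         \<longleftrightarrow> rs_isomorphic (BP_algebroid a) (BP_algebroid b)) \<and>
      (rs_isomorphic (BP_algebroid a) (BP_algebroid b)
         \<longleftrightarrow> germ_isomorphic (BP_analytic a) 0 (BP_analytic b) 0) \<and>
      (germ_isomorphic (BP_analytic a) 0 (BP_analytic b) 0
         \<longleftrightarrow> perm_equiv a b))"
proof -
  note a = assms(2) and b = assms(3)
  have 1: "rs_isomorphic (BP_variety a :: ('k, _, _) ringed_space) (BP_variety b :: ('k, _, _) ringed_space) \<longleftrightarrow>
      alg_isomorphic (BP_ring a :: ('k, _) module) (BP_ring b :: ('k, _) module)"
    unfolding BP_variety_def
    using rs_iso_Spec_imp_alg_iso[OF kalg_BP_ring kalg_BP_ring] alg_iso_imp_rs_iso_Spec[OF kalg_BP_ring kalg_BP_ring]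
    by blast
  have 2: "alg_isomorphic (BP_ring a :: ('k, _) module) (BP_ring b :: ('k, _) module) \<longleftrightarrow> perm_equiv a b"
  proof
    assume "alg_isomorphic (BP_ring a :: ('k, _) module) (BP_ring b :: ('k, _) module)"
    then show "perm_equiv a b" by (rule BP_ring_iso_imp_perm[rotated 2]) (rule a, rule b)
  qed (rule perm_imp_BP_ring_iso)
  have 3: "alg_isomorphic (BP_formal_ring a) (BP_formal_ring b) \<longleftrightarrow> perm_equiv a b"
  proof
    assume "alg_isomorphic (BP_formal_ring a) (BP_formal_ring b)"
    then show "perm_equiv a b" by (rule BP_formal_iso_imp_perm[rotated 2]) (rule a, rule b)
  qed (rule perm_imp_BP_formal_iso)
  have 4: "germ_isomorphic (BP_analytic a) 0 (BP_analytic b) 0 \<longleftrightarrow> perm_equiv a b"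
  proof
    assume "germ_isomorphic (BP_analytic a) 0 (BP_analytic b) 0"
    then have "perm_equiv b a" by (rule BP_germ_iso_imp_perm[rotated 2]) (rule a, rule b)
    then show "perm_equiv a b" by (rule perm_equiv_sym)
  qed (rule perm_imp_BP_germ_iso[OF a])
  show ?thesis unfolding 1 2 BP_algebroid_iso_iff 3 4 by blast
qed

end
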